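(* Let $T>0$. There are constants $C,c>0$ such that $$\left\| T_{\epsilon}(t)\begin{pmatrix}u_0 \\ v_0 \end{pmatrix}- T_{0}(t)\begin{pmatrix} h^0(v_0) \\ v_0 \end{pmatrix}\right\|_{X_1\times Y_1}\leq C \big(\epsilon e^{(\omega_B+c)t}\|v_0\|_{Y_1}+(\epsilon^{\delta_Y}e^{(\omega_B+c)t}+e^{\epsilon^{-1}\omega_f t})\| u_0-h^0(v_0)\|_{X_1}\big)$$ holds for all $(u_0,v_0)\in X_1\times Y_1$, all $t\in[0,T]$ and all $\epsilon\in(0,1]$. Here $T_\epsilon$ is the semiflow of the fast-slow system and $T_0$ the slow flow on the critical manifold (both defined in the context).
   Context: **Setting.** $X,Y$ are Banach spaces and $T>0$, $\epsilon\ge0$ are parameters. (i) $A\colon X\supset D(A)\to X$ is a closed linear operator generating an exponentially stable $C_0$-semigroup $(e^{tA})_{t\ge0}$ on $X$; $B\colon Y\supset D(B)\to Y$ is a closed linear operator generating a $C_0$-semigroup $(e^{tB})_{t\ge0}$ on $Y$. (ii) $(X_\alpha)_{\alpha\in[-1,\infty)}$ and $(Y_\alpha)_{\alpha\in[-1,\infty)}$ are, up to equivalence of norms for each fixed $\alpha$, the interpolation-extrapolation scales generated by $(X,A)$ and $(Y,B)$ (by $(Y,B-\lambda)$ for some $\lambda\in\rho(B)$ if $0\notin\rho(B)$). The interpolation-extrapolation scale of a densely defined closed operator $S$ on a Banach space $Z$ with $0\in\rho(S)$ is defined, after fixing for each $\theta\in(0,1)$ an exact interpolation functor $(\cdot,\cdot)_\theta$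 such that $Z_1$ is dense in $(Z_0,Z_1)_\theta$ whenever $Z_1$ is densely embedded in $Z_0$, by: $Z_k=D(S^k)$ with norm $\|S^kz\|_Z$ for $k\in\mathbb N_0$; $Z_{-1}$ is the completion of $Z$ with respect to $\|S^{-1}z\|_Z$; $Z_{k+\theta}=(Z_k,Z_{k+1})_\theta$ for $k\in\mathbb N_0\cup\{-1\}$, $\theta\in(0,1)$. The operator and its semigroup are extended/restricted to the spaces of the scale and denoted by the same symbols. In particular $X_0=X$, $X_1=D(A)$, $Y_0=Y$, $Y_1=D(B)$. (iii) $\gamma_X\in(0,1]$ if $(e^{tA})_{t\ge0}$ is holomorphic and $\gamma_X=1$ otherwise; $\delta_X\in[1-\gamma_X,1]$; $\delta_Y\in(0,1]$ if $(e^{tB})_{t\ge0}$ is holomorphic and $\delta_Y=1$ otherwise. (iv) $f\colon X_{\delta_X}\times Y_{1-\delta_X}\to X$ and $g\colon X_1\times Y_1\to Y_{\delta_Y}$ are continuous, $f(0,0)=0$, $g(0,0)=0$; $f(x,y)\in X_{\gamma_X}$ and $g(x,y)\in Y_{\delta_Y}$ for $(x,y)\in X_1\times Y_1$; $f(u,v)\in C^1([0,t];X_{\delta_X-1})$ whenever $u\in C^1([0,t];X_{\delta_X})$ and $v\in C^1([0,t];Y)\cap C([0,t];Y_{1-\delta_X})$; and there are constants $L_f,L_g>0$ with $\|f(x_1,y_1)-f(x_2,y_2)\|_{X_{\gamma_X}}\le L_f(\|x_1-x_2\|_{X_1}+\|y_1-y_2\|_{Y_1})$, $\|f(u_1,v_1)-f(u_2,v_2)\|_{C^1([0,t];X_{\delta_X-1})}\le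 L_f(\|u_1-u_2\|_{C^1([0,t];X_{\delta_X})}+\|v_1-v_2\|_{C^1([0,t];Y)})$, $\|g(x_1,y_1)-g(x_2,y_2)\|_{Y_{\delta_Y}}\le L_g(\|x_1-x_2\|_{X_1}+\|y_1-y_2\|_{Y_1})$ for all $x_i\in X_1$, $y_i\in Y_1$, $u_i\in C^1([0,t];X_{\delta_X})$, $v_i\in C^1([0,t];Y)\cap C([0,t];Y_{1-\delta_X})$. (v) $M_A,M_B,C_A,C_B>0$, $\omega_A<0$, $\omega_B\in\mathbb R$ are constants with, for all $t>0$, $\|e^{tA}\|_{\mathcal B(X_1)}\le M_Ae^{\omega_At}$, $\|e^{tA}\|_{\mathcal B(X_{\gamma_X},X_1)}\le C_At^{\gamma_X-1}e^{\omega_At}$, $\|e^{tA}\|_{\mathcal B(X_{\delta_X},X_1)}\le C_At^{\delta_X-1}e^{\omega_At}$, $\|e^{tB}\|_{\mathcal B(Y_1)}\le M_Be^{\omega_Bt}$, $\|e^{tB}\|_{\mathcal B(Y_{\delta_Y},Y_1)}\le C_Bt^{\delta_Y-1}e^{\omega_Bt}$. (vi) $\omega_f:=\omega_A+(2C_AL_f)^{1/\gamma_X}(1/\gamma_X)^{(1-\gamma_X)/\gamma_X}$ if $\gamma_X\in(0,1)$; if $\gamma_X=1$, $\omega_f$ is a fixed number $>\omega_A+C_AL_f$. It is assumed that $\omega_f<0$ and $L_f\max\{\|A^{-1}\|_{\mathcal B(X_{\gamma_X},X_1)},\|A^{-1}\|_{\mathcal B(X_{\delta_X-1},X_{\delta_X})}\}<1$.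 **Fast-slow system.** $\epsilon\partial_tu^\epsilon=Au^\epsilon+f(u^\epsilon,v^\epsilon)$, $\partial_tv^\epsilon=Bv^\epsilon+g(u^\epsilon,v^\epsilon)$, $u^\epsilon(0)=u_0\in X_1$, $v^\epsilon(0)=v_0\in Y_1$. For $\epsilon>0$ it has a unique strict solution in $C^1([0,T];X\times Y)\cap C([0,T];X_1\times Y_1)$; $T_\epsilon(t)(u_0,v_0):=(u^\epsilon(t),v^\epsilon(t))$. **Critical manifold and slow flow.** For $y\in Y_1$, $h^0(y)\in X_1$ is the unique solution of $0=Ah^0(y)+f(h^0(y),y)$. The critical manifold is $S_0=\{(h^0(y),y):y\in Y_1\}$. For $\epsilon=0$ and $u_0=h^0(v_0)$ the system has a unique strict solution $(u^0,v^0)$, with $u^0=h^0(v^0)$; the slow flow is $T_0(t)(h^0(v_0),v_0):=(u^0(t),v^0(t))$.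
   Formalization: The formal theorem additionally assumes δ_X>0, excluding only the endpoint γ_X=1, δ_X=0, where the estimate can fail: a translation example started on the critical manifold has error of order at least ε log(1/ε). *)

theory Defs
  imports "HOL-Analysis.Analysis"
begin

section \<open>Banach spaces over the real or complex field\<close>

text \<open>
  The class \<open>banach\<close> only knows real scalars. A Banach space over a scalar field is rendered as a
  type of class \<open>banach\<close> with a scalar multiplication \<open>sc\<close> that extends the real one. By the
  theorems of Gelfand--Mazur and Ostrowski a \<open>real_normed_field\<close> is \<open>\<real>\<close> or \<open>\<complex>\<close>, so
  real and complex Banach spaces are both covered.
\<close>

definition banach_over :: "('k::real_normed_field \<Rightarrow> 'a::banach \<Rightarrow> 'a) \<Rightarrow> bool" where
  "banach_over sc \<longleftrightarrow> vector_space sc \<and> (\<forall>r x. sc (of_real r) x = r *\<^sub>R x) \<and>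
     (\<forall>a x. norm (sc a x) = norm a * norm x)"

text \<open>Only the values of \<open>nrm\<close> on the carrier matter.\<close>

record 'a nspace =
  car :: "'a set"
  nrm :: "'a \<Rightarrow> real"

definition whole :: "'a::banach nspace" where
  "whole = \<lparr>car = UNIV, nrm = norm\<rparr>"

definition banach_subspace :: "('k::real_normed_field \<Rightarrow> 'a::banach \<Rightarrow> 'a) \<Rightarrow> 'a nspace \<Rightarrow> bool" where
  "banach_subspace sc E \<longleftrightarrow>
     module.subspace sc (car E) \<and>
     (\<forall>x\<in>car E. 0 \<le> nrm E x \<and> (nrm E x = 0 \<longleftrightarrow> x = 0)) \<and>
     (\<forall>x\<in>car E. \<forall>y\<in>car E. nrm E (x + y) \<le> nrm E x + nrm E y) \<and>
     (\<forall>a. \<forall>x\<in>car E. nrm E (sc a x) = norm a * nrm E x) \<and>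
     (\<forall>s::nat \<Rightarrow> 'a. (\<forall>n. s n \<in> car E) \<and> (\<forall>e>0. \<exists>N. \<forall>m\<ge>N. \<forall>n\<ge>N. nrm E (s m - s n) < e) \<longrightarrow>
        (\<exists>l\<in>car E. (\<lambda>n. nrm E (s n - l)) \<longlonglongrightarrow> 0))"

definition embeds :: "'a nspace \<Rightarrow> 'a nspace \<Rightarrow> bool" where
  "embeds E F \<longleftrightarrow> car E \<subseteq> car F \<and> (\<exists>C. \<forall>x\<in>car E. nrm F x \<le> C * nrm E x)"

definition same_up_to_equivalent_norm :: "'a nspace \<Rightarrow> 'a nspace \<Rightarrow> bool" where
  "same_up_to_equivalent_norm E F \<longleftrightarrow> embeds E F \<and> embeds F E"

definition dense_in :: "'a::banach nspace \<Rightarrow> 'a nspace \<Rightarrow> bool" where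
  "dense_in E F \<longleftrightarrow> car E \<subseteq> car F \<and> (\<forall>x\<in>car F. \<forall>e>0. \<exists>y\<in>car E. nrm F (x - y) < e)"

text \<open>\<open>op_bound E F S K\<close> says that \<open>S\<close> is bounded from \<open>E\<close> to \<open>F\<close> with operator norm at most \<open>K\<close>.\<close>

definition op_bound :: "'a nspace \<Rightarrow> 'b nspace \<Rightarrow> ('a \<Rightarrow> 'b) \<Rightarrow> real \<Rightarrow> bool" where
  "op_bound E F S K \<longleftrightarrow> (\<forall>x\<in>car E. S x \<in> car F \<and> nrm F (S x) \<le> K * nrm E x)"

definition op_norm :: "'a nspace \<Rightarrow> 'b nspace \<Rightarrow> ('a \<Rightarrow> 'b) \<Rightarrow> real" where
  "op_norm E F S = Inf {K. 0 \<le> K \<and> op_bound E F S K}"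


section \<open>Interpolation functors\<close>

definition int_space :: "'a::banach nspace \<Rightarrow> 'a nspace \<Rightarrow> 'a nspace" where
  "int_space E F = \<lparr>car = car E \<inter> car F, nrm = (\<lambda>x. max (nrm E x) (nrm F x))\<rparr>"

definition sum_space :: "'a::banach nspace \<Rightarrow> 'a nspace \<Rightarrow> 'a nspace" where
  "sum_space E F = \<lparr>car = {x + y | x y. x \<in> car E \<and> y \<in> car F},
     nrm = (\<lambda>z. Inf {nrm E x + nrm F y | x y. x \<in> car E \<and> y \<in> car F \<and> x + y = z})\<rparr>"

text \<open>
  All couples consist of spaces that embed continuously into one ambient Banach space, which will be
  the extrapolation space of order \<open>-1\<close>. A functor on the category of all Banach couples restricts
  to a functor on these couples.
\<close>

definition couple ::
  "('k::real_normed_field \<Rightarrow> 'a::banach \<Rightarrow> 'a) \<Rightarrow> 'a nspace \<Rightarrow> 'a nspace \<Rightarrow> bool" where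
  "couple sc E0 E1 \<longleftrightarrow> banach_subspace sc E0 \<and> banach_subspace sc E1 \<and>
     embeds E0 whole \<and> embeds E1 whole"

definition linear_on_set ::
  "('k::real_normed_field \<Rightarrow> 'a::banach \<Rightarrow> 'a) \<Rightarrow> ('k \<Rightarrow> 'b::banach \<Rightarrow> 'b) \<Rightarrow> 'a set \<Rightarrow> ('a \<Rightarrow> 'b) \<Rightarrow> bool" where
  "linear_on_set sc sc' V S \<longleftrightarrow> module.subspace sc V \<and>
     (\<forall>x\<in>V. \<forall>y\<in>V. S (x + y) = S x + S y) \<and> (\<forall>a. \<forall>x\<in>V. S (sc a x) = sc' a (S x))"

text \<open>
  Exactness is the bound by the maximum of the two operator norms; functors that are exact of
  exponent \<open>\<theta>\<close> satisfy it. The last clause is the density property required of the functors that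
  generate a scale.
\<close>

definition exact_interpolation_functor ::
  "('k::real_normed_field \<Rightarrow> 'a::banach \<Rightarrow> 'a) \<Rightarrow> ('a nspace \<Rightarrow> 'a nspace \<Rightarrow> 'a nspace) \<Rightarrow> bool" where
  "exact_interpolation_functor sc \<Phi> \<longleftrightarrow>
     (\<forall>E0 E1. couple sc E0 E1 \<longrightarrow>
        banach_subspace sc (\<Phi> E0 E1) \<and>
        embeds (int_space E0 E1) (\<Phi> E0 E1) \<and> embeds (\<Phi> E0 E1) (sum_space E0 E1)) \<and>
     (\<forall>E0 E1 F0 F1 S K0 K1. couple sc E0 E1 \<and> couple sc F0 F1 \<and>
        linear_on_set sc sc (car (sum_space E0 E1)) S \<and>
        op_bound E0 F0 S K0 \<and> op_bound E1 F1 S K1 \<longrightarrow>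
        op_bound (\<Phi> E0 E1) (\<Phi> F0 F1) S (max K0 K1))"

definition density_preserving ::
  "('k::real_normed_field \<Rightarrow> 'a::banach \<Rightarrow> 'a) \<Rightarrow> ('a nspace \<Rightarrow> 'a nspace \<Rightarrow> 'a nspace) \<Rightarrow> bool" where
  "density_preserving sc \<Phi> \<longleftrightarrow>
     (\<forall>E0 E1. couple sc E0 E1 \<and> embeds E1 E0 \<and> dense_in E1 E0 \<longrightarrow> dense_in E1 (\<Phi> E0 E1))"


section \<open>Operators and semigroups\<close>

definition closed_linear_operator ::
  "('k::real_normed_field \<Rightarrow> 'a::banach \<Rightarrow> 'a) \<Rightarrow> 'a set \<Rightarrow> ('a \<Rightarrow> 'a) \<Rightarrow> bool" where
  "closed_linear_operator sc D A \<longleftrightarrow> linear_on_set sc sc D A \<and> closed {(x, A x) | x. x \<in> D}"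

definition resolvent_set ::
  "('k::real_normed_field \<Rightarrow> 'a::banach \<Rightarrow> 'a) \<Rightarrow> 'a set \<Rightarrow> ('a \<Rightarrow> 'a) \<Rightarrow> 'k set" where
  "resolvent_set sc D A = {z. bij_betw (\<lambda>x. sc z x - A x) D UNIV \<and>
     (\<exists>C. \<forall>x\<in>D. norm x \<le> C * norm (sc z x - A x))}"

definition C0_semigroup ::
  "('k::real_normed_field \<Rightarrow> 'a::banach \<Rightarrow> 'a) \<Rightarrow> (real \<Rightarrow> 'a \<Rightarrow>\<^sub>L 'a) \<Rightarrow> bool" where
  "C0_semigroup sc S \<longleftrightarrow>
     (\<forall>t\<ge>0. \<forall>a x. S t (sc a x) = sc a (S t x)) \<and>
     S 0 = id_blinfun \<and> (\<forall>s\<ge>0. \<forall>t\<ge>0. S (s + t) = S s o\<^sub>L S t) \<and>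
     (\<forall>x. ((\<lambda>t. S t x) \<longlongrightarrow> x) (at_right 0))"

definition generates ::
  "'a::banach set \<Rightarrow> ('a \<Rightarrow> 'a) \<Rightarrow> (real \<Rightarrow> 'a \<Rightarrow>\<^sub>L 'a) \<Rightarrow> bool" where
  "generates D A S \<longleftrightarrow>
     D = {x. \<exists>y. ((\<lambda>t. (1 / t) *\<^sub>R (S t x - x)) \<longlongrightarrow> y) (at_right 0)} \<and>
     (\<forall>x\<in>D. ((\<lambda>t. (1 / t) *\<^sub>R (S t x - x)) \<longlongrightarrow> A x) (at_right 0))"

definition exponentially_stable :: "(real \<Rightarrow> 'a::banach \<Rightarrow>\<^sub>L 'a) \<Rightarrow> bool" where
  "exponentially_stable S \<longleftrightarrow> (\<exists>M w. w < 0 \<and> (\<forall>t\<ge>0. norm (S t) \<le> M * exp (w * t)))"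

definition sector :: "real \<Rightarrow> complex set" where
  "sector \<phi> = {z. z \<noteq> 0 \<and> \<bar>Arg z\<bar> < \<phi>}"

text \<open>
  \<open>J\<close> is multiplication by the imaginary unit. The family \<open>H\<close> consists of bounded complex linear
  operators, and the derivative clause says that it is complex differentiable in operator norm.
\<close>

definition holomorphic_wrt :: "('a::banach \<Rightarrow> 'a) \<Rightarrow> (real \<Rightarrow> 'a \<Rightarrow> 'a) \<Rightarrow> bool" where
  "holomorphic_wrt J S \<longleftrightarrow>
     (\<exists>\<phi>. \<exists>H :: complex \<Rightarrow> 'a \<Rightarrow>\<^sub>L 'a. 0 < \<phi> \<and> \<phi> \<le> pi / 2 \<and>
        (\<forall>t>0. \<forall>x. blinfun_apply (H (complex_of_real t)) x = S t x) \<and>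
        (\<forall>z\<in>sector \<phi>. \<forall>x. blinfun_apply (H z) (J x) = J (blinfun_apply (H z) x)) \<and>
        (\<forall>z\<in>sector \<phi>. \<forall>w\<in>sector \<phi>. H (z + w) = H z o\<^sub>L H w) \<and>
        (\<forall>z\<in>sector \<phi>. \<exists>D D'. (\<forall>x. blinfun_apply D' x = J (blinfun_apply D x)) \<and>
            (H has_derivative (\<lambda>h. Re h *\<^sub>R D + Im h *\<^sub>R D')) (at z)) \<and>
        (\<forall>\<psi>. 0 < \<psi> \<and> \<psi> < \<phi> \<longrightarrow>
            (\<forall>x. ((\<lambda>z. blinfun_apply (H z) x) \<longlongrightarrow> x) (at 0 within sector \<psi>))))"

text \<open>Over \<open>\<real>\<close> a semigroup is holomorphic if its complexification is.\<close>

definition holomorphic_semigroup ::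
  "('k::real_normed_field \<Rightarrow> 'a::banach \<Rightarrow> 'a) \<Rightarrow> (real \<Rightarrow> 'a \<Rightarrow>\<^sub>L 'a) \<Rightarrow> bool" where
  "holomorphic_semigroup sc S \<longleftrightarrow>
     (if \<exists>i::'k. i * i = - 1
      then \<exists>i::'k. i * i = - 1 \<and> holomorphic_wrt (sc i) (\<lambda>t. blinfun_apply (S t))
      else holomorphic_wrt (\<lambda>(x, y). (- y, x)) (\<lambda>t (x, y). (S t x, S t y)))"


section \<open>Interpolation-extrapolation scales\<close>

primrec dom_pow :: "'a set \<Rightarrow> ('a \<Rightarrow> 'a) \<Rightarrow> nat \<Rightarrow> 'a set" where
  "dom_pow D S 0 = UNIV"
| "dom_pow D S (Suc n) = {x \<in> D. S x \<in> dom_pow D S n}"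

text \<open>
  The type \<open>'e\<close> with the embedding \<open>j\<close> is a completion of \<open>'z\<close> with respect to the norm
  of \<open>S\<close> inverse.
\<close>

definition extrapolation_space ::
  "('k::real_normed_field \<Rightarrow> 'z::banach \<Rightarrow> 'z) \<Rightarrow> ('k \<Rightarrow> 'e::banach \<Rightarrow> 'e) \<Rightarrow>
    'z set \<Rightarrow> ('z \<Rightarrow> 'z) \<Rightarrow> ('z \<Rightarrow> 'e) \<Rightarrow> bool" where
  "extrapolation_space sc sce D S j \<longleftrightarrow> banach_over sce \<and> linear_on_set sc sce UNIV j \<and>
     (\<forall>z. norm (j z) = norm (inv_into D S z)) \<and> closure (range j) = UNIV"

definition integer_level :: "'z::banach set \<Rightarrow> ('z \<Rightarrow> 'z) \<Rightarrow> ('z \<Rightarrow> 'e::banach) \<Rightarrow> int \<Rightarrow> 'e nspace" where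
  "integer_level D S j k = (if k < 0 then whole
     else \<lparr>car = j ` dom_pow D S (nat k), nrm = (\<lambda>z. norm ((S ^^ nat k) (inv j z)))\<rparr>)"

definition canonical_scale ::
  "'z::banach set \<Rightarrow> ('z \<Rightarrow> 'z) \<Rightarrow> ('z \<Rightarrow> 'e::banach) \<Rightarrow>
    (real \<Rightarrow> 'e nspace \<Rightarrow> 'e nspace \<Rightarrow> 'e nspace) \<Rightarrow> real \<Rightarrow> 'e nspace" where
  "canonical_scale D S j \<Phi> \<alpha> =
     (if frac \<alpha> = 0 then integer_level D S j \<lfloor>\<alpha>\<rfloor>
      else \<Phi> (frac \<alpha>) (integer_level D S j \<lfloor>\<alpha>\<rfloor>) (integer_level D S j (\<lfloor>\<alpha>\<rfloor> + 1)))"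

definition interpolation_extrapolation_scale ::
  "('k::real_normed_field \<Rightarrow> 'z::banach \<Rightarrow> 'z) \<Rightarrow> ('k \<Rightarrow> 'e::banach \<Rightarrow> 'e) \<Rightarrow>
    'z set \<Rightarrow> ('z \<Rightarrow> 'z) \<Rightarrow> ('z \<Rightarrow> 'e) \<Rightarrow> (real \<Rightarrow> 'e nspace) \<Rightarrow> bool" where
  "interpolation_extrapolation_scale sc sce D S j Z \<longleftrightarrow>
     extrapolation_space sc sce D S j \<and>
     (\<exists>\<Phi>. (\<forall>\<theta>\<in>{0<..<1}. exact_interpolation_functor sce (\<Phi> \<theta>) \<and> density_preserving sce (\<Phi> \<theta>)) \<and>
        (\<forall>\<alpha>\<ge>-1. banach_subspace sce (Z \<alpha>) \<and>
           same_up_to_equivalent_norm (Z \<alpha>) (canonical_scale D S j \<Phi> \<alpha>)))"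

text \<open>
  The spaces of a scale live in the extrapolation space. For \<open>\<alpha> \<ge> 0\<close> they are also regarded as
  subspaces of the original space.
\<close>

definition level :: "('z \<Rightarrow> 'e) \<Rightarrow> (real \<Rightarrow> 'e nspace) \<Rightarrow> real \<Rightarrow> 'z nspace" where
  "level j Z \<alpha> = \<lparr>car = {x. j x \<in> car (Z \<alpha>)}, nrm = (\<lambda>x. nrm (Z \<alpha>) (j x))\<rparr>"

text \<open>The continuous extension of \<open>S\<close> to an operator from the original space to the extrapolation space.\<close>

definition extended_operator ::
  "'z::banach set \<Rightarrow> ('z \<Rightarrow> 'z) \<Rightarrow> ('z \<Rightarrow> 'e::banach) \<Rightarrow> 'z \<Rightarrow> 'e" where
  "extended_operator D S j = (THE R. continuous_on UNIV R \<and> (\<forall>x\<in>D. R x = j (S x)))"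


section \<open>Functions with values in a space of a scale\<close>

definition C0_in :: "'a::banach nspace \<Rightarrow> real \<Rightarrow> (real \<Rightarrow> 'a) \<Rightarrow> bool" where
  "C0_in E t u \<longleftrightarrow> (\<forall>s\<in>{0..t}. u s \<in> car E \<and>
     ((\<lambda>r. nrm E (u r - u s)) \<longlongrightarrow> 0) (at s within {0..t}))"

definition deriv_in :: "'a::banach nspace \<Rightarrow> real \<Rightarrow> (real \<Rightarrow> 'a) \<Rightarrow> real \<Rightarrow> 'a \<Rightarrow> bool" where
  "deriv_in E t u s d \<longleftrightarrow> d \<in> car E \<and>
     ((\<lambda>r. nrm E ((1 / (r - s)) *\<^sub>R (u r - u s) - d)) \<longlongrightarrow> 0) (at s within {0..t})"

definition C1_in :: "'a::banach nspace \<Rightarrow> real \<Rightarrow> (real \<Rightarrow> 'a) \<Rightarrow> bool" where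
  "C1_in E t u \<longleftrightarrow> C0_in E t u \<and> (\<exists>u'. (\<forall>s\<in>{0..t}. deriv_in E t u s (u' s)) \<and> C0_in E t u')"

definition C1_norm :: "'a::banach nspace \<Rightarrow> real \<Rightarrow> (real \<Rightarrow> 'a) \<Rightarrow> real" where
  "C1_norm E t u = (SUP s\<in>{0..t}. nrm E (u s)) + (SUP s\<in>{0..t}. nrm E (THE d. deriv_in E t u s d))"

definition continuous_map2 ::
  "'a::banach nspace \<Rightarrow> 'b::banach nspace \<Rightarrow> 'c::banach nspace \<Rightarrow> ('a \<Rightarrow> 'b \<Rightarrow> 'c) \<Rightarrow> bool" where
  "continuous_map2 E F G f \<longleftrightarrow> (\<forall>x\<in>car E. \<forall>y\<in>car F. f x y \<in> car G \<and>
     (\<forall>e>0. \<exists>d>0. \<forall>x'\<in>car E. \<forall>y'\<in>car F.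
        nrm E (x' - x) < d \<and> nrm F (y' - y) < d \<longrightarrow> nrm G (f x' y' - f x y) < e))"


section \<open>The fast-slow system\<close>

text \<open>
  The bound \<open>0 < \<delta>X\<close> excludes only the endpoint \<open>\<gamma>X = 1\<close>, \<open>\<delta>X = 0\<close> of the range
  \<open>1 - \<gamma>X \<le> \<delta>X \<le> 1\<close>, at which the weight \<open>t powr (\<delta>X - 1)\<close> is not integrable at \<open>0\<close> and the
  error estimate fails. On \<open>\<ell>\<^sup>1\<close> let \<open>A\<close> be multiplication by \<open>- a n\<close>, \<open>a n = 2 ^ n\<close>; let \<open>B\<close>
  generate the translations on the space \<open>Y\<close> for which \<open>Y\<^sub>1\<close> consists of the functions of class \<open>C\<^sub>0\<close>
  on \<open>\<real>\<close> into \<open>X\<^sub>1\<close> and of class \<open>C\<^sub>0\<^sup>1\<close> into the space of order \<open>-1\<close>; let \<open>g = 0\<close> and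
  \<open>f (u, v) = \<kappa> v(0)\<close> with small \<open>\<kappa> > 0\<close>. Taking for \<open>v0\<close> a function whose \<open>n\<close>-th component
  rises by about \<open>\<epsilon> / 2\<close> on \<open>[t - 2 \<epsilon> / a n, t - \<epsilon> / a n]\<close> for \<open>a n \<le> 1 / \<epsilon>\<close>, and starting
  on the critical manifold, gives \<open>v0\<close> bounded in \<open>Y\<^sub>1\<close> but an error of order at least
  \<open>\<epsilon> ln (1 / \<epsilon>)\<close>.
\<close>

definition admissible_exponents :: "bool \<Rightarrow> bool \<Rightarrow> real \<Rightarrow> real \<Rightarrow> real \<Rightarrow> bool" where
  "admissible_exponents holX holY \<gamma>X \<delta>X \<delta>Y \<longleftrightarrow>
     0 < \<gamma>X \<and> \<gamma>X \<le> 1 \<and> (\<not> holX \<longrightarrow> \<gamma>X = 1) \<and>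
     1 - \<gamma>X \<le> \<delta>X \<and> \<delta>X \<le> 1 \<and> 0 < \<delta>X \<and>
     0 < \<delta>Y \<and> \<delta>Y \<le> 1 \<and> (\<not> holY \<longrightarrow> \<delta>Y = 1)"

definition strict_solution ::
  "'x::banach nspace \<Rightarrow> ('x \<Rightarrow> 'x) \<Rightarrow> ('x \<Rightarrow> 'y::banach \<Rightarrow> 'x) \<Rightarrow>
    'y nspace \<Rightarrow> ('y \<Rightarrow> 'y) \<Rightarrow> ('x \<Rightarrow> 'y \<Rightarrow> 'y) \<Rightarrow>
    real \<Rightarrow> real \<Rightarrow> 'x \<times> 'y \<Rightarrow> (real \<Rightarrow> 'x) \<Rightarrow> (real \<Rightarrow> 'y) \<Rightarrow> bool" where
  "strict_solution X1 A f Y1 B g T \<epsilon> p u v \<longleftrightarrow>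
     C0_in X1 T u \<and> C0_in Y1 T v \<and> (u 0, v 0) = p \<and>
     (\<exists>u' v'. continuous_on {0..T} u' \<and> continuous_on {0..T} v' \<and>
        (\<forall>t\<in>{0..T}. (u has_vector_derivative u' t) (at t within {0..T}) \<and>
           (v has_vector_derivative v' t) (at t within {0..T}) \<and>
           \<epsilon> *\<^sub>R u' t = A (u t) + f (u t) (v t) \<and>
           v' t = B (v t) + g (u t) (v t)))"

text \<open>For \<open>\<epsilon> > 0\<close> this is the semiflow; for \<open>\<epsilon> = 0\<close> it is the slow flow on the critical manifold.\<close>

definition flow ::
  "'x::banach nspace \<Rightarrow> ('x \<Rightarrow> 'x) \<Rightarrow> ('x \<Rightarrow> 'y::banach \<Rightarrow> 'x) \<Rightarrow>
    'y nspace \<Rightarrow> ('y \<Rightarrow> 'y) \<Rightarrow> ('x \<Rightarrow> 'y \<Rightarrow> 'y) \<Rightarrow>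
    real \<Rightarrow> real \<Rightarrow> real \<Rightarrow> 'x \<times> 'y \<Rightarrow> 'x \<times> 'y" where
  "flow X1 A f Y1 B g T \<epsilon> t p =
     (THE q. \<exists>u v. strict_solution X1 A f Y1 B g T \<epsilon> p u v \<and> q = (u t, v t))"

definition critical_map ::
  "'x::banach nspace \<Rightarrow> ('x \<Rightarrow> 'x) \<Rightarrow> ('x \<Rightarrow> 'y::banach \<Rightarrow> 'x) \<Rightarrow> 'y \<Rightarrow> 'x" where
  "critical_map X1 A f y = (THE x. x \<in> car X1 \<and> 0 = A x + f x y)"

definition prod_norm :: "'x nspace \<Rightarrow> 'y nspace \<Rightarrow> 'x \<times> 'y \<Rightarrow> real" where
  "prod_norm E F p = nrm E (fst p) + nrm F (snd p)"

end

(* Variation of constants together with the weakly singular bounds in (v) gives existence and uniqueness of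
   the fast-slow solutions and of the slow flow, by contraction in weighted spaces of continuous functions.
   The slow solution u0 = h0(v0) solves the fast equation up to a defect of epsilon times its time
   derivative. This derivative is bounded in X_{delta_X}, because the iterates of u = - A^{-1} f(u, v)
   converge in C^1 by the smallness condition; convolved with exp((t - s) A / epsilon) it contributes
   O(epsilon). The convolution with the difference of the values of f contracts with the weight
   exp(omega_f t / epsilon) by the choice of omega_f, and since exp((omega_B + c) t) is bounded above and
   below on [0, T], coupling this estimate with the one for the slow component gives the result. *)

theory Submission
  imports Defs
begin

section \<open>Strongly continuous semigroups\<close>

text \<open>The critical map is differentiated along curves only, and the derivative is found in
  X_\<delta> only: the first smallness condition yields the map with values in \<open>X1\<close>,
  the second one the convergence of the derivatives of the iterates, in a weaker norm. Hence two
  smoothing estimates into \<open>X1\<close> run side by side, from X_\<gamma> for the values of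
  \<open>f\<close> and from X_\<delta> for the defect. All weakly singular convolutions are bounded
  by one device: s powr (\<theta> - 1) is cut at the height that it has at a free point a; the
  excess is integrated explicitly, and the rest multiplies the integral of the other factor. With a
  proportional to \<epsilon>, the powers of \<epsilon> come out by scaling. For the fast
  contraction, a = \<gamma> \<epsilon> / (\<omega>f - \<omega>A) gives the factor (2 - \<gamma>)
  \<gamma> powr (\<gamma> - 1), and for \<gamma> < 1 the formula for \<omega>f turns the whole rate
  into 1 - \<gamma>/2. A margin thus remains to absorb the coupling with the slow component.\<close>

lemma has_vector_derivative_iff_quotient:
  "(f has_vector_derivative d) (at t within U) \<longleftrightarrow>
     ((\<lambda>r. (f r - f t) /\<^sub>R (r - t)) \<longlongrightarrow> d) (at t within U)"
proof -
  have "(f has_vector_derivative d) (at t within U) \<longleftrightarrow>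
      ((\<lambda>r. norm (f r - f t - (r - t) *\<^sub>R d) / norm (r - t)) \<longlongrightarrow> 0) (at t within U)"
    by (simp add: has_vector_derivative_def has_derivative_iff_norm bounded_linear_scaleR_left)
  also have "\<dots> \<longleftrightarrow> ((\<lambda>r. norm ((f r - f t) /\<^sub>R (r - t) - d)) \<longlongrightarrow> 0) (at t within U)"
  proof (rule filterlim_cong[OF refl refl])
    show "eventually (\<lambda>r. norm (f r - f t - (r - t) *\<^sub>R d) / norm (r - t)
        = norm ((f r - f t) /\<^sub>R (r - t) - d)) (at t within U)"
      unfolding eventually_at_filter
    proof (rule always_eventually, intro allI impI)
      fix r assume "r \<noteq> t"
      then have "(f r - f t) /\<^sub>R (r - t) - d = (f r - f t - (r - t) *\<^sub>R d) /\<^sub>R (r - t)"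
        by (simp add: scaleR_diff_right)
      then show "norm (f r - f t - (r - t) *\<^sub>R d) / norm (r - t) = norm ((f r - f t) /\<^sub>R (r - t) - d)"
        by (simp add: divide_inverse mult.commute)
    qed
  qed
  also have "\<dots> \<longleftrightarrow> ((\<lambda>r. (f r - f t) /\<^sub>R (r - t)) \<longlongrightarrow> d) (at t within U)"
    by (simp add: tendsto_norm_zero_iff LIM_zero_iff)
  finally show ?thesis .
qed

text \<open>Local boundedness is supplied by exponential stability for the fast semigroup and, for
  the slow one, by the bound on \<open>Y1\<close> carried to the whole space by the resolvent. Plain
  functions leave room for rescaled time and for products.\<close>

locale strong_semigroup =
  fixes S :: "real \<Rightarrow> 'z::banach \<Rightarrow> 'z"
  assumes S_linear: "0 \<le> t \<Longrightarrow> bounded_linear (S t)"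
    and S_0: "S 0 x = x"
    and S_add: "0 \<le> s \<Longrightarrow> 0 \<le> t \<Longrightarrow> S (s + t) x = S s (S t x)"
    and S_tendsto_0: "((\<lambda>t. S t x) \<longlongrightarrow> x) (at_right 0)"
    and S_locally_bounded: "\<exists>M. \<forall>t\<in>{0..\<tau>}. \<forall>x. norm (S t x) \<le> M * norm x"
begin

lemma S_bound_pos: obtains M where "M > 0" "\<And>t x. t \<in> {0..\<tau>} \<Longrightarrow> norm (S t x) \<le> M * norm x"
proof -
  obtain M where M: "\<forall>t\<in>{0..\<tau>}. \<forall>x. norm (S t x) \<le> M * norm x"
    using S_locally_bounded by blast
  show ?thesis
  proof (rule that[of "max M 1"])
    fix t x assume "t \<in> {0..\<tau>}"
    then have "norm (S t x) \<le> M * norm x" using M by blast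
    also have "\<dots> \<le> max M 1 * norm x" by (intro mult_right_mono) auto
    finally show "norm (S t x) \<le> max M 1 * norm x" .
  qed simp
qed

lemma S_diff: "0 \<le> t \<Longrightarrow> S t (x - y) = S t x - S t y"
  using S_linear bounded_linear.linear linear_diff by blast

lemma S_plus: "0 \<le> t \<Longrightarrow> S t (x + y) = S t x + S t y"
  using S_linear bounded_linear.linear linear_add by blast

lemma S_scaleR: "0 \<le> t \<Longrightarrow> S t (c *\<^sub>R x) = c *\<^sub>R S t x"
  using S_linear bounded_linear.linear linear_scale by blast

lemma S_zero: "0 \<le> t \<Longrightarrow> S t 0 = 0"
  using S_linear bounded_linear.linear linear_0 by blast

text \<open>The increment between times q \<le> r is \<open>S q\<close> applied to
  \<open>S (r - q) x - x\<close>. Right continuity at 0 and the local bound therefore give a modulus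
  uniform in the smaller time, hence continuity from the left as well.\<close>

lemma S_continuous_on: "continuous_on {0..} (\<lambda>t. S t x)"
proof -
  have "\<exists>d>0. \<forall>r\<in>{0..}. dist r s < d \<longrightarrow> dist (S r x) (S s x) < e" if s: "0 \<le> s" and e: "0 < e" for s e
  proof -
    obtain M where M: "M > 0" "\<And>t x. t \<in> {0..s+1} \<Longrightarrow> norm (S t x) \<le> M * norm x"
      using S_bound_pos[of "s+1"] by blast
    have "eventually (\<lambda>t. dist (S t x) x < e / M) (at_right 0)"
      using S_tendsto_0[of x] M e by (intro tendstoD) auto
    then obtain d where d: "d > 0" "\<And>t. 0 < t \<Longrightarrow> t < d \<Longrightarrow> dist (S t x) x < e / M"
      unfolding eventually_at_right_field by auto
    have small: "dist (S r x) (S q x) < e" if "0 \<le> q" "q \<le> r" "r \<le> s + 1" "r - q < d" for q r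
    proof (cases "q = r")
      case False
      have "S r x - S q x = S q (S (r - q) x - x)"
        using S_add[of q "r - q" x] that by (simp add: S_diff)
      then have "norm (S r x - S q x) \<le> M * norm (S (r - q) x - x)"
        using M(2)[of q] that by auto
      also have "\<dots> < M * (e / M)"
        using d(2)[of "r - q"] that False M by (intro mult_strict_left_mono) (auto simp: dist_norm)
      finally show ?thesis using M by (simp add: dist_norm)
    qed (use e in auto)
    show ?thesis
    proof (intro exI[of _ "min d 1"] conjI ballI impI)
      fix r :: real assume r: "r \<in> {0..}" "dist r s < min d 1"
      show "dist (S r x) (S s x) < e"
      proof (cases "r \<le> s")
        case True then show ?thesis using small[of r s] r s by (auto simp: dist_real_def dist_commute)
      next
        case False then show ?thesis using small[of s r] r s by (auto simp: dist_real_def)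
      qed
    qed (use d in auto)
  qed
  then show ?thesis unfolding continuous_on_iff by auto
qed

text \<open>Joint continuity in time and vector: the local bound controls the change of the vector
  uniformly in time, and strong continuity handles the change of time at a fixed vector.\<close>

lemma S_tendsto:
  assumes \<tau>: "(\<tau> \<longlongrightarrow> \<tau>0) F" and w: "(w \<longlongrightarrow> w0) F"
    and nonneg: "eventually (\<lambda>k. 0 \<le> \<tau> k) F" and \<tau>0: "0 \<le> \<tau>0"
  shows "((\<lambda>k. S (\<tau> k) (w k)) \<longlongrightarrow> S \<tau>0 w0) F"
proof -
  obtain M where M: "M > 0" "\<And>t x. t \<in> {0..\<tau>0+1} \<Longrightarrow> norm (S t x) \<le> M * norm x"
    using S_bound_pos[of "\<tau>0+1"] by blast
  have ev: "eventually (\<lambda>k. \<tau> k \<in> {0..\<tau>0+1}) F"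
  proof -
    have "eventually (\<lambda>k. \<tau> k < \<tau>0 + 1) F" using \<tau> by (rule order_tendstoD) simp
    with nonneg show ?thesis by eventually_elim auto
  qed
  have "((\<lambda>k. S (\<tau> k) w0) \<longlongrightarrow> S \<tau>0 w0) F"
  proof (rule continuous_on_tendsto_compose[OF S_continuous_on \<tau>])
    show "eventually (\<lambda>k. \<tau> k \<in> {0..}) F" using nonneg by simp
  qed (use \<tau>0 in simp)
  moreover have "((\<lambda>k. S (\<tau> k) (w k) - S (\<tau> k) w0) \<longlongrightarrow> 0) F"
  proof (rule Lim_null_comparison)
    show "eventually (\<lambda>k. norm (S (\<tau> k) (w k) - S (\<tau> k) w0) \<le> M * norm (w k - w0)) F"
      using ev by eventually_elim (use M(2) in \<open>auto simp: S_diff[symmetric]\<close>)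
    show "((\<lambda>k. M * norm (w k - w0)) \<longlongrightarrow> 0) F"
      using w by (intro tendsto_mult_right_zero tendsto_norm_zero) (simp add: LIM_zero)
  qed
  ultimately show ?thesis using tendsto_add by fastforce
qed

lemma S_continuous_on_compose:
  assumes "continuous_on K \<tau>" "continuous_on K w" "\<And>k. k \<in> K \<Longrightarrow> 0 \<le> \<tau> k"
  shows "continuous_on K (\<lambda>k. S (\<tau> k) (w k))"
  using assms unfolding continuous_on_def
  by (auto intro!: S_tendsto simp: eventually_at_filter)

text \<open>On either side of t the difference quotient is \<open>S (min r t)\<close> applied to the
  quotient at 0 with step |r - t|, so joint continuity gives both one-sided derivatives at
  once.\<close>

lemma orbit_has_vector_derivative:
  assumes gen: "((\<lambda>h. (1 / h) *\<^sub>R (S h x - x)) \<longlongrightarrow> y) (at_right 0)" and t: "0 \<le> t"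
  shows "((\<lambda>t. S t x) has_vector_derivative S t y) (at t within {0..})"
proof -
  define q where "q h = (1 / h) *\<^sub>R (S h x - x)" for h
  have q: "(q \<longlongrightarrow> y) (at_right 0)"
    using gen by (simp add: q_def[abs_def])
  have abs: "filterlim (\<lambda>r. \<bar>r - t\<bar>) (at_right 0) (at t within {0..})"
    unfolding filterlim_at
    by (auto intro!: tendsto_eq_intros simp: eventually_at_filter)
  have "((\<lambda>r. S (min r t) (q \<bar>r - t\<bar>)) \<longlongrightarrow> S t y) (at t within {0..})"
  proof (rule S_tendsto)
    show "((\<lambda>r. min r t) \<longlongrightarrow> t) (at t within {0..})" by (auto intro!: tendsto_eq_intros)
    show "((\<lambda>r. q \<bar>r - t\<bar>) \<longlongrightarrow> y) (at t within {0..})"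
      using filterlim_compose[OF q abs] .
  qed (use t in \<open>auto simp: eventually_at_filter\<close>)
  moreover have "eventually (\<lambda>r. S (min r t) (q \<bar>r - t\<bar>) = (S r x - S t x) /\<^sub>R (r - t)) (at t within {0..})"
    unfolding eventually_at_filter
  proof (rule always_eventually, intro allI impI)
    fix r :: real assume r: "r \<noteq> t" "r \<in> {0..}"
    show "S (min r t) (q \<bar>r - t\<bar>) = (S r x - S t x) /\<^sub>R (r - t)"
    proof (cases "r < t")
      case True
      then have "S t x = S r (S (t - r) x)" using S_add[of r "t - r"] r by auto
      then show ?thesis using True r
        by (simp add: q_def S_scaleR S_diff min_def divide_inverse)
           (metis minus_diff_eq scaleR_minus_left scaleR_minus_right inverse_minus_eq)
    next
      case False
      then have "S r x = S t (S (r - t) x)" using S_add[of t "r - t"] r t by auto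
      then show ?thesis using False r t
        by (simp add: q_def S_scaleR S_diff min_def divide_inverse)
    qed
  qed
  ultimately have "((\<lambda>r. (S r x - S t x) /\<^sub>R (r - t)) \<longlongrightarrow> S t y) (at t within {0..})"
    by (simp add: filterlim_cong)
  then show ?thesis by (simp add: has_vector_derivative_iff_quotient)
qed

section \<open>Duhamel terms and variation of constants\<close>

definition conv :: "(real \<Rightarrow> 'z) \<Rightarrow> real \<Rightarrow> 'z" where
  "conv F t = integral {0..t} (\<lambda>s. S (t - s) (F s))"

lemma conv_integrand_continuous:
  assumes "continuous_on {a..b} F" "b \<le> t"
  shows "continuous_on {a..b} (\<lambda>s. S (t - s) (F s))"
  by (rule S_continuous_on_compose) (use assms in \<open>auto intro!: continuous_intros\<close>)

lemma conv_diff: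
  assumes "continuous_on {0..t} F" "continuous_on {0..t} H"
  shows "conv (\<lambda>s. F s - H s) t = conv F t - conv H t"
proof -
  have "conv (\<lambda>s. F s - H s) t = integral {0..t} (\<lambda>s. S (t - s) (F s) - S (t - s) (H s))"
    unfolding conv_def by (rule integral_cong) (auto simp: S_diff)
  also have "\<dots> = conv F t - conv H t"
    unfolding conv_def using assms
    by (intro integral_diff integrable_continuous_real conv_integrand_continuous) auto
  finally show ?thesis .
qed

lemma conv_0 [simp]: "conv F 0 = 0"
  by (simp add: conv_def)

end

text \<open>
  The domain of the generator \<open>A\<close> is parametrized as the range of \<open>R\<close>, the inverse of \<open>A - \<mu>\<close>. The
  bounded operator \<open>L\<close> expresses \<open>A\<close> in this parametrization.
\<close>

locale generated_semigroup = strong_semigroup S for S :: "real \<Rightarrow> 'z::banach \<Rightarrow> 'z" +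
  fixes A R L :: "'z \<Rightarrow> 'z"
  assumes R_linear: "bounded_linear R" and R_inj: "inj R"
    and S_R: "0 \<le> t \<Longrightarrow> S t (R x) = R (S t x)"
    and generator: "((\<lambda>t. (1 / t) *\<^sub>R (S t (R x) - R x)) \<longlongrightarrow> A (R x)) (at_right 0)"
    and L_linear: "bounded_linear L" and A_R: "A (R x) = L x"
begin

lemma R_diff: "R (x - y) = R x - R y"
  using R_linear bounded_linear.linear linear_diff by blast

lemma R_plus: "R (x + y) = R x + R y"
  using R_linear bounded_linear.linear linear_add by blast

lemma R_scaleR: "R (c *\<^sub>R x) = c *\<^sub>R R x"
  using R_linear bounded_linear.linear linear_scale by blast

lemma R_zero: "R 0 = 0"
  using R_linear bounded_linear.linear linear_0 by blast

lemma R_eq_iff: "R x = R y \<longleftrightarrow> x = y"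
  using R_inj by (auto simp: inj_def)

lemma inv_R [simp]: "inv R (R x) = x"
  using R_inj by simp

lemma L_diff: "L (x - y) = L x - L y"
  using L_linear bounded_linear.linear linear_diff by blast

text \<open>Applying \<open>S t\<close> to the quotients that converge to \<open>L x\<close> yields
  the quotients that converge to \<open>L (S t x)\<close>; limits are unique.\<close>

lemma S_L:
  assumes "0 \<le> t"
  shows "S t (L x) = L (S t x)"
proof -
  have "((\<lambda>h. S t ((1 / h) *\<^sub>R (S h (R x) - R x))) \<longlongrightarrow> S t (L x)) (at_right 0)"
    using generator[of x] bounded_linear.tendsto[OF S_linear[OF assms]] A_R by metis
  moreover have "eventually (\<lambda>h. S t ((1 / h) *\<^sub>R (S h (R x) - R x))
       = (1 / h) *\<^sub>R (S h (R (S t x)) - R (S t x))) (at_right 0)"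
    unfolding eventually_at_right_field
  proof (intro exI[of _ 1] conjI allI impI)
    fix h :: real assume h: "0 < h"
    have "S t (S h (R x)) = S h (S t (R x))"
      using S_add[of t h "R x"] S_add[of h t "R x"] h assms by (simp add: add.commute)
    then show "S t ((1 / h) *\<^sub>R (S h (R x) - R x)) = (1 / h) *\<^sub>R (S h (R (S t x)) - R (S t x))"
      using h assms by (simp add: S_scaleR S_diff S_R)
  qed simp
  ultimately have "((\<lambda>h. (1 / h) *\<^sub>R (S h (R (S t x)) - R (S t x))) \<longlongrightarrow> S t (L x)) (at_right 0)"
    by (simp add: filterlim_cong)
  from tendsto_unique[OF _ this generator] show ?thesis by (simp add: A_R)
qed

lemma S_R_has_vector_derivative:
  assumes "0 \<le> t"
  shows "((\<lambda>t. S t (R x)) has_vector_derivative S t (L x)) (at t within {0..})"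
  using orbit_has_vector_derivative[OF generator assms] by (simp add: A_R)

lemma S_R_reversed_has_vector_derivative:
  assumes "s \<in> {a..t}"
  shows "((\<lambda>s. S (t - s) (R x)) has_vector_derivative - S (t - s) (L x)) (at s within {a..t})"
proof -
  have "((\<lambda>s. t - s) has_vector_derivative -1) (at s within {a..t})"
    by (auto intro!: derivative_eq_intros)
  moreover have "((\<lambda>t. S t (R x)) has_vector_derivative S (t - s) (L x))
      (at (t - s) within (\<lambda>s. t - s) ` {a..t})"
    by (rule has_vector_derivative_within_subset[OF S_R_has_vector_derivative]) (use assms in auto)
  ultimately show ?thesis using vector_diff_chain_within by (fastforce simp: o_def)
qed

text \<open>In the derivative of s \<mapsto> \<open>S (t - s) (u s)\<close> the two generator terms
  cancel and \<open>S (t - s) (F s)\<close> remains; it is then integrated from 0 to t.\<close>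

lemma variation_of_constants:
  assumes deriv: "\<And>s. s \<in> {0..T} \<Longrightarrow> (u has_vector_derivative (A (u s) + F s)) (at s within {0..T})"
    and dom: "\<And>s. s \<in> {0..T} \<Longrightarrow> u s \<in> range R"
    and t: "t \<in> {0..T}"
  shows "u t = S t (u 0) + conv F t"
proof -
  have "((\<lambda>s. S (t - s) (u s)) has_vector_derivative S (t - s) (F s)) (at s within {0..t})"
    if s: "s \<in> {0..t}" for s
  proof -
    obtain w where w: "u s = R w" using dom[of s] s t by auto
    have "(u has_vector_derivative (L w + F s)) (at s within {0..t})"
      using has_vector_derivative_within_subset[OF deriv] s t w A_R by fastforce
    then have q: "((\<lambda>r. (u r - u s) /\<^sub>R (r - s)) \<longlongrightarrow> L w + F s) (at s within {0..t})"
      by (simp add: has_vector_derivative_iff_quotient)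
    \<comment> \<open>The product rule is carried out on quotients: the operator at the moving time
      r acts on the quotient of \<open>u\<close>, which is where joint continuity is used, while the
      quotient of the operators acts on the fixed vector \<open>u s\<close> of the domain.\<close>
    have 1: "((\<lambda>r. S (t - r) ((u r - u s) /\<^sub>R (r - s))) \<longlongrightarrow> S (t - s) (L w + F s)) (at s within {0..t})"
      by (rule S_tendsto[OF _ q]) (use s in \<open>auto intro!: tendsto_eq_intros simp: eventually_at_filter\<close>)
    have 2: "((\<lambda>r. (S (t - r) (u s) - S (t - s) (u s)) /\<^sub>R (r - s)) \<longlongrightarrow> - S (t - s) (L w)) (at s within {0..t})"
      using S_R_reversed_has_vector_derivative[OF s] w by (simp add: has_vector_derivative_iff_quotient)
    have "((\<lambda>r. S (t - r) ((u r - u s) /\<^sub>R (r - s)) + (S (t - r) (u s) - S (t - s) (u s)) /\<^sub>R (r - s))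
        \<longlongrightarrow> S (t - s) (F s)) (at s within {0..t})"
      using tendsto_add[OF 1 2] s by (simp add: S_plus)
    moreover have "eventually (\<lambda>r. S (t - r) ((u r - u s) /\<^sub>R (r - s)) + (S (t - r) (u s) - S (t - s) (u s)) /\<^sub>R (r - s)
        = (S (t - r) (u r) - S (t - s) (u s)) /\<^sub>R (r - s)) (at s within {0..t})"
      unfolding eventually_at_filter
      by (rule always_eventually) (auto simp: S_scaleR S_diff scaleR_diff_right)
    ultimately show ?thesis
      by (simp add: has_vector_derivative_iff_quotient filterlim_cong)
  qed
  then have "((\<lambda>s. S (t - s) (F s)) has_integral (S (t - t) (u t) - S (t - 0) (u 0))) {0..t}"
    using t by (intro fundamental_theorem_of_calculus) auto
  then show ?thesis by (simp add: conv_def S_0 integral_unique)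
qed

text \<open>A Duhamel term need not be differentiable for merely continuous \<open>F\<close>; values
  in the domain with a continuous coordinate \<open>w\<close> make it so. Then each increment is the
  integral of an integrand that tends to \<open>L (w p) + F p\<close> near p.\<close>

lemma conv_has_vector_derivative:
  assumes F: "continuous_on {0..T} F" and w: "continuous_on {0..T} w"
    and conv: "\<And>t. t \<in> {0..T} \<Longrightarrow> conv F t = R (w t)"
    and p: "p \<in> {0..T}"
  shows "(conv F has_vector_derivative (L (w p) + F p)) (at p within {0..T})"
proof -
  \<comment> \<open>The increment consists of the new part of the integral and of
    \<open>S (t - s) - 1\<close> applied to the old value \<open>R (w s)\<close>; the latter is
    itself an integral of \<open>S (t - r) (L (w s))\<close>, so both merge into one.\<close>
  have diff: "((\<lambda>r. S (t - r) (F r + L (w s))) has_integral (conv F t - conv F s)) {s..t}"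
    if st: "0 \<le> s" "s \<le> t" "t \<le> T" for s t
  proof -
    have Ft: "continuous_on {0..t} F" "continuous_on {s..t} F" "continuous_on {0..s} F"
      by (rule continuous_on_subset[OF F], use st in auto)+
    have "conv F t = integral {0..s} (\<lambda>r. S (t - r) (F r)) + integral {s..t} (\<lambda>r. S (t - r) (F r))"
      unfolding conv_def
      by (rule Henstock_Kurzweil_Integration.integral_combine[symmetric])
         (use st Ft in \<open>auto intro!: integrable_continuous_real conv_integrand_continuous\<close>)
    also have "integral {0..s} (\<lambda>r. S (t - r) (F r)) = integral {0..s} (\<lambda>r. S (t - s) (S (s - r) (F r)))"
      by (rule integral_cong) (use st S_add[of "t - s"] in \<open>auto simp flip: S_add\<close>)
    also have "\<dots> = S (t - s) (conv F s)"
      unfolding conv_def using st Ft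
      by (intro integral_linear[unfolded o_def] integrable_continuous_real conv_integrand_continuous S_linear) auto
    finally have "((\<lambda>r. S (t - r) (F r)) has_integral (conv F t - S (t - s) (conv F s))) {s..t}"
      using st Ft by (auto intro!: integrable_integral integrable_continuous_real conv_integrand_continuous simp: has_integral_iff)
    moreover have "((\<lambda>r. - (- S (t - r) (L (w s)))) has_integral - (S (t - t) (R (w s)) - S (t - s) (R (w s)))) {s..t}"
      by (intro has_integral_neg fundamental_theorem_of_calculus S_R_reversed_has_vector_derivative) (use st in auto)
    ultimately have "((\<lambda>r. S (t - r) (F r) + - (- S (t - r) (L (w s)))) has_integral
        (conv F t - S (t - s) (conv F s) + - (S (t - t) (R (w s)) - S (t - s) (R (w s))))) {s..t}"
      by (rule has_integral_add)
    moreover have "conv F t - S (t - s) (conv F s) + - (S (t - t) (R (w s)) - S (t - s) (R (w s))) = conv F t - conv F s"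
      using conv[of s] st by (simp add: S_0)
    ultimately have "((\<lambda>r. S (t - r) (F r) + S (t - r) (L (w s))) has_integral (conv F t - conv F s)) {s..t}"
      by (simp only: minus_minus)
    then show ?thesis
      by (rule has_integral_eq[rotated]) (auto simp: S_plus)
  qed
  define k where "k = L (w p) + F p"
  obtain M where M: "M > 0" "\<And>t x. t \<in> {0..T} \<Longrightarrow> norm (S t x) \<le> M * norm x"
    using S_bound_pos[of T] by blast
  have Lw: "continuous_on {0..T} (\<lambda>s. L (w s))"
    using bounded_linear.continuous_on[OF L_linear w] .
  have "\<exists>d>0. \<forall>y\<in>{0..T}. norm (y - p) < d \<longrightarrow>
      norm (conv F y - conv F p - (y - p) *\<^sub>R k) \<le> e * norm (y - p)" if e: "0 < e" for e
  proof -
    have e': "e / (3 * M) > 0" "e / 3 > 0" using e M by auto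
    obtain d1 where d1: "d1 > 0" "\<And>r. r \<in> {0..T} \<Longrightarrow> \<bar>r - p\<bar> < d1 \<Longrightarrow> norm (F r - F p) < e / (3 * M)"
      using F p e'(1) unfolding continuous_on_iff dist_norm real_norm_def by meson
    obtain d2 where d2: "d2 > 0" "\<And>r. r \<in> {0..T} \<Longrightarrow> \<bar>r - p\<bar> < d2 \<Longrightarrow> norm (L (w r) - L (w p)) < e / (3 * M)"
      using Lw p e'(1) unfolding continuous_on_iff dist_norm real_norm_def by meson
    obtain d3 where d3: "d3 > 0" "\<And>r. r \<in> {0..} \<Longrightarrow> \<bar>r - 0\<bar> < d3 \<Longrightarrow> norm (S r k - S 0 k) < e / 3"
      using S_continuous_on[of k] e'(2) unfolding continuous_on_iff dist_norm real_norm_def by (meson atLeast_iff order_refl)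
    have near: "norm (S (t - r) (F r + L (w s)) - k) \<le> e"
      if "0 \<le> s" "s \<le> r" "r \<le> t" "t \<le> T" "\<bar>s - p\<bar> < min d1 d2" "\<bar>r - p\<bar> < min d1 d2" "t - r < d3" for s r t
    proof -
      have "S (t - r) (F r + L (w s)) - k = S (t - r) (F r - F p + (L (w s) - L (w p))) + (S (t - r) k - k)"
        using that by (simp add: S_plus S_diff k_def)
      also have "norm \<dots> \<le> M * norm (F r - F p + (L (w s) - L (w p))) + norm (S (t - r) k - k)"
        using that M(2)[of "t - r"] by (intro order_trans[OF norm_triangle_ineq] add_mono) auto
      also have "\<dots> \<le> M * (e / (3 * M) + e / (3 * M)) + e / 3"
      proof (intro add_mono mult_left_mono)
        show "norm (F r - F p + (L (w s) - L (w p))) \<le> e / (3 * M) + e / (3 * M)"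
          using d1(2)[of r] d2(2)[of s] that by (intro order_trans[OF norm_triangle_ineq] add_mono) auto
        show "norm (S (t - r) k - k) \<le> e / 3" using d3(2)[of "t - r"] that by (auto simp: S_0)
      qed (use M in auto)
      also have "\<dots> = e" using M by (simp add: field_simps)
      finally show ?thesis .
    qed
    \<comment> \<open>The case t = p is the derivative from the left: there \<open>w\<close> is
      taken at the left end point instead of p, and its continuity closes the gap.\<close>
    have bound: "norm (conv F t - conv F s - (t - s) *\<^sub>R k) \<le> e * (t - s)"
      if "0 \<le> s" "s \<le> t" "t \<le> T" "s = p \<or> t = p" "t - s < min (min d1 d2) d3" for s t
    proof -
      have "((\<lambda>r. S (t - r) (F r + L (w s)) - k) has_integral (conv F t - conv F s - (t - s) *\<^sub>R k)) (cbox s t)"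
        using has_integral_diff[OF diff has_integral_const_real[of k s t]] that by (simp add: cbox_interval)
      from has_integral_bound[OF _ this, of e] show ?thesis
        using near[of s _ t] that e by (auto simp: cbox_interval)
    qed
    show ?thesis
    proof (intro exI[of _ "min (min d1 d2) d3"] conjI ballI impI)
      fix y assume y: "y \<in> {0..T}" "norm (y - p) < min (min d1 d2) d3"
      show "norm (conv F y - conv F p - (y - p) *\<^sub>R k) \<le> e * norm (y - p)"
      proof (cases "p \<le> y")
        case True then show ?thesis using bound[of p y] y p by auto
      next
        case False
        have "conv F y - conv F p - (y - p) *\<^sub>R k = - (conv F p - conv F y - (p - y) *\<^sub>R k)"
          by (simp add: scaleR_diff_left)
        then show ?thesis using False bound[of y p] y p by (simp only: norm_minus_cancel) auto
      qed
    qed (use d1 d2 d3 in auto)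
  qed
  then show ?thesis
    unfolding has_vector_derivative_def has_derivative_within_alt k_def[symmetric]
    by (auto intro: bounded_linear_scaleR_left)
qed

end

section \<open>Normed subspaces\<close>

text \<open>Definiteness is left out, since the estimates treat the norm as a seminorm; where a
  vector has to vanish, an embedding or the locale \<open>normed_subspace\<close> supplies
  it.\<close>

definition normed_nspace :: "'a::real_normed_vector nspace \<Rightarrow> bool" where
  "normed_nspace E \<longleftrightarrow> subspace (car E) \<and> (\<forall>x\<in>car E. 0 \<le> nrm E x) \<and>
     (\<forall>x\<in>car E. \<forall>y\<in>car E. nrm E (x + y) \<le> nrm E x + nrm E y) \<and>
     (\<forall>a. \<forall>x\<in>car E. nrm E (a *\<^sub>R x) = \<bar>a\<bar> * nrm E x)"

lemma normed_nspaceD: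
  assumes "normed_nspace E"
  shows nspace_subspace: "subspace (car E)"
    and nspace_zero: "0 \<in> car E"
    and nspace_add: "\<And>x y. x \<in> car E \<Longrightarrow> y \<in> car E \<Longrightarrow> x + y \<in> car E"
    and nspace_diff: "\<And>x y. x \<in> car E \<Longrightarrow> y \<in> car E \<Longrightarrow> x - y \<in> car E"
    and nspace_scale: "\<And>x c. x \<in> car E \<Longrightarrow> c *\<^sub>R x \<in> car E"
    and nrm_nonneg: "\<And>x. x \<in> car E \<Longrightarrow> 0 \<le> nrm E x"
    and nrm_triangle: "\<And>x y. x \<in> car E \<Longrightarrow> y \<in> car E \<Longrightarrow> nrm E (x + y) \<le> nrm E x + nrm E y"
    and nrm_scale: "\<And>x c. x \<in> car E \<Longrightarrow> nrm E (c *\<^sub>R x) = \<bar>c\<bar> * nrm E x"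
  using assms unfolding normed_nspace_def
  by (auto intro: subspace_0 subspace_add subspace_diff subspace_scale)

lemma nrm_zero: "normed_nspace E \<Longrightarrow> nrm E 0 = 0"
  using nrm_scale[of E 0 0] nspace_zero[of E] by simp

lemma nrm_minus_commute:
  assumes "normed_nspace E" "x \<in> car E" "y \<in> car E"
  shows "nrm E (x - y) = nrm E (y - x)"
  using nrm_scale[OF assms(1), of "y - x" "-1"] nspace_diff[OF assms(1)] assms by simp

lemma nrm_triangle_sub:
  assumes "normed_nspace E" "x \<in> car E" "y \<in> car E"
  shows "nrm E x \<le> nrm E (x - y) + nrm E y"
  using nrm_triangle[OF assms(1), of "x - y" y] nspace_diff[OF assms(1)] assms by simp

lemma nrm_triangle_diff:
  assumes "normed_nspace E" "x \<in> car E" "y \<in> car E" "z \<in> car E"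
  shows "nrm E (x - z) \<le> nrm E (x - y) + nrm E (y - z)"
  using nrm_triangle[OF assms(1), of "x - y" "y - z"] nspace_diff[OF assms(1)] assms by simp

lemma nrm_abs_diff:
  assumes "normed_nspace E" "x \<in> car E" "y \<in> car E"
  shows "\<bar>nrm E x - nrm E y\<bar> \<le> nrm E (x - y)"
  using nrm_triangle_sub[OF assms(1,2,3)] nrm_triangle_sub[OF assms(1,3,2)]
    nrm_minus_commute[OF assms] by linarith

lemma C0_in_nrm_continuous:
  assumes E: "normed_nspace E" and u: "C0_in E T u"
  shows "continuous_on {0..T} (\<lambda>s. nrm E (u s))"
  unfolding continuous_on_def
proof
  fix s assume s: "s \<in> {0..T}"
  have "((\<lambda>r. nrm E (u r) - nrm E (u s)) \<longlongrightarrow> 0) (at s within {0..T})"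
  proof (rule Lim_null_comparison)
    show "((\<lambda>r. nrm E (u r - u s)) \<longlongrightarrow> 0) (at s within {0..T})"
      using u s by (auto simp: C0_in_def)
    show "\<forall>\<^sub>F r in at s within {0..T}. norm (nrm E (u r) - nrm E (u s)) \<le> nrm E (u r - u s)"
      unfolding eventually_at_filter
      using u s by (auto simp: C0_in_def intro!: always_eventually nrm_abs_diff[OF E])
  qed
  then show "((\<lambda>s. nrm E (u s)) \<longlongrightarrow> nrm E (u s)) (at s within {0..T})"
    by (simp add: LIM_zero_iff)
qed

lemma C0_in_bounded:
  assumes "normed_nspace E" "C0_in E T u"
  obtains K where "K \<ge> 0" "\<And>s. s \<in> {0..T} \<Longrightarrow> nrm E (u s) \<le> K"
proof -
  have "bounded ((\<lambda>s. nrm E (u s)) ` {0..T})"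
    by (intro compact_imp_bounded compact_continuous_image C0_in_nrm_continuous assms) auto
  then obtain K where "\<And>s. s \<in> {0..T} \<Longrightarrow> \<bar>nrm E (u s)\<bar> \<le> K"
    unfolding bounded_iff by force
  then have "nrm E (u s) \<le> max K 0" if "s \<in> {0..T}" for s using that by (force simp: abs_le_iff)
  then show ?thesis using that[of "max K 0"] by simp
qed

lemma C0_in_continuous_on:
  assumes K: "\<And>x. x \<in> car E \<Longrightarrow> norm x \<le> K * nrm E x" and E: "normed_nspace E" and u: "C0_in E T u"
  shows "continuous_on {0..T} u"
  unfolding continuous_on_def
proof
  fix s assume s: "s \<in> {0..T}"
  have "((\<lambda>r. u r - u s) \<longlongrightarrow> 0) (at s within {0..T})"
  proof (rule Lim_null_comparison)
    show "((\<lambda>r. K * nrm E (u r - u s)) \<longlongrightarrow> 0) (at s within {0..T})"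
      using u s by (auto simp: C0_in_def intro!: tendsto_mult_right_zero)
    show "\<forall>\<^sub>F r in at s within {0..T}. norm (u r - u s) \<le> K * nrm E (u r - u s)"
      unfolding eventually_at_filter
      using u s by (auto simp: C0_in_def intro!: always_eventually K nspace_diff[OF E])
  qed
  then show "(u \<longlongrightarrow> u s) (at s within {0..T})" by (simp add: LIM_zero_iff)
qed

lemma C0_in_diff:
  assumes E: "normed_nspace E" and u: "C0_in E T u" and v: "C0_in E T v"
  shows "C0_in E T (\<lambda>s. u s - v s)"
  unfolding C0_in_def
proof (intro ballI conjI)
  fix s assume s: "s \<in> {0..T}"
  then show "u s - v s \<in> car E" using u v by (auto simp: C0_in_def intro: nspace_diff[OF E])
  show "((\<lambda>r. nrm E (u r - v r - (u s - v s))) \<longlongrightarrow> 0) (at s within {0..T})"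
  proof (rule Lim_null_comparison)
    show "((\<lambda>r. nrm E (u r - u s) + nrm E (v r - v s)) \<longlongrightarrow> 0) (at s within {0..T})"
      using u v s by (auto simp: C0_in_def intro!: tendsto_add_zero)
    have "norm (nrm E (u r - v r - (u s - v s))) \<le> nrm E (u r - u s) + nrm E (v r - v s)" if "r \<in> {0..T}" for r
    proof -
      have car: "u r \<in> car E" "u s \<in> car E" "v r \<in> car E" "v s \<in> car E"
        using that s u v by (auto simp: C0_in_def)
      have eq: "u r - v r - (u s - v s) = (u r - u s) - (v r - v s)" by simp
      have "0 \<le> nrm E (u r - v r - (u s - v s))" using nrm_nonneg[OF E] nspace_diff[OF E] car by simp
      then show ?thesis unfolding eq
        using nrm_triangle_diff[OF E, of "u r - u s" 0 "v r - v s"] nspace_diff[OF E] car nspace_zero[OF E]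
          nrm_minus_commute[OF E, of 0 "v r - v s"]
        by simp
    qed
    then show "\<forall>\<^sub>F r in at s within {0..T}. norm (nrm E (u r - v r - (u s - v s))) \<le> nrm E (u r - u s) + nrm E (v r - v s)"
      unfolding eventually_at_filter by (auto intro!: always_eventually)
  qed
qed

section \<open>Convolution with a weakly singular kernel\<close>

text \<open>On a division fine for both gauges, the Riemann sums of \<open>f\<close> are dominated
  term by term by those of \<open>g\<close>, and the bound by \<open>K\<close> passes to the limit.
  The main use is with \<open>p x = nrm X1 (R x)\<close>, the domain norm expressed in the
  coordinate.\<close>

lemma has_integral_seminorm_le:
  fixes f :: "real \<Rightarrow> 'a::real_normed_vector" and p :: "'a \<Rightarrow> real"
  assumes f: "(f has_integral I) {a..b}" and g: "(g has_integral J) {a..b}"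
    and add: "\<And>x y. p (x + y) \<le> p x + p y" and scale: "\<And>c x. p (c *\<^sub>R x) = \<bar>c\<bar> * p x"
    and K: "\<And>x. p x \<le> K * norm x"
    and le: "\<And>x. x \<in> {a..b} \<Longrightarrow> p (f x) \<le> g x"
  shows "p I \<le> J"
proof (rule field_le_epsilon)
  fix e :: real assume e: "0 < e"
  \<comment> \<open>One share \<open>d\<close> is spent on the integral of \<open>g\<close>, and |K|
    shares on the seminorm of the difference between the integral of \<open>f\<close> and its
    Riemann sum.\<close>
  define d where "d = e / (\<bar>K\<bar> + 1)"
  have d: "d > 0" using e by (simp add: d_def add_nonneg_pos)
  obtain \<gamma>1 where \<gamma>1: "gauge \<gamma>1"
    "\<And>q. q tagged_division_of cbox a b \<Longrightarrow> \<gamma>1 fine q \<Longrightarrow> norm ((\<Sum>(x, k)\<in>q. measure lborel k *\<^sub>R f x) - I) < d"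
    using f d unfolding box_real[symmetric] has_integral by meson
  obtain \<gamma>2 where \<gamma>2: "gauge \<gamma>2"
    "\<And>q. q tagged_division_of cbox a b \<Longrightarrow> \<gamma>2 fine q \<Longrightarrow> norm ((\<Sum>(x, k)\<in>q. measure lborel k *\<^sub>R g x) - J) < d"
    using g d unfolding box_real[symmetric] has_integral by meson
  obtain q where q: "q tagged_division_of cbox a b" "(\<lambda>x. \<gamma>1 x \<inter> \<gamma>2 x) fine q"
    using fine_division_exists[OF gauge_Int[OF \<gamma>1(1) \<gamma>2(1)]] by blast
  have fine: "\<gamma>1 fine q" "\<gamma>2 fine q" using q(2) by (auto simp: fine_def)
  define s where "s = (\<Sum>(x, k)\<in>q. measure lborel k *\<^sub>R f x)"
  define t where "t = (\<Sum>(x, k)\<in>q. measure lborel k *\<^sub>R g x)"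
  have p0: "p 0 = 0" using scale[of 0 0] by simp
  have "p (sum h Q) \<le> (\<Sum>y\<in>Q. p (h y))" if "finite Q" for h :: "real \<times> real set \<Rightarrow> 'a" and Q
    using that by induction (auto simp: p0 intro: order_trans[OF add])
  then have "p s \<le> (\<Sum>y\<in>q. p (case y of (x, k) \<Rightarrow> measure lborel k *\<^sub>R f x))"
    unfolding s_def using q(1) by blast
  also have "\<dots> \<le> t"
    unfolding t_def
  proof (rule sum_mono)
    fix y assume y: "y \<in> q"
    obtain x k where xk: "y = (x, k)" by force
    have "x \<in> {a..b}" using tagged_division_ofD(2,3)[OF q(1), of x k] y xk by auto
    then show "p (case y of (x, k) \<Rightarrow> measure lborel k *\<^sub>R f x) \<le> (case y of (x, k) \<Rightarrow> measure lborel k *\<^sub>R g x)"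
      using le[of x] by (auto simp: xk scale intro!: mult_left_mono)
  qed
  finally have st: "p s \<le> t" .
  have "p I \<le> p s + p (I - s)" using add[of s "I - s"] by simp
  also have "p (I - s) \<le> \<bar>K\<bar> * d"
  proof -
    have "p (I - s) \<le> K * norm (I - s)" by (rule K)
    also have "\<dots> \<le> \<bar>K\<bar> * d"
      using \<gamma>1(2)[OF q(1) fine(1)] by (intro mult_mono) (auto simp: s_def norm_minus_commute)
    finally show ?thesis .
  qed
  also have "p s + \<bar>K\<bar> * d \<le> J + d + \<bar>K\<bar> * d"
    using st \<gamma>2(2)[OF q(1) fine(2)] by (auto simp: t_def)
  also have "\<dots> = J + (\<bar>K\<bar> + 1) * d" by (simp add: algebra_simps)
  also have "(\<bar>K\<bar> + 1) * d = e" by (simp add: d_def add_nonneg_eq_0_iff)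
  finally show "p I \<le> J + e" by simp
qed

text \<open>
  An upper bound for the integral of \<open>s powr (\<theta> - 1) * \<psi> s\<close>, where \<open>0 \<le> \<psi> \<le> K\<close> and \<open>D\<close> is the integral
  of \<open>\<psi>\<close>. It comes from the part of \<open>s powr (\<theta> - 1)\<close> above \<open>a powr (\<theta> - 1)\<close>, which lives on \<open>s < a\<close>.
\<close>

definition singular_weight :: "real \<Rightarrow> real \<Rightarrow> real \<Rightarrow> real \<Rightarrow> real" where
  "singular_weight \<theta> a K D = K * (a powr \<theta> / \<theta> - a powr \<theta>) + a powr (\<theta> - 1) * D"

text \<open>\<open>H\<close> is a primitive of the truncated power in s, and s = t r^m transports it
  to r in [0, 1]. Since \<open>h\<close> vanishes at 0 and increases up to a, the value
  \<open>h a\<close> is the bound for every t.\<close>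

lemma truncated_power_has_integral:
  fixes \<theta> t a :: real and m :: nat
  assumes \<theta>: "0 < \<theta>" "\<theta> \<le> 1" and m: "m \<noteq> 0" and t: "0 \<le> t" and a: "0 < a"
  obtains J where "((\<lambda>r. (t * m * r ^ (m - 1)) * max 0 ((t * r ^ m) powr (\<theta> - 1) - a powr (\<theta> - 1))) has_integral J) {0..1}"
    "J \<le> a powr \<theta> / \<theta> - a powr \<theta>"
proof (cases "t = 0")
  case True
  have "a powr \<theta> / \<theta> - a powr \<theta> \<ge> 0" using \<theta> by (simp add: field_simps mult_left_le_one_le)
  with True show ?thesis by (intro that[of 0]) auto
next
  case False
  then have t: "t > 0" using t by simp
  define h where "h s = s powr \<theta> / \<theta> - a powr (\<theta> - 1) * s" for s
  define H where "H s = h (min s a)" for s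
  have aa: "a powr (\<theta> - 1) * a = a powr \<theta>" using a by (simp add: powr_diff)
  have h': "(h has_real_derivative (s powr (\<theta> - 1) - a powr (\<theta> - 1))) (at s)" if "0 < s" for s
    unfolding h_def using that \<theta> by (auto intro!: derivative_eq_intros)
  have hc: "continuous_on {0..} h"
    unfolding h_def using \<theta> by (intro continuous_intros continuous_on_powr') auto
  have Hc: "continuous_on {0..} H"
    unfolding H_def
    by (rule continuous_on_compose2[OF hc]) (use a in \<open>auto intro!: continuous_intros\<close>)
  have H': "(H has_real_derivative max 0 (s powr (\<theta> - 1) - a powr (\<theta> - 1))) (at s)" if s: "0 < s" "s \<noteq> a" for s
  proof (cases "s < a")
    case True
    have "a powr (\<theta> - 1) \<le> s powr (\<theta> - 1)" using s True \<theta> by (intro powr_mono2') auto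
    then have "(h has_real_derivative max 0 (s powr (\<theta> - 1) - a powr (\<theta> - 1))) (at s)"
      using h'[OF s(1)] by simp
    then show ?thesis
      by (rule DERIV_cong_ev[THEN iffD2, rotated -1, OF _ refl _ refl])
         (use True in \<open>auto simp: H_def eventually_nhds intro!: exI[of _ "{..<a}"]\<close>)
  next
    case False
    have "s powr (\<theta> - 1) \<le> a powr (\<theta> - 1)" using s a False \<theta> by (intro powr_mono2') auto
    then have "((\<lambda>_. h a) has_real_derivative max 0 (s powr (\<theta> - 1) - a powr (\<theta> - 1))) (at s)"
      by simp
    then show ?thesis
      by (rule DERIV_cong_ev[THEN iffD2, rotated -1, OF _ refl _ refl])
         (use False s in \<open>auto simp: H_def eventually_nhds intro!: exI[of _ "{a<..}"]\<close>)
  qed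
  have "((\<lambda>r. (t * m * r ^ (m - 1)) * max 0 ((t * r ^ m) powr (\<theta> - 1) - a powr (\<theta> - 1))) has_integral
      (H (t * 1 ^ m) - H (t * 0 ^ m))) {0..1}"
  \<comment> \<open>The two excluded points are r = 0, where the power is singular, and the point
    with t r^m = a, where \<open>H\<close> may have a kink.\<close>
  proof (rule fundamental_theorem_of_calculus_strong[where S = "{0, root m (a / t)}"])
    show "continuous_on {0..1} (\<lambda>r. H (t * r ^ m))"
      by (rule continuous_on_compose2[OF Hc]) (use t in \<open>auto intro!: continuous_intros\<close>)
    fix r :: real assume r: "r \<in> {0..1} - {0, root m (a / t)}"
    have ne: "t * r ^ m \<noteq> a"
    proof
      assume "t * r ^ m = a"
      then have "r ^ m = a / t" using t by (simp add: field_simps)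
      then have "r = root m (a / t)" using r m real_root_power_cancel[of m r] by auto
      then show False using r by simp
    qed
    have "((\<lambda>r. t * r ^ m) has_real_derivative t * (m * r ^ (m - 1))) (at r)"
      by (auto intro!: derivative_eq_intros)
    from DERIV_chain2[OF H' this] show "((\<lambda>r. H (t * r ^ m)) has_vector_derivative
        (t * m * r ^ (m - 1)) * max 0 ((t * r ^ m) powr (\<theta> - 1) - a powr (\<theta> - 1))) (at r)"
      using ne r t by (simp add: has_real_derivative_iff_has_vector_derivative[symmetric] mult_ac)
  qed auto
  moreover have "H (t * 1 ^ m) - H (t * 0 ^ m) \<le> a powr \<theta> / \<theta> - a powr \<theta>"
  proof -
    have "h (min t a) \<le> h a"
    proof (rule DERIV_nonneg_imp_increasing_open[where f = h and a = "min t a" and b = a])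
      show "continuous_on {min t a..a} h" by (rule continuous_on_subset[OF hc]) (use t a in auto)
      fix s assume s: "min t a < s" "s < a"
      then have "a powr (\<theta> - 1) \<le> s powr (\<theta> - 1)" using t a \<theta> by (intro powr_mono2') auto
      then show "\<exists>y. (h has_real_derivative y) (at s) \<and> 0 \<le> y" using h'[of s] s t a by force
    qed simp
    then show ?thesis using m a by (simp add: H_def h_def aa power_0_left)
  qed
  ultimately show ?thesis by (rule that)
qed

text \<open>Above the height a powr (\<theta> - 1) the factor \<psi> is replaced by its bound K;
  below it only the integral of \<psi> counts, which the primitive \<Psi> gives. The result is a
  dominating function in the variable r, the form that comparison of Riemann sums requires.\<close>

lemma singular_weight_has_integral:
  fixes \<theta> t a :: real and m :: nat
  assumes \<theta>: "0 < \<theta>" "\<theta> \<le> 1" and m: "m \<noteq> 0" and t: "0 \<le> t" and a: "0 < a"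
    and \<psi>: "\<And>s. s \<in> {0..t} \<Longrightarrow> 0 \<le> \<psi> s" "\<And>s. s \<in> {0..t} \<Longrightarrow> \<psi> s \<le> K"
    and \<Psi>: "\<And>s. s \<in> {0..t} \<Longrightarrow> (\<Psi> has_real_derivative \<psi> s) (at s within {0..t})"
  obtains g J where "(g has_integral J) {0..1}" "J \<le> singular_weight \<theta> a K (\<Psi> t - \<Psi> 0)"
    "\<And>r. r \<in> {0..1} \<Longrightarrow> (t * m * r ^ (m - 1)) * (t * r ^ m) powr (\<theta> - 1) * \<psi> (t * r ^ m) \<le> g r"
proof -
  obtain J where J: "((\<lambda>r. (t * m * r ^ (m - 1)) * max 0 ((t * r ^ m) powr (\<theta> - 1) - a powr (\<theta> - 1))) has_integral J) {0..1}"
    "J \<le> a powr \<theta> / \<theta> - a powr \<theta>"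
    using truncated_power_has_integral[OF \<theta> m t a] by blast
  have tr: "t * r ^ m \<in> {0..t}" if "r \<in> {0..1}" for r
    using that t by (auto simp: power_le_one mult_left_le)
  have K: "K \<ge> 0" using \<psi>[of 0] t by auto
  have "((\<lambda>r. (t * m * r ^ (m - 1)) * \<psi> (t * r ^ m)) has_integral \<Psi> (t * 1 ^ m) - \<Psi> (t * 0 ^ m)) {0..1}"
  proof (rule fundamental_theorem_of_calculus)
    fix r :: real assume r: "r \<in> {0..1}"
    have "((\<lambda>r. t * r ^ m) has_real_derivative t * (m * r ^ (m - 1))) (at r within {0..1})"
      by (auto intro!: derivative_eq_intros)
    moreover have "(\<Psi> has_real_derivative \<psi> (t * r ^ m)) (at (t * r ^ m) within (\<lambda>r. t * r ^ m) ` {0..1})"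
      by (rule DERIV_subset[OF \<Psi>]) (use tr r in blast)+
    ultimately have "((\<lambda>r. \<Psi> (t * r ^ m)) has_real_derivative \<psi> (t * r ^ m) * (t * (m * r ^ (m - 1)))) (at r within {0..1})"
      using DERIV_image_chain[of \<Psi> _ "\<lambda>r. t * r ^ m"] by (simp add: o_def)
    then show "((\<lambda>r. \<Psi> (t * r ^ m)) has_vector_derivative (t * m * r ^ (m - 1)) * \<psi> (t * r ^ m)) (at r within {0..1})"
      by (simp add: has_real_derivative_iff_has_vector_derivative[symmetric] mult_ac)
  qed simp
  then have 2: "((\<lambda>r. (t * m * r ^ (m - 1)) * \<psi> (t * r ^ m)) has_integral (\<Psi> t - \<Psi> 0)) {0..1}"
    using m by (simp add: power_0_left)
  show ?thesis
  proof (rule that)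
    show "((\<lambda>r. (t * m * r ^ (m - 1)) * max 0 ((t * r ^ m) powr (\<theta> - 1) - a powr (\<theta> - 1)) * K
        + a powr (\<theta> - 1) * ((t * m * r ^ (m - 1)) * \<psi> (t * r ^ m))) has_integral
        (J * K + a powr (\<theta> - 1) * (\<Psi> t - \<Psi> 0))) {0..1}"
      by (intro has_integral_add has_integral_mult_left has_integral_mult_right J 2)
    show "J * K + a powr (\<theta> - 1) * (\<Psi> t - \<Psi> 0) \<le> singular_weight \<theta> a K (\<Psi> t - \<Psi> 0)"
      unfolding singular_weight_def using mult_right_mono[OF J(2) K] by (simp add: mult.commute)
    fix r :: real assume r: "r \<in> {0..1}"
    let ?p = "(t * r ^ m) powr (\<theta> - 1)" and ?q = "a powr (\<theta> - 1)" and ?w = "t * m * r ^ (m - 1)"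
    have \<psi>r: "0 \<le> \<psi> (t * r ^ m)" "\<psi> (t * r ^ m) \<le> K" using \<psi> tr[OF r] by auto
    have "?p * \<psi> (t * r ^ m) = (?p - ?q) * \<psi> (t * r ^ m) + ?q * \<psi> (t * r ^ m)" by (simp add: algebra_simps)
    also have "\<dots> \<le> max 0 (?p - ?q) * K + ?q * \<psi> (t * r ^ m)"
    proof (intro add_right_mono)
      have "(?p - ?q) * \<psi> (t * r ^ m) \<le> max 0 (?p - ?q) * \<psi> (t * r ^ m)"
        using \<psi>r by (intro mult_right_mono) auto
      also have "\<dots> \<le> max 0 (?p - ?q) * K" using \<psi>r by (intro mult_left_mono) auto
      finally show "(?p - ?q) * \<psi> (t * r ^ m) \<le> max 0 (?p - ?q) * K" .
    qed
    finally have "?w * (?p * \<psi> (t * r ^ m)) \<le> ?w * (max 0 (?p - ?q) * K + ?q * \<psi> (t * r ^ m))"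
      using t r by (intro mult_left_mono) auto
    then show "?w * ?p * \<psi> (t * r ^ m) \<le> ?w * max 0 (?p - ?q) * K + ?q * (?w * \<psi> (t * r ^ m))"
      by (simp add: algebra_simps)
  qed
qed

text \<open>\<open>E\<close> plays the role of the level of order \<theta>, and the norm of
  \<open>X1\<close> is equivalent to the norm of the coordinate \<open>inv R\<close>. Continuity
  into \<open>X1\<close> thus becomes continuity of the coordinate in the Banach type itself, where
  integrals and fixed points are available.\<close>

locale smoothing_semigroup = generated_semigroup S A R L
  for S :: "real \<Rightarrow> 'z::banach \<Rightarrow> 'z" and A R L :: "'z \<Rightarrow> 'z" +
  fixes X1 E :: "'z nspace" and \<theta> C \<omega> :: real
  assumes X1: "normed_nspace X1" and car_X1: "car X1 = range R"
    and X1_upper: "\<exists>K. \<forall>x. nrm X1 (R x) \<le> K * norm x"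
    and X1_lower: "\<exists>K. \<forall>x. norm x \<le> K * nrm X1 (R x)"
    and E: "normed_nspace E" and E_embeds: "\<exists>K. \<forall>x\<in>car E. norm x \<le> K * nrm E x"
    and \<theta>: "0 < \<theta>" "\<theta> \<le> 1" and C: "0 \<le> C"
    and smoothing: "\<And>t. 0 < t \<Longrightarrow> op_bound E X1 (S t) (C * t powr (\<theta> - 1) * exp (\<omega> * t))"
begin

lemma X1_upperE: obtains K where "K > 0" "\<And>x. nrm X1 (R x) \<le> K * norm x"
proof -
  obtain K where K: "\<And>x. nrm X1 (R x) \<le> K * norm x" using X1_upper by blast
  have "nrm X1 (R x) \<le> max K 1 * norm x" for x
    by (rule order_trans[OF K]) (auto intro: mult_right_mono)
  then show ?thesis using that[of "max K 1"] by simp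
qed

lemma X1_lowerE: obtains K where "K > 0" "\<And>x. norm x \<le> K * nrm X1 (R x)"
proof -
  obtain K where K: "\<And>x. norm x \<le> K * nrm X1 (R x)" using X1_lower by blast
  have "norm x \<le> max K 1 * nrm X1 (R x)" for x
    by (rule order_trans[OF K]) (auto intro!: mult_right_mono nrm_nonneg[OF X1] simp: car_X1)
  then show ?thesis using that[of "max K 1"] by simp
qed

lemma E_embedsE: obtains K where "K > 0" "\<And>x. x \<in> car E \<Longrightarrow> norm x \<le> K * nrm E x"
proof -
  obtain K where K: "\<And>x. x \<in> car E \<Longrightarrow> norm x \<le> K * nrm E x" using E_embeds by blast
  have "norm x \<le> max K 1 * nrm E x" if "x \<in> car E" for x
    by (rule order_trans[OF K[OF that]]) (auto intro!: mult_right_mono nrm_nonneg[OF E] that)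
  then show ?thesis using that[of "max K 1"] by simp
qed

lemma C0_in_X1I:
  assumes w: "continuous_on {0..T} w" and u: "\<And>t. t \<in> {0..T} \<Longrightarrow> u t = R (w t)"
  shows "C0_in X1 T u"
  unfolding C0_in_def
proof (intro ballI conjI)
  obtain K where K: "K > 0" "\<And>x. nrm X1 (R x) \<le> K * norm x" by (rule X1_upperE) blast
  fix s assume s: "s \<in> {0..T}"
  show "u s \<in> car X1" using u[OF s] car_X1 by simp
  show "((\<lambda>r. nrm X1 (u r - u s)) \<longlongrightarrow> 0) (at s within {0..T})"
  proof (rule Lim_null_comparison)
    show "((\<lambda>r. K * norm (w r - w s)) \<longlongrightarrow> 0) (at s within {0..T})"
      using w s unfolding continuous_on_def
      by (intro tendsto_mult_right_zero tendsto_norm_zero) (simp add: LIM_zero)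
    have "norm (nrm X1 (u r - u s)) \<le> K * norm (w r - w s)" if "r \<in> {0..T}" for r
    proof -
      have "u r - u s = R (w r - w s)" using u that s by (simp add: R_diff)
      then show ?thesis using K(2)[of "w r - w s"] nrm_nonneg[OF X1, of "R (w r - w s)"] car_X1 by simp
    qed
    then show "\<forall>\<^sub>F r in at s within {0..T}. norm (nrm X1 (u r - u s)) \<le> K * norm (w r - w s)"
      unfolding eventually_at_filter by (auto intro!: always_eventually)
  qed
qed

lemma C0_in_X1D:
  assumes u: "C0_in X1 T u"
  shows "continuous_on {0..T} (\<lambda>t. inv R (u t))" "\<And>t. t \<in> {0..T} \<Longrightarrow> R (inv R (u t)) = u t"
proof -
  show R: "R (inv R (u t)) = u t" if "t \<in> {0..T}" for t
    using u that car_X1 unfolding C0_in_def by (metis f_inv_into_f)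
  obtain K where K: "K > 0" "\<And>x. norm x \<le> K * nrm X1 (R x)" by (rule X1_lowerE) blast
  show "continuous_on {0..T} (\<lambda>t. inv R (u t))"
    unfolding continuous_on_def
  proof
    fix s assume s: "s \<in> {0..T}"
    have "((\<lambda>r. inv R (u r) - inv R (u s)) \<longlongrightarrow> 0) (at s within {0..T})"
    proof (rule Lim_null_comparison)
      show "((\<lambda>r. K * nrm X1 (u r - u s)) \<longlongrightarrow> 0) (at s within {0..T})"
        using u s by (auto simp: C0_in_def intro!: tendsto_mult_right_zero)
      show "\<forall>\<^sub>F r in at s within {0..T}. norm (inv R (u r) - inv R (u s)) \<le> K * nrm X1 (u r - u s)"
        unfolding eventually_at_filter
      proof (rule always_eventually, intro allI impI)
        fix r assume "r \<in> {0..T}"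
        then show "norm (inv R (u r) - inv R (u s)) \<le> K * nrm X1 (u r - u s)"
          using K(2)[of "inv R (u r) - inv R (u s)"] R s by (simp add: R_diff)
      qed
    qed
    then show "((\<lambda>t. inv R (u t)) \<longlongrightarrow> inv R (u s)) (at s within {0..T})" by (simp add: LIM_zero_iff)
  qed
qed

lemma C0_in_E_continuous_on: "C0_in E T F \<Longrightarrow> continuous_on {0..T} F"
  using E_embedsE C0_in_continuous_on[OF _ E] by metis

lemma smoothing_nrm:
  assumes "0 < t" "x \<in> car E"
  shows "R (inv R (S t x)) = S t x" "nrm X1 (S t x) \<le> C * t powr (\<theta> - 1) * exp (\<omega> * t) * nrm E x"
  using smoothing[OF assms(1)] assms(2) car_X1 unfolding op_bound_def by (auto intro: f_inv_into_f)

text \<open>At positive limit time, part of the evolution has already moved the limit vector into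
  the domain, and the remaining part acts on its coordinate by strong continuity. The change of the
  vector is controlled by the smoothing bound, whose power stays bounded away from time 0.\<close>

lemma smoothing_tendsto:
  assumes \<tau>: "(\<tau> \<longlongrightarrow> \<tau>0) F" "0 < \<tau>0" and x: "((\<lambda>k. nrm E (x k - x0)) \<longlongrightarrow> 0) F"
    and car: "eventually (\<lambda>k. x k \<in> car E) F" "x0 \<in> car E"
  shows "((\<lambda>k. inv R (S (\<tau> k) (x k))) \<longlongrightarrow> inv R (S \<tau>0 x0)) F"
proof -
  obtain K where K: "K > 0" "\<And>x. norm x \<le> K * nrm X1 (R x)" by (rule X1_lowerE) blast
  \<comment> \<open>Any time strictly between 0 and the limit time would do as the smoothing
    time.\<close>
  define h where "h = \<tau>0 / 2"
  define y where "y = inv R (S h x0)"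
  have h: "0 < h" "h < \<tau>0" using \<tau>(2) by (auto simp: h_def)
  have y: "S h x0 = R y" using smoothing_nrm(1)[OF h(1) car(2)] by (simp add: y_def)
  have inv: "inv R (S t x0) = S (t - h) y" if "h \<le> t" for t
    using S_add[of "t - h" h x0] that h y by (simp add: S_R)
  have big: "eventually (\<lambda>k. h < \<tau> k) F" using order_tendstoD(1)[OF \<tau>(1) h(2)] .
  have "((\<lambda>k. S (\<tau> k - h) y) \<longlongrightarrow> S (\<tau>0 - h) y) F"
    by (rule S_tendsto) (use \<tau> h in \<open>auto intro!: tendsto_eq_intros eventually_mono[OF big]\<close>)
  then have 1: "((\<lambda>k. inv R (S (\<tau> k) x0)) \<longlongrightarrow> inv R (S \<tau>0 x0)) F"
    unfolding inv[OF less_imp_le[OF h(2)]]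
    by (rule Lim_transform_eventually) (use big in eventually_elim, simp add: inv)
  have 2: "((\<lambda>k. inv R (S (\<tau> k) (x k)) - inv R (S (\<tau> k) x0)) \<longlongrightarrow> 0) F"
  proof (rule Lim_null_comparison)
    have "((\<lambda>k. K * (C * \<tau> k powr (\<theta> - 1) * exp (\<omega> * \<tau> k) * nrm E (x k - x0)))
        \<longlongrightarrow> K * (C * \<tau>0 powr (\<theta> - 1) * exp (\<omega> * \<tau>0) * 0)) F"
      using \<tau> x by (intro tendsto_intros) auto
    then show "((\<lambda>k. K * (C * \<tau> k powr (\<theta> - 1) * exp (\<omega> * \<tau> k) * nrm E (x k - x0))) \<longlongrightarrow> 0) F" by simp
    show "\<forall>\<^sub>F k in F. norm (inv R (S (\<tau> k) (x k)) - inv R (S (\<tau> k) x0))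
        \<le> K * (C * \<tau> k powr (\<theta> - 1) * exp (\<omega> * \<tau> k) * nrm E (x k - x0))"
      using big car(1)
    proof eventually_elim
      case (elim k)
      have pos: "0 < \<tau> k" using elim h by simp
      have "R (inv R (S (\<tau> k) (x k)) - inv R (S (\<tau> k) x0)) = S (\<tau> k) (x k - x0)"
        using smoothing_nrm(1)[OF pos] elim car(2) pos by (simp add: R_diff S_diff)
      then have "norm (inv R (S (\<tau> k) (x k)) - inv R (S (\<tau> k) x0)) \<le> K * nrm X1 (S (\<tau> k) (x k - x0))"
        using K(2) by metis
      also have "\<dots> \<le> K * (C * \<tau> k powr (\<theta> - 1) * exp (\<omega> * \<tau> k) * nrm E (x k - x0))"
        using smoothing_nrm(2)[OF pos nspace_diff[OF E elim(2) car(2)]] K(1) by (intro mult_left_mono) auto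
      finally show ?case .
    qed
  qed
  show ?thesis using tendsto_add[OF 2 1] by simp
qed

text \<open>
  Substituting \<open>s = t (1 - r ^ m)\<close> with \<open>m \<theta> > 1\<close> turns the weakly singular integrand into one that is
  jointly continuous in \<open>t \<ge> 0\<close> and \<open>r \<in> [0, 1]\<close>, so that no improper integrals of vector valued
  functions are needed.
\<close>

definition subst_kernel :: "nat \<Rightarrow> (real \<Rightarrow> 'z) \<Rightarrow> real \<Rightarrow> real \<Rightarrow> 'z" where
  "subst_kernel m F t r = (if t = 0 \<or> r = 0 then 0
     else (t * m * r ^ (m - 1)) *\<^sub>R inv R (S (t * r ^ m) (F (t * (1 - r ^ m)))))"

context
  fixes T :: real and F :: "real \<Rightarrow> 'z" and m :: nat
  assumes F: "C0_in E T F" and m: "1 < m * \<theta>"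
begin

private lemma m0: "2 \<le> m"
proof -
  have "1 < m * \<theta>" by (rule m)
  also have "\<dots> \<le> m" using \<theta> by (simp add: mult_left_le)
  finally show ?thesis by simp
qed

private lemma subst_in: "t * (1 - r ^ m) \<in> {0..T}" if "t \<in> {0..T}" "r \<in> {0..1}"
proof -
  have "0 \<le> 1 - r ^ m" "1 - r ^ m \<le> 1" using that by (auto simp: power_le_one)
  then have "0 \<le> t * (1 - r ^ m)" "t * (1 - r ^ m) \<le> t" using that by (auto simp: mult_left_le)
  then show ?thesis using that by simp
qed

private lemma F_car: "t \<in> {0..T} \<Longrightarrow> F t \<in> car E"
  using F by (auto simp: C0_in_def)

text \<open>The Jacobian t m r^(m-1) times (t r^m) powr (\<theta> - 1) equals m t powr \<theta>
  times r powr (m \<theta> - 1). Both exponents are positive, so 0 is the right value of the kernel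
  at t = 0 and at r = 0.\<close>

lemma subst_kernel_bound:
  obtains K where "\<And>t r. t \<in> {0..T} \<Longrightarrow> r \<in> {0..1} \<Longrightarrow>
    norm (subst_kernel m F t r) \<le> K * t powr \<theta> * r powr (m * \<theta> - 1)"
proof -
  obtain K where K: "K > 0" "\<And>x. norm x \<le> K * nrm X1 (R x)" by (rule X1_lowerE) blast
  obtain B where B: "B \<ge> 0" "\<And>s. s \<in> {0..T} \<Longrightarrow> nrm E (F s) \<le> B" by (rule C0_in_bounded[OF E F]) blast
  show ?thesis
  proof (rule that)
    fix t r assume tr: "t \<in> {0..T}" "r \<in> {0..1::real}"
    show "norm (subst_kernel m F t r) \<le> (K * m * C * exp (\<bar>\<omega>\<bar> * T) * B) * t powr \<theta> * r powr (m * \<theta> - 1)"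
    proof (cases "t = 0 \<or> r = 0")
      case True
      then show ?thesis using K B C by (auto simp: subst_kernel_def)
    next
      case False
      then have pos: "0 < t" "0 < r" "0 < t * r ^ m" using tr by auto
      let ?x = "F (t * (1 - r ^ m))"
      have x: "?x \<in> car E" using F_car subst_in[OF tr] by blast
      have "norm (subst_kernel m F t r) = (t * m * r ^ (m - 1)) * norm (inv R (S (t * r ^ m) ?x))"
        using pos by (simp add: subst_kernel_def)
      also have "\<dots> \<le> (t * m * r ^ (m - 1)) * (K * (C * (t * r ^ m) powr (\<theta> - 1) * exp (\<bar>\<omega>\<bar> * T) * B))"
      proof (rule mult_left_mono)
        have "norm (inv R (S (t * r ^ m) ?x)) \<le> K * nrm X1 (S (t * r ^ m) ?x)"
          using K(2)[of "inv R (S (t * r ^ m) ?x)"] smoothing_nrm(1)[OF pos(3) x] by simp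
        also have "\<dots> \<le> K * (C * (t * r ^ m) powr (\<theta> - 1) * exp (\<omega> * (t * r ^ m)) * nrm E ?x)"
          using smoothing_nrm(2)[OF pos(3) x] K by (intro mult_left_mono) auto
        also have "\<dots> \<le> K * (C * (t * r ^ m) powr (\<theta> - 1) * exp (\<bar>\<omega>\<bar> * T) * B)"
        proof -
          have "t * r ^ m \<le> T" using tr by (auto simp: power_le_one intro: order_trans[OF mult_left_le])
          then have "\<omega> * (t * r ^ m) \<le> \<bar>\<omega>\<bar> * T" using pos by (intro mult_mono) auto
          then show ?thesis using K C B(2)[OF subst_in[OF tr]] nrm_nonneg[OF E x]
            by (intro mult_left_mono mult_mono) auto
        qed
        finally show "norm (inv R (S (t * r ^ m) ?x)) \<le> K * (C * (t * r ^ m) powr (\<theta> - 1) * exp (\<bar>\<omega>\<bar> * T) * B)" .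
      qed (use pos in auto)
      also have "\<dots> = (K * m * C * exp (\<bar>\<omega>\<bar> * T) * B) * (t * t powr (\<theta> - 1)) * (r ^ (m - 1) * (r ^ m) powr (\<theta> - 1))"
        using pos by (simp add: powr_mult)
      also have "t * t powr (\<theta> - 1) = t powr \<theta>" using pos by (simp add: powr_diff)
      also have "r ^ (m - 1) * (r ^ m) powr (\<theta> - 1) = r powr (m * \<theta> - 1)"
      proof -
        have "r ^ (m - 1) = r powr (real m - 1)" using pos m0 powr_realpow[of r "m - 1"] by (simp add: of_nat_diff)
        moreover have "(r ^ m) powr (\<theta> - 1) = r powr (m * (\<theta> - 1))"
          using pos by (simp add: powr_powr flip: powr_realpow)
        ultimately show ?thesis by (simp add: powr_add[symmetric] algebra_simps)
      qed
      finally show ?thesis .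
    qed
  qed
qed

text \<open>On the two axes the bound forces the limit 0. Elsewhere the elapsed time t r^m stays
  positive, so the smoothed vectors converge in the coordinate.\<close>

lemma subst_kernel_continuous: "continuous_on ({0..T} \<times> {0..1}) (\<lambda>(t, r). subst_kernel m F t r)"
  unfolding continuous_on_def
proof clarify
  fix t0 r0 assume *: "t0 \<in> {0..T}" "r0 \<in> {0..1::real}"
  let ?G = "at (t0, r0) within {0..T} \<times> {0..1}"
  have fst: "(fst \<longlongrightarrow> t0) ?G" and snd: "(snd \<longlongrightarrow> r0) ?G"
    by (auto intro!: tendsto_eq_intros)
  have dom: "eventually (\<lambda>q. fst q \<in> {0..T} \<and> snd q \<in> {0..1}) ?G"
    unfolding eventually_at_filter by (rule always_eventually) auto
  show "((\<lambda>(t, r). subst_kernel m F t r) \<longlongrightarrow> subst_kernel m F t0 r0) ?G"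
  proof (cases "t0 = 0 \<or> r0 = 0")
    case True
    obtain K where K: "\<And>t r. t \<in> {0..T} \<Longrightarrow> r \<in> {0..1} \<Longrightarrow>
        norm (subst_kernel m F t r) \<le> K * t powr \<theta> * r powr (m * \<theta> - 1)"
      using subst_kernel_bound by blast
    have "((\<lambda>q. subst_kernel m F (fst q) (snd q)) \<longlongrightarrow> 0) ?G"
    proof (rule Lim_null_comparison)
      show "\<forall>\<^sub>F q in ?G. norm (subst_kernel m F (fst q) (snd q)) \<le> K * fst q powr \<theta> * snd q powr (m * \<theta> - 1)"
        using dom by eventually_elim (auto intro: K)
      have "((\<lambda>q. K * fst q powr \<theta> * snd q powr (m * \<theta> - 1)) \<longlongrightarrow> K * t0 powr \<theta> * r0 powr (m * \<theta> - 1)) ?G"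
        using m \<theta> by (intro tendsto_mult tendsto_const tendsto_powr' fst snd disjI2 conjI eventually_mono[OF dom]) auto
      then show "((\<lambda>q. K * fst q powr \<theta> * snd q powr (m * \<theta> - 1)) \<longlongrightarrow> 0) ?G" using True by auto
    qed
    moreover have "subst_kernel m F t0 r0 = 0" using True by (auto simp: subst_kernel_def)
    ultimately show ?thesis by (simp add: case_prod_unfold)
  next
    case False
    then have pos: "0 < t0" "0 < r0" using * by auto
    let ?s = "\<lambda>q. fst q * (1 - snd q ^ m)"
    have s0: "t0 * (1 - r0 ^ m) \<in> {0..T}" using subst_in * by blast
    have s: "filterlim ?s (nhds (t0 * (1 - r0 ^ m))) ?G"
      by (intro tendsto_intros fst snd)
    have s_in: "eventually (\<lambda>q. ?s q \<in> {0..T}) ?G"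
      using dom by eventually_elim (rule subst_in, auto)
    have "continuous_on {0..T} (\<lambda>r. nrm E (F r - F (t0 * (1 - r0 ^ m))))"
    proof (rule C0_in_nrm_continuous[OF E C0_in_diff[OF E F]])
      show "C0_in E T (\<lambda>r. F (t0 * (1 - r0 ^ m)))"
        using F_car[OF s0] by (auto simp: C0_in_def nrm_zero[OF E])
    qed
    from continuous_on_tendsto_compose[OF this s s0 s_in]
    have Fs: "((\<lambda>q. nrm E (F (?s q) - F (t0 * (1 - r0 ^ m)))) \<longlongrightarrow> 0) ?G"
      by (simp add: nrm_zero[OF E])
    have "((\<lambda>q. (fst q * m * snd q ^ (m - 1)) *\<^sub>R inv R (S (fst q * snd q ^ m) (F (?s q)))) \<longlongrightarrow>
        (t0 * m * r0 ^ (m - 1)) *\<^sub>R inv R (S (t0 * r0 ^ m) (F (t0 * (1 - r0 ^ m))))) ?G"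
    proof (intro tendsto_scaleR smoothing_tendsto Fs tendsto_intros fst snd)
      show "\<forall>\<^sub>F q in ?G. F (?s q) \<in> car E" using s_in by eventually_elim (rule F_car)
    qed (use pos F_car[OF s0] in auto)
    moreover have "eventually (\<lambda>q. (fst q * m * snd q ^ (m - 1)) *\<^sub>R inv R (S (fst q * snd q ^ m) (F (?s q)))
        = (case q of (t, r) \<Rightarrow> subst_kernel m F t r)) ?G"
      using order_tendstoD(1)[OF fst pos(1)] order_tendstoD(1)[OF snd pos(2)]
      by eventually_elim (auto simp: subst_kernel_def case_prod_unfold)
    ultimately show ?thesis
      using pos by (simp add: subst_kernel_def[of m F t0 r0] Lim_transform_eventually)
  qed
qed

private lemma kernel_slice:
  assumes "t \<in> {0..T}"
  shows "continuous_on {0..1} (subst_kernel m F t)"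
proof -
  have "continuous_on {0..1::real} (Pair t)" by (intro continuous_intros)
  moreover have "Pair t ` {0..1::real} \<subseteq> {0..T} \<times> {0..1}" using assms by auto
  ultimately show ?thesis using continuous_on_compose2[OF subst_kernel_continuous, of "{0..1}" "Pair t"] by simp
qed

text \<open>The substitution is made in the ambient space, where the integrand is continuous up to
  the end point; afterwards the integrand has a continuous coordinate, and the bounded operator
  \<open>R\<close> may be taken out of the integral.\<close>

lemma conv_eq_R:
  assumes t: "t \<in> {0..T}"
  shows "conv F t = R (integral {0..1} (subst_kernel m F t))"
proof -
  have Fc: "continuous_on {0..t} F"
    by (rule continuous_on_subset[OF C0_in_E_continuous_on[OF F]]) (use t in auto)
  define \<phi> where "\<phi> s = S (t - s) (F s)" for s
  have \<phi>: "continuous_on {0..t} \<phi>"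
    unfolding \<phi>_def[abs_def] by (rule conv_integrand_continuous[OF Fc]) simp
  have R_kernel: "R (subst_kernel m F t r) = (t * m * r ^ (m - 1)) *\<^sub>R \<phi> (t * (1 - r ^ m))" if r: "r \<in> {0..1}" for r
  proof (cases "t = 0 \<or> r = 0")
    case True
    \<comment> \<open>At r = 0 the right-hand side vanishes because m \<ge> 2 leaves a positive
      power of r in the Jacobian.\<close>
    then show ?thesis using m0 by (auto simp: subst_kernel_def R_zero power_0_left)
  next
    case False
    then have "0 < t * r ^ m" using t r by auto
    moreover have "t - t * (1 - r ^ m) = t * r ^ m" by (simp add: algebra_simps)
    ultimately show ?thesis using False smoothing_nrm(1)[OF _ F_car[OF subst_in[OF t r]]]
      by (simp add: subst_kernel_def R_scaleR \<phi>_def)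
  qed
  have "((\<lambda>r. integral {0..t * (1 - r ^ m)} \<phi>) has_vector_derivative
      - ((t * m * r ^ (m - 1)) *\<^sub>R \<phi> (t * (1 - r ^ m)))) (at r within {0..1})" if r: "r \<in> {0..1}" for r
  proof -
    have img: "(\<lambda>r. t * (1 - r ^ m)) ` {0..1} \<subseteq> {0..t}"
      using t by (auto simp: power_le_one mult_left_le)
    have "((\<lambda>r. t * (1 - r ^ m)) has_vector_derivative - (t * m * r ^ (m - 1))) (at r within {0..1})"
      unfolding has_real_derivative_iff_has_vector_derivative[symmetric]
      by (auto intro!: derivative_eq_intros)
    moreover have "((\<lambda>s. integral {0..s} \<phi>) has_vector_derivative \<phi> (t * (1 - r ^ m)))
        (at (t * (1 - r ^ m)) within (\<lambda>r. t * (1 - r ^ m)) ` {0..1})"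
      by (rule has_vector_derivative_within_subset[OF integral_has_vector_derivative[OF \<phi>] img])
         (use img r in blast)
    ultimately show ?thesis
      by (rule vector_diff_chain_within[THEN has_vector_derivative_eq_rhs, unfolded o_def]) simp
  qed
  from fundamental_theorem_of_calculus[OF zero_le_one this]
  have "((\<lambda>r. - ((t * m * r ^ (m - 1)) *\<^sub>R \<phi> (t * (1 - r ^ m)))) has_integral
      (integral {0..t * (1 - 1 ^ m)} \<phi> - integral {0..t * (1 - 0 ^ m)} \<phi>)) {0..1}"
    by blast
  then have "((\<lambda>r. - ((t * m * r ^ (m - 1)) *\<^sub>R \<phi> (t * (1 - r ^ m)))) has_integral - conv F t) {0..1}"
    using m0 by (simp add: conv_def \<phi>_def[abs_def] power_0_left)
  from has_integral_neg[OF this]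
  have "((\<lambda>r. (t * m * r ^ (m - 1)) *\<^sub>R \<phi> (t * (1 - r ^ m))) has_integral conv F t) {0..1}"
    by (simp only: minus_minus)
  then have "((\<lambda>r. R (subst_kernel m F t r)) has_integral conv F t) {0..1}"
    by (rule has_integral_eq[rotated]) (simp_all add: R_kernel)
  moreover have "((\<lambda>r. R (subst_kernel m F t r)) has_integral R (integral {0..1} (subst_kernel m F t))) {0..1}"
    using has_integral_linear[OF integrable_integral R_linear, of "subst_kernel m F t" "{0..1}"]
      kernel_slice[OF t] by (simp add: integrable_continuous_real o_def)
  ultimately show ?thesis using has_integral_unique by blast
qed

lemma kernel_integral_continuous: "continuous_on {0..T} (\<lambda>t. integral {0..1} (subst_kernel m F t))"
  using integral_continuous_on_param[of "{0..T}" 0 "1::real" "subst_kernel m F"] subst_kernel_continuous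
  by (simp add: cbox_interval)

lemma conv_nrm_bound:
  assumes t: "t \<in> {0..T}" and a: "0 < a" "0 < b"
    and le: "\<And>s. 0 < s \<Longrightarrow> s \<le> t \<Longrightarrow> exp (\<omega> * s) * nrm E (F (t - s)) \<le> \<psi> s + \<phi> s"
    and \<psi>: "\<And>s. s \<in> {0..t} \<Longrightarrow> 0 \<le> \<psi> s" "\<And>s. s \<in> {0..t} \<Longrightarrow> \<psi> s \<le> Ka"
      "\<And>s. s \<in> {0..t} \<Longrightarrow> (\<Psi> has_real_derivative \<psi> s) (at s within {0..t})"
    and \<phi>: "\<And>s. s \<in> {0..t} \<Longrightarrow> 0 \<le> \<phi> s" "\<And>s. s \<in> {0..t} \<Longrightarrow> \<phi> s \<le> Kb"
      "\<And>s. s \<in> {0..t} \<Longrightarrow> (\<Phi> has_real_derivative \<phi> s) (at s within {0..t})"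
  shows "nrm X1 (conv F t) \<le> C * (singular_weight \<theta> a Ka (\<Psi> t - \<Psi> 0) + singular_weight \<theta> b Kb (\<Phi> t - \<Phi> 0))"
proof -
  have m0': "m \<noteq> 0" and t0: "0 \<le> t" using m0 t by auto
  obtain g1 J1 where g1: "(g1 has_integral J1) {0..1}" "J1 \<le> singular_weight \<theta> a Ka (\<Psi> t - \<Psi> 0)"
    "\<And>r. r \<in> {0..1} \<Longrightarrow> (t * m * r ^ (m - 1)) * (t * r ^ m) powr (\<theta> - 1) * \<psi> (t * r ^ m) \<le> g1 r"
    using singular_weight_has_integral[OF \<theta> m0' t0 a(1) \<psi>] by blast
  obtain g2 J2 where g2: "(g2 has_integral J2) {0..1}" "J2 \<le> singular_weight \<theta> b Kb (\<Phi> t - \<Phi> 0)"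
    "\<And>r. r \<in> {0..1} \<Longrightarrow> (t * m * r ^ (m - 1)) * (t * r ^ m) powr (\<theta> - 1) * \<phi> (t * r ^ m) \<le> g2 r"
    using singular_weight_has_integral[OF \<theta> m0' t0 a(2) \<phi>] by blast
  obtain K where K: "K > 0" "\<And>x. nrm X1 (R x) \<le> K * norm x" by (rule X1_upperE) blast
  have "nrm X1 (R (integral {0..1} (subst_kernel m F t))) \<le> C * (J1 + J2)"
  proof (rule has_integral_seminorm_le[where p = "\<lambda>x. nrm X1 (R x)"])
    show "(subst_kernel m F t has_integral integral {0..1} (subst_kernel m F t)) {0..1}"
      using kernel_slice[OF t] by (intro integrable_integral integrable_continuous_real)
    show "((\<lambda>r. C * (g1 r + g2 r)) has_integral C * (J1 + J2)) {0..1}"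
      by (intro has_integral_mult_right has_integral_add g1 g2)
    fix r :: real assume r: "r \<in> {0..1}"
    let ?w = "t * m * r ^ (m - 1)" and ?p = "(t * r ^ m) powr (\<theta> - 1)"
    have tr: "t * r ^ m \<in> {0..t}" using r t by (auto simp: power_le_one mult_left_le)
    have "nrm X1 (R (subst_kernel m F t r)) \<le> C * (?w * ?p * (\<psi> (t * r ^ m) + \<phi> (t * r ^ m)))"
    proof (cases "t = 0 \<or> r = 0")
      case True
      then show ?thesis using C \<psi>(1)[OF tr] \<phi>(1)[OF tr] r t
        by (auto simp: subst_kernel_def R_zero nrm_zero[OF X1])
    next
      case False
      then have pos: "0 < t * r ^ m" "0 \<le> ?w" using t r by auto
      let ?x = "F (t * (1 - r ^ m))"
      have x: "?x \<in> car E" using F_car subst_in[OF t r] by blast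
      have car: "S (t * r ^ m) ?x \<in> car X1"
        using smoothing_nrm(1)[OF pos(1) x] car_X1 by (metis rangeI)
      have eq: "t * (1 - r ^ m) = t - t * r ^ m" by (simp add: algebra_simps)
      have "nrm X1 (R (subst_kernel m F t r)) = ?w * nrm X1 (S (t * r ^ m) ?x)"
        using False pos smoothing_nrm(1)[OF pos(1) x] nrm_scale[OF X1 car, of ?w]
        by (simp add: subst_kernel_def R_scaleR)
      also have "\<dots> \<le> ?w * (C * ?p * exp (\<omega> * (t * r ^ m)) * nrm E ?x)"
        by (intro mult_left_mono smoothing_nrm pos x)
      also have "\<dots> = C * (?w * ?p * (exp (\<omega> * (t * r ^ m)) * nrm E (F (t - t * r ^ m))))"
        by (simp add: eq mult_ac)
      also have "\<dots> \<le> C * (?w * ?p * (\<psi> (t * r ^ m) + \<phi> (t * r ^ m)))"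
        using pos tr C by (intro mult_left_mono le) auto
      finally show ?thesis .
    qed
    also have "\<dots> \<le> C * (g1 r + g2 r)"
      using g1(3)[OF r] g2(3)[OF r] C by (intro mult_left_mono) (auto simp: algebra_simps)
    finally show "nrm X1 (R (subst_kernel m F t r)) \<le> C * (g1 r + g2 r)" .
  next
    show "nrm X1 (R (x + y)) \<le> nrm X1 (R x) + nrm X1 (R y)" for x y
      using nrm_triangle[OF X1, of "R x" "R y"] by (simp add: R_plus car_X1)
    show "nrm X1 (R (c *\<^sub>R x)) = \<bar>c\<bar> * nrm X1 (R x)" for c x
      using nrm_scale[OF X1, of "R x" c] by (simp add: R_scaleR car_X1)
  qed (rule K)
  also have "\<dots> \<le> C * (singular_weight \<theta> a Ka (\<Psi> t - \<Psi> 0) + singular_weight \<theta> b Kb (\<Phi> t - \<Phi> 0))"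
    using g1(2) g2(2) C by (intro mult_left_mono add_mono)
  finally show ?thesis using conv_eq_R[OF t] by simp
qed

end

lemma exponent_exists: obtains m :: nat where "1 < m * \<theta>"
  using \<theta>(1) reals_Archimedean3 by blast

end

section \<open>Elementary properties of the singular weight\<close>

lemma singular_weight_mono:
  "0 \<le> a \<Longrightarrow> D \<le> D' \<Longrightarrow> singular_weight \<theta> a K D \<le> singular_weight \<theta> a K D'"
  unfolding singular_weight_def by (intro add_left_mono mult_left_mono) auto

lemma singular_weight_scale: "singular_weight \<theta> a (c * K) (c * D) = c * singular_weight \<theta> a K D"
  unfolding singular_weight_def by (simp add: algebra_simps)

lemma singular_weight_0 [simp]: "singular_weight \<theta> a 0 0 = 0"
  by (simp add: singular_weight_def)

lemma singular_weight_nonneg: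
  assumes "0 < \<theta>" "\<theta> \<le> 1" "0 \<le> K" "0 \<le> D"
  shows "0 \<le> singular_weight \<theta> a K D"
proof -
  have "\<theta> * a powr \<theta> \<le> a powr \<theta>" using assms by (intro mult_left_le_one_le) auto
  then have "0 \<le> a powr \<theta> / \<theta> - a powr \<theta>" using assms by (simp add: field_simps)
  then show ?thesis unfolding singular_weight_def using assms by (intro add_nonneg_nonneg mult_nonneg_nonneg) auto
qed

text \<open>The cut \<open>a\<close> is chosen so that the excess of the power contributes at most
  c/2; with \<open>a\<close> fixed, a large rate makes the remaining term a powr (\<theta> - 1) /
  \<nu> at most c/2.\<close>

lemma singular_weight_small:
  assumes \<theta>: "0 < \<theta>" "\<theta> \<le> 1" and c: "0 < c"
  obtains a \<mu> where "0 < a" "0 < \<mu>" "\<And>\<nu>. \<mu> \<le> \<nu> \<Longrightarrow> singular_weight \<theta> a 1 (1 / \<nu>) \<le> c"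
proof -
  define a where "a = (\<theta> * c / 2) powr (1 / \<theta>)"
  have a: "a > 0" using \<theta> c by (simp add: a_def)
  have "a powr \<theta> = \<theta> * c / 2" using \<theta> c by (simp add: a_def powr_powr)
  then have 1: "a powr \<theta> / \<theta> - a powr \<theta> \<le> c / 2" using \<theta> c by simp
  define \<mu> where "\<mu> = 2 * a powr (\<theta> - 1) / c"
  have \<mu>: "\<mu> > 0" using a c by (simp add: \<mu>_def)
  show ?thesis
  proof (rule that[OF a \<mu>])
    fix \<nu> assume \<nu>: "\<mu> \<le> \<nu>"
    then have "2 * a powr (\<theta> - 1) \<le> c * \<nu>" using c by (simp add: \<mu>_def field_simps)
    then have "a powr (\<theta> - 1) * (1 / \<nu>) \<le> c / 2" using \<mu> \<nu> by (simp add: field_simps)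
    then show "singular_weight \<theta> a 1 (1 / \<nu>) \<le> c" unfolding singular_weight_def mult_1 using 1 by linarith
  qed
qed

lemma continuous_attains_sup_interval:
  fixes \<phi> :: "real \<Rightarrow> real"
  assumes "continuous_on {0..T} \<phi>" "0 \<le> T"
  obtains s where "s \<in> {0..T}" "\<And>t. t \<in> {0..T} \<Longrightarrow> \<phi> t \<le> \<phi> s"
  using continuous_attains_sup[of "{0..T}" \<phi>] assms by auto

section \<open>Bounds of convolutions, growth and regularity of mild solutions\<close>

context smoothing_semigroup
begin

lemma conv_in_range:
  assumes F: "C0_in E T F"
  obtains w where "continuous_on {0..T} w" "\<And>t. t \<in> {0..T} \<Longrightarrow> conv F t = R (w t)"
proof -
  obtain m :: nat where "1 < m * \<theta>" by (rule exponent_exists) blast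
  from kernel_integral_continuous[OF F this] conv_eq_R[OF F this] show ?thesis using that by blast
qed

lemma conv_C0_in: "C0_in E T F \<Longrightarrow> C0_in X1 T (conv F)"
  by (rule conv_in_range[of T F]) (auto intro: C0_in_X1I)

text \<open>Relative to the final time t, the forcing and the exponential of the semigroup together
  decay at rate \<eta> in the elapsed time; the integral of exp (- \<eta> s) is at most 1/\<eta>,
  which is the last argument of the weight.\<close>

lemma conv_decay_bound:
  assumes F: "C0_in E T F" and t: "t \<in> {0..T}" and a: "0 < a" and k: "0 \<le> k" and \<eta>: "0 < \<eta>"
    and le: "\<And>s. s \<in> {0..t} \<Longrightarrow> exp (\<omega> * (t - s)) * nrm E (F s) \<le> k * exp (- \<eta> * (t - s))"
  shows "nrm X1 (conv F t) \<le> C * k * singular_weight \<theta> a 1 (1 / \<eta>)"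
proof -
  obtain m :: nat where m: "1 < m * \<theta>" by (rule exponent_exists) blast
  have "nrm X1 (conv F t) \<le> C * (singular_weight \<theta> a k (- (k / \<eta>) * exp (- \<eta> * t) - - (k / \<eta>) * exp (- \<eta> * 0))
      + singular_weight \<theta> a 0 (0 - 0))"
  proof (rule conv_nrm_bound[OF F m t a a, where \<psi> = "\<lambda>s. k * exp (- \<eta> * s)" and \<phi> = "\<lambda>_. 0"
      and \<Psi> = "\<lambda>s. - (k / \<eta>) * exp (- \<eta> * s)" and \<Phi> = "\<lambda>_. 0"])
    fix s assume s: "0 < s" "s \<le> t"
    show "exp (\<omega> * s) * nrm E (F (t - s)) \<le> k * exp (- \<eta> * s) + 0"
      using le[of "t - s"] s by simp
  next
    fix s assume s: "s \<in> {0..t}"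
    show "k * exp (- \<eta> * s) \<le> k" using s \<eta> k by (intro mult_left_le) (auto simp: mult_nonpos_nonneg)
    show "((\<lambda>s. - (k / \<eta>) * exp (- \<eta> * s)) has_real_derivative k * exp (- \<eta> * s)) (at s within {0..t})"
      using \<eta> by (auto intro!: derivative_eq_intros)
  qed (use k in auto)
  also have "\<dots> \<le> C * singular_weight \<theta> a (k * 1) (k * (1 / \<eta>))"
    using C a k \<eta> by (auto intro!: mult_left_mono singular_weight_mono simp: field_simps)
  also have "\<dots> = C * k * singular_weight \<theta> a 1 (1 / \<eta>)"
    unfolding singular_weight_scale by (simp add: mult_ac)
  finally show ?thesis .
qed

text \<open>Measured with the weight exp (\<kappa> t), the kernel decays in the elapsed time at the
  rate \<kappa> - \<omega>.\<close>

lemma conv_exp_bound: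
  assumes F: "C0_in E T F" and t: "t \<in> {0..T}" and a: "0 < a" and B: "0 \<le> B" and \<kappa>: "\<omega> < \<kappa>"
    and le: "\<And>s. s \<in> {0..t} \<Longrightarrow> nrm E (F s) \<le> B * exp (\<kappa> * s)"
  shows "nrm X1 (conv F t) \<le> C * B * singular_weight \<theta> a 1 (1 / (\<kappa> - \<omega>)) * exp (\<kappa> * t)"
proof -
  have "nrm X1 (conv F t) \<le> C * (B * exp (\<kappa> * t)) * singular_weight \<theta> a 1 (1 / (\<kappa> - \<omega>))"
  proof (rule conv_decay_bound[OF F t a])
    fix s assume s: "s \<in> {0..t}"
    have "exp (\<omega> * (t - s)) * nrm E (F s) \<le> exp (\<omega> * (t - s)) * (B * exp (\<kappa> * s))"
      using le[OF s] by (intro mult_left_mono) auto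
    also have "\<dots> = B * exp (\<kappa> * t) * exp (- (\<kappa> - \<omega>) * (t - s))"
      by (simp add: mult_exp_exp algebra_simps)
    finally show "exp (\<omega> * (t - s)) * nrm E (F s) \<le> B * exp (\<kappa> * t) * exp (- (\<kappa> - \<omega>) * (t - s))" .
  qed (use B \<kappa> in auto)
  then show ?thesis by (simp add: mult_ac)
qed

text \<open>A steeper weight shortens the memory of the convolution, so its norm between weighted
  spaces becomes as small as desired. This takes the place of a Gronwall inequality and of stepwise
  continuation in time.\<close>

lemma small_growth_rate:
  assumes "0 < c"
  obtains a \<kappa> where "0 < a" "\<omega> < \<kappa>" "0 \<le> \<kappa>" "C * singular_weight \<theta> a 1 (1 / (\<kappa> - \<omega>)) \<le> c"
    "\<And>\<kappa>'. \<kappa> \<le> \<kappa>' \<Longrightarrow> C * singular_weight \<theta> a 1 (1 / (\<kappa>' - \<omega>)) \<le> c"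
proof -
  have "c / (C + 1) > 0" using assms C by simp
  then obtain a \<mu> where a: "0 < a" "0 < \<mu>" "\<And>\<nu>. \<mu> \<le> \<nu> \<Longrightarrow> singular_weight \<theta> a 1 (1 / \<nu>) \<le> c / (C + 1)"
    using singular_weight_small[OF \<theta>] by blast
  have *: "C * singular_weight \<theta> a 1 (1 / (\<kappa>' - \<omega>)) \<le> c" if "\<bar>\<omega>\<bar> + \<mu> \<le> \<kappa>'" for \<kappa>'
  proof -
    have "C * singular_weight \<theta> a 1 (1 / (\<kappa>' - \<omega>)) \<le> C * (c / (C + 1))"
      using that C by (intro mult_left_mono a) auto
    also have "\<dots> \<le> c" using C assms by (simp add: field_simps)
    finally show ?thesis .
  qed
  show ?thesis by (rule that[of a "\<bar>\<omega>\<bar> + \<mu>"]) (use a * in auto)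
qed

lemma S_in_X1: "0 \<le> t \<Longrightarrow> x \<in> car X1 \<Longrightarrow> S t x \<in> car X1"
  using S_R car_X1 by (metis imageE rangeI)

lemma S_X1_bounded: obtains M where "M > 0" "\<And>t x. t \<in> {0..T} \<Longrightarrow> x \<in> car X1 \<Longrightarrow> nrm X1 (S t x) \<le> M * nrm X1 x"
proof -
  obtain M where M: "M > 0" "\<And>t x. t \<in> {0..T} \<Longrightarrow> norm (S t x) \<le> M * norm x"
    using S_bound_pos by blast
  obtain K where K: "K > 0" "\<And>x. nrm X1 (R x) \<le> K * norm x" by (rule X1_upperE) blast
  obtain K' where K': "K' > 0" "\<And>x. norm x \<le> K' * nrm X1 (R x)" by (rule X1_lowerE) blast
  show ?thesis
  proof (rule that[of "K * (M * K')"])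
    fix t x assume t: "t \<in> {0..T}" and "x \<in> car X1"
    then obtain y where y: "x = R y" using car_X1 by auto
    have "nrm X1 (S t x) \<le> K * norm (S t y)" using K(2) t by (simp add: y S_R)
    also have "\<dots> \<le> K * (M * (K' * nrm X1 (R y)))"
      using K K' M t by (intro mult_left_mono order_trans[OF M(2)]) auto
    finally show "nrm X1 (S t x) \<le> K * (M * K') * nrm X1 x" by (simp add: y)
  qed (use K K' M in auto)
qed

text \<open>The weight is so steep that the convolution contributes at most half of the weighted
  maximum N; hence N \<le> M |u 0| + N/2. The constant depends on \<open>Lip\<close> and
  \<open>T\<close> only, which is what makes it uniform over all solutions.\<close>

lemma growth_bound:
  assumes T: "0 \<le> T" and Lip: "0 \<le> Lip"
  obtains K where "K > 0"
    "\<And>u G t. C0_in X1 T u \<Longrightarrow> C0_in E T G \<Longrightarrow> (\<And>t. t \<in> {0..T} \<Longrightarrow> u t = S t (u 0) + conv G t) \<Longrightarrow>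
      (\<And>t. t \<in> {0..T} \<Longrightarrow> nrm E (G t) \<le> Lip * nrm X1 (u t)) \<Longrightarrow> t \<in> {0..T} \<Longrightarrow>
      nrm X1 (u t) \<le> K * nrm X1 (u 0)"
proof -
  obtain M where M: "M > 0" "\<And>t x. t \<in> {0..T} \<Longrightarrow> x \<in> car X1 \<Longrightarrow> nrm X1 (S t x) \<le> M * nrm X1 x"
    using S_X1_bounded by blast
  \<comment> \<open>The summand 1 in \<open>Lip + 1\<close> covers \<open>Lip = 0\<close>.\<close>
  obtain a \<kappa> where a: "0 < a" "\<omega> < \<kappa>" "0 \<le> \<kappa>" "C * singular_weight \<theta> a 1 (1 / (\<kappa> - \<omega>)) \<le> 1 / (2 * (Lip + 1))"
    by (rule small_growth_rate[of "1 / (2 * (Lip + 1))"]) (use Lip in auto)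
  show ?thesis
  proof (rule that[of "2 * M * exp (\<kappa> * T)"])
    show "2 * M * exp (\<kappa> * T) > 0" using M by simp
    fix u G t assume u: "C0_in X1 T u" and G: "C0_in E T G"
      and sol: "\<And>t. t \<in> {0..T} \<Longrightarrow> u t = S t (u 0) + conv G t"
      and le: "\<And>t. t \<in> {0..T} \<Longrightarrow> nrm E (G t) \<le> Lip * nrm X1 (u t)" and t: "t \<in> {0..T}"
    have car: "u t \<in> car X1" if "t \<in> {0..T}" for t using u that by (auto simp: C0_in_def)
    have u0: "u 0 \<in> car X1" using car T by simp
    have "continuous_on {0..T} (\<lambda>t. exp (- \<kappa> * t) * nrm X1 (u t))"
      by (intro continuous_intros C0_in_nrm_continuous[OF X1 u])
    from continuous_attains_sup_interval[OF this T]
    obtain s where s: "s \<in> {0..T}" "\<And>t. t \<in> {0..T} \<Longrightarrow> exp (- \<kappa> * t) * nrm X1 (u t) \<le> exp (- \<kappa> * s) * nrm X1 (u s)"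
      by blast
    \<comment> \<open>The maximum is attained, so the mild formula at the single time
      \<open>s\<close> bounds N itself.\<close>
    define N where "N = exp (- \<kappa> * s) * nrm X1 (u s)"
    have N0: "N \<ge> 0" using nrm_nonneg[OF X1 car[OF s(1)]] by (simp add: N_def)
    have uN: "nrm X1 (u t) \<le> N * exp (\<kappa> * t)" if "t \<in> {0..T}" for t
    proof -
      have "nrm X1 (u t) = exp (\<kappa> * t) * (exp (- \<kappa> * t) * nrm X1 (u t))" by (simp add: exp_minus)
      also have "\<dots> \<le> exp (\<kappa> * t) * N" using s(2)[OF that] by (intro mult_left_mono) (auto simp: N_def)
      finally show ?thesis by (simp add: mult.commute)
    qed
    have "nrm X1 (u s) \<le> nrm X1 (S s (u 0)) + nrm X1 (conv G s)"
      using sol[OF s(1)] nrm_triangle[OF X1 S_in_X1[OF _ u0]] conv_C0_in[OF G] s(1) by (auto simp: C0_in_def)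
    also have "nrm X1 (conv G s) \<le> C * (Lip * N) * singular_weight \<theta> a 1 (1 / (\<kappa> - \<omega>)) * exp (\<kappa> * s)"
    proof (rule conv_exp_bound[OF G s(1) a(1) _ a(2)])
      fix r assume "r \<in> {0..s}"
      then have r: "r \<in> {0..T}" using s by auto
      show "nrm E (G r) \<le> Lip * N * exp (\<kappa> * r)"
        using le[OF r] mult_left_mono[OF uN[OF r] Lip] by simp
    qed (use Lip N0 in simp)
    also have "\<dots> \<le> (N / 2) * exp (\<kappa> * s)"
    proof (rule mult_right_mono)
      have "C * (Lip * N) * singular_weight \<theta> a 1 (1 / (\<kappa> - \<omega>)) = (C * singular_weight \<theta> a 1 (1 / (\<kappa> - \<omega>))) * (Lip * N)"
        by simp
      also have "\<dots> \<le> (1 / (2 * (Lip + 1))) * (Lip * N)" using a N0 Lip by (intro mult_right_mono) auto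
      also have "\<dots> \<le> N / 2" using N0 Lip by (simp add: field_simps)
      finally show "C * (Lip * N) * singular_weight \<theta> a 1 (1 / (\<kappa> - \<omega>)) \<le> N / 2" .
    qed simp
    also have "nrm X1 (S s (u 0)) \<le> M * nrm X1 (u 0) * exp (\<kappa> * s)"
    proof -
      have "nrm X1 (S s (u 0)) \<le> M * nrm X1 (u 0)" by (rule M(2)[OF s(1) u0])
      also have "\<dots> \<le> M * nrm X1 (u 0) * exp (\<kappa> * s)"
      proof -
        have "1 \<le> exp (\<kappa> * s)" using a(3) s(1) by simp
        moreover have "0 \<le> M * nrm X1 (u 0)" using M(1) nrm_nonneg[OF X1 u0] by simp
        ultimately show ?thesis using mult_left_mono[of 1 "exp (\<kappa> * s)" "M * nrm X1 (u 0)"] by simp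
      qed
      finally show ?thesis .
    qed
    finally have "nrm X1 (u s) \<le> (M * nrm X1 (u 0) + N / 2) * exp (\<kappa> * s)" by (simp add: algebra_simps)
    then have "N \<le> M * nrm X1 (u 0) + N / 2"
      by (simp add: N_def exp_minus field_simps)
    then have N: "N \<le> 2 * M * nrm X1 (u 0)" by simp
    have "nrm X1 (u t) \<le> N * exp (\<kappa> * t)" by (rule uN[OF t])
    also have "\<dots> \<le> (2 * M * nrm X1 (u 0)) * exp (\<kappa> * T)"
      using N N0 t a by (intro mult_mono) (auto intro: mult_left_mono)
    finally show "nrm X1 (u t) \<le> 2 * M * exp (\<kappa> * T) * nrm X1 (u 0)" by (simp add: mult_ac)
  qed
qed

text \<open>Smoothing puts the Duhamel term into the domain with a continuous coordinate, exactly
  the condition under which it is differentiable.\<close>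

lemma mild_solution_strict:
  assumes F: "C0_in E T F" and z: "z \<in> car X1" and u: "\<And>t. t \<in> {0..T} \<Longrightarrow> u t = S t z + conv F t" and t: "t \<in> {0..T}"
  shows "(u has_vector_derivative (A (u t) + F t)) (at t within {0..T})"
proof -
  obtain x where x: "z = R x" using z car_X1 by auto
  obtain w where w: "continuous_on {0..T} w" "\<And>t. t \<in> {0..T} \<Longrightarrow> conv F t = R (w t)"
    using conv_in_range[OF F] by blast
  have "((\<lambda>t. S t z) has_vector_derivative S t (L x)) (at t within {0..T})"
    unfolding x by (rule has_vector_derivative_within_subset[OF S_R_has_vector_derivative]) (use t in auto)
  from has_vector_derivative_add[OF this conv_has_vector_derivative[OF C0_in_E_continuous_on[OF F] w t]]
  have "((\<lambda>t. S t z + conv F t) has_vector_derivative S t (L x) + (L (w t) + F t)) (at t within {0..T})" by simp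
  moreover have "S t (L x) + (L (w t) + F t) = A (u t) + F t"
    using t u[OF t] w(2)[OF t] x A_R[of "S t x + w t"] linear_add[OF bounded_linear.linear[OF L_linear]]
    by (simp add: S_L S_R R_plus)
  ultimately show ?thesis
    by (intro has_vector_derivative_transform[OF t u]) auto
qed

end

section \<open>Semilinear evolution equations\<close>

locale semilinear = smoothing_semigroup S A R L X1 E \<theta> C \<omega>
  for S :: "real \<Rightarrow> 'z::banach \<Rightarrow> 'z" and A R L :: "'z \<Rightarrow> 'z" and X1 E :: "'z nspace" and \<theta> C \<omega> :: real +
  fixes F :: "'z \<Rightarrow> 'z" and Lip :: real
  assumes F_range: "x \<in> car X1 \<Longrightarrow> F x \<in> car E"
    and Lip: "0 \<le> Lip"
    and F_lipschitz: "x \<in> car X1 \<Longrightarrow> y \<in> car X1 \<Longrightarrow> nrm E (F x - F y) \<le> Lip * nrm X1 (x - y)"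
begin

lemma F_C0_in:
  assumes u: "C0_in X1 T u"
  shows "C0_in E T (\<lambda>s. F (u s))"
  unfolding C0_in_def
proof (intro ballI conjI)
  fix s assume s: "s \<in> {0..T}"
  have car: "u r \<in> car X1" if "r \<in> {0..T}" for r using u that by (auto simp: C0_in_def)
  show "F (u s) \<in> car E" using F_range car s by blast
  show "((\<lambda>r. nrm E (F (u r) - F (u s))) \<longlongrightarrow> 0) (at s within {0..T})"
  proof (rule Lim_null_comparison)
    show "((\<lambda>r. Lip * nrm X1 (u r - u s)) \<longlongrightarrow> 0) (at s within {0..T})"
      using u s by (auto simp: C0_in_def intro!: tendsto_mult_right_zero)
    show "\<forall>\<^sub>F r in at s within {0..T}. norm (nrm E (F (u r) - F (u s))) \<le> Lip * nrm X1 (u r - u s)"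
      unfolding eventually_at_filter
      using F_lipschitz car s nrm_nonneg[OF E nspace_diff[OF E F_range F_range]] by (auto intro!: always_eventually)
  qed
qed

definition solves :: "real \<Rightarrow> 'z \<Rightarrow> (real \<Rightarrow> 'z) \<Rightarrow> bool" where
  "solves T z u \<longleftrightarrow> C0_in X1 T u \<and> u 0 = z \<and>
     (\<forall>t\<in>{0..T}. (u has_vector_derivative (A (u t) + F (u t))) (at t within {0..T}))"

lemma solves_derivative_continuous:
  assumes "solves T z u"
  shows "continuous_on {0..T} (\<lambda>t. A (u t) + F (u t))"
proof -
  have u: "C0_in X1 T u" using assms by (simp add: solves_def)
  have "continuous_on {0..T} (\<lambda>t. L (inv R (u t)) + F (u t))"
    by (intro continuous_on_add bounded_linear.continuous_on[OF L_linear] C0_in_X1D(1)[OF u]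
        C0_in_E_continuous_on F_C0_in u)
  moreover have "L (inv R (u t)) = A (u t)" if "t \<in> {0..T}" for t
    using A_R[of "inv R (u t)"] C0_in_X1D(2)[OF u that] by simp
  ultimately show ?thesis by (simp cong: continuous_on_cong_simp)
qed

lemma solves_mild:
  assumes u: "solves T z u" and t: "t \<in> {0..T}"
  shows "u t = S t z + conv (\<lambda>s. F (u s)) t"
proof -
  have "u t = S t (u 0) + conv (\<lambda>s. F (u s)) t"
    by (rule variation_of_constants[OF _ _ t]) (use u car_X1 in \<open>auto simp: solves_def C0_in_def\<close>)
  then show ?thesis using u by (simp add: solves_def)
qed

text \<open>The difference of two solutions is a mild solution with initial value 0 whose forcing is
  bounded by \<open>Lip\<close> times the difference, so the growth bound makes it vanish.\<close>

lemma solves_unique: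
  assumes u: "solves T z u" and v: "solves T z v" and t: "t \<in> {0..T}"
  shows "u t = v t"
proof -
  have T: "0 \<le> T" using t by simp
  have uC: "C0_in X1 T u" and vC: "C0_in X1 T v" using u v by (auto simp: solves_def)
  obtain K where K: "K > 0"
    "\<And>u G t. C0_in X1 T u \<Longrightarrow> C0_in E T G \<Longrightarrow> (\<And>t. t \<in> {0..T} \<Longrightarrow> u t = S t (u 0) + conv G t) \<Longrightarrow>
      (\<And>t. t \<in> {0..T} \<Longrightarrow> nrm E (G t) \<le> Lip * nrm X1 (u t)) \<Longrightarrow> t \<in> {0..T} \<Longrightarrow>
      nrm X1 (u t) \<le> K * nrm X1 (u 0)"
    using growth_bound[OF T Lip] by blast
  have "nrm X1 (u t - v t) \<le> K * nrm X1 (u 0 - v 0)"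
  proof (rule K(2)[OF C0_in_diff[OF X1 uC vC] C0_in_diff[OF E F_C0_in[OF uC] F_C0_in[OF vC]] _ _ t])
    fix t assume t: "t \<in> {0..T}"
    have cont: "continuous_on {0..t} (\<lambda>s. F (w s))" if "C0_in X1 T w" for w
      by (rule continuous_on_subset[OF C0_in_E_continuous_on[OF F_C0_in[OF that]]]) (use t in auto)
    have "u 0 - v 0 = 0" using u v by (simp add: solves_def)
    then show "u t - v t = S t (u 0 - v 0) + conv (\<lambda>s. F (u s) - F (v s)) t"
      using solves_mild[OF u t] solves_mild[OF v t] conv_diff[OF cont[OF uC] cont[OF vC]] t
      by (simp add: S_zero)
    show "nrm E (F (u t) - F (v t)) \<le> Lip * nrm X1 (u t - v t)"
      using uC vC t by (auto simp: C0_in_def intro: F_lipschitz)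
  qed
  also have "\<dots> = 0" using u v by (simp add: solves_def nrm_zero[OF X1])
  finally have le: "nrm X1 (u t - v t) \<le> 0" .
  have "u t \<in> car X1" "v t \<in> car X1" using uC vC t by (auto simp: C0_in_def)
  then obtain x y where xy: "u t = R x" "v t = R y" using car_X1 by auto
  obtain K' where K': "K' > 0" "\<And>x. norm x \<le> K' * nrm X1 (R x)" by (rule X1_lowerE) blast
  have "norm (x - y) \<le> K' * nrm X1 (u t - v t)" using K'(2)[of "x - y"] by (simp add: R_diff xy)
  also have "\<dots> \<le> 0" using mult_left_mono[OF le, of K'] K'(1) by simp
  finally show ?thesis by (simp add: xy)
qed

text \<open>The unknown is the weighted coordinate exp (- \<kappa> t) \<open>inv R\<close> (u t). In
  this form the Duhamel map contracts on all of [0, T] in the sup norm, and the contraction takes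
  place in the complete type of bounded continuous functions.\<close>

lemma solution_exists:
  assumes T: "0 \<le> T" and z: "z \<in> car X1"
  shows "\<exists>u. solves T z u"
proof -
  obtain w0 where w0: "z = R w0" using z car_X1 by auto
  obtain K1 where K1: "K1 > 0" "\<And>x. norm x \<le> K1 * nrm X1 (R x)" by (rule X1_lowerE) blast
  obtain K2 where K2: "K2 > 0" "\<And>x. nrm X1 (R x) \<le> K2 * norm x" by (rule X1_upperE) blast
  \<comment> \<open>\<open>k\<close> is the Lipschitz constant of the nonlinearity once both norms
    are exchanged for norms of coordinates.\<close>
  define k where "k = K1 * Lip * K2"
  have k: "k \<ge> 0" using K1 K2 Lip by (simp add: k_def)
  obtain a \<kappa> where a: "0 < a" "\<omega> < \<kappa>" "C * singular_weight \<theta> a 1 (1 / (\<kappa> - \<omega>)) \<le> 1 / (2 * (k + 1))"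
    by (rule small_growth_rate[of "1 / (2 * (k + 1))"]) (use k in auto)
  \<comment> \<open>The type of bounded continuous functions requires the whole line; clamping time
    to [0, T] extends each image by constants.\<close>
  define c where "c t = max 0 (min T t)" for t :: real
  have c: "c t \<in> {0..T}" for t using T by (auto simp: c_def)
  have c_id: "c t = t" if "t \<in> {0..T}" for t using that by (auto simp: c_def)
  have c_cont: "continuous_on UNIV c" unfolding c_def by (intro continuous_intros)
  define lift where "lift W s = R (exp (\<kappa> * s) *\<^sub>R apply_bcontfun W s)" for W :: "real \<Rightarrow>\<^sub>C 'z" and s
  have lift: "C0_in X1 T (lift W)" for W
    by (rule C0_in_X1I[where w = "\<lambda>s. exp (\<kappa> * s) *\<^sub>R apply_bcontfun W s"])
       (auto simp: lift_def intro!: continuous_intros)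
  define G where "G W s = F (lift W s)" for W s
  have G: "C0_in E T (G W)" for W unfolding G_def[abs_def] by (rule F_C0_in[OF lift])
  have G_cont: "continuous_on {0..t} (G W)" if "t \<in> {0..T}" for W t
    by (rule continuous_on_subset[OF C0_in_E_continuous_on[OF G]]) (use that in auto)
  define g where "g W t = exp (- \<kappa> * t) *\<^sub>R (S t w0 + inv R (conv (G W) t))" for W t
  have inv_conv: "R (inv R (conv (G W) t)) = conv (G W) t" if "t \<in> {0..T}" for W t
    by (rule C0_in_X1D(2)[OF conv_C0_in[OF G] that])
  have g_cont: "continuous_on {0..T} (g W)" for W
    unfolding g_def by (intro continuous_intros C0_in_X1D(1)[OF conv_C0_in[OF G]] continuous_on_subset[OF S_continuous_on]) auto
  have g_bcont: "(\<lambda>t. g W (c t)) \<in> bcontfun" for W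
  proof -
    have "continuous_on UNIV (\<lambda>t. g W (c t))"
      by (rule continuous_on_compose2[OF g_cont c_cont]) (use c in auto)
    moreover have "bounded (range (\<lambda>t. g W (c t)))"
      by (rule bounded_subset[OF compact_imp_bounded[OF compact_continuous_image[OF g_cont]]]) (use c in auto)
    ultimately show ?thesis by (simp add: bcontfun_def)
  qed
  define \<Phi> where "\<Phi> W = Bcontfun (\<lambda>t. g W (c t))" for W
  have \<Phi>: "apply_bcontfun (\<Phi> W) t = g W (c t)" for W t
    by (simp add: \<Phi>_def Bcontfun_inverse[OF g_bcont])
  have contraction: "dist (\<Phi> V) (\<Phi> W) \<le> dist V W / 2" for V W
  proof (rule dist_bound)
    fix t'
    define t where "t = c t'"
    have t: "t \<in> {0..T}" using c by (simp add: t_def)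
    have "norm (inv R (conv (G V) t) - inv R (conv (G W) t)) \<le> K1 * nrm X1 (conv (\<lambda>s. G V s - G W s) t)"
      using K1(2)[of "inv R (conv (G V) t) - inv R (conv (G W) t)"] inv_conv[OF t]
        conv_diff[OF G_cont[OF t] G_cont[OF t]] by (simp add: R_diff)
    also have "nrm X1 (conv (\<lambda>s. G V s - G W s) t)
        \<le> C * (Lip * K2 * dist V W) * singular_weight \<theta> a 1 (1 / (\<kappa> - \<omega>)) * exp (\<kappa> * t)"
    proof (rule conv_exp_bound[OF C0_in_diff[OF E G G] t a(1) _ a(2)])
      fix s assume s: "s \<in> {0..t}"
      then have "lift V s \<in> car X1" "lift W s \<in> car X1" using lift t by (auto simp: C0_in_def)
      then have "nrm E (G V s - G W s) \<le> Lip * nrm X1 (lift V s - lift W s)"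
        unfolding G_def by (rule F_lipschitz)
      also have "lift V s - lift W s = R (exp (\<kappa> * s) *\<^sub>R (apply_bcontfun V s - apply_bcontfun W s))"
        by (simp add: lift_def R_diff scaleR_diff_right)
      also have "Lip * nrm X1 (R (exp (\<kappa> * s) *\<^sub>R (apply_bcontfun V s - apply_bcontfun W s)))
          \<le> Lip * (K2 * (exp (\<kappa> * s) * dist V W))"
      proof (rule mult_left_mono[OF order_trans[OF K2(2)] Lip])
        show "K2 * norm (exp (\<kappa> * s) *\<^sub>R (apply_bcontfun V s - apply_bcontfun W s)) \<le> K2 * (exp (\<kappa> * s) * dist V W)"
          using K2(1) dist_bounded[of V s W] by (simp add: dist_norm)
      qed
      finally show "nrm E (G V s - G W s) \<le> Lip * K2 * dist V W * exp (\<kappa> * s)" by (simp add: mult_ac)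
    qed (use Lip K2 in simp)
    finally have "norm (inv R (conv (G V) t) - inv R (conv (G W) t))
        \<le> K1 * (C * (Lip * K2 * dist V W) * singular_weight \<theta> a 1 (1 / (\<kappa> - \<omega>)) * exp (\<kappa> * t))"
      using K1 by simp
    also have "\<dots> = (C * singular_weight \<theta> a 1 (1 / (\<kappa> - \<omega>))) * (k * dist V W * exp (\<kappa> * t))"
      by (simp add: k_def mult_ac)
    also have "\<dots> \<le> (1 / (2 * (k + 1))) * (k * dist V W * exp (\<kappa> * t))"
      using a k by (intro mult_right_mono) auto
    also have "\<dots> = (k / (k + 1)) * (dist V W / 2 * exp (\<kappa> * t))" using k by (simp add: field_simps)
    also have "\<dots> \<le> 1 * (dist V W / 2 * exp (\<kappa> * t))" using k by (intro mult_right_mono) auto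
    finally have le: "norm (inv R (conv (G V) t) - inv R (conv (G W) t)) \<le> dist V W / 2 * exp (\<kappa> * t)" by simp
    have "dist (apply_bcontfun (\<Phi> V) t') (apply_bcontfun (\<Phi> W) t')
        = exp (- \<kappa> * t) * norm (inv R (conv (G V) t) - inv R (conv (G W) t))"
      by (simp add: \<Phi> g_def t_def[symmetric] dist_norm flip: scaleR_diff_right)
    also have "\<dots> \<le> exp (- \<kappa> * t) * (dist V W / 2 * exp (\<kappa> * t))"
      by (intro mult_left_mono le) auto
    also have "\<dots> = dist V W / 2" by (simp add: exp_minus)
    finally show "dist (apply_bcontfun (\<Phi> V) t') (apply_bcontfun (\<Phi> W) t') \<le> dist V W / 2" .
  qed
  obtain W where W: "\<Phi> W = W"
    using banach_fix_type[where c = "1 / 2" and f = \<Phi>] contraction by auto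
  have sol: "lift W t = S t z + conv (G W) t" if t: "t \<in> {0..T}" for t
  proof -
    have "lift W t = R (exp (\<kappa> * t) *\<^sub>R g W t)"
      using \<Phi>[of W t] W c_id[OF t] by (simp add: lift_def)
    also have "\<dots> = S t z + conv (G W) t"
      using t inv_conv[OF t] by (simp add: g_def R_plus w0 S_R exp_minus)
    finally show ?thesis .
  qed
  show ?thesis
    unfolding solves_def
  proof (intro exI[of _ "lift W"] conjI ballI lift)
    show "lift W 0 = z" using sol[of 0] T by (simp add: S_0)
    fix t assume t: "t \<in> {0..T}"
    show "(lift W has_vector_derivative A (lift W t) + F (lift W t)) (at t within {0..T})"
      using mild_solution_strict[where F = "G W" and u = "lift W", OF G z sol t] by (simp add: G_def)
  qed
qed

end

section \<open>Rescaling time and products\<close>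

lemma strong_semigroup_rescale:
  assumes "strong_semigroup S" and \<epsilon>: "0 < \<epsilon>"
  shows "strong_semigroup (\<lambda>t. S (t / \<epsilon>))"
proof -
  interpret strong_semigroup S by fact
  have lim: "filterlim (\<lambda>t. t / \<epsilon>) (at_right 0) (at_right 0)"
    unfolding filterlim_at using \<epsilon>
    by (auto intro!: tendsto_eq_intros simp: eventually_at_filter)
  show ?thesis
  proof (rule strong_semigroup.intro)
    show "((\<lambda>t. S (t / \<epsilon>) x) \<longlongrightarrow> x) (at_right 0)" for x
      using filterlim_compose[OF S_tendsto_0 lim] .
    show "\<exists>M. \<forall>t\<in>{0..\<tau>}. \<forall>x. norm (S (t / \<epsilon>) x) \<le> M * norm x" for \<tau>
    proof -
      obtain M where "\<forall>t\<in>{0..\<tau> / \<epsilon>}. \<forall>x. norm (S t x) \<le> M * norm x"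
        using S_locally_bounded by blast
      then show ?thesis using \<epsilon> by (intro exI[of _ M]) (auto simp: divide_right_mono)
    qed
  next
    show "bounded_linear (S (t / \<epsilon>))" if "0 \<le> t" for t using S_linear that \<epsilon> by simp
  qed (use \<epsilon> in \<open>simp_all add: S_0 S_add add_divide_distrib\<close>)
qed

lemma generated_semigroup_rescale:
  assumes "generated_semigroup S A R L" and \<epsilon>: "0 < \<epsilon>"
  shows "generated_semigroup (\<lambda>t. S (t / \<epsilon>)) (\<lambda>x. (1 / \<epsilon>) *\<^sub>R A x) R (\<lambda>x. (1 / \<epsilon>) *\<^sub>R L x)"
proof -
  interpret generated_semigroup S A R L by fact
  interpret r: strong_semigroup "\<lambda>t. S (t / \<epsilon>)"
    by (rule strong_semigroup_rescale[OF strong_semigroup_axioms \<epsilon>])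
  have lim: "filterlim (\<lambda>t. t / \<epsilon>) (at_right 0) (at_right 0)"
    unfolding filterlim_at using \<epsilon>
    by (auto intro!: tendsto_eq_intros simp: eventually_at_filter)
  show ?thesis
  proof (intro generated_semigroup.intro generated_semigroup_axioms.intro r.strong_semigroup_axioms R_linear R_inj)
    fix x
    have "((\<lambda>t. (1 / \<epsilon>) *\<^sub>R ((1 / (t / \<epsilon>)) *\<^sub>R (S (t / \<epsilon>) (R x) - R x))) \<longlongrightarrow> (1 / \<epsilon>) *\<^sub>R A (R x)) (at_right 0)"
      by (intro tendsto_scaleR tendsto_const filterlim_compose[OF generator lim])
    then show "((\<lambda>t. (1 / t) *\<^sub>R (S (t / \<epsilon>) (R x) - R x)) \<longlongrightarrow> (1 / \<epsilon>) *\<^sub>R A (R x)) (at_right 0)"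
      using \<epsilon> by (simp add: field_simps)
  next
    show "bounded_linear (\<lambda>x. (1 / \<epsilon>) *\<^sub>R L x)"
      by (rule bounded_linear_const_scaleR[OF L_linear])
  qed (use \<epsilon> in \<open>simp_all add: S_R A_R\<close>)
qed

text \<open>The factor \<epsilon> powr (1 - \<theta>) comes from (t / \<epsilon>) powr (\<theta> -
  1). Together with the 1/\<epsilon> in front of the nonlinearity it makes \<epsilon> powr -
  \<theta>, which the weight on the time scale \<epsilon> compensates. The parametrization
  \<open>R\<close> of the domain does not change.\<close>

lemma smoothing_semigroup_rescale:
  assumes "smoothing_semigroup S A R L X1 E \<theta> C \<omega>" and \<epsilon>: "0 < \<epsilon>"
  shows "smoothing_semigroup (\<lambda>t. S (t / \<epsilon>)) (\<lambda>x. (1 / \<epsilon>) *\<^sub>R A x) R (\<lambda>x. (1 / \<epsilon>) *\<^sub>R L x) X1 E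
    \<theta> (C * \<epsilon> powr (1 - \<theta>)) (\<omega> / \<epsilon>)"
proof -
  interpret smoothing_semigroup S A R L X1 E \<theta> C \<omega> by fact
  interpret r: generated_semigroup "\<lambda>t. S (t / \<epsilon>)" "\<lambda>x. (1 / \<epsilon>) *\<^sub>R A x" R "\<lambda>x. (1 / \<epsilon>) *\<^sub>R L x"
    by (rule generated_semigroup_rescale[OF generated_semigroup_axioms \<epsilon>])
  show ?thesis
  proof
    show "op_bound E X1 (S (t / \<epsilon>)) (C * \<epsilon> powr (1 - \<theta>) * t powr (\<theta> - 1) * exp (\<omega> / \<epsilon> * t))" if t: "0 < t" for t
    proof -
      have "(t / \<epsilon>) powr (\<theta> - 1) = \<epsilon> powr (1 - \<theta>) * t powr (\<theta> - 1)"
        using t \<epsilon> powr_minus[of \<epsilon> "1 - \<theta>"] by (simp add: powr_divide field_simps)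
      then show ?thesis using smoothing[of "t / \<epsilon>"] t \<epsilon> by (simp add: mult_ac)
    qed
  qed (use X1 car_X1 X1_upper X1_lower E E_embeds \<theta> C in auto)
qed

definition prod_nspace :: "'a nspace \<Rightarrow> 'b nspace \<Rightarrow> ('a \<times> 'b) nspace" where
  "prod_nspace E F = \<lparr>car = car E \<times> car F, nrm = prod_norm E F\<rparr>"

lemma car_prod_nspace: "p \<in> car (prod_nspace E F) \<longleftrightarrow> fst p \<in> car E \<and> snd p \<in> car F"
  by (cases p) (simp add: prod_nspace_def)

lemma nrm_prod_nspace: "nrm (prod_nspace E F) p = nrm E (fst p) + nrm F (snd p)"
  by (simp add: prod_nspace_def prod_norm_def)

lemma normed_prod_nspace:
  assumes E: "normed_nspace E" and F: "normed_nspace F"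
  shows "normed_nspace (prod_nspace E F)"
  unfolding normed_nspace_def
proof (intro conjI ballI allI)
  show "subspace (car (prod_nspace E F))"
    using nspace_subspace[OF E] nspace_subspace[OF F]
    unfolding subspace_def by (auto simp: car_prod_nspace)
  fix x y assume x: "x \<in> car (prod_nspace E F)" and y: "y \<in> car (prod_nspace E F)"
  then show "nrm (prod_nspace E F) (x + y) \<le> nrm (prod_nspace E F) x + nrm (prod_nspace E F) y"
    using nrm_triangle[OF E, of "fst x" "fst y"] nrm_triangle[OF F, of "snd x" "snd y"]
    by (simp add: car_prod_nspace nrm_prod_nspace)
qed (use nrm_nonneg[OF E] nrm_nonneg[OF F] nrm_scale[OF E] nrm_scale[OF F]
  in \<open>auto simp: car_prod_nspace nrm_prod_nspace algebra_simps intro!: add_nonneg_nonneg\<close>)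

lemma C0_in_prod:
  assumes E: "normed_nspace E" and F: "normed_nspace F"
  shows "C0_in (prod_nspace E F) T u \<longleftrightarrow> C0_in E T (\<lambda>t. fst (u t)) \<and> C0_in F T (\<lambda>t. snd (u t))"
proof
  assume u: "C0_in (prod_nspace E F) T u"
  have car: "fst (u t) \<in> car E" "snd (u t) \<in> car F" if "t \<in> {0..T}" for t
    using u that by (auto simp: C0_in_def car_prod_nspace)
  have lim: "((\<lambda>r. nrm E (fst (u r) - fst (u s)) + nrm F (snd (u r) - snd (u s))) \<longlongrightarrow> 0) (at s within {0..T})"
    if "s \<in> {0..T}" for s using u that by (auto simp: C0_in_def nrm_prod_nspace)
  show "C0_in E T (\<lambda>t. fst (u t)) \<and> C0_in F T (\<lambda>t. snd (u t))"
    unfolding C0_in_def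
  proof (intro conjI ballI car)
    fix s assume s: "s \<in> {0..T}"
    have nonneg: "0 \<le> nrm E (fst (u r) - fst (u s))" "0 \<le> nrm F (snd (u r) - snd (u s))" if "r \<in> {0..T}" for r
      using nrm_nonneg[OF E nspace_diff[OF E car(1)[OF that] car(1)[OF s]]]
        nrm_nonneg[OF F nspace_diff[OF F car(2)[OF that] car(2)[OF s]]] by auto
    show "((\<lambda>r. nrm E (fst (u r) - fst (u s))) \<longlongrightarrow> 0) (at s within {0..T})"
      by (rule Lim_null_comparison[OF _ lim[OF s]])
         (auto simp: eventually_at_filter nonneg intro!: always_eventually)
    show "((\<lambda>r. nrm F (snd (u r) - snd (u s))) \<longlongrightarrow> 0) (at s within {0..T})"
      by (rule Lim_null_comparison[OF _ lim[OF s]])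
         (auto simp: eventually_at_filter nonneg intro!: always_eventually)
  qed
next
  assume "C0_in E T (\<lambda>t. fst (u t)) \<and> C0_in F T (\<lambda>t. snd (u t))"
  then show "C0_in (prod_nspace E F) T u"
    by (auto simp: C0_in_def car_prod_nspace nrm_prod_nspace intro!: tendsto_add_zero)
qed

definition prod_map :: "('a \<Rightarrow> 'c) \<Rightarrow> ('b \<Rightarrow> 'd) \<Rightarrow> 'a \<times> 'b \<Rightarrow> 'c \<times> 'd" where
  "prod_map f g p = (f (fst p), g (snd p))"

lemma bounded_linear_prod_map: "bounded_linear f \<Longrightarrow> bounded_linear g \<Longrightarrow> bounded_linear (prod_map f g)"
  unfolding prod_map_def
  by (intro bounded_linear_Pair bounded_linear_compose[OF _ bounded_linear_fst] bounded_linear_compose[OF _ bounded_linear_snd])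

lemma generated_semigroup_prod:
  assumes "generated_semigroup S A R L" "generated_semigroup S' A' R' L'"
  shows "generated_semigroup (\<lambda>t. prod_map (S t) (S' t)) (prod_map A A') (prod_map R R') (prod_map L L')"
proof -
  interpret a: generated_semigroup S A R L by fact
  interpret b: generated_semigroup S' A' R' L' by fact
  show ?thesis
  proof (intro generated_semigroup.intro generated_semigroup_axioms.intro strong_semigroup.intro
      bounded_linear_prod_map a.S_linear b.S_linear a.R_linear b.R_linear a.L_linear b.L_linear)
    show "((\<lambda>t. prod_map (S t) (S' t) x) \<longlongrightarrow> x) (at_right 0)" for x
      using tendsto_Pair[OF a.S_tendsto_0[of "fst x"] b.S_tendsto_0[of "snd x"]] by (simp add: prod_map_def)
    show "\<exists>M. \<forall>t\<in>{0..\<tau>}. \<forall>x. norm (prod_map (S t) (S' t) x) \<le> M * norm x" for \<tau>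
    proof -
      obtain M where M: "M > 0" "\<And>t x. t \<in> {0..\<tau>} \<Longrightarrow> norm (S t x) \<le> M * norm x"
        using a.S_bound_pos by blast
      obtain M' where M': "M' > 0" "\<And>t x. t \<in> {0..\<tau>} \<Longrightarrow> norm (S' t x) \<le> M' * norm x"
        using b.S_bound_pos by blast
      have "norm (prod_map (S t) (S' t) x) \<le> (M + M') * norm x" if t: "t \<in> {0..\<tau>}" for t x
      proof -
        have "norm (prod_map (S t) (S' t) x) \<le> norm (S t (fst x)) + norm (S' t (snd x))"
          unfolding prod_map_def by (rule norm_Pair_le)
        also have "\<dots> \<le> M * norm x + M' * norm x"
          using norm_fst_le[of "fst x" "snd x"] norm_snd_le[of "snd x" "fst x"] M(1) M'(1)
          by (intro add_mono order_trans[OF M(2)[OF t]] order_trans[OF M'(2)[OF t]] mult_left_mono) auto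
        finally show ?thesis by (simp add: algebra_simps)
      qed
      then show ?thesis by blast
    qed
    show "((\<lambda>t. (1 / t) *\<^sub>R (prod_map (S t) (S' t) (prod_map R R' x) - prod_map R R' x)) \<longlongrightarrow> prod_map A A' (prod_map R R' x)) (at_right 0)" for x
      using tendsto_Pair[OF a.generator[of "fst x"] b.generator[of "snd x"]] by (simp add: prod_map_def)
    show "inj (prod_map R R')"
      by (auto simp: inj_def prod_map_def a.R_eq_iff b.R_eq_iff prod_eq_iff)
  qed (simp_all add: prod_map_def a.S_0 b.S_0 a.S_add b.S_add a.S_R b.S_R a.A_R b.A_R)
qed

text \<open>Lowering the exponent from \<theta> to \<theta>' costs the factor t powr (\<theta> -
  \<theta>'), which is at most exp t because ln t < t and \<theta> - \<theta>' \<le> 1.\<close>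

lemma powr_exp_le:
  fixes t :: real
  assumes t: "0 < t" and \<theta>: "\<theta>' \<le> \<theta>" "\<theta> \<le> \<theta>' + 1" and \<omega>: "\<omega> + 1 \<le> \<omega>'"
  shows "t powr (\<theta> - 1) * exp (\<omega> * t) \<le> t powr (\<theta>' - 1) * exp (\<omega>' * t)"
proof -
  have "t \<noteq> 0" using t by simp
  then have "t powr (\<theta> - \<theta>') = exp ((\<theta> - \<theta>') * ln t)" by (simp add: powr_def)
  also have "(\<theta> - \<theta>') * ln t \<le> (\<theta> - \<theta>') * t" using \<theta> t by (intro mult_left_mono) (auto intro: less_imp_le ln_less_self)
  also have "(\<theta> - \<theta>') * t \<le> 1 * t" using \<theta> t by (intro mult_right_mono) auto
  finally have 1: "t powr (\<theta> - \<theta>') \<le> exp t" by simp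
  have "t powr (\<theta> - 1) * exp (\<omega> * t) = t powr (\<theta>' - 1) * (t powr (\<theta> - \<theta>') * exp (\<omega> * t))"
    using t by (simp add: powr_add[symmetric])
  also have "\<dots> \<le> t powr (\<theta>' - 1) * (exp t * exp (\<omega> * t))"
    using 1 by (intro mult_left_mono mult_right_mono) auto
  also have "exp t * exp (\<omega> * t) = exp ((\<omega> + 1) * t)" by (simp add: mult_exp_exp algebra_simps)
  also have "t powr (\<theta>' - 1) * \<dots> \<le> t powr (\<theta>' - 1) * exp (\<omega>' * t)"
    using \<omega> t by (intro mult_left_mono) auto
  finally show ?thesis by simp
qed

text \<open>The components share the smaller exponent, and the extra 1 in the rate pays for lowering
  the other one. The product serves well-posedness and the continuity of the nonlinear terms; the
  error estimate treats the components separately, with their own constants.\<close>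

lemma smoothing_semigroup_prod:
  assumes "smoothing_semigroup S A R L X1 E \<theta> C \<omega>" "smoothing_semigroup S' A' R' L' X1' E' \<theta>' C' \<omega>'"
  shows "smoothing_semigroup (\<lambda>t. prod_map (S t) (S' t)) (prod_map A A') (prod_map R R') (prod_map L L')
    (prod_nspace X1 X1') (prod_nspace E E') (min \<theta> \<theta>') (max C C') (max \<omega> \<omega>' + 1)"
proof -
  interpret a: smoothing_semigroup S A R L X1 E \<theta> C \<omega> by fact
  interpret b: smoothing_semigroup S' A' R' L' X1' E' \<theta>' C' \<omega>' by fact
  interpret p: generated_semigroup "\<lambda>t. prod_map (S t) (S' t)" "prod_map A A'" "prod_map R R'" "prod_map L L'"
    by (rule generated_semigroup_prod[OF a.generated_semigroup_axioms b.generated_semigroup_axioms])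
  have fst_le: "norm (fst x) \<le> norm x" and snd_le: "norm (snd x) \<le> norm x" for x :: "'a \<times> 'b"
    using norm_fst_le[of "fst x" "snd x"] norm_snd_le[of "snd x" "fst x"] by auto
  show ?thesis
  proof
    show "normed_nspace (prod_nspace X1 X1')" "normed_nspace (prod_nspace E E')"
      by (intro normed_prod_nspace a.X1 b.X1 a.E b.E)+
    show "car (prod_nspace X1 X1') = range (prod_map R R')"
      by (auto simp: car_prod_nspace a.car_X1 b.car_X1 prod_map_def image_iff prod_eq_iff)
    show "\<exists>K. \<forall>x. nrm (prod_nspace X1 X1') (prod_map R R' x) \<le> K * norm x"
    proof -
      obtain K where K: "K > 0" "\<And>x. nrm X1 (R x) \<le> K * norm x" by (rule a.X1_upperE) blast
      obtain K' where K': "K' > 0" "\<And>x. nrm X1' (R' x) \<le> K' * norm x" by (rule b.X1_upperE) blast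
      have "nrm (prod_nspace X1 X1') (prod_map R R' x) \<le> (K + K') * norm x" for x
        using K(1) K'(1) unfolding nrm_prod_nspace prod_map_def fst_conv snd_conv ring_distribs
        by (intro add_mono order_trans[OF K(2)] order_trans[OF K'(2)] mult_left_mono fst_le snd_le) auto
      then show ?thesis by blast
    qed
    show "\<exists>K. \<forall>x. norm x \<le> K * nrm (prod_nspace X1 X1') (prod_map R R' x)"
    proof -
      obtain K where K: "K > 0" "\<And>x. norm x \<le> K * nrm X1 (R x)" by (rule a.X1_lowerE) blast
      obtain K' where K': "K' > 0" "\<And>x. norm x \<le> K' * nrm X1' (R' x)" by (rule b.X1_lowerE) blast
      have "norm x \<le> max K K' * nrm (prod_nspace X1 X1') (prod_map R R' x)" for x
      proof -
        have "norm x \<le> norm (fst x) + norm (snd x)" using norm_Pair_le[of "fst x" "snd x"] by simp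
        also have "\<dots> \<le> max K K' * nrm X1 (R (fst x)) + max K K' * nrm X1' (R' (snd x))"
          using nrm_nonneg[OF a.X1, of "R (fst x)"] nrm_nonneg[OF b.X1, of "R' (snd x)"] a.car_X1 b.car_X1
          by (intro add_mono order_trans[OF K(2)] order_trans[OF K'(2)] mult_right_mono) auto
        finally show ?thesis by (simp add: nrm_prod_nspace prod_map_def algebra_simps)
      qed
      then show ?thesis by blast
    qed
    show "\<exists>K. \<forall>x\<in>car (prod_nspace E E'). norm x \<le> K * nrm (prod_nspace E E') x"
    proof -
      obtain K where K: "K > 0" "\<And>x. x \<in> car E \<Longrightarrow> norm x \<le> K * nrm E x" by (rule a.E_embedsE) blast
      obtain K' where K': "K' > 0" "\<And>x. x \<in> car E' \<Longrightarrow> norm x \<le> K' * nrm E' x" by (rule b.E_embedsE) blast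
      have "norm x \<le> max K K' * nrm (prod_nspace E E') x" if "x \<in> car (prod_nspace E E')" for x
      proof -
        have x: "fst x \<in> car E" "snd x \<in> car E'" using that by (auto simp: car_prod_nspace)
        have "norm x \<le> norm (fst x) + norm (snd x)" using norm_Pair_le[of "fst x" "snd x"] by simp
        also have "\<dots> \<le> max K K' * nrm E (fst x) + max K K' * nrm E' (snd x)"
          using nrm_nonneg[OF a.E x(1)] nrm_nonneg[OF b.E x(2)]
          by (intro add_mono order_trans[OF K(2)[OF x(1)]] order_trans[OF K'(2)[OF x(2)]] mult_right_mono) auto
        finally show ?thesis by (simp add: nrm_prod_nspace algebra_simps)
      qed
      then show ?thesis by blast
    qed
    show "op_bound (prod_nspace E E') (prod_nspace X1 X1') (prod_map (S t) (S' t))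
        (max C C' * t powr (min \<theta> \<theta>' - 1) * exp ((max \<omega> \<omega>' + 1) * t))" if t: "0 < t" for t
    proof -
      let ?k = "max C C' * t powr (min \<theta> \<theta>' - 1) * exp ((max \<omega> \<omega>' + 1) * t)"
      have k1: "C * t powr (\<theta> - 1) * exp (\<omega> * t) \<le> ?k"
        using mult_mono[OF max.cobounded1[of C C'] powr_exp_le[OF t, of "min \<theta> \<theta>'" \<theta> \<omega> "max \<omega> \<omega>' + 1"]]
          a.C a.\<theta> b.\<theta> by (auto simp: mult.assoc)
      have k2: "C' * t powr (\<theta>' - 1) * exp (\<omega>' * t) \<le> ?k"
        using mult_mono[OF max.cobounded2[of C' C] powr_exp_le[OF t, of "min \<theta> \<theta>'" \<theta>' \<omega>' "max \<omega> \<omega>' + 1"]]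
          b.C a.\<theta> b.\<theta> by (auto simp: mult.assoc)
      show ?thesis
        unfolding op_bound_def
      proof (intro ballI conjI)
        fix x assume "x \<in> car (prod_nspace E E')"
        then have x: "fst x \<in> car E" "snd x \<in> car E'" by (auto simp: car_prod_nspace)
        show "prod_map (S t) (S' t) x \<in> car (prod_nspace X1 X1')"
          using a.smoothing[OF t] b.smoothing[OF t] x by (simp add: op_bound_def car_prod_nspace prod_map_def)
        have "nrm X1 (S t (fst x)) \<le> ?k * nrm E (fst x)"
          by (rule order_trans[OF a.smoothing_nrm(2)[OF t x(1)] mult_right_mono[OF k1 nrm_nonneg[OF a.E x(1)]]])
        moreover have "nrm X1' (S' t (snd x)) \<le> ?k * nrm E' (snd x)"
          by (rule order_trans[OF b.smoothing_nrm(2)[OF t x(2)] mult_right_mono[OF k2 nrm_nonneg[OF b.E x(2)]]])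
        ultimately show "nrm (prod_nspace X1 X1') (prod_map (S t) (S' t) x) \<le> ?k * nrm (prod_nspace E E') x"
          by (simp add: nrm_prod_nspace prod_map_def distrib_left)
      qed
    qed
  qed (use a.\<theta> b.\<theta> a.C b.C in auto)
qed

section \<open>The error estimate\<close>

text \<open>The two fast instances have the semigroup and the domain in common:
  \<open>X\<gamma>\<close> receives the values of \<open>f\<close>, \<open>X\<delta>\<close> the
  time derivative of the slow solution. \<open>RA\<close> is the inverse of the fast generator, so
  that in this coordinate \<open>A\<close> is the identity. The properties of the critical map are
  assumptions here, which separates the estimate from its construction.\<close>

locale fast_slow =
  fast: smoothing_semigroup SA A RA "\<lambda>x. x" X1 X\<gamma> \<gamma> CA \<omega>A +
  fast': smoothing_semigroup SA A RA "\<lambda>x. x" X1 X\<delta> \<delta> CA \<omega>A +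
  slow: smoothing_semigroup SB B RB LB Y1 Y\<delta> \<delta>Y CB \<omega>B
  for SA :: "real \<Rightarrow> 'x::banach \<Rightarrow> 'x" and A RA X1 X\<gamma> \<gamma> CA \<omega>A X\<delta> \<delta>
    and SB :: "real \<Rightarrow> 'y::banach \<Rightarrow> 'y" and B RB LB Y1 Y\<delta> \<delta>Y CB \<omega>B +
  fixes f :: "'x \<Rightarrow> 'y \<Rightarrow> 'x" and g :: "'x \<Rightarrow> 'y \<Rightarrow> 'y" and h :: "'y \<Rightarrow> 'x"
    and Lf Lg Kh MA \<omega>f T :: real
  assumes f_range: "x \<in> car X1 \<Longrightarrow> y \<in> car Y1 \<Longrightarrow> f x y \<in> car X\<gamma>"
    and g_range: "x \<in> car X1 \<Longrightarrow> y \<in> car Y1 \<Longrightarrow> g x y \<in> car Y\<delta>"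
    and Lf: "0 < Lf" and Lg: "0 < Lg"
    and f_lipschitz: "x1 \<in> car X1 \<Longrightarrow> x2 \<in> car X1 \<Longrightarrow> y1 \<in> car Y1 \<Longrightarrow> y2 \<in> car Y1 \<Longrightarrow>
      nrm X\<gamma> (f x1 y1 - f x2 y2) \<le> Lf * (nrm X1 (x1 - x2) + nrm Y1 (y1 - y2))"
    and g_lipschitz: "x1 \<in> car X1 \<Longrightarrow> x2 \<in> car X1 \<Longrightarrow> y1 \<in> car Y1 \<Longrightarrow> y2 \<in> car Y1 \<Longrightarrow>
      nrm Y\<delta> (g x1 y1 - g x2 y2) \<le> Lg * (nrm X1 (x1 - x2) + nrm Y1 (y1 - y2))"
    and g_0: "g 0 0 = 0"
    and SA_X1: "0 < t \<Longrightarrow> op_bound X1 X1 (SA t) (MA * exp (\<omega>A * t))"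
    and h_range: "y \<in> car Y1 \<Longrightarrow> h y \<in> car X1"
    and h_equation: "y \<in> car Y1 \<Longrightarrow> A (h y) + f (h y) y = 0"
    and h_unique: "y \<in> car Y1 \<Longrightarrow> x \<in> car X1 \<Longrightarrow> A x + f x y = 0 \<Longrightarrow> x = h y"
    and h_0: "h 0 = 0"
    and Kh: "0 \<le> Kh"
    and h_lipschitz: "y1 \<in> car Y1 \<Longrightarrow> y2 \<in> car Y1 \<Longrightarrow> nrm X1 (h y1 - h y2) \<le> Kh * nrm Y1 (y1 - y2)"
    and T: "0 < T"
    and h_C1: "\<exists>K. \<forall>v v'. C0_in Y1 T v \<and> continuous_on {0..T} v' \<and>
        (\<forall>s\<in>{0..T}. (v has_vector_derivative v' s) (at s within {0..T})) \<longrightarrow>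
        (\<exists>d. C0_in X\<delta> T d \<and> (\<forall>s\<in>{0..T}. ((\<lambda>s. h (v s)) has_vector_derivative d s) (at s within {0..T})) \<and>
          (\<forall>b. (\<forall>s\<in>{0..T}. norm (v s) \<le> b \<and> norm (v' s) \<le> b) \<longrightarrow> (\<forall>s\<in>{0..T}. nrm X\<delta> (d s) \<le> K * b)))"
    and \<omega>: "\<omega>A < \<omega>f" "\<omega>f < 0"
    and rate: "CA * Lf * (\<omega>f - \<omega>A) powr - \<gamma> * \<gamma> powr (\<gamma> - 1) * (2 - \<gamma>) < 1"
begin

section \<open>Well-posedness of the coupled system and of the slow flow\<close>

abbreviation "solution \<equiv> strict_solution X1 A f Y1 B g T"

lemma product_semilinear:
  assumes \<epsilon>: "0 < \<epsilon>"
  shows "semilinear (\<lambda>t. prod_map (SA (t / \<epsilon>)) (SB t)) (prod_map (\<lambda>x. (1 / \<epsilon>) *\<^sub>R A x) B) (prod_map RA RB)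
    (prod_map (\<lambda>x. (1 / \<epsilon>) *\<^sub>R x) LB) (prod_nspace X1 Y1) (prod_nspace X\<gamma> Y\<delta>) (min \<gamma> \<delta>Y)
    (max (CA * \<epsilon> powr (1 - \<gamma>)) CB) (max (\<omega>A / \<epsilon>) \<omega>B + 1)
    (\<lambda>p. ((1 / \<epsilon>) *\<^sub>R f (fst p) (snd p), g (fst p) (snd p))) (Lf / \<epsilon> + Lg)"
proof -
  interpret p: smoothing_semigroup "\<lambda>t. prod_map (SA (t / \<epsilon>)) (SB t)" "prod_map (\<lambda>x. (1 / \<epsilon>) *\<^sub>R A x) B" "prod_map RA RB"
    "prod_map (\<lambda>x. (1 / \<epsilon>) *\<^sub>R x) LB" "prod_nspace X1 Y1" "prod_nspace X\<gamma> Y\<delta>" "min \<gamma> \<delta>Y"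
    "max (CA * \<epsilon> powr (1 - \<gamma>)) CB" "max (\<omega>A / \<epsilon>) \<omega>B + 1"
    by (rule smoothing_semigroup_prod[OF smoothing_semigroup_rescale[OF fast.smoothing_semigroup_axioms \<epsilon>]
          slow.smoothing_semigroup_axioms])
  show ?thesis
  proof
    fix x y assume x: "x \<in> car (prod_nspace X1 Y1)" and y: "y \<in> car (prod_nspace X1 Y1)"
    then have car: "fst x \<in> car X1" "snd x \<in> car Y1" "fst y \<in> car X1" "snd y \<in> car Y1"
      by (auto simp: car_prod_nspace)
    show "((1 / \<epsilon>) *\<^sub>R f (fst x) (snd x), g (fst x) (snd x)) \<in> car (prod_nspace X\<gamma> Y\<delta>)"
      using car by (auto simp: car_prod_nspace intro!: nspace_scale[OF fast.E] f_range g_range)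
    let ?d = "nrm X1 (fst x - fst y) + nrm Y1 (snd x - snd y)"
    have "nrm X\<gamma> ((1 / \<epsilon>) *\<^sub>R f (fst x) (snd x) - (1 / \<epsilon>) *\<^sub>R f (fst y) (snd y))
        = (1 / \<epsilon>) * nrm X\<gamma> (f (fst x) (snd x) - f (fst y) (snd y))"
      using \<epsilon> nrm_scale[OF fast.E, of "f (fst x) (snd x) - f (fst y) (snd y)" "1 / \<epsilon>"]
        nspace_diff[OF fast.E f_range f_range] car by (simp add: scaleR_diff_right)
    also have "\<dots> \<le> (1 / \<epsilon>) * (Lf * ?d)"
      using \<epsilon> by (intro mult_left_mono f_lipschitz car) auto
    finally show "nrm (prod_nspace X\<gamma> Y\<delta>) (((1 / \<epsilon>) *\<^sub>R f (fst x) (snd x), g (fst x) (snd x)) -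
        ((1 / \<epsilon>) *\<^sub>R f (fst y) (snd y), g (fst y) (snd y))) \<le> (Lf / \<epsilon> + Lg) * nrm (prod_nspace X1 Y1) (x - y)"
      using g_lipschitz[OF car(1,3,2,4)] by (simp add: nrm_prod_nspace algebra_simps)
  next
    show "0 \<le> Lf / \<epsilon> + Lg" using Lf Lg \<epsilon> by simp
  qed
qed

lemma slow_semilinear: "semilinear SB B RB LB Y1 Y\<delta> \<delta>Y CB \<omega>B (\<lambda>y. g (h y) y) (Lg * (Kh + 1))"
proof
  fix x y assume xy: "x \<in> car Y1" "y \<in> car Y1"
  then show "g (h x) x \<in> car Y\<delta>" by (auto intro: g_range h_range)
  have "nrm Y\<delta> (g (h x) x - g (h y) y) \<le> Lg * (nrm X1 (h x - h y) + nrm Y1 (x - y))"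
    by (intro g_lipschitz h_range xy)
  also have "\<dots> \<le> Lg * (Kh * nrm Y1 (x - y) + nrm Y1 (x - y))"
    using Lg by (intro mult_left_mono add_right_mono h_lipschitz xy) auto
  finally show "nrm Y\<delta> (g (h x) x - g (h y) y) \<le> Lg * (Kh + 1) * nrm Y1 (x - y)"
    by (simp add: algebra_simps)
qed (use Lg Kh in auto)

sublocale slow: semilinear SB B RB LB Y1 Y\<delta> \<delta>Y CB \<omega>B "\<lambda>y. g (h y) y" "Lg * (Kh + 1)"
  by (rule slow_semilinear)

text \<open>The continuous derivatives demanded of a strict solution come for free: along a curve
  continuous into the domain the right-hand sides are continuous.\<close>

lemma solution_iff_solves:
  assumes \<epsilon>: "0 < \<epsilon>"
  shows "solution \<epsilon> p u v \<longleftrightarrow> semilinear.solves (prod_map (\<lambda>x. (1 / \<epsilon>) *\<^sub>R A x) B) (prod_nspace X1 Y1)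
    (\<lambda>p. ((1 / \<epsilon>) *\<^sub>R f (fst p) (snd p), g (fst p) (snd p))) T p (\<lambda>t. (u t, v t))"
proof -
  interpret p: semilinear "\<lambda>t. prod_map (SA (t / \<epsilon>)) (SB t)" "prod_map (\<lambda>x. (1 / \<epsilon>) *\<^sub>R A x) B" "prod_map RA RB"
    "prod_map (\<lambda>x. (1 / \<epsilon>) *\<^sub>R x) LB" "prod_nspace X1 Y1" "prod_nspace X\<gamma> Y\<delta>" "min \<gamma> \<delta>Y"
    "max (CA * \<epsilon> powr (1 - \<gamma>)) CB" "max (\<omega>A / \<epsilon>) \<omega>B + 1"
    "\<lambda>p. ((1 / \<epsilon>) *\<^sub>R f (fst p) (snd p), g (fst p) (snd p))" "Lf / \<epsilon> + Lg"
    by (rule product_semilinear[OF \<epsilon>])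
  define du where "du t = (1 / \<epsilon>) *\<^sub>R A (u t) + (1 / \<epsilon>) *\<^sub>R f (u t) (v t)" for t
  define dv where "dv t = B (v t) + g (u t) (v t)" for t
  have pair: "prod_map (\<lambda>x. (1 / \<epsilon>) *\<^sub>R A x) B (u t, v t) + ((1 / \<epsilon>) *\<^sub>R f (fst (u t, v t)) (snd (u t, v t)), g (fst (u t, v t)) (snd (u t, v t)))
      = (du t, dv t)" for t
    by (simp add: prod_map_def du_def dv_def)
  have C0: "C0_in (prod_nspace X1 Y1) T (\<lambda>t. (u t, v t)) \<longleftrightarrow> C0_in X1 T u \<and> C0_in Y1 T v"
    using C0_in_prod[OF fast.X1 slow.X1, of T "\<lambda>t. (u t, v t)"] by simp
  have du: "\<epsilon> *\<^sub>R x = A (u t) + f (u t) (v t) \<longleftrightarrow> x = du t" for x t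
  proof -
    have "A (u t) + f (u t) (v t) = \<epsilon> *\<^sub>R du t" using \<epsilon> by (simp add: du_def scaleR_add_right)
    then show ?thesis using \<epsilon> by simp
  qed
  show ?thesis
  proof
    assume sol: "solution \<epsilon> p u v"
    then obtain u' v' where uv: "\<And>t. t \<in> {0..T} \<Longrightarrow> (u has_vector_derivative u' t) (at t within {0..T})"
        "\<And>t. t \<in> {0..T} \<Longrightarrow> (v has_vector_derivative v' t) (at t within {0..T})"
        "\<And>t. t \<in> {0..T} \<Longrightarrow> \<epsilon> *\<^sub>R u' t = A (u t) + f (u t) (v t)" "\<And>t. t \<in> {0..T} \<Longrightarrow> v' t = B (v t) + g (u t) (v t)"
      unfolding strict_solution_def by blast
    have "((\<lambda>t. (u t, v t)) has_vector_derivative (du t, dv t)) (at t within {0..T})" if t: "t \<in> {0..T}" for t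
    proof -
      have "u' t = du t" "v' t = dv t" using uv(3,4)[OF t] by (simp_all add: du dv_def)
      then show ?thesis using has_vector_derivative_Pair[OF uv(1,2)[OF t]] by simp
    qed
    then show "p.solves T p (\<lambda>t. (u t, v t))"
      using sol unfolding p.solves_def C0 pair by (auto simp: strict_solution_def)
  next
    assume sol: "p.solves T p (\<lambda>t. (u t, v t))"
    have cont: "continuous_on {0..T} (\<lambda>t. (du t, dv t))"
      using p.solves_derivative_continuous[OF sol] unfolding pair .
    have deriv: "((\<lambda>t. (u t, v t)) has_vector_derivative (du t, dv t)) (at t within {0..T})" if "t \<in> {0..T}" for t
      using sol that unfolding p.solves_def pair by blast
    show "solution \<epsilon> p u v"
      unfolding strict_solution_def
    proof (intro conjI exI ballI)
      show "continuous_on {0..T} du" "continuous_on {0..T} dv"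
        using continuous_on_fst[OF cont] continuous_on_snd[OF cont] by simp_all
      fix t assume "t \<in> {0..T}"
      from bounded_linear.has_vector_derivative[OF bounded_linear_fst deriv[OF this]]
        bounded_linear.has_vector_derivative[OF bounded_linear_snd deriv[OF this]]
      show "(u has_vector_derivative du t) (at t within {0..T})" "(v has_vector_derivative dv t) (at t within {0..T})"
        by simp_all
    qed (use sol in \<open>auto simp: p.solves_def C0 du dv_def\<close>)
  qed
qed

lemma solution_ex_unique:
  assumes \<epsilon>: "0 < \<epsilon>" and p: "p \<in> car (prod_nspace X1 Y1)"
  shows "\<exists>u v. solution \<epsilon> p u v"
    and "solution \<epsilon> p u v \<Longrightarrow> solution \<epsilon> p u' v' \<Longrightarrow> t \<in> {0..T} \<Longrightarrow> u t = u' t \<and> v t = v' t"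
proof -
  interpret p: semilinear "\<lambda>t. prod_map (SA (t / \<epsilon>)) (SB t)" "prod_map (\<lambda>x. (1 / \<epsilon>) *\<^sub>R A x) B" "prod_map RA RB"
    "prod_map (\<lambda>x. (1 / \<epsilon>) *\<^sub>R x) LB" "prod_nspace X1 Y1" "prod_nspace X\<gamma> Y\<delta>" "min \<gamma> \<delta>Y"
    "max (CA * \<epsilon> powr (1 - \<gamma>)) CB" "max (\<omega>A / \<epsilon>) \<omega>B + 1"
    "\<lambda>p. ((1 / \<epsilon>) *\<^sub>R f (fst p) (snd p), g (fst p) (snd p))" "Lf / \<epsilon> + Lg"
    by (rule product_semilinear[OF \<epsilon>])
  obtain w where "p.solves T p w" using p.solution_exists[OF _ p, of T] T by auto
  then have "p.solves T p (\<lambda>t. (fst (w t), snd (w t)))" by simp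
  then show "\<exists>u v. solution \<epsilon> p u v" 
    using solution_iff_solves[OF \<epsilon>, of p "\<lambda>t. fst (w t)" "\<lambda>t. snd (w t)"] by blast
  show "u t = u' t \<and> v t = v' t" if "solution \<epsilon> p u v" "solution \<epsilon> p u' v'" "t \<in> {0..T}"
    using p.solves_unique[of T p "\<lambda>t. (u t, v t)" "\<lambda>t. (u' t, v' t)" t] that(3)
      solution_iff_solves[OF \<epsilon>, of p u v] solution_iff_solves[OF \<epsilon>, of p u' v'] that(1,2) by simp
qed

lemma slow_derivative_continuous:
  assumes "slow.solves T y v"
  shows "continuous_on {0..T} (\<lambda>t. B (v t) + g (h (v t)) (v t))"
  using slow.solves_derivative_continuous[OF assms] .

text \<open>At \<epsilon> = 0 the fast equation is algebraic and forces the fast component onto the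
  critical manifold. Conversely, a strict solution has a differentiable fast component even at
  \<epsilon> = 0, and \<open>h_C1\<close> provides this derivative.\<close>

lemma slow_solution_iff_solves:
  assumes y: "y \<in> car Y1"
  shows "solution 0 (h y, y) u v \<longleftrightarrow> slow.solves T y v \<and> (\<forall>t\<in>{0..T}. u t = h (v t))"
proof
  assume sol: "solution 0 (h y, y) u v"
  then obtain u' v' where uv: "\<And>t. t \<in> {0..T} \<Longrightarrow> (v has_vector_derivative v' t) (at t within {0..T})"
      "\<And>t. t \<in> {0..T} \<Longrightarrow> 0 *\<^sub>R u' t = A (u t) + f (u t) (v t)" "\<And>t. t \<in> {0..T} \<Longrightarrow> v' t = B (v t) + g (u t) (v t)"
    unfolding strict_solution_def by blast
  have C0: "C0_in X1 T u" "C0_in Y1 T v" "v 0 = y" using sol by (auto simp: strict_solution_def)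
  have u: "u t = h (v t)" if t: "t \<in> {0..T}" for t
  proof (rule h_unique)
    show "A (u t) + f (u t) (v t) = 0" using uv(2)[OF t] by simp
  qed (use C0 t in \<open>auto simp: C0_in_def\<close>)
  have "(v has_vector_derivative B (v t) + g (h (v t)) (v t)) (at t within {0..T})" if t: "t \<in> {0..T}" for t
    using uv(1)[OF t] uv(3)[OF t] u[OF t] by simp
  then show "slow.solves T y v \<and> (\<forall>t\<in>{0..T}. u t = h (v t))"
    using C0 u by (simp add: slow.solves_def)
next
  assume *: "slow.solves T y v \<and> (\<forall>t\<in>{0..T}. u t = h (v t))"
  then have v: "C0_in Y1 T v" "v 0 = y"
    "\<And>t. t \<in> {0..T} \<Longrightarrow> (v has_vector_derivative B (v t) + g (h (v t)) (v t)) (at t within {0..T})"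
    and u: "\<And>t. t \<in> {0..T} \<Longrightarrow> u t = h (v t)"
    by (auto simp: slow.solves_def)
  have car: "v t \<in> car Y1" if "t \<in> {0..T}" for t using v(1) that by (auto simp: C0_in_def)
  have cont: "continuous_on {0..T} (\<lambda>t. B (v t) + g (h (v t)) (v t))"
    by (rule slow_derivative_continuous) (use * in blast)
  obtain d where d: "C0_in X\<delta> T d" "\<And>s. s \<in> {0..T} \<Longrightarrow> ((\<lambda>s. h (v s)) has_vector_derivative d s) (at s within {0..T})"
    using h_C1 v(1) v(3) cont by blast
  have "C0_in X1 T u"
    unfolding C0_in_def
  proof (intro ballI conjI)
    fix s assume s: "s \<in> {0..T}"
    show "u s \<in> car X1" using u s car h_range by simp
    show "((\<lambda>r. nrm X1 (u r - u s)) \<longlongrightarrow> 0) (at s within {0..T})"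
    proof (rule Lim_null_comparison)
      show "((\<lambda>r. Kh * nrm Y1 (v r - v s)) \<longlongrightarrow> 0) (at s within {0..T})"
        using v(1) s by (auto simp: C0_in_def intro!: tendsto_mult_right_zero)
      have "norm (nrm X1 (u r - u s)) \<le> Kh * nrm Y1 (v r - v s)" if "r \<in> {0..T}" for r
        using u[OF that] u[OF s] h_lipschitz[OF car[OF that] car[OF s]]
          nrm_nonneg[OF fast.X1 nspace_diff[OF fast.X1 h_range[OF car[OF that]] h_range[OF car[OF s]]]] by simp
      then show "\<forall>\<^sub>F r in at s within {0..T}. norm (nrm X1 (u r - u s)) \<le> Kh * nrm Y1 (v r - v s)"
        unfolding eventually_at_filter by (auto intro!: always_eventually)
    qed
  qed
  moreover have "(u has_vector_derivative d t) (at t within {0..T})" if t: "t \<in> {0..T}" for t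
    by (rule has_vector_derivative_transform[OF t u d(2)[OF t]])
  moreover have "continuous_on {0..T} d" by (rule fast'.C0_in_E_continuous_on[OF d(1)])
  moreover have "0 *\<^sub>R d t = A (u t) + f (u t) (v t)" if "t \<in> {0..T}" for t
    using h_equation[OF car[OF that]] u[OF that] by simp
  moreover have "(u 0, v 0) = (h y, y)" using u[of 0] v(2) T by simp
  ultimately show "solution 0 (h y, y) u v"
    unfolding strict_solution_def using v(1,3) cont u
    by (intro conjI exI[of _ d] exI[of _ "\<lambda>t. B (v t) + g (h (v t)) (v t)"] ballI) auto
qed

text \<open>A solution is a function on the whole line that is determined on [0, T] only; the
  description in \<open>flow\<close> picks the value at t, so uniqueness at this single time
  suffices.\<close>

lemma flow_eq:
  assumes ex: "solution \<epsilon> p u v" and unique: "\<And>u' v'. solution \<epsilon> p u' v' \<Longrightarrow> u' t = u t \<and> v' t = v t"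
  shows "flow X1 A f Y1 B g T \<epsilon> t p = (u t, v t)"
  unfolding flow_def
proof (rule the_equality)
  show "\<exists>u' v'. solution \<epsilon> p u' v' \<and> (u t, v t) = (u' t, v' t)" using ex by blast
  show "q = (u t, v t)" if "\<exists>u v. solution \<epsilon> p u v \<and> q = (u t, v t)" for q
    using that unique by force
qed

lemma flow_positive:
  assumes "0 < \<epsilon>" "p \<in> car (prod_nspace X1 Y1)"
  obtains u v where "solution \<epsilon> p u v" "\<And>t. t \<in> {0..T} \<Longrightarrow> flow X1 A f Y1 B g T \<epsilon> t p = (u t, v t)"
proof -
  obtain u v where uv: "solution \<epsilon> p u v" using solution_ex_unique(1)[OF assms] by blast
  moreover have "flow X1 A f Y1 B g T \<epsilon> t p = (u t, v t)" if "t \<in> {0..T}" for t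
    by (rule flow_eq[OF uv]) (rule solution_ex_unique(2)[OF assms _ uv that])
  ultimately show ?thesis by (rule that)
qed

lemma flow_zero:
  assumes y: "y \<in> car Y1"
  obtains w where "slow.solves T y w" "\<And>t. t \<in> {0..T} \<Longrightarrow> flow X1 A f Y1 B g T 0 t (h y, y) = (h (w t), w t)"
proof -
  obtain w where w: "slow.solves T y w" using slow.solution_exists[OF _ y, of T] T by auto
  then have sol: "solution 0 (h y, y) (\<lambda>t. h (w t)) w" by (simp add: slow_solution_iff_solves[OF y])
  have "flow X1 A f Y1 B g T 0 t (h y, y) = (h (w t), w t)" if t: "t \<in> {0..T}" for t
  proof (rule flow_eq[OF sol])
    fix u' v' assume "solution 0 (h y, y) u' v'"
    then show "u' t = h (w t) \<and> v' t = w t"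
      using slow.solves_unique[OF _ w t] t by (auto simp: slow_solution_iff_solves[OF y])
  qed
  with w show ?thesis by (rule that)
qed

end

section \<open>The error estimate and its dependence on \<epsilon>\<close>

context fast_slow
begin

text \<open>The last three factors are the singular weight of order \<gamma> for the decay rate
  \<omega>f - \<omega>A, cut at \<gamma> / (\<omega>f - \<omega>A); the others bound the smoothing
  and the nonlinearity.\<close>

definition contraction_rate :: real where
  "contraction_rate = CA * Lf * (\<omega>f - \<omega>A) powr - \<gamma> * \<gamma> powr (\<gamma> - 1) * (2 - \<gamma>)"

lemma contraction_rate: "0 \<le> contraction_rate" "contraction_rate < 1"
  using rate fast.C Lf fast.\<theta> by (auto simp: contraction_rate_def)

text \<open>
  At the splitting point \<open>\<gamma> \<epsilon> / (\<omega>f - \<omega>A)\<close> the powers of \<open>\<epsilon>\<close> cancel, so that the contraction rate does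
  not depend on \<open>\<epsilon>\<close>.
\<close>

lemma fast_weight:
  assumes \<epsilon>: "0 < \<epsilon>"
  shows "CA * \<epsilon> powr (1 - \<gamma>) * (Lf / \<epsilon>) * singular_weight \<gamma> (\<gamma> * \<epsilon> / (\<omega>f - \<omega>A)) 1 (1 / ((\<omega>f - \<omega>A) / \<epsilon>)) = contraction_rate"
proof -
  define x where "x = \<epsilon> / (\<omega>f - \<omega>A)"
  have x: "x > 0" using \<epsilon> \<omega> by (simp add: x_def)
  have \<gamma>: "0 < \<gamma>" by (rule fast.\<theta>)
  have "singular_weight \<gamma> (\<gamma> * x) 1 x = (\<gamma> * x) powr \<gamma> / \<gamma> - (\<gamma> * x) powr \<gamma> + (\<gamma> * x) powr \<gamma> / (\<gamma> * x) * x"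
    using \<gamma> x by (simp add: singular_weight_def powr_diff)
  also have "\<dots> = (\<gamma> * x) powr \<gamma> / \<gamma> * (2 - \<gamma>)" using \<gamma> x by (simp add: field_simps)
  also have "(\<gamma> * x) powr \<gamma> / \<gamma> = \<gamma> powr (\<gamma> - 1) * x powr \<gamma>" using \<gamma> x by (simp add: powr_mult powr_diff)
  also have "x powr \<gamma> = \<epsilon> powr \<gamma> * (\<omega>f - \<omega>A) powr - \<gamma>"
    using \<epsilon> \<omega> by (simp add: x_def powr_divide powr_minus_divide)
  finally have sw: "singular_weight \<gamma> (\<gamma> * x) 1 x = \<gamma> powr (\<gamma> - 1) * (\<epsilon> powr \<gamma> * (\<omega>f - \<omega>A) powr - \<gamma>) * (2 - \<gamma>)" .
  have "\<epsilon> powr (1 - \<gamma>) / \<epsilon> * \<epsilon> powr \<gamma> = 1" using \<epsilon> by (simp add: powr_diff)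
  moreover have "CA * \<epsilon> powr (1 - \<gamma>) * (Lf / \<epsilon>) * singular_weight \<gamma> (\<gamma> * x) 1 x
      = (\<epsilon> powr (1 - \<gamma>) / \<epsilon> * \<epsilon> powr \<gamma>) * contraction_rate"
    unfolding sw contraction_rate_def times_divide_eq_right by (simp add: mult_ac)
  ultimately have "CA * \<epsilon> powr (1 - \<gamma>) * (Lf / \<epsilon>) * singular_weight \<gamma> (\<gamma> * x) 1 x = contraction_rate"
    by (simp only: mult_1_left)
  then show ?thesis by (simp add: x_def)
qed

text \<open>The growth bound controls the slow solution in \<open>Y1\<close> by its initial value.
  The parametrization of the domain turns this into ambient bounds for the solution and its
  derivative, which is the input that \<open>h_C1\<close> asks for.\<close>

lemma slow_solution_bounds:
  obtains K where "K > 0"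
    "\<And>y w. y \<in> car Y1 \<Longrightarrow> slow.solves T y w \<Longrightarrow>
      \<exists>d. C0_in X\<delta> T d \<and> (\<forall>s\<in>{0..T}. ((\<lambda>s. h (w s)) has_vector_derivative d s) (at s within {0..T})) \<and>
        (\<forall>s\<in>{0..T}. nrm X\<delta> (d s) \<le> K * nrm Y1 y)"
proof -
  obtain Kg where Kg: "Kg > 0"
    "\<And>u G t. C0_in Y1 T u \<Longrightarrow> C0_in Y\<delta> T G \<Longrightarrow> (\<And>t. t \<in> {0..T} \<Longrightarrow> u t = SB t (u 0) + slow.conv G t) \<Longrightarrow>
      (\<And>t. t \<in> {0..T} \<Longrightarrow> nrm Y\<delta> (G t) \<le> Lg * (Kh + 1) * nrm Y1 (u t)) \<Longrightarrow> t \<in> {0..T} \<Longrightarrow>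
      nrm Y1 (u t) \<le> Kg * nrm Y1 (u 0)"
    using slow.growth_bound[OF _ slow.Lip, of T] T by (metis less_imp_le)
  obtain Kd where Kd: "\<forall>v v'. C0_in Y1 T v \<and> continuous_on {0..T} v' \<and>
        (\<forall>s\<in>{0..T}. (v has_vector_derivative v' s) (at s within {0..T})) \<longrightarrow>
        (\<exists>d. C0_in X\<delta> T d \<and> (\<forall>s\<in>{0..T}. ((\<lambda>s. h (v s)) has_vector_derivative d s) (at s within {0..T})) \<and>
          (\<forall>b. (\<forall>s\<in>{0..T}. norm (v s) \<le> b \<and> norm (v' s) \<le> b) \<longrightarrow> (\<forall>s\<in>{0..T}. nrm X\<delta> (d s) \<le> Kd * b)))"
    using h_C1 by blast
  obtain K1 where K1: "K1 > 0" "\<And>x. norm x \<le> K1 * nrm Y1 (RB x)" by (rule slow.X1_lowerE) blast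
  obtain KE where KE: "KE > 0" "\<And>x. x \<in> car Y\<delta> \<Longrightarrow> norm x \<le> KE * nrm Y\<delta> x" by (rule slow.E_embedsE) blast
  obtain KL where KL: "KL > 0" "\<And>x. norm (LB x) \<le> norm x * KL"
    using bounded_linear.pos_bounded[OF slow.L_linear] by blast
  obtain KR where KR: "KR > 0" "\<And>x. norm (RB x) \<le> norm x * KR"
    using bounded_linear.pos_bounded[OF slow.R_linear] by blast
  \<comment> \<open>The three summands bound the ambient norms of \<open>w\<close>, of
    \<open>B w\<close> and of the slow nonlinearity along the critical manifold.\<close>
  define Kn where "Kn = KR * K1 + KL * K1 + KE * (Lg * (Kh + 1))"
  have Kn0: "Kn \<ge> 0" using KR K1 KL KE Lg Kh by (simp add: Kn_def)
  \<comment> \<open>The maximum with 1 secures positivity, because \<open>h_C1\<close> gives no sign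
    for its constant.\<close>
  define K where "K = max 1 (Kd * (Kn * Kg))"
  show ?thesis
  proof (rule that[of K])
    show "K > 0" by (simp add: K_def)
    fix y w assume y: "y \<in> car Y1" and w: "slow.solves T y w"
    have wC: "C0_in Y1 T w" and w0: "w 0 = y"
      and wD: "\<And>t. t \<in> {0..T} \<Longrightarrow> (w has_vector_derivative B (w t) + g (h (w t)) (w t)) (at t within {0..T})"
      using w by (auto simp: slow.solves_def)
    have car: "w t \<in> car Y1" if "t \<in> {0..T}" for t using wC that by (auto simp: C0_in_def)
    have g_le: "nrm Y\<delta> (g (h x) x) \<le> Lg * (Kh + 1) * nrm Y1 x" if x: "x \<in> car Y1" for x
      using slow.F_lipschitz[OF x nspace_zero[OF slow.X1]] by (simp add: h_0 g_0)
    have w_le: "nrm Y1 (w t) \<le> Kg * nrm Y1 y" if t: "t \<in> {0..T}" for t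
      using Kg(2)[OF wC slow.F_C0_in[OF wC] _ _ t] slow.solves_mild[OF w] g_le[OF car] by (simp add: w0)
    obtain d where d: "C0_in X\<delta> T d" "\<forall>s\<in>{0..T}. ((\<lambda>s. h (w s)) has_vector_derivative d s) (at s within {0..T})"
      "\<And>b. (\<forall>s\<in>{0..T}. norm (w s) \<le> b \<and> norm (B (w s) + g (h (w s)) (w s)) \<le> b) \<Longrightarrow> (\<forall>s\<in>{0..T}. nrm X\<delta> (d s) \<le> Kd * b)"
      using Kd wC wD slow_derivative_continuous[OF w] by blast
    have "norm (w s) \<le> Kn * (Kg * nrm Y1 y) \<and> norm (B (w s) + g (h (w s)) (w s)) \<le> Kn * (Kg * nrm Y1 y)"
      if s: "s \<in> {0..T}" for s
    proof -
      obtain z where z: "w s = RB z" using car[OF s] slow.car_X1 by auto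
      let ?n = "nrm Y1 (w s)"
      have n: "0 \<le> ?n" by (rule nrm_nonneg[OF slow.X1 car[OF s]])
      have nz: "norm z \<le> K1 * ?n" using K1(2)[of z] z by simp
      have 1: "norm (w s) \<le> KR * K1 * ?n"
        using order_trans[OF KR(2)[of z] mult_right_mono[OF nz less_imp_le[OF KR(1)]]] z by (simp add: mult_ac)
      have 2: "norm (B (w s)) \<le> KL * K1 * ?n"
        using order_trans[OF KL(2)[of z] mult_right_mono[OF nz less_imp_le[OF KL(1)]]] z by (simp add: slow.A_R mult_ac)
      have 3: "norm (g (h (w s)) (w s)) \<le> KE * (Lg * (Kh + 1) * ?n)"
        using KE(1) by (intro order_trans[OF KE(2)[OF slow.F_range[OF car[OF s]]]] mult_left_mono g_le[OF car[OF s]]) auto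
      have pos: "0 \<le> KR * K1 * ?n" "0 \<le> KL * K1 * ?n" "0 \<le> KE * (Lg * (Kh + 1) * ?n)"
        using KR(1) K1(1) KL(1) KE(1) Lg Kh n by simp_all
      have eq: "Kn * ?n = KR * K1 * ?n + KL * K1 * ?n + KE * (Lg * (Kh + 1) * ?n)"
        by (simp add: Kn_def algebra_simps)
      have "norm (w s) \<le> Kn * ?n" using 1 pos unfolding eq by linarith
      moreover have "norm (B (w s) + g (h (w s)) (w s)) \<le> Kn * ?n"
        using 2 3 pos norm_triangle_ineq[of "B (w s)" "g (h (w s)) (w s)"] unfolding eq by linarith
      moreover have "Kn * ?n \<le> Kn * (Kg * nrm Y1 y)" using w_le[OF s] Kn0 by (rule mult_left_mono)
      ultimately show ?thesis by linarith
    qed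
    then have "nrm X\<delta> (d s) \<le> Kd * (Kn * (Kg * nrm Y1 y))" if "s \<in> {0..T}" for s using d(3) that by blast
    moreover have "Kd * (Kn * (Kg * nrm Y1 y)) \<le> K * nrm Y1 y"
      using nrm_nonneg[OF slow.X1 y] mult_right_mono[of "Kd * (Kn * Kg)" K "nrm Y1 y"] by (simp add: K_def mult.assoc)
    ultimately show "\<exists>d. C0_in X\<delta> T d \<and> (\<forall>s\<in>{0..T}. ((\<lambda>s. h (w s)) has_vector_derivative d s) (at s within {0..T})) \<and>
        (\<forall>s\<in>{0..T}. nrm X\<delta> (d s) \<le> K * nrm Y1 y)"
      using d(1,2) order_trans by blast
  qed
qed

text \<open>Let P and Q be the fast and the slow error. Once the layer is removed from P, their
  maxima NP and NQ in the weight exp (c t) satisfy NP \<le> \<rho> (NP + NQ) + O(\<epsilon>) and NQ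
  \<le> (1 - \<rho>)/2 (NP + NQ) + O(\<epsilon> powr \<delta>Y). The two coefficients add up to less
  than 1, so NP + NQ is bounded by the source terms, which are proportional to the initial slow norm
  and to the initial distance from the manifold.\<close>

lemma error_bound:
  obtains K where "K > 0"
    "\<And>\<epsilon> u v w x0 y0 t. 0 < \<epsilon> \<Longrightarrow> x0 \<in> car X1 \<Longrightarrow> y0 \<in> car Y1 \<Longrightarrow>
      solution \<epsilon> (x0, y0) u v \<Longrightarrow> slow.solves T y0 w \<Longrightarrow> t \<in> {0..T} \<Longrightarrow>
      nrm X1 (u t - h (w t)) + nrm Y1 (v t - w t) \<le>
        K * (\<epsilon> * nrm Y1 y0 + (\<epsilon> powr \<delta>Y + exp (\<omega>f * t / \<epsilon>)) * nrm X1 (x0 - h y0))"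
proof -
  define \<rho> where "\<rho> = contraction_rate"
  have \<rho>: "0 \<le> \<rho>" "\<rho> < 1" using contraction_rate by (auto simp: \<rho>_def)
  define M where "M = max MA 1"
  \<comment> \<open>\<open>mb\<close> solves m = M + \<rho> m: the layer majorant dominates the
    initial term together with its own image under the fast convolution.\<close>
  define mb where "mb = M / (1 - \<rho>)"
  have mb: "mb > 0" "M + \<rho> * mb = mb" using \<rho> by (auto simp: mb_def M_def field_simps)
  obtain Kd where Kd: "Kd > 0" "\<And>y w. y \<in> car Y1 \<Longrightarrow> slow.solves T y w \<Longrightarrow>
      \<exists>d. C0_in X\<delta> T d \<and> (\<forall>s\<in>{0..T}. ((\<lambda>s. h (w s)) has_vector_derivative d s) (at s within {0..T})) \<and>
        (\<forall>s\<in>{0..T}. nrm X\<delta> (d s) \<le> Kd * nrm Y1 y)"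
    using slow_solution_bounds by blast
  \<comment> \<open>The slow convolution, including the factor \<open>Lg\<close>, is allotted half
    of the margin left by the fast contraction.\<close>
  obtain a c where a: "0 < a" and c: "\<omega>B < c" "0 \<le> c"
    and small: "CB * singular_weight \<delta>Y a 1 (1 / (c - \<omega>B)) \<le> (1 - \<rho>) / (2 * Lg)"
    by (rule slow.small_growth_rate[of "(1 - \<rho>) / (2 * Lg)"]) (use \<rho> Lg in auto)
  have \<omega>A: "\<omega>A < 0" using \<omega> by simp
  \<comment> \<open>\<open>K1\<close> and \<open>K2\<close> contain the weights with cut 1 that
    remain when \<epsilon> is scaled out: \<open>K1\<close> for the defect with decay rate -
    \<omega>A, \<open>K2\<close> for the action of the layer on the slow component with decay rate -
    \<omega>f.\<close>
  define K1 where "K1 = CA * Kd * singular_weight \<delta> 1 1 (1 / - \<omega>A)"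
  define kb where "kb = Lg * mb * exp (\<bar>\<omega>B\<bar> * T)"
  define K2 where "K2 = CB * kb * singular_weight \<delta>Y 1 1 (1 / - \<omega>f)"
  have kb: "kb > 0" using Lg mb by (simp add: kb_def)
  have K1: "K1 \<ge> 0" unfolding K1_def
    using fast.C Kd(1) \<omega>A by (intro mult_nonneg_nonneg singular_weight_nonneg fast'.\<theta>) auto
  have K2: "K2 \<ge> 0" unfolding K2_def
    using slow.C kb \<omega> by (intro mult_nonneg_nonneg singular_weight_nonneg slow.\<theta>) auto
  define K where "K = mb + exp (c * T) * (2 / (1 - \<rho>)) * (K1 + K2)"
  show ?thesis
  proof (rule that[of K])
    show "K > 0" unfolding K_def using mb K1 K2 \<rho> by (intro add_pos_nonneg mult_nonneg_nonneg) auto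
    fix \<epsilon> u v w x0 y0 t0
    assume \<epsilon>: "0 < \<epsilon>" and x0: "x0 \<in> car X1" and y0: "y0 \<in> car Y1"
      and sol: "solution \<epsilon> (x0, y0) u v" and w: "slow.solves T y0 w" and t0: "t0 \<in> {0..T}"
    obtain d where d: "C0_in X\<delta> T d" "\<And>s. s \<in> {0..T} \<Longrightarrow> ((\<lambda>s. h (w s)) has_vector_derivative d s) (at s within {0..T})"
      "\<And>s. s \<in> {0..T} \<Longrightarrow> nrm X\<delta> (d s) \<le> Kd * nrm Y1 y0"
      using Kd(2)[OF y0 w] by blast
    define D where "D = nrm X1 (x0 - h y0)"
    define V where "V = nrm Y1 y0"
    have D: "D \<ge> 0" and V: "V \<ge> 0"
      using nrm_nonneg[OF fast.X1 nspace_diff[OF fast.X1 x0 h_range[OF y0]]] nrm_nonneg[OF slow.X1 y0]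
      by (auto simp: D_def V_def)
    interpret e: smoothing_semigroup "\<lambda>t. SA (t / \<epsilon>)" "\<lambda>x. (1 / \<epsilon>) *\<^sub>R A x" RA "\<lambda>x. (1 / \<epsilon>) *\<^sub>R x" X1 X\<gamma> \<gamma>
      "CA * \<epsilon> powr (1 - \<gamma>)" "\<omega>A / \<epsilon>"
      by (rule smoothing_semigroup_rescale[OF fast.smoothing_semigroup_axioms \<epsilon>])
    interpret e': smoothing_semigroup "\<lambda>t. SA (t / \<epsilon>)" "\<lambda>x. (1 / \<epsilon>) *\<^sub>R A x" RA "\<lambda>x. (1 / \<epsilon>) *\<^sub>R x" X1 X\<delta> \<delta>
      "CA * \<epsilon> powr (1 - \<delta>)" "\<omega>A / \<epsilon>"
      by (rule smoothing_semigroup_rescale[OF fast'.smoothing_semigroup_axioms \<epsilon>])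
    have slow_sol: "solution 0 (h y0, y0) (\<lambda>t. h (w t)) w"
      using slow_solution_iff_solves[OF y0] w by simp
    have C0: "C0_in X1 T u" "C0_in Y1 T v" "C0_in X1 T (\<lambda>t. h (w t))" "C0_in Y1 T w"
      and init: "u 0 = x0" "v 0 = y0" "w 0 = y0"
      using sol slow_sol by (auto simp: strict_solution_def)
    have car: "u s \<in> car X1" "v s \<in> car Y1" "h (w s) \<in> car X1" "w s \<in> car Y1" if "s \<in> {0..T}" for s
      using C0 that by (auto simp: C0_in_def)
    have pC: "C0_in X1 T (\<lambda>t. u t - h (w t))" by (rule C0_in_diff[OF fast.X1 C0(1,3)])
    have qC: "C0_in Y1 T (\<lambda>t. v t - w t)" by (rule C0_in_diff[OF slow.X1 C0(2,4)])
    define P where "P t = nrm X1 (u t - h (w t))" for t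
    define Q where "Q t = nrm Y1 (v t - w t)" for t
    have P0: "0 \<le> P s" and Q0: "0 \<le> Q s" if "s \<in> {0..T}" for s
      using nrm_nonneg[OF fast.X1 nspace_diff[OF fast.X1 car(1)[OF that] car(3)[OF that]]]
        nrm_nonneg[OF slow.X1 nspace_diff[OF slow.X1 car(2)[OF that] car(4)[OF that]]]
      by (auto simp: P_def Q_def)
    have Pc: "continuous_on {0..T} P" and Qc: "continuous_on {0..T} Q"
      unfolding P_def Q_def by (rule C0_in_nrm_continuous[OF fast.X1 pC] C0_in_nrm_continuous[OF slow.X1 qC])+
    define F where "F s = (1 / \<epsilon>) *\<^sub>R (f (u s) (v s) - f (h (w s)) (w s))" for s
    define G where "G s = g (u s) (v s) - g (h (w s)) (w s)" for s
    \<comment> \<open>Only the continuity of the nonlinear terms along continuous curves is drawn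
      from the product equation here.\<close>
    interpret p: semilinear "\<lambda>t. prod_map (SA (t / \<epsilon>)) (SB t)" "prod_map (\<lambda>x. (1 / \<epsilon>) *\<^sub>R A x) B" "prod_map RA RB"
      "prod_map (\<lambda>x. (1 / \<epsilon>) *\<^sub>R x) LB" "prod_nspace X1 Y1" "prod_nspace X\<gamma> Y\<delta>" "min \<gamma> \<delta>Y"
      "max (CA * \<epsilon> powr (1 - \<gamma>)) CB" "max (\<omega>A / \<epsilon>) \<omega>B + 1"
      "\<lambda>p. ((1 / \<epsilon>) *\<^sub>R f (fst p) (snd p), g (fst p) (snd p))" "Lf / \<epsilon> + Lg"
      by (rule product_semilinear[OF \<epsilon>])
    have FG_C0: "C0_in X\<gamma> T (\<lambda>s. (1 / \<epsilon>) *\<^sub>R f (a s) (b s)) \<and> C0_in Y\<delta> T (\<lambda>s. g (a s) (b s))"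
      if "C0_in X1 T a" "C0_in Y1 T b" for a b
      using p.F_C0_in[of T "\<lambda>s. (a s, b s)"] that
      by (simp add: C0_in_prod[OF fast.X1 slow.X1] C0_in_prod[OF fast.E slow.E])
    have FC: "C0_in X\<gamma> T F"
      using C0_in_diff[OF fast.E conjunct1[OF FG_C0[OF C0(1,2)]] conjunct1[OF FG_C0[OF C0(3,4)]]]
      by (simp add: F_def[abs_def] scaleR_diff_right)
    have GC: "C0_in Y\<delta> T G"
      using C0_in_diff[OF slow.E conjunct2[OF FG_C0[OF C0(1,2)]] conjunct2[OF FG_C0[OF C0(3,4)]]]
      by (simp add: G_def[abs_def])
    have F_le: "nrm X\<gamma> (F s) \<le> (Lf / \<epsilon>) * (P s + Q s)" if s: "s \<in> {0..T}" for s
    proof -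
      have "nrm X\<gamma> (F s) = (1 / \<epsilon>) * nrm X\<gamma> (f (u s) (v s) - f (h (w s)) (w s))"
        unfolding F_def using \<epsilon> nrm_scale[OF fast.E nspace_diff[OF fast.E f_range f_range]] car[OF s] by simp
      also have "\<dots> \<le> (1 / \<epsilon>) * (Lf * (P s + Q s))"
        unfolding P_def Q_def using \<epsilon> car[OF s] by (intro mult_left_mono f_lipschitz) auto
      finally show ?thesis by simp
    qed
    have G_le: "nrm Y\<delta> (G s) \<le> Lg * (P s + Q s)" if s: "s \<in> {0..T}" for s
      unfolding P_def Q_def G_def using car[OF s] by (intro g_lipschitz) auto
    obtain u' v' where uv: "\<And>t. t \<in> {0..T} \<Longrightarrow> (u has_vector_derivative u' t) (at t within {0..T})"
        "\<And>t. t \<in> {0..T} \<Longrightarrow> (v has_vector_derivative v' t) (at t within {0..T})"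
        "\<And>t. t \<in> {0..T} \<Longrightarrow> \<epsilon> *\<^sub>R u' t = A (u t) + f (u t) (v t)" "\<And>t. t \<in> {0..T} \<Longrightarrow> v' t = B (v t) + g (u t) (v t)"
      using sol unfolding strict_solution_def by blast
    have A_diff: "A x - A y = A (x - y)" if xy: "x \<in> car X1" "y \<in> car X1" for x y
    proof -
      obtain x' y' where "x = RA x'" "y = RA y'" using xy fast.car_X1 by auto
      then show ?thesis using fast.A_R[of "x' - y'"] by (simp add: fast.A_R fast.R_diff)
    qed
    have B_diff: "B x - B y = B (x - y)" if xy: "x \<in> car Y1" "y \<in> car Y1" for x y
    proof -
      obtain x' y' where "x = RB x'" "y = RB y'" using xy slow.car_X1 by auto
      then show ?thesis using slow.A_R[of "x' - y'"] by (simp add: slow.A_R slow.R_diff slow.L_diff)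
    qed
    have p_mild: "u t - h (w t) = SA (t / \<epsilon>) (x0 - h y0) + (e.conv F t - e.conv d t)" if t: "t \<in> {0..T}" for t
    proof -
      have "u t - h (w t) = SA (t / \<epsilon>) (u 0 - h (w 0)) + e.conv (\<lambda>s. F s - d s) t"
      proof (rule e.variation_of_constants[OF _ _ t])
        fix s assume s: "s \<in> {0..T}"
        show "u s - h (w s) \<in> range RA"
          using nspace_diff[OF fast.X1 car(1)[OF s] car(3)[OF s]] fast.car_X1 by simp
        have "u' s = (1 / \<epsilon>) *\<^sub>R (\<epsilon> *\<^sub>R u' s)" using \<epsilon> by simp
        also have "\<dots> = (1 / \<epsilon>) *\<^sub>R (A (u s) + f (u s) (v s))" by (simp only: uv(3)[OF s])
        \<comment> \<open>Zero is inserted: the fast right-hand side vanishes at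
          \<open>h (w s)\<close>. The derivative of the slow solution is therefore the whole
          defect.\<close>
        also have "\<dots> = (1 / \<epsilon>) *\<^sub>R (A (u s) + f (u s) (v s) - (A (h (w s)) + f (h (w s)) (w s)))"
          using h_equation[OF car(4)[OF s]] by simp
        also have "\<dots> = (1 / \<epsilon>) *\<^sub>R A (u s - h (w s)) + F s"
          using A_diff[OF car(1)[OF s] car(3)[OF s]] unfolding F_def by (simp add: algebra_simps)
        finally show "((\<lambda>t. u t - h (w t)) has_vector_derivative (1 / \<epsilon>) *\<^sub>R A (u s - h (w s)) + (F s - d s)) (at s within {0..T})"
          using has_vector_derivative_diff[OF uv(1)[OF s] d(2)[OF s]] by (simp add: add_diff_eq)
      qed
      also have "e.conv (\<lambda>s. F s - d s) t = e.conv F t - e.conv d t"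
        by (rule e.conv_diff; rule continuous_on_subset[OF fast.C0_in_E_continuous_on[OF FC]] continuous_on_subset[OF fast'.C0_in_E_continuous_on[OF d(1)]])
           (use t in auto)
      finally show ?thesis by (simp add: init)
    qed
    have q_mild: "v t - w t = slow.conv G t" if t: "t \<in> {0..T}" for t
    proof -
      have "v t - w t = SB t (v 0 - w 0) + slow.conv G t"
      proof (rule slow.variation_of_constants[OF _ _ t])
        fix s assume s: "s \<in> {0..T}"
        show "v s - w s \<in> range RB"
          using nspace_diff[OF slow.X1 car(2)[OF s] car(4)[OF s]] slow.car_X1 by simp
        have "(w has_vector_derivative B (w s) + g (h (w s)) (w s)) (at s within {0..T})"
          using w s by (simp add: slow.solves_def)
        from has_vector_derivative_diff[OF uv(2)[OF s] this]
        show "((\<lambda>t. v t - w t) has_vector_derivative B (v s - w s) + G s) (at s within {0..T})"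
          using B_diff[OF car(2)[OF s] car(4)[OF s]] by (simp add: uv(4)[OF s] G_def algebra_simps)
      qed
      then show ?thesis using t by (simp add: init slow.S_zero)
    qed
    define b where "b t = exp (\<omega>f * t / \<epsilon>)" for t
    \<comment> \<open>The positive part keeps the maximum nonnegative where the layer majorant
      exceeds P; later estimates multiply by this maximum.\<close>
    have "continuous_on {0..T} (\<lambda>t. max 0 (P t - mb * D * b t) * exp (- c * t))"
      unfolding b_def using \<epsilon> by (intro continuous_intros Pc) auto
    from continuous_attains_sup_interval[OF this] T obtain s1 where s1: "s1 \<in> {0..T}"
      "\<And>t. t \<in> {0..T} \<Longrightarrow> max 0 (P t - mb * D * b t) * exp (- c * t) \<le> max 0 (P s1 - mb * D * b s1) * exp (- c * s1)"
      by auto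
    have "continuous_on {0..T} (\<lambda>t. Q t * exp (- c * t))" by (intro continuous_intros Qc)
    from continuous_attains_sup_interval[OF this] T obtain s2 where s2: "s2 \<in> {0..T}"
      "\<And>t. t \<in> {0..T} \<Longrightarrow> Q t * exp (- c * t) \<le> Q s2 * exp (- c * s2)"
      by auto
    \<comment> \<open>The initial layer \<open>mb * D * b\<close> is subtracted from \<open>P\<close> because its rate, unlike the weight
      \<open>exp (c * t)\<close>, depends on \<open>\<epsilon>\<close>.\<close>
    define NP where "NP = max 0 (P s1 - mb * D * b s1) * exp (- c * s1)"
    define NQ where "NQ = Q s2 * exp (- c * s2)"
    have NPQ: "0 \<le> NP" "0 \<le> NQ" using Q0[OF s2(1)] by (auto simp: NP_def NQ_def)
    have weight: "x \<le> y * exp (c * t)" if "x * exp (- c * t) \<le> y" for x y t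
    proof -
      have "x = (x * exp (- c * t)) * exp (c * t)" by (simp add: exp_minus)
      also have "\<dots> \<le> y * exp (c * t)" using that by (intro mult_right_mono) auto
      finally show ?thesis .
    qed
    have PQ_le: "P t + Q t \<le> mb * D * b t + (NP + NQ) * exp (c * t)" if t: "t \<in> {0..T}" for t
      using weight[OF s1(2)[OF t, folded NP_def]] weight[OF s2(2)[OF t, folded NQ_def]]
      by (simp add: algebra_simps)
    have conv_F: "nrm X1 (e.conv F t) \<le> \<rho> * (mb * D * b t + (NP + NQ) * exp (c * t))" if t: "t \<in> {0..T}" for t
    proof -
      let ?k = "mb * D * b t + (NP + NQ) * exp (c * t)"
      have k: "0 \<le> ?k" using mb D NPQ by (auto simp: b_def)
      have "nrm X1 (e.conv F t) \<le> (CA * \<epsilon> powr (1 - \<gamma>)) * ((Lf / \<epsilon>) * ?k)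
          * singular_weight \<gamma> (\<gamma> * \<epsilon> / (\<omega>f - \<omega>A)) 1 (1 / ((\<omega>f - \<omega>A) / \<epsilon>))"
      proof (rule e.conv_decay_bound[OF FC t])
        show "0 < \<gamma> * \<epsilon> / (\<omega>f - \<omega>A)" "0 < (\<omega>f - \<omega>A) / \<epsilon>" using fast.\<theta> \<epsilon> \<omega> by auto
        show "0 \<le> Lf / \<epsilon> * ?k" using k Lf \<epsilon> by (intro mult_nonneg_nonneg) auto
        fix s assume s: "s \<in> {0..t}"
        then have sT: "s \<in> {0..T}" using t by auto
        have 1: "exp (\<omega>A / \<epsilon> * (t - s)) * b s = b t * exp (- ((\<omega>f - \<omega>A) / \<epsilon>) * (t - s))"
          using \<epsilon> unfolding b_def mult_exp_exp by (simp add: field_simps)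
        \<comment> \<open>The slow weight obeys the same decay rate as the layer, because \<omega>f
          < 0 \<le> c; one application of the convolution bound serves both parts of the
          majorant.\<close>
        have "exp (\<omega>A / \<epsilon> * (t - s)) * exp (c * s) = exp (c * t) * exp ((\<omega>A / \<epsilon> - c) * (t - s))"
          unfolding mult_exp_exp by (simp add: algebra_simps)
        also have "\<dots> \<le> exp (c * t) * exp (- ((\<omega>f - \<omega>A) / \<epsilon>) * (t - s))"
        proof -
          have "\<omega>A / \<epsilon> - c \<le> - ((\<omega>f - \<omega>A) / \<epsilon>)" using \<epsilon> \<omega> c(2) divide_neg_pos[of \<omega>f \<epsilon>] by (simp add: diff_divide_distrib)
          then have "(\<omega>A / \<epsilon> - c) * (t - s) \<le> - ((\<omega>f - \<omega>A) / \<epsilon>) * (t - s)" using s by (intro mult_right_mono) auto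
          then show ?thesis by simp
        qed
        finally have 2: "exp (\<omega>A / \<epsilon> * (t - s)) * exp (c * s) \<le> exp (c * t) * exp (- ((\<omega>f - \<omega>A) / \<epsilon>) * (t - s))" .
        have "exp (\<omega>A / \<epsilon> * (t - s)) * nrm X\<gamma> (F s)
            \<le> exp (\<omega>A / \<epsilon> * (t - s)) * ((Lf / \<epsilon>) * (mb * D * b s + (NP + NQ) * exp (c * s)))"
          using Lf \<epsilon> by (intro mult_left_mono order_trans[OF F_le[OF sT]] PQ_le[OF sT]) auto
        also have "\<dots> = (Lf / \<epsilon>) * (mb * D * (exp (\<omega>A / \<epsilon> * (t - s)) * b s) + (NP + NQ) * (exp (\<omega>A / \<epsilon> * (t - s)) * exp (c * s)))"
          by (simp add: algebra_simps)
        also have "\<dots> \<le> (Lf / \<epsilon>) * (mb * D * (b t * exp (- ((\<omega>f - \<omega>A) / \<epsilon>) * (t - s))) + (NP + NQ) * (exp (c * t) * exp (- ((\<omega>f - \<omega>A) / \<epsilon>) * (t - s))))"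
          unfolding 1 using Lf \<epsilon> NPQ by (intro mult_left_mono add_left_mono 2) auto
        also have "\<dots> = (Lf / \<epsilon> * ?k) * exp (- ((\<omega>f - \<omega>A) / \<epsilon>) * (t - s))" by (simp add: algebra_simps)
        finally show "exp (\<omega>A / \<epsilon> * (t - s)) * nrm X\<gamma> (F s) \<le> (Lf / \<epsilon> * ?k) * exp (- ((\<omega>f - \<omega>A) / \<epsilon>) * (t - s))" .
      qed
      also have "\<dots> = ((CA * \<epsilon> powr (1 - \<gamma>)) * (Lf / \<epsilon>)
          * singular_weight \<gamma> (\<gamma> * \<epsilon> / (\<omega>f - \<omega>A)) 1 (1 / ((\<omega>f - \<omega>A) / \<epsilon>))) * ?k"
        by (simp only: mult_ac)
      also have "\<dots> = \<rho> * ?k" unfolding fast_weight[OF \<epsilon>] \<rho>_def ..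
      finally show ?thesis .
    qed
    \<comment> \<open>Homogeneity of the weight: with cut and time scale \<epsilon> it scales like
      \<epsilon> powr \<theta>, so the factor from the rescaled semigroup leaves exactly one power
      of \<epsilon>, whatever \<theta> is.\<close>
    have scaled: "\<epsilon> powr (1 - \<theta>) * singular_weight \<theta> \<epsilon> 1 (\<epsilon> * x) = \<epsilon> * singular_weight \<theta> 1 1 x" for \<theta> x
    proof -
      have "\<epsilon> powr (1 - \<theta>) * \<epsilon> powr \<theta> = \<epsilon>" "\<epsilon> powr (1 - \<theta>) * \<epsilon> powr (\<theta> - 1) = 1" using \<epsilon> by (simp_all flip: powr_add)
      then show ?thesis unfolding singular_weight_def by (simp add: algebra_simps)
    qed
    \<comment> \<open>Unlike the difference of the values of \<open>f\<close>, the derivative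
      \<open>d\<close> carries no factor 1/\<epsilon>; hence its contribution is of order
      \<epsilon>.\<close>
    have conv_d: "nrm X1 (e.conv d t) \<le> K1 * (\<epsilon> * V)" if t: "t \<in> {0..T}" for t
    proof -
      have "nrm X1 (e.conv d t) \<le> (CA * \<epsilon> powr (1 - \<delta>)) * (Kd * V) * singular_weight \<delta> \<epsilon> 1 (1 / (- \<omega>A / \<epsilon>))"
      proof (rule e'.conv_decay_bound[OF d(1) t \<epsilon>])
        fix s assume s: "s \<in> {0..t}"
        then have "exp (\<omega>A / \<epsilon> * (t - s)) * nrm X\<delta> (d s) \<le> exp (\<omega>A / \<epsilon> * (t - s)) * (Kd * V)"
          using d(3)[of s] t by (intro mult_left_mono) (auto simp: V_def)
        then show "exp (\<omega>A / \<epsilon> * (t - s)) * nrm X\<delta> (d s) \<le> Kd * V * exp (- (- \<omega>A / \<epsilon>) * (t - s))"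
          by (simp add: mult_ac)
      qed (use Kd(1) V \<omega>A \<epsilon> in \<open>auto simp: divide_neg_pos\<close>)
      also have "\<dots> = CA * Kd * V * (\<epsilon> powr (1 - \<delta>) * singular_weight \<delta> \<epsilon> 1 (\<epsilon> * (1 / - \<omega>A)))"
        by (simp add: mult_ac)
      also have "\<dots> = K1 * (\<epsilon> * V)" unfolding scaled by (simp add: K1_def)
      finally show ?thesis .
    qed
    have P_le: "P t \<le> mb * D * b t + (\<rho> * (NP + NQ) + K1 * (\<epsilon> * V)) * exp (c * t)" if t: "t \<in> {0..T}" for t
    proof -
      let ?x = "x0 - h y0"
      have x: "?x \<in> car X1" by (rule nspace_diff[OF fast.X1 x0 h_range[OF y0]])
      have start: "SA (t / \<epsilon>) ?x \<in> car X1 \<and> nrm X1 (SA (t / \<epsilon>) ?x) \<le> M * D * b t"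
      \<comment> \<open>The semigroup bounds hold for positive times only; at time 0 the choice
        \<open>M \<ge> 1\<close> takes over.\<close>
      proof (cases "t = 0")
        case True
        then show ?thesis using x D by (simp add: fast.S_0 b_def D_def M_def mult_le_cancel_right1)
      next
        case False
        then have pos: "0 < t / \<epsilon>" using t \<epsilon> by simp
        have mem: "SA (t / \<epsilon>) ?x \<in> car X1" using SA_X1[OF pos] x by (auto simp: op_bound_def)
        have "nrm X1 (SA (t / \<epsilon>) ?x) \<le> MA * exp (\<omega>A * (t / \<epsilon>)) * D"
          using SA_X1[OF pos] x by (auto simp: op_bound_def D_def)
        also have "\<dots> \<le> M * b t * D"
        proof (intro mult_right_mono mult_mono)
          show "exp (\<omega>A * (t / \<epsilon>)) \<le> b t" unfolding b_def using \<omega> t \<epsilon> by (auto intro!: divide_right_mono mult_right_mono)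
        qed (use D in \<open>auto simp: M_def\<close>)
        finally show ?thesis using mem by (simp add: mult_ac)
      qed
      have cF: "e.conv F t \<in> car X1" and cd: "e.conv d t \<in> car X1"
        using e.conv_C0_in[OF FC] e'.conv_C0_in[OF d(1)] t by (auto simp: C0_in_def)
      have "P t \<le> nrm X1 (SA (t / \<epsilon>) ?x) + nrm X1 (e.conv F t - e.conv d t)"
        unfolding P_def p_mild[OF t] using start cF cd by (intro nrm_triangle[OF fast.X1] nspace_diff[OF fast.X1]) auto
      also have "nrm X1 (e.conv F t - e.conv d t) \<le> nrm X1 (e.conv F t) + nrm X1 (e.conv d t)"
        using nrm_triangle_diff[OF fast.X1 cF nspace_zero[OF fast.X1] cd] nrm_minus_commute[OF fast.X1 cd nspace_zero[OF fast.X1]] by simp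
      also have "\<dots> \<le> \<rho> * (mb * D * b t + (NP + NQ) * exp (c * t)) + K1 * (\<epsilon> * V)"
        by (intro add_mono conv_F conv_d t)
      also have "K1 * (\<epsilon> * V) \<le> K1 * (\<epsilon> * V) * exp (c * t)"
      proof -
        have "1 \<le> exp (c * t)" using c t by simp
        moreover have "0 \<le> K1 * (\<epsilon> * V)" using K1 \<epsilon> V by simp
        ultimately show ?thesis using mult_left_mono[of 1 "exp (c * t)" "K1 * (\<epsilon> * V)"] by simp
      qed
      \<comment> \<open>The coefficient of the layer reproduces itself, because
        \<open>M + \<rho> * mb = mb\<close>.\<close>
      finally have "P t \<le> (M + \<rho> * mb) * D * b t + (\<rho> * (NP + NQ) + K1 * (\<epsilon> * V)) * exp (c * t)"
        using start by (simp add: algebra_simps)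
      then show ?thesis using mb(2) by simp
    qed
    have NP_le: "NP \<le> \<rho> * (NP + NQ) + K1 * (\<epsilon> * V)"
    proof -
      let ?r = "\<rho> * (NP + NQ) + K1 * (\<epsilon> * V)"
      have r: "0 \<le> ?r" using \<rho> NPQ K1 \<epsilon> V by (intro add_nonneg_nonneg mult_nonneg_nonneg) auto
      have "max 0 (P s1 - mb * D * b s1) \<le> ?r * exp (c * s1)"
        using P_le[OF s1(1)] r by simp
      then have "NP \<le> (?r * exp (c * s1)) * exp (- c * s1)" unfolding NP_def by (intro mult_right_mono) auto
      then show ?thesis unfolding mult.assoc[of ?r] mult_exp_exp by simp
    qed
    have Q_le: "Q t \<le> ((1 - \<rho>) / 2 * (NP + NQ) + K2 * (\<epsilon> powr \<delta>Y * D)) * exp (c * t)" if t: "t \<in> {0..T}" for t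
    proof -
      define \<kappa> where "\<kappa> = c - \<omega>B"
      have \<kappa>: "\<kappa> > 0" using c by (simp add: \<kappa>_def)
      obtain m :: nat where m: "1 < m * \<delta>Y" by (rule slow.exponent_exists) blast
      let ?k = "Lg * ((NP + NQ) * exp (c * t))"
      have k: "0 \<le> ?k" using Lg NPQ by simp
      define \<nu> where "\<nu> = - \<omega>f / \<epsilon>"
      have \<nu>: "0 < \<nu>" using \<omega> \<epsilon> by (simp add: \<nu>_def divide_neg_pos)
      \<comment> \<open>In the elapsed time s the first majorant decays, whereas the layer part exp
        (- \<nu> (t - s)) increases up to s = t. Its maximum is \<open>kb * D\<close> and its
        integral at most \<open>kb * D\<close> \<epsilon> / (- \<omega>f); the cut at \<epsilon>
        then produces \<epsilon> powr \<delta>Y.\<close>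
      let ?\<Psi> = "\<lambda>s. - (?k / \<kappa>) * exp (- \<kappa> * s)" and ?\<Phi> = "\<lambda>s. (kb * D) / \<nu> * exp (- \<nu> * (t - s))"
      have "nrm Y1 (slow.conv G t) \<le> CB * (singular_weight \<delta>Y a ?k (?\<Psi> t - ?\<Psi> 0) + singular_weight \<delta>Y \<epsilon> (kb * D) (?\<Phi> t - ?\<Phi> 0))"
      proof (rule slow.conv_nrm_bound[OF GC m t a \<epsilon>, where \<psi> = "\<lambda>s. ?k * exp (- \<kappa> * s)" and \<phi> = "\<lambda>s. (kb * D) * exp (- \<nu> * (t - s))"])
        fix s assume s: "0 < s" "s \<le> t"
        then have ts: "t - s \<in> {0..T}" using t by auto
        have "exp (\<omega>B * s) * nrm Y\<delta> (G (t - s)) \<le> exp (\<omega>B * s) * (Lg * (mb * D * b (t - s) + (NP + NQ) * exp (c * (t - s))))"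
          using Lg by (intro mult_left_mono order_trans[OF G_le[OF ts]] PQ_le[OF ts]) auto
        also have "\<dots> = Lg * ((NP + NQ) * (exp (\<omega>B * s) * exp (c * (t - s)))) + Lg * mb * exp (\<omega>B * s) * D * b (t - s)"
          by (simp add: algebra_simps)
        also have "exp (\<omega>B * s) * exp (c * (t - s)) = exp (c * t) * exp (- \<kappa> * s)"
          unfolding mult_exp_exp \<kappa>_def by (simp add: algebra_simps)
        also have "b (t - s) = exp (- \<nu> * (t - s))" by (simp add: b_def \<nu>_def)
        also have "Lg * mb * exp (\<omega>B * s) * D * exp (- \<nu> * (t - s)) \<le> kb * D * exp (- \<nu> * (t - s))"
        proof -
          have "\<omega>B * s \<le> \<bar>\<omega>B\<bar> * T" using s t by (intro mult_mono) auto
          then show ?thesis unfolding kb_def using Lg mb(1) D by (intro mult_right_mono mult_left_mono) auto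
        qed
        finally show "exp (\<omega>B * s) * nrm Y\<delta> (G (t - s)) \<le> ?k * exp (- \<kappa> * s) + (kb * D) * exp (- \<nu> * (t - s))"
          by (simp add: mult_ac)
      next
        fix s assume s: "s \<in> {0..t}"
        show "?k * exp (- \<kappa> * s) \<le> ?k" using s \<kappa> k by (intro mult_left_le) (auto simp: mult_nonpos_nonneg)
        show "kb * D * exp (- \<nu> * (t - s)) \<le> kb * D" using s \<nu> kb D by (intro mult_left_le) (auto simp: mult_nonpos_nonneg)
        show "(?\<Psi> has_real_derivative ?k * exp (- \<kappa> * s)) (at s within {0..t})"
          using \<kappa> by (auto intro!: derivative_eq_intros)
        show "(?\<Phi> has_real_derivative kb * D * exp (- \<nu> * (t - s))) (at s within {0..t})"
          using \<nu> by (auto intro!: derivative_eq_intros)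
      qed (use k kb D in auto)
      also have "\<dots> \<le> CB * (singular_weight \<delta>Y a (?k * 1) (?k * (1 / \<kappa>)) + singular_weight \<delta>Y \<epsilon> (kb * D * 1) (kb * D * (\<epsilon> * (1 / - \<omega>f))))"
      proof (intro mult_left_mono add_mono)
        show "singular_weight \<delta>Y a ?k (?\<Psi> t - ?\<Psi> 0) \<le> singular_weight \<delta>Y a (?k * 1) (?k * (1 / \<kappa>))"
          unfolding mult_1_right using a k \<kappa> by (intro singular_weight_mono) auto
        have "?\<Phi> t - ?\<Phi> 0 \<le> ?\<Phi> t" using kb D \<nu> by auto
        also have "?\<Phi> t = kb * D * (\<epsilon> * (1 / - \<omega>f))" by (simp add: \<nu>_def)
        finally show "singular_weight \<delta>Y \<epsilon> (kb * D) (?\<Phi> t - ?\<Phi> 0) \<le> singular_weight \<delta>Y \<epsilon> (kb * D * 1) (kb * D * (\<epsilon> * (1 / - \<omega>f)))"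
          unfolding mult_1_right using \<epsilon> by (intro singular_weight_mono) auto
      qed (rule slow.C)
      also have "\<dots> = (CB * singular_weight \<delta>Y a 1 (1 / \<kappa>)) * ?k + CB * (kb * D * singular_weight \<delta>Y \<epsilon> 1 (\<epsilon> * (1 / - \<omega>f)))"
        unfolding singular_weight_scale by (simp add: algebra_simps)
      also have "singular_weight \<delta>Y \<epsilon> 1 (\<epsilon> * (1 / - \<omega>f)) = \<epsilon> powr \<delta>Y * singular_weight \<delta>Y 1 1 (1 / - \<omega>f)"
      proof -
        have "\<epsilon> powr (1 - \<delta>Y) * \<epsilon> powr \<delta>Y = \<epsilon>" using \<epsilon> by (simp flip: powr_add)
        then have "\<epsilon> powr (1 - \<delta>Y) * singular_weight \<delta>Y \<epsilon> 1 (\<epsilon> * (1 / - \<omega>f))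
            = \<epsilon> powr (1 - \<delta>Y) * (\<epsilon> powr \<delta>Y * singular_weight \<delta>Y 1 1 (1 / - \<omega>f))"
          unfolding scaled by (simp only: mult.assoc[symmetric])
        then show ?thesis using \<epsilon> by simp
      qed
      also have "CB * (kb * D * (\<epsilon> powr \<delta>Y * singular_weight \<delta>Y 1 1 (1 / - \<omega>f))) = K2 * (\<epsilon> powr \<delta>Y * D)"
        by (simp only: K2_def mult_ac)
      also have "(CB * singular_weight \<delta>Y a 1 (1 / \<kappa>)) * ?k \<le> ((1 - \<rho>) / (2 * Lg)) * ?k"
        using small k unfolding \<kappa>_def by (intro mult_right_mono)
      also have "((1 - \<rho>) / (2 * Lg)) * ?k = (1 - \<rho>) / 2 * (NP + NQ) * exp (c * t)" using Lg by (simp add: field_simps)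
      also have "K2 * (\<epsilon> powr \<delta>Y * D) \<le> K2 * (\<epsilon> powr \<delta>Y * D) * exp (c * t)"
      proof -
        have "1 \<le> exp (c * t)" using c t by simp
        moreover have "0 \<le> K2 * (\<epsilon> powr \<delta>Y * D)" using K2 D by simp
        ultimately show ?thesis using mult_left_mono[of 1 "exp (c * t)" "K2 * (\<epsilon> powr \<delta>Y * D)"] by simp
      qed
      finally show ?thesis unfolding Q_def q_mild[OF t] by (simp add: algebra_simps)
    qed
    have NQ_le: "NQ \<le> (1 - \<rho>) / 2 * (NP + NQ) + K2 * (\<epsilon> powr \<delta>Y * D)"
    proof -
      let ?r = "(1 - \<rho>) / 2 * (NP + NQ) + K2 * (\<epsilon> powr \<delta>Y * D)"
      have "Q s2 * exp (- c * s2) \<le> (?r * exp (c * s2)) * exp (- c * s2)"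
        by (intro mult_right_mono Q_le[OF s2(1)]) auto
      then have "NQ \<le> (?r * exp (c * s2)) * exp (- c * s2)" by (simp only: NQ_def)
      then show ?thesis unfolding mult.assoc[of ?r] mult_exp_exp by simp
    qed
    \<comment> \<open>The coefficients \<rho> and (1 - \<rho>)/2 on the right leave (1 - \<rho>)/2
      on the left.\<close>
    have "(NP + NQ) * ((1 - \<rho>) / 2) \<le> K1 * (\<epsilon> * V) + K2 * (\<epsilon> powr \<delta>Y * D)"
      using add_mono[OF NP_le NQ_le] by (simp add: field_simps)
    then have N_le: "NP + NQ \<le> (2 / (1 - \<rho>)) * (K1 * (\<epsilon> * V) + K2 * (\<epsilon> powr \<delta>Y * D))"
      using \<rho> by (simp add: field_simps)
    have "P t0 + Q t0 \<le> mb * D * b t0 + (NP + NQ) * exp (c * t0)" by (rule PQ_le[OF t0])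
    also have "(NP + NQ) * exp (c * t0) \<le> ((2 / (1 - \<rho>)) * (K1 * (\<epsilon> * V) + K2 * (\<epsilon> powr \<delta>Y * D))) * exp (c * T)"
      using N_le NPQ c t0 by (intro mult_mono) (auto intro: mult_left_mono)
    also have "\<dots> \<le> ((2 / (1 - \<rho>)) * ((K1 + K2) * (\<epsilon> * V + \<epsilon> powr \<delta>Y * D))) * exp (c * T)"
    proof -
      have "0 \<le> K1 * (\<epsilon> powr \<delta>Y * D)" "0 \<le> K2 * (\<epsilon> * V)" using K1 K2 \<epsilon> D V by simp_all
      then have "K1 * (\<epsilon> * V) + K2 * (\<epsilon> powr \<delta>Y * D) \<le> (K1 + K2) * (\<epsilon> * V + \<epsilon> powr \<delta>Y * D)"
        by (simp add: algebra_simps)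
      then show ?thesis using \<rho> by (intro mult_right_mono mult_left_mono) auto
    qed
    also have "\<dots> = exp (c * T) * (2 / (1 - \<rho>)) * (K1 + K2) * (\<epsilon> * V + \<epsilon> powr \<delta>Y * D)" by (simp only: mult_ac)
    also have "\<dots> \<le> exp (c * T) * (2 / (1 - \<rho>)) * (K1 + K2) * (\<epsilon> * V + (\<epsilon> powr \<delta>Y + b t0) * D)"
      using \<rho> K1 K2 D by (intro mult_left_mono) (auto simp: b_def algebra_simps)
    also have "mb * D * b t0 \<le> mb * (\<epsilon> * V + (\<epsilon> powr \<delta>Y + b t0) * D)"
    proof -
      have "D * b t0 \<le> \<epsilon> * V + (\<epsilon> powr \<delta>Y + b t0) * D" using \<epsilon> V D by (simp add: algebra_simps)
      then show ?thesis using mb(1) by (simp add: mult.assoc)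
    qed
    finally show "nrm X1 (u t0 - h (w t0)) + nrm Y1 (v t0 - w t0) \<le>
        K * (\<epsilon> * nrm Y1 y0 + (\<epsilon> powr \<delta>Y + exp (\<omega>f * t0 / \<epsilon>)) * nrm X1 (x0 - h y0))"
      by (simp add: P_def Q_def K_def V_def D_def b_def distrib_right)
  qed
qed

end

section \<open>Generators\<close>

context strong_semigroup
begin

text \<open>Integrals of orbits lie in the domain for every y. Short intervals give density of the
  domain, long ones approximate the inverse of a stable generator.\<close>

definition orbit_integral :: "'z \<Rightarrow> real \<Rightarrow> 'z" where
  "orbit_integral y t = integral {0..t} (\<lambda>s. S s y)"

lemma orbit_integral_has_vector_derivative:
  assumes "t \<in> {0..b}"
  shows "(orbit_integral y has_vector_derivative S t y) (at t within {0..b})"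
  unfolding orbit_integral_def
  by (rule integral_has_vector_derivative[OF _ assms]) (rule continuous_on_subset[OF S_continuous_on], auto)

lemma S_orbit_integral:
  assumes h: "0 \<le> h" and t: "0 \<le> t"
  shows "S h (orbit_integral y t) = orbit_integral y (t + h) - orbit_integral y h"
proof -
  have "((\<lambda>s. orbit_integral y (s + h)) has_vector_derivative S (s + h) y) (at s within {0..t})"
    if s: "s \<in> {0..t}" for s
  proof -
    have "((\<lambda>s. s + h) has_vector_derivative 1) (at s within {0..t})"
      by (auto intro!: derivative_eq_intros)
    moreover have "(orbit_integral y has_vector_derivative S (s + h) y) (at (s + h) within (\<lambda>s. s + h) ` {0..t})"
      by (rule has_vector_derivative_within_subset[OF orbit_integral_has_vector_derivative[where b = "t + h"]]) (use s h in auto)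
    ultimately show ?thesis
      by (rule vector_diff_chain_within[THEN has_vector_derivative_eq_rhs, unfolded o_def]) simp
  qed
  from fundamental_theorem_of_calculus[OF t this]
  have 1: "((\<lambda>s. S (s + h) y) has_integral (orbit_integral y (t + h) - orbit_integral y h)) {0..t}"
    by simp
  have "((\<lambda>s. S s y) has_integral orbit_integral y t) {0..t}"
    unfolding orbit_integral_def
    by (intro integrable_integral integrable_continuous_real continuous_on_subset[OF S_continuous_on]) auto
  from has_integral_linear[OF this S_linear[OF h]]
  have "((\<lambda>s. S h (S s y)) has_integral S h (orbit_integral y t)) {0..t}" by (simp add: o_def)
  then have "((\<lambda>s. S (s + h) y) has_integral S h (orbit_integral y t)) {0..t}"
    by (rule has_integral_eq[rotated]) (use h in \<open>simp add: S_add[symmetric] add.commute\<close>)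
  with 1 show ?thesis using has_integral_unique by blast
qed

text \<open>Applying \<open>S h\<close> shifts the interval of integration, so the quotient reduces
  to averages of the orbit near the two ends.\<close>

lemma orbit_integral_generator:
  assumes t: "0 \<le> t"
  shows "((\<lambda>h. (1 / h) *\<^sub>R (S h (orbit_integral y t) - orbit_integral y t)) \<longlongrightarrow> S t y - y) (at_right 0)"
proof -
  have right: "((\<lambda>h. (1 / h) *\<^sub>R (orbit_integral y (r + h) - orbit_integral y r)) \<longlongrightarrow> S r y) (at_right 0)"
    if r: "0 \<le> r" for r
  proof -
    have "((\<lambda>q. (orbit_integral y q - orbit_integral y r) /\<^sub>R (q - r)) \<longlongrightarrow> S r y) (at r within {0..r + 1})"
      using orbit_integral_has_vector_derivative[of r "r + 1"] r by (simp add: has_vector_derivative_iff_quotient)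
    moreover have "filterlim (\<lambda>h. r + h) (at r within {0..r + 1}) (at_right 0)"
      unfolding filterlim_at
    proof
      show "((\<lambda>h. r + h) \<longlongrightarrow> r) (at_right 0)" by (auto intro!: tendsto_eq_intros)
      show "\<forall>\<^sub>F h in at_right 0. r + h \<in> {0..r + 1} \<and> r + h \<noteq> r"
        unfolding eventually_at_right_field using r by (intro exI[of _ 1]) auto
    qed
    ultimately show ?thesis by (drule_tac filterlim_compose) (auto simp: divide_inverse)
  qed
  have "((\<lambda>h. (1 / h) *\<^sub>R (orbit_integral y (t + h) - orbit_integral y t) - (1 / h) *\<^sub>R (orbit_integral y (0 + h) - orbit_integral y 0))
      \<longlongrightarrow> S t y - S 0 y) (at_right 0)"
    by (intro tendsto_diff right t) simp
  moreover have "eventually (\<lambda>h. (1 / h) *\<^sub>R (orbit_integral y (t + h) - orbit_integral y t) - (1 / h) *\<^sub>R (orbit_integral y (0 + h) - orbit_integral y 0)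
      = (1 / h) *\<^sub>R (S h (orbit_integral y t) - orbit_integral y t)) (at_right 0)"
    unfolding eventually_at_right_field
    by (intro exI[of _ 1]) (auto simp: S_orbit_integral t algebra_simps orbit_integral_def[of y 0])
  ultimately show ?thesis by (simp add: S_0 filterlim_cong)
qed

text \<open>The approximating vectors are averages of the orbit of z over short intervals.\<close>

lemma generator_dense:
  assumes "0 < e"
  obtains x y where "((\<lambda>h. (1 / h) *\<^sub>R (S h x - x)) \<longlongrightarrow> y) (at_right 0)" "norm (x - z) < e"
proof -
  have "((\<lambda>q. (orbit_integral z q - orbit_integral z 0) /\<^sub>R (q - 0)) \<longlongrightarrow> S 0 z) (at 0 within {0..1})"
    using orbit_integral_has_vector_derivative[of 0 1 z] by (simp add: has_vector_derivative_iff_quotient)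
  then have "((\<lambda>q. orbit_integral z q /\<^sub>R q) \<longlongrightarrow> z) (at 0 within {0..1})"
    by (simp add: S_0 orbit_integral_def[of z 0])
  then have "eventually (\<lambda>q. dist (orbit_integral z q /\<^sub>R q) z < e) (at 0 within {0..1})"
    using assms by (rule tendstoD)
  then obtain d where d: "d > 0" "\<And>q. q \<in> {0..1} \<Longrightarrow> q \<noteq> 0 \<Longrightarrow> dist q 0 < d \<Longrightarrow> dist (orbit_integral z q /\<^sub>R q) z < e"
    unfolding eventually_at by blast
  define q where "q = min 1 (d / 2)"
  have q: "0 < q" "q \<le> 1" "q < d" using d(1) by (auto simp: q_def)
  have "((\<lambda>h. inverse q *\<^sub>R ((1 / h) *\<^sub>R (S h (orbit_integral z q) - orbit_integral z q))) \<longlongrightarrow> inverse q *\<^sub>R (S q z - z)) (at_right 0)"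
    using q by (intro tendsto_scaleR tendsto_const orbit_integral_generator) auto
  moreover have "eventually (\<lambda>h. inverse q *\<^sub>R ((1 / h) *\<^sub>R (S h (orbit_integral z q) - orbit_integral z q)) =
      (1 / h) *\<^sub>R (S h (orbit_integral z q /\<^sub>R q) - orbit_integral z q /\<^sub>R q)) (at_right 0)"
    unfolding eventually_at_right_field by (intro exI[of _ 1]) (auto simp: S_scaleR scaleR_diff_right)
  ultimately have "((\<lambda>h. (1 / h) *\<^sub>R (S h (orbit_integral z q /\<^sub>R q) - orbit_integral z q /\<^sub>R q)) \<longlongrightarrow> inverse q *\<^sub>R (S q z - z)) (at_right 0)"
    by (simp add: filterlim_cong)
  moreover have "norm (orbit_integral z q /\<^sub>R q - z) < e" using d(2)[of q] q by (simp add: dist_norm)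
  ultimately show ?thesis by (rule that)
qed

text \<open>The solution is minus the integral of the orbit over the half-line. The partial
  integrals up to n are sent by the generator to y - S n y, which tends to y, and closedness passes
  to the limit. The constant \<open>M / - w\<close> is the integral of M exp (w t).\<close>

lemma stable_generator_solvable:
  assumes stable: "\<And>t x. 0 \<le> t \<Longrightarrow> norm (S t x) \<le> M * exp (w * t) * norm x" and M: "0 \<le> M" and w: "w < 0"
    and closed: "\<And>x y a b. (\<And>n. ((\<lambda>h. (1 / h) *\<^sub>R (S h (x n) - x n)) \<longlongrightarrow> y n) (at_right 0)) \<Longrightarrow>
      x \<longlonglongrightarrow> a \<Longrightarrow> y \<longlonglongrightarrow> b \<Longrightarrow> ((\<lambda>h. (1 / h) *\<^sub>R (S h a - a)) \<longlongrightarrow> b) (at_right 0)"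
  obtains x where "((\<lambda>h. (1 / h) *\<^sub>R (S h x - x)) \<longlongrightarrow> y) (at_right 0)" "norm x \<le> M / - w * norm y"
proof -
  have J_le: "norm (orbit_integral y t) \<le> M / - w * norm y" if t: "0 \<le> t" for t
  proof -
    have "norm (orbit_integral y t) \<le> M / w * norm y * exp (w * t) - M / w * norm y * exp (w * 0)"
    proof (rule has_integral_seminorm_le[where p = norm and K = 1 and a = 0 and b = t])
      show "((\<lambda>s. S s y) has_integral orbit_integral y t) {0..t}"
        unfolding orbit_integral_def
        by (intro integrable_integral integrable_continuous_real continuous_on_subset[OF S_continuous_on]) auto
      show "((\<lambda>s. M * exp (w * s) * norm y) has_integral M / w * norm y * exp (w * t) - M / w * norm y * exp (w * 0)) {0..t}"
      proof (rule fundamental_theorem_of_calculus[OF t])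
        fix s show "((\<lambda>s. M / w * norm y * exp (w * s)) has_vector_derivative M * exp (w * s) * norm y) (at s within {0..t})"
          unfolding has_real_derivative_iff_has_vector_derivative[symmetric]
          using w by (auto intro!: derivative_eq_intros)
      qed
    qed (auto intro: norm_triangle_ineq stable)
    also have "\<dots> \<le> M / - w * norm y"
    proof -
      have "M / w * norm y * exp (w * t) \<le> 0" using M w by (intro mult_nonpos_nonneg divide_nonneg_neg) auto
      then show ?thesis by simp
    qed
    finally show ?thesis .
  qed
  define x where "x n = - orbit_integral y (real n)" for n
  have lim0: "(\<lambda>n. M * exp (w * real n) * k) \<longlonglongrightarrow> 0" for k
  proof -
    have "(\<lambda>n. exp w ^ n) \<longlonglongrightarrow> 0" using w by (intro LIMSEQ_power_zero) auto
    then have "(\<lambda>n. M * exp w ^ n * k) \<longlonglongrightarrow> 0" by (intro tendsto_mult_left_zero tendsto_mult_right_zero)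
    then show ?thesis by (simp add: exp_of_nat_mult[symmetric] mult.commute[of w])
  qed
  have "Cauchy x"
  proof (rule metric_CauchyI)
    fix e :: real assume e: "0 < e"
    have "\<exists>N. \<forall>n\<ge>N. norm (M * exp (w * real n) * (M / - w * norm y) - 0) < e / 2"
      using LIMSEQ_D[OF lim0] e by (meson half_gt_zero)
    then obtain N where N: "\<And>n. n \<ge> N \<Longrightarrow> norm (M * exp (w * real n) * (M / - w * norm y)) < e / 2"
      unfolding diff_0_right by blast
    have close: "dist (x n) (x N) < e / 2" if n: "n \<ge> N" for n
    proof -
      \<comment> \<open>The difference of two partial integrals is the image under
        \<open>S (real N)\<close> of another one; these are uniformly bounded, so stability makes
        the tail small.\<close>
      have "orbit_integral y (real n) - orbit_integral y (real N) = S (real N) (orbit_integral y (real n - real N))"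
        using S_orbit_integral[of "real N" "real n - real N" y] n by simp
      then have "dist (x n) (x N) = norm (S (real N) (orbit_integral y (real n - real N)))"
        by (simp add: x_def dist_norm norm_minus_commute[of "orbit_integral y (real N)"])
      also have "\<dots> \<le> M * exp (w * real N) * norm (orbit_integral y (real n - real N))" by (rule stable) simp
      also have "\<dots> \<le> norm (M * exp (w * real N) * (M / - w * norm y))"
      proof -
        have "M * exp (w * real N) * norm (orbit_integral y (real n - real N)) \<le> M * exp (w * real N) * (M / - w * norm y)"
          using M n by (intro mult_left_mono J_le) auto
        then show ?thesis by (metis abs_ge_self order_trans real_norm_def)
      qed
      also have "\<dots> < e / 2" by (rule N) simp
      finally show ?thesis .
    qed
    show "\<exists>N. \<forall>m\<ge>N. \<forall>n\<ge>N. dist (x m) (x n) < e"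
      using close by (metis dist_triangle_half_l dist_commute)
  qed
  then obtain a where a: "x \<longlonglongrightarrow> a" using Cauchy_convergent_iff convergent_def by blast
  have "((\<lambda>h. (1 / h) *\<^sub>R (S h a - a)) \<longlongrightarrow> y) (at_right 0)"
  proof (rule closed[OF _ a, where y = "\<lambda>n. y - S (real n) y"])
    fix n
    have "eventually (\<lambda>h. - ((1 / h) *\<^sub>R (S h (orbit_integral y n) - orbit_integral y n)) = (1 / h) *\<^sub>R (S h (x n) - x n)) (at_right 0)"
      unfolding eventually_at_right_field x_def
      using S_scaleR[of _ "-1"] by (intro exI[of _ 1]) (auto simp: scaleR_diff_right)
    with tendsto_minus[OF orbit_integral_generator[of "real n" y]]
    show "((\<lambda>h. (1 / h) *\<^sub>R (S h (x n) - x n)) \<longlongrightarrow> y - S (real n) y) (at_right 0)"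
      by (simp add: filterlim_cong)
  next
    have "(\<lambda>n. S (real n) y) \<longlonglongrightarrow> 0"
      by (rule Lim_null_comparison[OF _ lim0[of "norm y"]]) (simp add: stable)
    then show "(\<lambda>n. y - S (real n) y) \<longlonglongrightarrow> y" using tendsto_diff[OF tendsto_const] by fastforce
  qed
  moreover have "norm a \<le> M / - w * norm y"
    by (rule LIMSEQ_le_const2[OF tendsto_norm[OF a]]) (use J_le in \<open>auto simp: x_def\<close>)
  ultimately show ?thesis by (rule that)
qed

text \<open>The orbit of a vector in the kernel is constant, and stability makes it decay.\<close>

lemma stable_generator_injective:
  assumes stable: "\<And>t x. 0 \<le> t \<Longrightarrow> norm (S t x) \<le> M * exp (w * t) * norm x" and w: "w < 0"
    and x: "((\<lambda>h. (1 / h) *\<^sub>R (S h x - x)) \<longlongrightarrow> 0) (at_right 0)"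
  shows "x = 0"
proof -
  have const: "S t x = x" if t: "0 \<le> t" for t
  proof -
    have "((\<lambda>s. 0) has_integral (S t x - S 0 x)) {0..t}"
    proof (rule fundamental_theorem_of_calculus[OF t])
      fix s assume "s \<in> {0..t}"
      then show "((\<lambda>t. S t x) has_vector_derivative 0) (at s within {0..t})"
        using has_vector_derivative_within_subset[OF orbit_has_vector_derivative[OF x, of s], of "{0..t}"]
        by (simp add: S_zero)
    qed
    then have "S t x - S 0 x = 0" using has_integral_0_eq by blast
    then show ?thesis by (simp add: S_0)
  qed
  have "(\<lambda>n. exp w ^ n) \<longlonglongrightarrow> 0" using w by (intro LIMSEQ_power_zero) auto
  then have "(\<lambda>n. M * exp w ^ n * norm x) \<longlonglongrightarrow> 0" by (intro tendsto_mult_left_zero tendsto_mult_right_zero)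
  moreover have "norm x \<le> M * exp w ^ n * norm x" for n
    using stable[of "real n" x] const[of "real n"] by (simp add: exp_of_nat_mult[symmetric] mult.commute[of w])
  ultimately have "norm x \<le> 0" by (intro LIMSEQ_le_const) auto
  then show ?thesis by simp
qed

end

section \<open>Generators over the given scalar field and their resolvents\<close>

lemma banach_over_bounded_linear:
  assumes "banach_over sc"
  shows "bounded_linear (sc a)"
proof -
  interpret vector_space sc using assms by (simp add: banach_over_def)
  have of_real: "r *\<^sub>R x = sc (of_real r) x" for r x using assms by (simp add: banach_over_def)
  have "sc a (r *\<^sub>R x) = r *\<^sub>R sc a x" for r x by (simp add: of_real scale_left_commute)
  then show ?thesis
    using assms by (intro bounded_linear_intro[where K = "norm a"])
      (auto simp: scale_right_distrib banach_over_def mult.commute)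
qed

locale banach_generator =
  fixes sc :: "'k::real_normed_field \<Rightarrow> 'z::banach \<Rightarrow> 'z" and D :: "'z set" and A :: "'z \<Rightarrow> 'z"
    and S :: "real \<Rightarrow> 'z \<Rightarrow>\<^sub>L 'z"
  assumes space: "banach_over sc" and operator: "closed_linear_operator sc D A"
    and semigroup: "C0_semigroup sc S" and generates: "generates D A S"
begin

sublocale vector_space sc
  using space by (simp add: banach_over_def)

lemma sc_of_real: "sc (of_real r) x = r *\<^sub>R x" and norm_sc: "norm (sc a x) = norm a * norm x"
  using space by (auto simp: banach_over_def)

lemma D_real_subspace: "Real_Vector_Spaces.subspace D"
  and A_add: "x \<in> D \<Longrightarrow> y \<in> D \<Longrightarrow> A (x + y) = A x + A y"
  and A_scaleR: "x \<in> D \<Longrightarrow> A (r *\<^sub>R x) = r *\<^sub>R A x"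
  and A_sc: "x \<in> D \<Longrightarrow> A (sc a x) = sc a (A x)"
  and D_sc: "x \<in> D \<Longrightarrow> sc a x \<in> D"
  and D_add: "x \<in> D \<Longrightarrow> y \<in> D \<Longrightarrow> x + y \<in> D"
  using operator unfolding closed_linear_operator_def linear_on_set_def
  by (auto simp: subspace_def Real_Vector_Spaces.subspace_def simp flip: sc_of_real)

lemma A_diff: "x \<in> D \<Longrightarrow> y \<in> D \<Longrightarrow> A (x - y) = A x - A y"
  using A_add[of x "-1 *\<^sub>R y"] A_scaleR[of y "-1"] D_real_subspace
    Real_Vector_Spaces.subspace_scale[OF D_real_subspace, of y "-1"] by simp

lemma generator_limit:
  "x \<in> D \<Longrightarrow> ((\<lambda>t. (1 / t) *\<^sub>R (S t x - x)) \<longlongrightarrow> A x) (at_right 0)"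
  using generates by (auto simp: generates_def)

lemma generatorI:
  assumes "((\<lambda>t. (1 / t) *\<^sub>R (S t x - x)) \<longlongrightarrow> y) (at_right 0)"
  shows "x \<in> D" "A x = y"
proof -
  show "x \<in> D" using assms generates by (auto simp: generates_def)
  from tendsto_unique[OF _ generator_limit[OF this] assms] show "A x = y" by simp
qed

lemma S_facts: "S 0 x = x" "0 \<le> s \<Longrightarrow> 0 \<le> t \<Longrightarrow> S (s + t) x = S s (S t x)"
  "0 \<le> t \<Longrightarrow> S t (sc a x) = sc a (S t x)" "((\<lambda>t. S t x) \<longlongrightarrow> x) (at_right 0)"
  using semigroup by (auto simp: C0_semigroup_def)

lemma S_D:
  assumes t: "0 \<le> t" and x: "x \<in> D"
  shows "S t x \<in> D" "A (S t x) = S t (A x)"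
proof -
  have "((\<lambda>h. S t ((1 / h) *\<^sub>R (S h x - x))) \<longlongrightarrow> S t (A x)) (at_right 0)"
    by (intro blinfun.tendsto tendsto_const generator_limit x)
  moreover have "eventually (\<lambda>h. S t ((1 / h) *\<^sub>R (S h x - x)) = (1 / h) *\<^sub>R (S h (S t x) - S t x)) (at_right 0)"
    unfolding eventually_at_right_field
  proof (intro exI[of _ 1] conjI allI impI)
    fix h :: real assume "0 < h"
    then have "S t (S h x) = S h (S t x)" using S_facts(2)[of t h x] S_facts(2)[of h t x] t by (simp add: add.commute)
    then show "S t ((1 / h) *\<^sub>R (S h x - x)) = (1 / h) *\<^sub>R (S h (S t x) - S t x)"
      by (simp add: blinfun.scaleR_right blinfun.diff_right)
  qed simp
  ultimately have "((\<lambda>h. (1 / h) *\<^sub>R (S h (S t x) - S t x)) \<longlongrightarrow> S t (A x)) (at_right 0)"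
    by (simp add: filterlim_cong)
  from generatorI[OF this] show "S t x \<in> D" "A (S t x) = S t (A x)" by auto
qed

lemma strong_semigroupI:
  assumes "\<And>\<tau>. \<exists>M. \<forall>t\<in>{0..\<tau>}. \<forall>x. norm (S t x) \<le> M * norm x"
  shows "strong_semigroup (\<lambda>t. blinfun_apply (S t))"
  by (rule strong_semigroup.intro) (simp_all add: S_facts assms blinfun.bounded_linear_right)

text \<open>Exponential stability puts 0 into the resolvent set, so the scale can be generated by
  \<open>A\<close> itself and its inverse serves as the parametrization of the domain. Closedness of
  the graph is what the limit of the partial orbit integrals needs.\<close>

lemma stable_bijective:
  assumes "exponentially_stable S"
  shows "strong_semigroup (\<lambda>t. blinfun_apply (S t))" "bij_betw A D UNIV" "\<exists>C. \<forall>x\<in>D. norm x \<le> C * norm (A x)"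
proof -
  obtain M0 w where w: "w < 0" and M0: "\<And>t. 0 \<le> t \<Longrightarrow> norm (S t) \<le> M0 * exp (w * t)"
    using assms by (auto simp: exponentially_stable_def)
  define M where "M = max M0 0"
  have M: "M \<ge> 0" by (simp add: M_def)
  have stable: "norm (S t x) \<le> M * exp (w * t) * norm x" if t: "0 \<le> t" for t x
  proof -
    have "norm (S t x) \<le> norm (S t) * norm x" by (rule norm_blinfun)
    also have "\<dots> \<le> M * exp (w * t) * norm x"
      using M0[OF t] by (intro mult_right_mono order_trans[OF M0[OF t]]) (auto simp: M_def)
    finally show ?thesis .
  qed
  show "strong_semigroup (\<lambda>t. blinfun_apply (S t))"
  proof (rule strong_semigroupI)
    fix \<tau> :: real
    have "norm (S t x) \<le> M * norm x" if "t \<in> {0..\<tau>}" for t x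
    proof -
      have "M * exp (w * t) * norm x \<le> M * 1 * norm x"
        using that w M by (intro mult_right_mono mult_left_mono) (auto simp: mult_nonpos_nonneg)
      then show ?thesis using stable[of t x] that by simp
    qed
    then show "\<exists>M. \<forall>t\<in>{0..\<tau>}. \<forall>x. norm (S t x) \<le> M * norm x" by blast
  qed
  then interpret s: strong_semigroup "\<lambda>t. blinfun_apply (S t)" .
  have graph_closed: "((\<lambda>h. (1 / h) *\<^sub>R (S h a - a)) \<longlongrightarrow> b) (at_right 0)"
    if *: "\<And>n. ((\<lambda>h. (1 / h) *\<^sub>R (S h (x n) - x n)) \<longlongrightarrow> y n) (at_right 0)" and "x \<longlonglongrightarrow> a" "y \<longlonglongrightarrow> b" for x y a b
  proof -
    have "closed {(x, A x) |x. x \<in> D}" using operator by (simp add: closed_linear_operator_def)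
    moreover have "(x n, y n) \<in> {(x, A x) |x. x \<in> D}" for n using generatorI[OF *] by auto
    moreover have "(\<lambda>n. (x n, y n)) \<longlonglongrightarrow> (a, b)" using that by (intro tendsto_Pair)
    ultimately have "(a, b) \<in> {(x, A x) |x. x \<in> D}" by (rule closed_sequentially)
    then show ?thesis using generator_limit by auto
  qed
  have solvable: "\<exists>x\<in>D. A x = y \<and> norm x \<le> M / - w * norm y" for y
  proof (rule s.stable_generator_solvable[where y = y and M = M and w = w])
    fix x y a b
    assume "\<And>n::nat. ((\<lambda>h. (1 / h) *\<^sub>R (S h (x n) - x n)) \<longlongrightarrow> y n) (at_right 0)" "x \<longlonglongrightarrow> a" "y \<longlonglongrightarrow> b"
    then show "((\<lambda>h. (1 / h) *\<^sub>R (S h a - a)) \<longlongrightarrow> b) (at_right 0)" by (rule graph_closed)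
  next
    fix x assume x: "((\<lambda>h. (1 / h) *\<^sub>R (S h x - x)) \<longlongrightarrow> y) (at_right 0)" "norm x \<le> M / - w * norm y"
    show ?thesis using generatorI[OF x(1)] x(2) by blast
  qed (use stable M w in auto)
  have inj: "inj_on A D"
  proof (rule inj_onI)
    fix x y assume xy: "x \<in> D" "y \<in> D" "A x = A y"
    then have "x - y \<in> D" "A (x - y) = 0"
      using A_diff Real_Vector_Spaces.subspace_diff[OF D_real_subspace] by auto
    then show "x = y" using s.stable_generator_injective[OF stable w, of "x - y"] generator_limit[of "x - y"] by simp
  qed
  moreover have "A ` D = UNIV"
  proof -
    have "y \<in> A ` D" for y using solvable[of y] by blast
    then show ?thesis by blast
  qed
  ultimately show "bij_betw A D UNIV" by (simp add: bij_betw_def)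
  have "norm x \<le> M / - w * norm (A x)" if "x \<in> D" for x
    using solvable[of "A x"] inj that by (auto dest: inj_onD)
  then show "\<exists>C. \<forall>x\<in>D. norm x \<le> C * norm (A x)" by blast
qed

end

text \<open>The shift is A - \<mu>, as in the definition of the scale, and not \<mu> - A as in the
  resolvent set. The fast operator uses \<mu> = 0.\<close>

locale generator_resolvent = banach_generator sc D A S
  for sc :: "'k::real_normed_field \<Rightarrow> 'z::banach \<Rightarrow> 'z" and D A S +
  fixes \<mu> :: 'k and G :: "'z \<Rightarrow> 'z"
  assumes G: "G = (\<lambda>x. A x - sc \<mu> x)"
    and G_bij: "bij_betw G D UNIV" and G_lower: "\<exists>C. \<forall>x\<in>D. norm x \<le> C * norm (G x)"
begin

lemma G_apply: "G x = A x - sc \<mu> x"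
  by (simp add: G)

definition R :: "'z \<Rightarrow> 'z" where "R = inv_into D G"

lemma G_R [simp]: "G (R y) = y" and R_D [simp]: "R y \<in> D"
  using G_bij unfolding R_def bij_betw_def by (auto intro: f_inv_into_f inv_into_into)

lemma R_G [simp]: "x \<in> D \<Longrightarrow> R (G x) = x"
  using G_bij unfolding R_def bij_betw_def by simp

lemma range_R: "range R = D"
proof
  show "range R \<subseteq> D" by auto
  show "D \<subseteq> range R" using R_G by (metis rangeI subsetI)
qed

lemma G_add: "x \<in> D \<Longrightarrow> y \<in> D \<Longrightarrow> G (x + y) = G x + G y"
  and G_sc: "x \<in> D \<Longrightarrow> G (sc a x) = sc a (G x)"
proof -
  show "G (sc a x) = sc a (G x)" if "x \<in> D"
    using that by (simp add: G A_sc scale_right_diff_distrib mult.commute)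
qed (simp add: G A_add scale_right_distrib)

lemma R_add: "R (x + y) = R x + R y" and R_sc: "R (sc a x) = sc a (R x)" and R_scaleR: "R (r *\<^sub>R x) = r *\<^sub>R R x"
proof -
  show "R (x + y) = R x + R y" using R_G[OF D_add[of "R x" "R y"]] by (simp add: G_add)
  show *: "R (sc a x) = sc a (R x)" for a using R_G[OF D_sc[of "R x" a]] by (simp add: G_sc)
  show "R (r *\<^sub>R x) = r *\<^sub>R R x" using *[of "of_real r"] by (simp add: sc_of_real)
qed

lemma R_bound: obtains K where "K > 0" "\<And>x. norm (R x) \<le> K * norm x"
proof -
  obtain C where "\<And>x. x \<in> D \<Longrightarrow> norm x \<le> C * norm (G x)" using G_lower by blast
  then have C: "norm (R x) \<le> C * norm x" for x by (metis G_R R_D)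
  have "norm (R x) \<le> max C 1 * norm x" for x by (rule order_trans[OF C mult_right_mono]) auto
  then show ?thesis using that[of "max C 1"] by simp
qed

lemma R_bounded_linear: "bounded_linear R"
proof -
  obtain K where "K > 0" "\<And>x. norm (R x) \<le> K * norm x" by (rule R_bound) blast
  then show ?thesis by (intro bounded_linear_intro[where K = K]) (auto simp: R_add R_scaleR mult.commute)
qed

lemma R_eq_iff: "R x = R y \<longleftrightarrow> x = y"
  by (metis G_R)

lemma S_R: "S t (R x) = R (S t x)" if t: "0 \<le> t"
proof -
  have "G (S t (R x)) = S t (G (R x))"
    by (simp only: G_apply S_D[OF t R_D] S_facts(3)[OF t] blinfun.diff_right)
  then show ?thesis using R_G[OF S_D(1)[OF t R_D], of x] by simp
qed

text \<open>Since A = G + \<mu>, the generator in the coordinate \<open>R\<close> is the identity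
  plus \<mu> times \<open>R\<close>.\<close>

lemma generated_semigroupI:
  assumes "strong_semigroup (\<lambda>t. blinfun_apply (S t))"
  shows "generated_semigroup (\<lambda>t. blinfun_apply (S t)) A R (\<lambda>x. x + sc \<mu> (R x))"
proof (intro generated_semigroup.intro generated_semigroup_axioms.intro assms R_bounded_linear)
  show "inj R" by (simp add: inj_def R_eq_iff)
  show "((\<lambda>t. (1 / t) *\<^sub>R (S t (R x) - R x)) \<longlongrightarrow> A (R x)) (at_right 0)" for x
    by (rule generator_limit) simp
  show "bounded_linear (\<lambda>x. x + sc \<mu> (R x))"
    by (intro bounded_linear_add bounded_linear_ident bounded_linear_compose[OF banach_over_bounded_linear[OF space] R_bounded_linear])
  show "A (R x) = x + sc \<mu> (R x)" for x using G_R[of x] G_apply[of "R x"] by (simp add: algebra_simps)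
qed (rule S_R)

end

section \<open>Scales\<close>

lemma embedsE:
  assumes "embeds E F" "\<And>x. x \<in> car E \<Longrightarrow> 0 \<le> nrm E x"
  obtains C where "C > 0" "\<And>x. x \<in> car E \<Longrightarrow> x \<in> car F \<and> nrm F x \<le> C * nrm E x"
proof -
  obtain C where C: "\<And>x. x \<in> car E \<Longrightarrow> x \<in> car F \<and> nrm F x \<le> C * nrm E x"
    using assms(1) unfolding embeds_def by blast
  have "x \<in> car F \<and> nrm F x \<le> max C 1 * nrm E x" if "x \<in> car E" for x
    using C[OF that] mult_right_mono[OF max.cobounded1[of C 1] assms(2)[OF that]] by simp
  then show ?thesis using that[of "max C 1"] by simp
qed

lemma banach_subspace_nonneg: "banach_subspace sc E \<Longrightarrow> x \<in> car E \<Longrightarrow> 0 \<le> nrm E x"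
  unfolding banach_subspace_def by blast

lemma banach_subspace_normed:
  assumes sc: "banach_over sc" and E: "banach_subspace sc E"
  shows "normed_nspace E"
proof -
  interpret vector_space sc using sc by (simp add: banach_over_def)
  have of_real: "r *\<^sub>R x = sc (of_real r) x" for r x using sc by (simp add: banach_over_def)
  have "subspace (car E)" using E by (simp add: banach_subspace_def)
  then have "Real_Vector_Spaces.subspace (car E)"
    by (auto simp: subspace_def Real_Vector_Spaces.subspace_def of_real)
  then show ?thesis using E unfolding normed_nspace_def banach_subspace_def by (simp add: of_real)
qed

text \<open>Completeness is transported along an isometric parametrization by a Banach type. The
  levels -1, 0 and 1 are all of this form, with the identity, \<open>j\<close> and \<open>j\<close>
  after \<open>R\<close>.\<close>

lemma banach_subspace_image:
  fixes sc :: "'k::real_normed_field \<Rightarrow> 'a::banach \<Rightarrow> 'a" and sc' :: "'k \<Rightarrow> 'b::banach \<Rightarrow> 'b"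
  assumes sc: "banach_over sc" and sc': "banach_over sc'"
    and add: "\<And>x y. J (x + y) = J x + J y" and scale: "\<And>a x. J (sc a x) = sc' a (J x)"
    and car: "car E = range J" and nrm: "\<And>x. nrm E (J x) = norm x"
  shows "banach_subspace sc' E"
proof -
  interpret a: vector_space sc using sc by (simp add: banach_over_def)
  interpret b: vector_space sc' using sc' by (simp add: banach_over_def)
  have norm_sc: "norm (sc a x) = norm a * norm x" for a x using sc by (simp add: banach_over_def)
  have J0: "J 0 = 0" using add[of 0 0] by simp
  have diff: "J (x - y) = J x - J y" for x y using add[of "x - y" y] by simp
  have nrm0: "nrm E 0 = 0" using nrm[of 0] J0 by simp
  have inj: "J x = 0 \<Longrightarrow> x = 0" for x using nrm[of x] nrm0 by simp
  show ?thesis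
    unfolding banach_subspace_def
  proof (intro conjI ballI allI impI)
    show "b.subspace (car E)"
      unfolding b.subspace_def car by (auto simp: add[symmetric] scale[symmetric] J0[symmetric])
    fix s :: "nat \<Rightarrow> 'b"
    assume s: "(\<forall>n. s n \<in> car E) \<and> (\<forall>e>0. \<exists>N. \<forall>m\<ge>N. \<forall>n\<ge>N. nrm E (s m - s n) < e)"
    then have "\<forall>n. \<exists>x. s n = J x" using car by auto
    then obtain x where x: "\<And>n. s n = J (x n)" by metis
    have "Cauchy x"
      using s unfolding Cauchy_def dist_norm x diff[symmetric] nrm by blast
    then obtain l where "x \<longlonglongrightarrow> l" using Cauchy_convergent_iff convergent_def by blast
    then have "(\<lambda>n. norm (x n - l)) \<longlonglongrightarrow> 0" by (simp add: LIM_zero tendsto_norm_zero)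
    then show "\<exists>l\<in>car E. (\<lambda>n. nrm E (s n - l)) \<longlonglongrightarrow> 0"
      unfolding car by (intro bexI[of _ "J l"]) (auto simp: x diff[symmetric] nrm)
  qed (auto simp: car add[symmetric] scale[symmetric] nrm norm_sc J0 nrm0 norm_triangle_ineq dest: inj)
qed

locale generator_scale = generator_resolvent sc D A S \<mu> G
  for sc :: "'k::real_normed_field \<Rightarrow> 'z::banach \<Rightarrow> 'z" and D A S \<mu> G +
  fixes sce :: "'k \<Rightarrow> 'e::banach \<Rightarrow> 'e" and j :: "'z \<Rightarrow> 'e" and Z :: "real \<Rightarrow> 'e nspace"
  assumes scale: "interpolation_extrapolation_scale sc sce D G j Z"
begin

lemma sce: "banach_over sce"
  and j_add: "j (x + y) = j x + j y" and j_sc: "j (sc a x) = sce a (j x)"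
  and norm_j: "norm (j x) = norm (R x)" and j_dense: "closure (range j) = UNIV"
  using scale unfolding interpolation_extrapolation_scale_def extrapolation_space_def linear_on_set_def R_def
  by auto

lemma Z_banach: "-1 \<le> \<alpha> \<Longrightarrow> banach_subspace sce (Z \<alpha>)"
  using scale unfolding interpolation_extrapolation_scale_def by blast

lemma j_0: "j 0 = 0"
  using j_add[of 0 0] by simp

lemma j_diff: "j (x - y) = j x - j y"
  using j_add[of "x - y" y] by simp

lemma j_scaleR: "j (r *\<^sub>R x) = r *\<^sub>R j x"
  using j_sc[of "of_real r" x] sce by (simp add: sc_of_real banach_over_def)

lemma R_0: "R 0 = 0"
  using R_add[of 0 0] by simp

lemma j_eq_iff: "j x = j y \<longleftrightarrow> x = y"
proof
  assume "j x = j y"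
  then have "norm (R (x - y)) = 0" using norm_j[of "x - y"] by (simp add: j_diff)
  then have "R (x - y) = R 0" by (simp add: R_0)
  then show "x = y" by (simp add: R_eq_iff)
qed simp

lemma inv_j [simp]: "inv j (j x) = x"
  by (simp add: inv_f_f inj_def j_eq_iff)

abbreviation "lvl \<equiv> integer_level D G j"

lemma lvl_0: "car (lvl 0) = range j" "nrm (lvl 0) (j x) = norm x"
  by (simp_all add: integer_level_def)

lemma lvl_1: "car (lvl 1) = j ` D" "nrm (lvl 1) (j x) = norm (G x)"
  by (simp_all add: integer_level_def)

lemma lvl_minus_1: "lvl (-1) = whole"
  by (simp add: integer_level_def)

lemma lvl_0_banach: "banach_subspace sce (lvl 0)"
  by (rule banach_subspace_image[OF space sce, where J = j]) (simp_all add: lvl_0 j_add j_sc)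

lemma lvl_1_banach: "banach_subspace sce (lvl 1)"
proof (rule banach_subspace_image[OF space sce, where J = "\<lambda>x. j (R x)"])
  show "car (lvl 1) = range (\<lambda>x. j (R x))"
    unfolding image_image[symmetric, of j R] range_R by (rule lvl_1)
qed (simp_all add: lvl_1 R_add R_sc j_add j_sc)

lemma whole_banach: "banach_subspace sce whole"
  by (rule banach_subspace_image[OF sce sce, where J = "\<lambda>x. x"]) (simp_all add: whole_def)

lemma lvl_0_embeds: "embeds (lvl 0) whole"
proof -
  obtain K where "K > 0" "\<And>x. norm (R x) \<le> K * norm x" by (rule R_bound) blast
  then show ?thesis unfolding embeds_def by (intro conjI exI[of _ K]) (auto simp: lvl_0 whole_def norm_j)
qed

lemma lvl_1_embeds: "embeds (lvl 1) whole"
proof -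
  obtain K where K: "K > 0" "\<And>x. norm (R x) \<le> K * norm x" by (rule R_bound) blast
  have "norm (R x) \<le> (K * K) * norm (G x)" if "x \<in> D" for x
  proof -
    have "norm (R x) \<le> K * norm (R (G x))" using K(2)[of x] that by simp
    also have "\<dots> \<le> K * (K * norm (G x))" using K by (intro mult_left_mono) auto
    finally show ?thesis by simp
  qed
  then show ?thesis unfolding embeds_def by (intro conjI exI[of _ "K * K"]) (auto simp: lvl_1 whole_def norm_j)
qed

lemma couple_0_1: "couple sce (lvl 0) (lvl 1)"
  by (simp add: couple_def lvl_0_banach lvl_1_banach lvl_0_embeds lvl_1_embeds)

lemma couple_minus_1_0: "couple sce (lvl (-1)) (lvl 0)"
  by (simp add: couple_def lvl_0_banach lvl_0_embeds lvl_minus_1 whole_banach) (auto simp: embeds_def intro!: exI[of _ 1])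

lemma interpolationE:
  obtains \<Phi> where "\<And>\<theta>. 0 < \<theta> \<Longrightarrow> \<theta> < 1 \<Longrightarrow> exact_interpolation_functor sce (\<Phi> \<theta>)"
    "\<And>\<alpha>. -1 \<le> \<alpha> \<Longrightarrow> same_up_to_equivalent_norm (Z \<alpha>) (canonical_scale D G j \<Phi> \<alpha>)"
  using scale unfolding interpolation_extrapolation_scale_def by (metis greaterThanLessThan_iff)

lemma canonical_integer: "canonical_scale D G j \<Phi> 0 = lvl 0" "canonical_scale D G j \<Phi> 1 = lvl 1"
  by (simp_all add: canonical_scale_def)

lemma canonical_fraction:
  assumes "0 < \<theta>" "\<theta> < 1"
  shows "canonical_scale D G j \<Phi> \<theta> = \<Phi> \<theta> (lvl 0) (lvl 1)"
    "canonical_scale D G j \<Phi> (\<theta> - 1) = \<Phi> \<theta> (lvl (-1)) (lvl 0)"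
proof -
  have "\<lfloor>\<theta>\<rfloor> = 0" "\<lfloor>\<theta> - 1\<rfloor> = -1" using assms by linarith+
  then show "canonical_scale D G j \<Phi> \<theta> = \<Phi> \<theta> (lvl 0) (lvl 1)" "canonical_scale D G j \<Phi> (\<theta> - 1) = \<Phi> \<theta> (lvl (-1)) (lvl 0)"
    using assms by (simp_all add: canonical_scale_def frac_def)
qed

lemma embeds_trans_Z:
  assumes \<alpha>: "-1 \<le> \<alpha>" and E: "same_up_to_equivalent_norm (Z \<alpha>) E" and nonneg: "\<And>x. x \<in> car E \<Longrightarrow> 0 \<le> nrm E x"
  obtains C where "C > 0" "\<And>x. x \<in> car (Z \<alpha>) \<longleftrightarrow> x \<in> car E"
    "\<And>x. x \<in> car E \<Longrightarrow> nrm E x \<le> C * nrm (Z \<alpha>) x" "\<And>x. x \<in> car E \<Longrightarrow> nrm (Z \<alpha>) x \<le> C * nrm E x"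
proof -
  obtain C1 where C1: "C1 > 0" "\<And>x. x \<in> car (Z \<alpha>) \<Longrightarrow> x \<in> car E \<and> nrm E x \<le> C1 * nrm (Z \<alpha>) x"
    using embedsE[of "Z \<alpha>" E] E banach_subspace_nonneg[OF Z_banach[OF \<alpha>]] unfolding same_up_to_equivalent_norm_def by blast
  obtain C2 where C2: "C2 > 0" "\<And>x. x \<in> car E \<Longrightarrow> x \<in> car (Z \<alpha>) \<and> nrm (Z \<alpha>) x \<le> C2 * nrm E x"
    using embedsE[of E "Z \<alpha>"] E nonneg unfolding same_up_to_equivalent_norm_def by blast
  show ?thesis
  proof (rule that[of "max C1 C2"])
    show car: "x \<in> car (Z \<alpha>) \<longleftrightarrow> x \<in> car E" for x using C1(2) C2(2) by blast
    fix x assume x: "x \<in> car E"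
    have "0 \<le> nrm (Z \<alpha>) x" using banach_subspace_nonneg[OF Z_banach[OF \<alpha>]] x car by blast
    then show "nrm E x \<le> max C1 C2 * nrm (Z \<alpha>) x"
      using C1(2)[of x] x car mult_right_mono[OF max.cobounded1[of C1 C2]] by fastforce
    show "nrm (Z \<alpha>) x \<le> max C1 C2 * nrm E x"
      using C2(2)[OF x] mult_right_mono[OF max.cobounded2[of C2 C1] nonneg[OF x]] by linarith
  qed (use C1 in simp)
qed

text \<open>At fractional order the functor space lies between the intersection and the sum of the
  couple. As level 1 embeds into level 0, these are level 1 and level 0 up to equivalent norms;
  hence the domain embeds into every level of order in [0, 1], and that level into the original
  space.\<close>

lemma Z_intermediate:
  assumes \<alpha>: "0 \<le> \<alpha>" "\<alpha> \<le> 1"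
  obtains K where "K > 0" "car (Z \<alpha>) \<subseteq> range j"
    "\<And>x. x \<in> D \<Longrightarrow> j x \<in> car (Z \<alpha>) \<and> nrm (Z \<alpha>) (j x) \<le> K * norm (G x)"
    "\<And>x. j x \<in> car (Z \<alpha>) \<Longrightarrow> norm x \<le> K * nrm (Z \<alpha>) (j x)"
proof -
  obtain \<Phi> where \<Phi>: "\<And>\<theta>. 0 < \<theta> \<Longrightarrow> \<theta> < 1 \<Longrightarrow> exact_interpolation_functor sce (\<Phi> \<theta>)"
    "\<And>\<alpha>. -1 \<le> \<alpha> \<Longrightarrow> same_up_to_equivalent_norm (Z \<alpha>) (canonical_scale D G j \<Phi> \<alpha>)"
    by (rule interpolationE) blast
  obtain KR where KR: "KR > 0" "\<And>x. norm (R x) \<le> KR * norm x" by (rule R_bound) blast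
  have D_le: "norm x \<le> KR * norm (G x)" if "x \<in> D" for x using KR(2)[of "G x"] that by simp
  define E where "E = canonical_scale D G j \<Phi> \<alpha>"
  have "\<exists>K1>0. (\<forall>z\<in>car E. 0 \<le> nrm E z) \<and> car E \<subseteq> range j \<and> (\<forall>x\<in>D. j x \<in> car E \<and> nrm E (j x) \<le> K1 * norm (G x)) \<and>
      (\<forall>x. j x \<in> car E \<longrightarrow> norm x \<le> K1 * nrm E (j x))"
  proof -
    consider "\<alpha> = 0" | "\<alpha> = 1" | "0 < \<alpha>" "\<alpha> < 1" using \<alpha> by linarith
    then show ?thesis
    proof cases
      case 1
      have "norm x \<le> max KR 1 * norm (G x)" if "x \<in> D" for x
        using D_le[OF that] mult_right_mono[OF max.cobounded1[of KR 1], of "norm (G x)"] by simp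
      moreover have "norm x \<le> max KR 1 * norm x" for x :: 'z using mult_right_mono[of 1 "max KR 1" "norm x"] by simp
      ultimately show ?thesis
        unfolding E_def 1 canonical_integer by (intro exI[of _ "max KR 1"]) (auto simp: lvl_0)
    next
      case 2
      have "norm (G x) \<le> max KR 1 * norm (G x)" for x using mult_right_mono[of 1 "max KR 1" "norm (G x)"] by simp
      moreover have "norm x \<le> max KR 1 * norm (G x)" if "x \<in> D" for x
        using D_le[OF that] mult_right_mono[OF max.cobounded1[of KR 1], of "norm (G x)"] by simp
      ultimately show ?thesis
        unfolding E_def 2 canonical_integer by (intro exI[of _ "max KR 1"]) (auto simp: lvl_1 j_eq_iff)
    next
      case 3
      have E: "E = \<Phi> \<alpha> (lvl 0) (lvl 1)" unfolding E_def by (rule canonical_fraction(1)[OF 3])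
      have ex: "banach_subspace sce E" "embeds (int_space (lvl 0) (lvl 1)) E" "embeds E (sum_space (lvl 0) (lvl 1))"
        using \<Phi>(1)[OF 3] couple_0_1 unfolding exact_interpolation_functor_def E by blast+
      have nonneg: "0 \<le> nrm E z" if "z \<in> car E" for z using banach_subspace_nonneg[OF ex(1) that] .
      have "0 \<le> nrm (int_space (lvl 0) (lvl 1)) z" if "z \<in> car (int_space (lvl 0) (lvl 1))" for z
        using banach_subspace_nonneg[OF lvl_0_banach, of z] that by (auto simp: int_space_def le_max_iff_disj)
      from embedsE[OF ex(2) this] obtain C1 where C1: "C1 > 0"
        "\<And>z. z \<in> car (int_space (lvl 0) (lvl 1)) \<Longrightarrow> z \<in> car E \<and> nrm E z \<le> C1 * nrm (int_space (lvl 0) (lvl 1)) z" by blast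
      from embedsE[OF ex(3) nonneg] obtain C2 where C2: "C2 > 0"
        "\<And>z. z \<in> car E \<Longrightarrow> z \<in> car (sum_space (lvl 0) (lvl 1)) \<and> nrm (sum_space (lvl 0) (lvl 1)) z \<le> C2 * nrm E z" by blast
      have sum_range: "car (sum_space (lvl 0) (lvl 1)) \<subseteq> range j"
        by (auto simp: sum_space_def lvl_0 lvl_1 j_add[symmetric])
      have sum_ge: "norm x \<le> max KR 1 * nrm (sum_space (lvl 0) (lvl 1)) (j x)" for x
      proof -
        let ?N = "{nrm (lvl 0) y + nrm (lvl 1) z |y z. y \<in> car (lvl 0) \<and> z \<in> car (lvl 1) \<and> y + z = j x}"
        \<comment> \<open>The decomposition with second part zero shows that the infimum in the sum
          norm is taken over a nonempty set.\<close>
        have "j x + j (R 0) = j x" by (simp add: R_0 j_0)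
        moreover have "j x \<in> car (lvl 0)" "j (R 0) \<in> car (lvl 1)" by (simp_all add: lvl_0 lvl_1)
        ultimately have ne: "?N \<noteq> {}" by blast
        have "norm x / max KR 1 \<le> Inf ?N"
        proof (rule cInf_greatest[OF ne])
          fix q assume "q \<in> ?N"
          then obtain y' z' where "q = nrm (lvl 0) y' + nrm (lvl 1) z'" "y' \<in> car (lvl 0)" "z' \<in> car (lvl 1)" "y' + z' = j x"
            by blast
          moreover from this obtain y z where "y' = j y" "z' = j z" "z \<in> D" by (auto simp: lvl_0(1) lvl_1(1))
          ultimately have yz: "q = norm y + norm (G z)" "z \<in> D" "j y + j z = j x" by (simp_all add: lvl_0 lvl_1)
          then have "x = y + z" by (simp add: j_add[symmetric] j_eq_iff)
          then have "norm x \<le> norm y + norm z" by (simp add: norm_triangle_ineq)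
          also have "\<dots> \<le> max KR 1 * norm y + max KR 1 * norm (G z)"
            using D_le[OF yz(2)] mult_right_mono[of 1 "max KR 1" "norm y"] mult_right_mono[OF max.cobounded1[of KR 1], of "norm (G z)"] by auto
          finally show "norm x / max KR 1 \<le> q" by (simp add: yz(1) field_simps)
        qed
        then show ?thesis by (simp add: sum_space_def field_simps)
      qed
      show ?thesis
      proof (intro exI[of _ "max (C1 * max KR 1) (max KR 1 * C2)"] conjI ballI allI impI nonneg)
        show "0 < max (C1 * max KR 1) (max KR 1 * C2)" using C1(1) by (simp add: less_max_iff_disj)
        show "car E \<subseteq> range j" using C2(2) sum_range by blast
        fix x assume x: "x \<in> D"
        then have jx: "j x \<in> car (int_space (lvl 0) (lvl 1))" by (auto simp: int_space_def lvl_0 lvl_1)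
        show "j x \<in> car E" using C1(2)[OF jx] by blast
        have "nrm (int_space (lvl 0) (lvl 1)) (j x) \<le> max KR 1 * norm (G x)"
          using D_le[OF x] mult_right_mono[OF max.cobounded1[of KR 1], of "norm (G x)"] mult_right_mono[of 1 "max KR 1" "norm (G x)"]
          by (auto simp: int_space_def lvl_0 lvl_1)
        then have "C1 * nrm (int_space (lvl 0) (lvl 1)) (j x) \<le> C1 * (max KR 1 * norm (G x))" using C1(1) by simp
        then show "nrm E (j x) \<le> max (C1 * max KR 1) (max KR 1 * C2) * norm (G x)"
          using C1(2)[OF jx] mult_right_mono[OF max.cobounded1[of "C1 * max KR 1" "max KR 1 * C2"], of "norm (G x)"] by simp
      next
        fix x assume x: "j x \<in> car E"
        have "norm x \<le> max KR 1 * nrm (sum_space (lvl 0) (lvl 1)) (j x)" by (rule sum_ge)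
        also have "\<dots> \<le> max KR 1 * (C2 * nrm E (j x))" using C2(2)[OF x] by (intro mult_left_mono) auto
        also have "\<dots> \<le> max (C1 * max KR 1) (max KR 1 * C2) * nrm E (j x)"
          unfolding mult.assoc[symmetric] by (intro mult_right_mono nonneg x) auto
        finally show "norm x \<le> max (C1 * max KR 1) (max KR 1 * C2) * nrm E (j x)" .
      qed
    qed
  qed
  then obtain K1 where K1: "K1 > 0" "\<And>z. z \<in> car E \<Longrightarrow> 0 \<le> nrm E z" "car E \<subseteq> range j"
    "\<And>x. x \<in> D \<Longrightarrow> j x \<in> car E \<and> nrm E (j x) \<le> K1 * norm (G x)"
    "\<And>x. j x \<in> car E \<Longrightarrow> norm x \<le> K1 * nrm E (j x)" by blast
  have "-1 \<le> \<alpha>" using \<alpha> by simp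
  from embeds_trans_Z[OF this \<Phi>(2)[OF this, folded E_def] K1(2)] obtain C where C: "C > 0" "\<And>x. x \<in> car (Z \<alpha>) \<longleftrightarrow> x \<in> car E"
    "\<And>x. x \<in> car E \<Longrightarrow> nrm E x \<le> C * nrm (Z \<alpha>) x" "\<And>x. x \<in> car E \<Longrightarrow> nrm (Z \<alpha>) x \<le> C * nrm E x" by blast
  show ?thesis
  proof (rule that[of "C * K1"])
    show "C * K1 > 0" using C K1 by simp
    show "car (Z \<alpha>) \<subseteq> range j" using C(2) K1(3) by blast
    fix x assume x: "x \<in> D"
    have "nrm (Z \<alpha>) (j x) \<le> C * nrm E (j x)" using C(4) K1(4)[OF x] by blast
    also have "\<dots> \<le> C * (K1 * norm (G x))" using K1(4)[OF x] C(1) by (intro mult_left_mono) auto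
    finally show "j x \<in> car (Z \<alpha>) \<and> nrm (Z \<alpha>) (j x) \<le> C * K1 * norm (G x)" using C(2) K1(4)[OF x] by simp
  next
    fix x assume x: "j x \<in> car (Z \<alpha>)"
    then have xE: "j x \<in> car E" using C(2) by blast
    have "norm x \<le> K1 * nrm E (j x)" by (rule K1(5)[OF xE])
    also have "\<dots> \<le> K1 * (C * nrm (Z \<alpha>) (j x))" using C(3)[OF xE] K1(1) by (intro mult_left_mono) auto
    finally show "norm x \<le> C * K1 * nrm (Z \<alpha>) (j x)" by (simp add: mult_ac)
  qed
qed

lemma car_level: "x \<in> car (level j Z \<alpha>) \<longleftrightarrow> j x \<in> car (Z \<alpha>)" and nrm_level: "nrm (level j Z \<alpha>) x = nrm (Z \<alpha>) (j x)"
  by (simp_all add: level_def)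

lemma Z_normed: "-1 \<le> \<alpha> \<Longrightarrow> normed_nspace (Z \<alpha>)"
  by (rule banach_subspace_normed[OF sce Z_banach])

lemma level_normed: "-1 \<le> \<alpha> \<Longrightarrow> normed_nspace (level j Z \<alpha>)"
  using Z_normed[of \<alpha>] unfolding normed_nspace_def Real_Vector_Spaces.subspace_def
  by (simp add: car_level nrm_level j_add j_0 j_scaleR)

text \<open>The limit is formed in the extrapolation space; for orders in [0, 1] it lies in the
  range of \<open>j\<close> and is pulled back to the original space.\<close>

lemma level_complete:
  assumes \<alpha>: "0 \<le> \<alpha>" "\<alpha> \<le> 1" and s: "\<And>n. s n \<in> car (level j Z \<alpha>)"
    and Cauchy: "\<And>e. 0 < e \<Longrightarrow> \<exists>N. \<forall>m\<ge>N. \<forall>n\<ge>N. nrm (level j Z \<alpha>) (s m - s n) < e"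
  obtains l where "l \<in> car (level j Z \<alpha>)" "(\<lambda>n. nrm (level j Z \<alpha>) (s n - l)) \<longlonglongrightarrow> 0"
proof -
  have "banach_subspace sce (Z \<alpha>)" using \<alpha> by (intro Z_banach) auto
  then have complete: "(\<forall>n. q n \<in> car (Z \<alpha>)) \<and> (\<forall>e>0. \<exists>N. \<forall>m\<ge>N. \<forall>n\<ge>N. nrm (Z \<alpha>) (q m - q n) < e) \<Longrightarrow>
      \<exists>l\<in>car (Z \<alpha>). (\<lambda>n. nrm (Z \<alpha>) (q n - l)) \<longlonglongrightarrow> 0" for q :: "nat \<Rightarrow> 'e"
    unfolding banach_subspace_def by blast
  obtain l where l: "l \<in> car (Z \<alpha>)" "(\<lambda>n. nrm (Z \<alpha>) (j (s n) - l)) \<longlonglongrightarrow> 0"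
    using complete[of "\<lambda>n. j (s n)"] s Cauchy by (auto simp: car_level nrm_level j_diff)
  have "car (Z \<alpha>) \<subseteq> range j" by (rule Z_intermediate[OF \<alpha>]) blast
  then obtain x where "l = j x" using l(1) by auto
  then show ?thesis using l by (intro that[of x]) (auto simp: car_level nrm_level j_diff)
qed

lemma level_embeds:
  assumes \<alpha>: "0 \<le> \<alpha>" "\<alpha> \<le> 1"
  shows "\<exists>K. \<forall>x\<in>car (level j Z \<alpha>). norm x \<le> K * nrm (level j Z \<alpha>) x"
proof -
  obtain K where "\<And>x. j x \<in> car (Z \<alpha>) \<Longrightarrow> norm x \<le> K * nrm (Z \<alpha>) (j x)"
    by (rule Z_intermediate[OF \<alpha>]) blast
  then show ?thesis by (intro exI[of _ K]) (simp add: car_level nrm_level)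
qed

lemma level_upper:
  assumes \<alpha>: "0 \<le> \<alpha>" "\<alpha> \<le> 1"
  obtains K where "K > 0" "\<And>x. x \<in> D \<Longrightarrow> x \<in> car (level j Z \<alpha>) \<and> nrm (level j Z \<alpha>) x \<le> K * norm (G x)"
  by (rule Z_intermediate[OF \<alpha>]) (use that in \<open>simp add: car_level nrm_level\<close>)

lemma level_1:
  obtains K where "K > 0" "car (level j Z 1) = D" "\<And>x. x \<in> D \<Longrightarrow> norm (G x) \<le> K * nrm (level j Z 1) x"
proof -
  obtain \<Phi> where \<Phi>: "\<And>\<alpha>. -1 \<le> \<alpha> \<Longrightarrow> same_up_to_equivalent_norm (Z \<alpha>) (canonical_scale D G j \<Phi> \<alpha>)"
    by (rule interpolationE) blast
  have nonneg: "0 \<le> nrm (lvl 1) x" if "x \<in> car (lvl 1)" for x by (rule banach_subspace_nonneg[OF lvl_1_banach that])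
  have le: "-1 \<le> (1::real)" by simp
  have "same_up_to_equivalent_norm (Z 1) (lvl 1)" using \<Phi>[OF le] by (simp only: canonical_integer)
  from embeds_trans_Z[OF le this nonneg] obtain C where C: "C > 0" "\<And>x. x \<in> car (Z 1) \<longleftrightarrow> x \<in> car (lvl 1)"
    "\<And>x. x \<in> car (lvl 1) \<Longrightarrow> nrm (lvl 1) x \<le> C * nrm (Z 1) x"
    "\<And>x. x \<in> car (lvl 1) \<Longrightarrow> nrm (Z 1) x \<le> C * nrm (lvl 1) x" by blast
  show ?thesis
  proof (rule that[OF C(1)])
    show "car (level j Z 1) = D" by (auto simp: car_level C(2) lvl_1 j_eq_iff)
    show "norm (G x) \<le> C * nrm (level j Z 1) x" if "x \<in> D" for x
      using C(3)[of "j x"] that by (simp add: lvl_1 nrm_level)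
  qed
qed

lemma car_level_1: "car (level j Z 1) = D"
  by (rule level_1) blast

end

section \<open>The extrapolated operator and its inverse\<close>

context generator_scale
begin

lemma D_dense:
  assumes "strong_semigroup (\<lambda>t. blinfun_apply (S t))"
  shows "closure D = UNIV"
proof -
  interpret s: strong_semigroup "\<lambda>t. blinfun_apply (S t)" by fact
  have "\<exists>x\<in>D. dist x z < e" if "0 < e" for z e
    by (rule s.generator_dense[OF that, of z]) (auto simp: dist_norm intro: generatorI)
  then show ?thesis by (auto simp: closure_approachable)
qed

context
  assumes dense: "closure D = UNIV"
begin

abbreviation "ext \<equiv> extended_operator D G j"

text \<open>On the domain, \<open>j\<close> after \<open>G\<close> is isometric for the original
  norm, because the extrapolation norm of \<open>j (G x)\<close> is the norm of
  \<open>R (G x)\<close>. A uniformly continuous map on a dense set has exactly one continuous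
  extension, so the description is meaningful.\<close>

lemma ext_continuous: "continuous_on UNIV ext" and ext_D: "x \<in> D \<Longrightarrow> ext x = j (G x)"
proof -
  have "dist (j (G x)) (j (G y)) = dist x y" if "x \<in> D" "y \<in> D" for x y
  proof -
    have "R (G x - G y) = x - y" using R_add[of "G x - G y" "G y"] that by (simp add: eq_diff_eq)
    then show ?thesis by (simp add: dist_norm j_diff[symmetric] norm_j)
  qed
  then have "uniformly_continuous_on D (\<lambda>x. j (G x))"
    unfolding uniformly_continuous_on_def by auto
  then obtain g where g: "uniformly_continuous_on (closure D) g" "\<And>x. x \<in> D \<Longrightarrow> j (G x) = g x"
      "\<And>Y h x. D \<subseteq> Y \<Longrightarrow> Y \<subseteq> closure D \<Longrightarrow> continuous_on Y h \<Longrightarrow> (\<And>x. x \<in> D \<Longrightarrow> j (G x) = h x) \<Longrightarrow> x \<in> Y \<Longrightarrow> h x = g x"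
    by (rule uniformly_continuous_on_extension_on_closure) blast
  have g': "continuous_on UNIV g \<and> (\<forall>x\<in>D. g x = j (G x))"
    using uniformly_continuous_imp_continuous[OF g(1)] g(2) dense by simp
  have unique: "h = g" if "continuous_on UNIV h \<and> (\<forall>x\<in>D. h x = j (G x))" for h
  proof
    fix x show "h x = g x" using g(3)[of UNIV h x] that dense by simp
  qed
  have "ext = g" unfolding extended_operator_def 
    by (rule the_equality, rule g', rule unique)
  then show "continuous_on UNIV ext" "x \<in> D \<Longrightarrow> ext x = j (G x)" for x using g' by auto
qed

lemma approx_D: obtains s where "\<And>n. s n \<in> D" "s \<longlonglongrightarrow> x"
  using closure_sequential[of x D] dense by auto

lemma ext_tendsto: "s \<longlonglongrightarrow> x \<Longrightarrow> (\<lambda>n. ext (s n)) \<longlonglongrightarrow> ext x"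
  using ext_continuous continuous_on_tendsto_compose[of UNIV ext s x sequentially] by simp

lemma ext_add: "ext (x + y) = ext x + ext y"
proof -
  obtain s where s: "\<And>n. s n \<in> D" "s \<longlonglongrightarrow> x" by (rule approx_D) blast
  obtain r where r: "\<And>n. r n \<in> D" "r \<longlonglongrightarrow> y" by (rule approx_D) blast
  have "(\<lambda>n. ext (s n + r n)) \<longlonglongrightarrow> ext (x + y)" by (intro ext_tendsto tendsto_add s r)
  moreover have "(\<lambda>n. ext (s n) + ext (r n)) \<longlonglongrightarrow> ext x + ext y" by (intro tendsto_add ext_tendsto s r)
  moreover have "ext (s n + r n) = ext (s n) + ext (r n)" for n
    using s r by (simp add: ext_D D_add G_add j_add)
  ultimately show ?thesis using LIMSEQ_unique by simp
qed

lemma ext_sc: "ext (sc a x) = sce a (ext x)"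
proof -
  obtain s where s: "\<And>n. s n \<in> D" "s \<longlonglongrightarrow> x" by (rule approx_D) blast
  have "(\<lambda>n. ext (sc a (s n))) \<longlonglongrightarrow> ext (sc a x)"
    by (intro ext_tendsto bounded_linear.tendsto[OF banach_over_bounded_linear[OF space]] s)
  moreover have "(\<lambda>n. sce a (ext (s n))) \<longlonglongrightarrow> sce a (ext x)"
    by (intro bounded_linear.tendsto[OF banach_over_bounded_linear[OF sce]] ext_tendsto s)
  moreover have "ext (sc a (s n)) = sce a (ext (s n))" for n
    using s by (simp add: ext_D D_sc G_sc j_sc)
  ultimately show ?thesis using LIMSEQ_unique by simp
qed

lemma norm_ext: "norm (ext x) = norm x"
proof -
  obtain s where s: "\<And>n. s n \<in> D" "s \<longlonglongrightarrow> x" by (rule approx_D) blast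
  have "(\<lambda>n. norm (ext (s n))) \<longlonglongrightarrow> norm (ext x)" by (intro tendsto_norm ext_tendsto s)
  moreover have "norm (ext (s n)) = norm (s n)" for n using s by (simp add: ext_D norm_j)
  ultimately show ?thesis using LIMSEQ_unique[OF _ tendsto_norm[OF s(2)]] by simp
qed

lemma ext_diff: "ext (x - y) = ext x - ext y"
  using ext_add[of "x - y" y] by simp

text \<open>The extension is isometric, so preimages of a convergent sequence are Cauchy; its range
  contains the dense range of \<open>j\<close>, since \<open>j y\<close> is the image of
  \<open>R y\<close>.\<close>

lemma ext_bij: "bij ext"
proof (rule bijI)
  show "inj ext"
  proof (rule injI)
    fix x y assume "ext x = ext y"
    then have "norm (x - y) = 0" using norm_ext[of "x - y"] by (simp add: ext_diff)
    then show "x = y" by simp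
  qed
  have "e \<in> range ext" for e
  proof -
    have "e \<in> closure (range j)" using j_dense by simp
    then obtain q where q: "\<And>n. q n \<in> range j" "q \<longlonglongrightarrow> e" using closure_sequential by blast
    then have "\<forall>n. \<exists>y. q n = j y" by blast
    then obtain y where y: "\<And>n. q n = j (y n)" by metis
    have qe: "q n = ext (R (y n))" for n by (simp add: ext_D y)
    have "Cauchy q" using q(2) Cauchy_convergent_iff convergent_def by blast
    then have "Cauchy (\<lambda>n. R (y n))"
      unfolding Cauchy_def dist_norm qe ext_diff[symmetric] norm_ext .
    then obtain x where "(\<lambda>n. R (y n)) \<longlonglongrightarrow> x" using Cauchy_convergent_iff convergent_def by blast
    moreover have "q = (\<lambda>n. ext (R (y n)))" using qe by auto
    ultimately have "q \<longlonglongrightarrow> ext x" using ext_tendsto[of "\<lambda>n. R (y n)" x] by simp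
    then show ?thesis using LIMSEQ_unique[OF q(2)] by blast
  qed
  then show "range ext = UNIV" by blast
qed

lemma inv_ext: "ext (inv ext e) = e" "inv ext (ext x) = x"
  using ext_bij by (simp_all add: bij_def surj_f_inv_f)

lemma inv_ext_add: "inv ext (x + y) = inv ext x + inv ext y"
  using inv_ext(2)[of "inv ext x + inv ext y"] by (simp add: ext_add inv_ext(1))

lemma inv_ext_diff: "inv ext (x - y) = inv ext x - inv ext y"
  using inv_ext(2)[of "inv ext x - inv ext y"] by (simp add: ext_diff inv_ext(1))

lemma inv_ext_sc: "inv ext (sce a x) = sc a (inv ext x)"
  using inv_ext(2)[of "sc a (inv ext x)"] by (simp add: ext_sc inv_ext(1))

lemma inv_ext_scaleR: "inv ext (r *\<^sub>R x) = r *\<^sub>R inv ext x"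
proof -
  have "inv ext (sce (of_real r) x) = sc (of_real r) (inv ext x)" by (rule inv_ext_sc)
  then show ?thesis using sce by (simp add: banach_over_def sc_of_real)
qed

lemma inv_ext_j: "inv ext (j x) = R x"
  using inv_ext(2)[of "R x"] by (simp add: ext_D)

lemma norm_inv_ext: "norm (inv ext e) = norm e"
  using norm_ext[of "inv ext e"] by (simp add: inv_ext(1))

text \<open>The inverse is isometric from level -1 to level 0 and from level 0 to level 1, and
  interpolation covers the orders in between. Some finite bound must be known before the smallness
  of \<open>op_norm\<close>, an infimum of bounds, can be exploited.\<close>

lemma inv_ext_op_bound:
  assumes \<delta>: "0 < \<delta>" "\<delta> \<le> 1"
  shows "\<exists>K\<ge>0. op_bound (Z (\<delta> - 1)) (level j Z \<delta>) (inv ext) K"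
proof -
  obtain \<Phi> where \<Phi>: "\<And>\<theta>. 0 < \<theta> \<Longrightarrow> \<theta> < 1 \<Longrightarrow> exact_interpolation_functor sce (\<Phi> \<theta>)"
    "\<And>\<alpha>. -1 \<le> \<alpha> \<Longrightarrow> same_up_to_equivalent_norm (Z \<alpha>) (canonical_scale D G j \<Phi> \<alpha>)"
    by (rule interpolationE) blast
  define E where "E = canonical_scale D G j \<Phi> (\<delta> - 1)"
  define F where "F = canonical_scale D G j \<Phi> \<delta>"
  \<comment> \<open>Functors act on operators within one ambient space, so the inverse is followed
    by \<open>j\<close>.\<close>
  define W where "W e = j (inv ext e)" for e
  have lvl_0_1: "op_bound (lvl 0) (lvl 1) W 1"
    by (auto simp: op_bound_def W_def lvl_0 lvl_1 inv_ext_j)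
  have "(\<forall>x\<in>car E. 0 \<le> nrm E x) \<and> (\<forall>x\<in>car F. 0 \<le> nrm F x) \<and> op_bound E F W 1"
  proof (cases "\<delta> = 1")
    case True
    then show ?thesis
      using lvl_0_1 banach_subspace_nonneg[OF lvl_0_banach] banach_subspace_nonneg[OF lvl_1_banach]
      by (simp add: E_def F_def canonical_integer)
  next
    case False
    then have \<delta>': "0 < \<delta>" "\<delta> < 1" using \<delta> by auto
    have E: "E = \<Phi> \<delta> (lvl (-1)) (lvl 0)" and F: "F = \<Phi> \<delta> (lvl 0) (lvl 1)"
      unfolding E_def F_def by (rule canonical_fraction[OF \<delta>'])+
    have banach: "banach_subspace sce E" "banach_subspace sce F"
      and interp: "linear_on_set sce sce (car (sum_space (lvl (-1)) (lvl 0))) W \<Longrightarrow> op_bound (lvl (-1)) (lvl 0) W 1 \<Longrightarrow>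
        op_bound (lvl 0) (lvl 1) W 1 \<Longrightarrow> op_bound E F W (max 1 1)"
      using \<Phi>(1)[OF \<delta>'] couple_0_1 couple_minus_1_0 unfolding exact_interpolation_functor_def E F by blast+
    have "op_bound (lvl (-1)) (lvl 0) W 1"
      by (auto simp: op_bound_def W_def lvl_0 lvl_minus_1 whole_def norm_inv_ext)
    \<comment> \<open>Level -1 is the whole extrapolation space, hence so is the sum space.\<close>
    moreover have "linear_on_set sce sce (car (sum_space (lvl (-1)) (lvl 0))) W"
    proof -
      interpret e: vector_space sce using sce by (simp add: banach_over_def)
      have "x \<in> car (sum_space (lvl (-1)) (lvl 0))" for x
      proof -
        have "x + j 0 \<in> car (sum_space (lvl (-1)) (lvl 0))"
          unfolding sum_space_def lvl_minus_1 lvl_0 by (auto simp: whole_def)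
        then show ?thesis by (simp add: j_0)
      qed
      then have "car (sum_space (lvl (-1)) (lvl 0)) = UNIV" by blast
      then show ?thesis
        by (simp add: linear_on_set_def e.subspace_UNIV W_def inv_ext_add inv_ext_sc j_add j_sc)
    qed
    ultimately show ?thesis using interp lvl_0_1 banach_subspace_nonneg[OF banach(1)] banach_subspace_nonneg[OF banach(2)] by simp
  qed
  then have EF: "\<And>x. x \<in> car E \<Longrightarrow> 0 \<le> nrm E x" "\<And>x. x \<in> car F \<Longrightarrow> 0 \<le> nrm F x" "op_bound E F W 1" by auto
  have le: "-1 \<le> \<delta> - 1" "-1 \<le> \<delta>" using \<delta> by auto
  from embeds_trans_Z[OF le(1) \<Phi>(2)[OF le(1), folded E_def] EF(1)]
  obtain C where C: "C > 0" "\<And>x. x \<in> car (Z (\<delta> - 1)) \<longleftrightarrow> x \<in> car E"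
    "\<And>x. x \<in> car E \<Longrightarrow> nrm E x \<le> C * nrm (Z (\<delta> - 1)) x" "\<And>x. x \<in> car E \<Longrightarrow> nrm (Z (\<delta> - 1)) x \<le> C * nrm E x" by blast
  from embeds_trans_Z[OF le(2) \<Phi>(2)[OF le(2), folded F_def] EF(2)]
  obtain C' where C': "C' > 0" "\<And>x. x \<in> car (Z \<delta>) \<longleftrightarrow> x \<in> car F"
    "\<And>x. x \<in> car F \<Longrightarrow> nrm F x \<le> C' * nrm (Z \<delta>) x" "\<And>x. x \<in> car F \<Longrightarrow> nrm (Z \<delta>) x \<le> C' * nrm F x" by blast
  have "op_bound (Z (\<delta> - 1)) (level j Z \<delta>) (inv ext) (C' * C)"
    unfolding op_bound_def
  proof (intro ballI conjI)
    fix x assume "x \<in> car (Z (\<delta> - 1))"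
    then have x: "x \<in> car E" using C(2) by simp
    then have W: "W x \<in> car F" "nrm F (W x) \<le> nrm E x" using EF(3) by (auto simp: op_bound_def)
    then show "inv ext x \<in> car (level j Z \<delta>)" by (simp add: car_level C'(2) W_def)
    have "nrm (level j Z \<delta>) (inv ext x) \<le> C' * nrm F (W x)" using C'(4)[OF W(1)] by (simp add: nrm_level W_def)
    also have "\<dots> \<le> C' * (C * nrm (Z (\<delta> - 1)) x)" using W(2) C(3)[OF x] C'(1) by (intro mult_left_mono) auto
    finally show "nrm (level j Z \<delta>) (inv ext x) \<le> C' * C * nrm (Z (\<delta> - 1)) x" by simp
  qed
  then show ?thesis using C(1) C'(1) by (intro exI[of _ "C' * C"]) auto
qed

end

end

context generator_scale
begin

lemma level_1_upper:
  obtains K where "K > 0" "\<And>x. nrm (level j Z 1) (R x) \<le> K * norm x"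
proof -
  obtain K where K: "K > 0" "\<And>x. x \<in> D \<Longrightarrow> x \<in> car (level j Z 1) \<and> nrm (level j Z 1) x \<le> K * norm (G x)"
    by (rule level_upper[of 1]) auto
  have "nrm (level j Z 1) (R x) \<le> K * norm x" for x using K(2)[of "R x"] by simp
  with K(1) show ?thesis by (rule that)
qed

lemma level_1_lower:
  obtains K where "K > 0" "\<And>x. norm x \<le> K * nrm (level j Z 1) (R x)"
proof -
  obtain K where K: "K > 0" "\<And>x. x \<in> D \<Longrightarrow> norm (G x) \<le> K * nrm (level j Z 1) x"
    by (rule level_1) blast
  have "norm x \<le> K * nrm (level j Z 1) (R x)" for x using K(2)[of "R x"] by simp
  with K(1) show ?thesis by (rule that)
qed

text \<open>The semigroup commutes with \<open>R\<close>, and the level 1 norm of \<open>R x\<close>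
  is equivalent to the norm of x; a bound on level 1 is therefore a bound on the original space.
  Time 0 is not covered by the hypothesis and is treated apart.\<close>

lemma strong_semigroup_of_level_bound:
  assumes S1: "\<And>t. 0 < t \<Longrightarrow> op_bound (level j Z 1) (level j Z 1) (S t) (M * exp (\<omega> * t))" and M: "0 \<le> M"
  shows "strong_semigroup (\<lambda>t. blinfun_apply (S t))"
proof (rule strong_semigroupI)
  fix \<tau> :: real
  obtain K1 where K1: "K1 > 0" "\<And>x. nrm (level j Z 1) (R x) \<le> K1 * norm x" by (rule level_1_upper) blast
  obtain K2 where K2: "K2 > 0" "\<And>x. norm x \<le> K2 * nrm (level j Z 1) (R x)" by (rule level_1_lower) blast
  define C where "C = max 1 (K2 * (M * exp (\<bar>\<omega>\<bar> * \<tau>) * K1))"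
  have "norm (S t x) \<le> C * norm x" if t: "t \<in> {0..\<tau>}" for t x
  proof (cases "t = 0")
    case True
    then show ?thesis using mult_right_mono[of 1 C "norm x"] by (simp add: S_facts C_def)
  next
    case False
    then have pos: "0 < t" using t by simp
    have "norm (S t x) \<le> K2 * nrm (level j Z 1) (S t (R x))" using K2(2)[of "S t x"] pos by (simp add: S_R)
    also have "\<dots> \<le> K2 * (M * exp (\<omega> * t) * nrm (level j Z 1) (R x))"
      using S1[OF pos] K2(1) by (intro mult_left_mono) (auto simp: op_bound_def car_level_1)
    also have "\<dots> \<le> K2 * (M * exp (\<bar>\<omega>\<bar> * \<tau>) * (K1 * norm x))"
    proof -
      have "\<omega> * t \<le> \<bar>\<omega>\<bar> * \<tau>" using t by (intro mult_mono) auto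
      moreover have "0 \<le> nrm (level j Z 1) (R x)"
        by (rule nrm_nonneg[OF level_normed]) (simp_all add: car_level_1)
      ultimately show ?thesis using K1 K2(1) M by (intro mult_left_mono mult_mono) auto
    qed
    also have "\<dots> \<le> C * norm x"
      using mult_right_mono[OF max.cobounded2[of "K2 * (M * exp (\<bar>\<omega>\<bar> * \<tau>) * K1)" 1], of "norm x"]
      by (simp add: C_def mult.assoc)
    finally show ?thesis .
  qed
  then show "\<exists>M. \<forall>t\<in>{0..\<tau>}. \<forall>x. norm (S t x) \<le> M * norm x" by blast
qed

lemma smoothing_semigroupI:
  assumes S: "strong_semigroup (\<lambda>t. blinfun_apply (S t))" and \<theta>: "0 < \<theta>" "\<theta> \<le> 1" and C: "0 \<le> C"
    and bound: "\<And>t. 0 < t \<Longrightarrow> op_bound (level j Z \<theta>) (level j Z 1) (S t) (C * t powr (\<theta> - 1) * exp (\<omega> * t))"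
  shows "smoothing_semigroup (\<lambda>t. blinfun_apply (S t)) A R (\<lambda>x. x + sc \<mu> (R x)) (level j Z 1) (level j Z \<theta>) \<theta> C \<omega>"
proof (intro smoothing_semigroup.intro generated_semigroupI[OF S] smoothing_semigroup_axioms.intro bound \<theta> C level_normed level_embeds)
  show "car (level j Z 1) = range R" by (simp only: car_level_1 range_R)
  show "\<exists>K. \<forall>x. nrm (level j Z 1) (R x) \<le> K * norm x" by (rule level_1_upper) blast
  show "\<exists>K. \<forall>x. norm x \<le> K * nrm (level j Z 1) (R x)" by (rule level_1_lower) blast
qed (use \<theta> in auto)

lemma level_1_embeds_level:
  assumes \<alpha>: "0 \<le> \<alpha>" "\<alpha> \<le> 1"
  shows "embeds (level j Z 1) (level j Z \<alpha>)"
proof -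
  obtain K where K: "K > 0" "\<And>x. x \<in> D \<Longrightarrow> x \<in> car (level j Z \<alpha>) \<and> nrm (level j Z \<alpha>) x \<le> K * norm (G x)"
    by (rule level_upper[OF \<alpha>]) blast
  obtain K' where K': "K' > 0" "\<And>x. x \<in> D \<Longrightarrow> norm (G x) \<le> K' * nrm (level j Z 1) x"
    by (rule level_1) blast
  have "x \<in> car (level j Z \<alpha>) \<and> nrm (level j Z \<alpha>) x \<le> (K * K') * nrm (level j Z 1) x" if "x \<in> D" for x
    using K(2)[OF that] order_trans[OF _ mult_left_mono[OF K'(2)[OF that] less_imp_le[OF K(1)]]]
    by (auto simp: mult.assoc)
  then show ?thesis unfolding embeds_def car_level_1 by blast
qed

end

section \<open>Continuously differentiable functions into normed subspaces\<close>

locale normed_subspace =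
  fixes E :: "'a::banach nspace"
  assumes normed: "normed_nspace E" and definite: "x \<in> car E \<Longrightarrow> nrm E x = 0 \<Longrightarrow> x = 0"
begin

lemma deriv_in_unique:
  assumes t: "0 < t" and s: "s \<in> {0..t}" and u: "\<And>r. r \<in> {0..t} \<Longrightarrow> u r \<in> car E"
    and d: "deriv_in E t u s d" and d': "deriv_in E t u s d'"
  shows "d = d'"
proof -
  let ?q = "\<lambda>r. (1 / (r - s)) *\<^sub>R (u r - u s)"
  have car: "d \<in> car E" "d' \<in> car E" and lim: "((\<lambda>r. nrm E (?q r - d)) \<longlongrightarrow> 0) (at s within {0..t})"
    "((\<lambda>r. nrm E (?q r - d')) \<longlongrightarrow> 0) (at s within {0..t})"
    using d d' by (auto simp: deriv_in_def)
  have "((\<lambda>r. nrm E (d - d')) \<longlongrightarrow> 0) (at s within {0..t})"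
  proof (rule Lim_null_comparison)
    show "((\<lambda>r. nrm E (?q r - d) + nrm E (?q r - d')) \<longlongrightarrow> 0) (at s within {0..t})"
      by (rule tendsto_add_zero[OF lim])
    have "norm (nrm E (d - d')) \<le> nrm E (?q r - d) + nrm E (?q r - d')" if "r \<in> {0..t}" for r
    proof -
      have q: "?q r \<in> car E" using u[OF that] u[OF s] by (intro nspace_scale[OF normed] nspace_diff[OF normed])
      show ?thesis
        using nrm_triangle_diff[OF normed car(1) q car(2)] nrm_minus_commute[OF normed car(1) q]
          nrm_nonneg[OF normed nspace_diff[OF normed car]] by simp
    qed
    then show "\<forall>\<^sub>F r in at s within {0..t}. norm (nrm E (d - d')) \<le> nrm E (?q r - d) + nrm E (?q r - d')"
      unfolding eventually_at_filter by (auto intro!: always_eventually)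
  qed
  \<comment> \<open>The interval has positive length, so s is a limit point of it and a constant
    that tends to 0 is 0.\<close>
  moreover have "at s within {0..t} \<noteq> bot"
    using t s by (simp add: trivial_limit_within islimpt_Icc)
  ultimately have "nrm E (d - d') = 0" using tendsto_const_iff by blast
  then show ?thesis using definite[OF nspace_diff[OF normed car]] by simp
qed

text \<open>Uniqueness of derivatives resolves the description inside \<open>C1_norm\<close>, so the
  norm splits into the suprema of \<open>u\<close> and of \<open>u'\<close>. The last clause keeps
  the two suprema apart, because operator bounds act on each of them separately.\<close>

lemma C1_norm_bounds:
  assumes t: "0 < t" and u: "C0_in E t u" and u': "C0_in E t u'"
    and deriv: "\<And>s. s \<in> {0..t} \<Longrightarrow> deriv_in E t u s (u' s)"
  shows "\<And>s. s \<in> {0..t} \<Longrightarrow> nrm E (u s) \<le> C1_norm E t u"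
    and "\<And>s. s \<in> {0..t} \<Longrightarrow> nrm E (u' s) \<le> C1_norm E t u"
    and "\<And>a b. (\<And>s. s \<in> {0..t} \<Longrightarrow> nrm E (u s) \<le> a) \<Longrightarrow> (\<And>s. s \<in> {0..t} \<Longrightarrow> nrm E (u' s) \<le> b) \<Longrightarrow> C1_norm E t u \<le> a + b"
    and "0 \<le> C1_norm E t u"
    and "\<exists>a b. C1_norm E t u = a + b \<and> (\<forall>s\<in>{0..t}. nrm E (u s) \<le> a) \<and> (\<forall>s\<in>{0..t}. nrm E (u' s) \<le> b)"
proof -
  have car: "u s \<in> car E" "u' s \<in> car E" if "s \<in> {0..t}" for s using u u' that by (auto simp: C0_in_def)
  have "(THE d. deriv_in E t u s d) = u' s" if "s \<in> {0..t}" for s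
    using deriv_in_unique[OF t that car(1)] deriv[OF that] by (intro the_equality) auto
  then have eq: "C1_norm E t u = (SUP s\<in>{0..t}. nrm E (u s)) + (SUP s\<in>{0..t}. nrm E (u' s))"
    by (simp add: C1_norm_def)
  have bdd: "bdd_above ((\<lambda>s. nrm E (w s)) ` {0..t})" if "C0_in E t w" for w
    using compact_imp_bounded[OF compact_continuous_image[OF C0_in_nrm_continuous[OF normed that] compact_Icc]]
    by (rule bounded_imp_bdd_above)
  have up: "nrm E (w s) \<le> (SUP s\<in>{0..t}. nrm E (w s))" if "C0_in E t w" "s \<in> {0..t}" for w s
    using bdd[OF that(1)] that(2) by (intro cSUP_upper)
  have t0: "(0::real) \<in> {0..t}" using t by simp
  have pos: "0 \<le> (SUP s\<in>{0..t}. nrm E (u s))" "0 \<le> (SUP s\<in>{0..t}. nrm E (u' s))"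
    using up[OF u t0] up[OF u' t0] nrm_nonneg[OF normed car(1)[OF t0]] nrm_nonneg[OF normed car(2)[OF t0]] by auto
  show "nrm E (u s) \<le> C1_norm E t u" "nrm E (u' s) \<le> C1_norm E t u" if "s \<in> {0..t}" for s
    using up[OF u that] up[OF u' that] pos unfolding eq by auto
  show "C1_norm E t u \<le> a + b" if "\<And>s. s \<in> {0..t} \<Longrightarrow> nrm E (u s) \<le> a" "\<And>s. s \<in> {0..t} \<Longrightarrow> nrm E (u' s) \<le> b" for a b
    unfolding eq using t that by (intro add_mono cSUP_least) auto
  show "0 \<le> C1_norm E t u" unfolding eq using pos by simp
  show "\<exists>a b. C1_norm E t u = a + b \<and> (\<forall>s\<in>{0..t}. nrm E (u s) \<le> a) \<and> (\<forall>s\<in>{0..t}. nrm E (u' s) \<le> b)"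
    using eq up[OF u] up[OF u'] by blast
qed

lemma deriv_in_diff:
  assumes u: "\<And>r. r \<in> {0..t} \<Longrightarrow> u r \<in> car E" and v: "\<And>r. r \<in> {0..t} \<Longrightarrow> v r \<in> car E" and s: "s \<in> {0..t}"
    and du: "deriv_in E t u s d" and dv: "deriv_in E t v s e"
  shows "deriv_in E t (\<lambda>s. u s - v s) s (d - e)"
  unfolding deriv_in_def
proof
  have car: "d \<in> car E" "e \<in> car E" using du dv by (auto simp: deriv_in_def)
  then show "d - e \<in> car E" by (rule nspace_diff[OF normed])
  let ?q = "\<lambda>u r. (1 / (r - s)) *\<^sub>R (u r - u s)"
  show "((\<lambda>r. nrm E (?q (\<lambda>s. u s - v s) r - (d - e))) \<longlongrightarrow> 0) (at s within {0..t})"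
  proof (rule Lim_null_comparison)
    show "((\<lambda>r. nrm E (?q u r - d) + nrm E (?q v r - e)) \<longlongrightarrow> 0) (at s within {0..t})"
      using du dv by (intro tendsto_add_zero) (auto simp: deriv_in_def)
    have "norm (nrm E (?q (\<lambda>s. u s - v s) r - (d - e))) \<le> nrm E (?q u r - d) + nrm E (?q v r - e)" if r: "r \<in> {0..t}" for r
    proof -
      have q: "?q u r - d \<in> car E" "?q v r - e \<in> car E"
        using u[OF r] u[OF s] v[OF r] v[OF s] car by (auto intro!: nspace_diff[OF normed] nspace_scale[OF normed])
      have eq: "?q (\<lambda>s. u s - v s) r - (d - e) = (?q u r - d) - (?q v r - e)" by (simp add: algebra_simps)
      show ?thesis unfolding eq
        using nrm_triangle_diff[OF normed q(1) nspace_zero[OF normed] q(2)] nrm_minus_commute[OF normed nspace_zero[OF normed] q(2)]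
          nrm_nonneg[OF normed nspace_diff[OF normed q]] by simp
    qed
    then show "\<forall>\<^sub>F r in at s within {0..t}. norm (nrm E (?q (\<lambda>s. u s - v s) r - (d - e))) \<le> nrm E (?q u r - d) + nrm E (?q v r - e)"
      unfolding eventually_at_filter by (auto intro!: always_eventually)
  qed
qed

lemma C1_inE:
  assumes "C1_in E t u"
  obtains u' where "C0_in E t u" "C0_in E t u'" "\<And>s. s \<in> {0..t} \<Longrightarrow> deriv_in E t u s (u' s)"
  using assms unfolding C1_in_def by blast

lemma C1_in_diff:
  assumes "C1_in E t u" "C1_in E t v"
  shows "C1_in E t (\<lambda>s. u s - v s)"
proof -
  obtain u' where u: "C0_in E t u" "C0_in E t u'" "\<And>s. s \<in> {0..t} \<Longrightarrow> deriv_in E t u s (u' s)"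
    by (rule C1_inE[OF assms(1)]) blast
  obtain v' where v: "C0_in E t v" "C0_in E t v'" "\<And>s. s \<in> {0..t} \<Longrightarrow> deriv_in E t v s (v' s)"
    by (rule C1_inE[OF assms(2)]) blast
  have "deriv_in E t (\<lambda>s. u s - v s) s (u' s - v' s)" if "s \<in> {0..t}" for s
    by (rule deriv_in_diff[OF _ _ that u(3)[OF that] v(3)[OF that]]) (use u(1) v(1) in \<open>auto simp: C0_in_def\<close>)
  then show ?thesis
    unfolding C1_in_def using C0_in_diff[OF normed u(1) v(1)] C0_in_diff[OF normed u(2) v(2)]
    by (intro conjI exI[of _ "\<lambda>s. u' s - v' s"] ballI)
qed

lemma C1_in_0: "C1_in E t (\<lambda>s. 0)" and deriv_in_0: "deriv_in E t (\<lambda>s. 0) s 0" and C0_in_0: "C0_in E t (\<lambda>s. 0)"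
  using nspace_zero[OF normed] nrm_zero[OF normed]
  by (auto simp: C1_in_def C0_in_def deriv_in_def intro!: exI[of _ "\<lambda>s. 0"])

end

lemma Lim_op_bound:
  assumes E: "normed_nspace E" and F: "normed_nspace F" and W: "op_bound E F W K"
    and x: "eventually (\<lambda>r. x r \<in> car E) G" and lim: "((\<lambda>r. nrm E (x r)) \<longlongrightarrow> 0) G"
  shows "((\<lambda>r. nrm F (W (x r))) \<longlongrightarrow> 0) G"
proof (rule Lim_null_comparison)
  show "((\<lambda>r. K * nrm E (x r)) \<longlongrightarrow> 0) G" using lim by (rule tendsto_mult_right_zero)
  show "\<forall>\<^sub>F r in G. norm (nrm F (W (x r))) \<le> K * nrm E (x r)"
    using x by eventually_elim (use W nrm_nonneg[OF F] in \<open>auto simp: op_bound_def\<close>)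
qed

lemma C0_in_map:
  assumes E: "normed_nspace E" and F: "normed_nspace F" and W: "op_bound E F W K"
    and diff: "\<And>x y. W (x - y) = W x - W y" and u: "C0_in E t u"
  shows "C0_in F t (\<lambda>s. W (u s))"
  unfolding C0_in_def
proof (intro ballI conjI)
  fix s assume s: "s \<in> {0..t}"
  show "W (u s) \<in> car F" using u s W by (auto simp: C0_in_def op_bound_def)
  have "((\<lambda>r. nrm F (W (u r - u s))) \<longlongrightarrow> 0) (at s within {0..t})"
    by (rule Lim_op_bound[OF E F W])
       (use u s in \<open>auto simp: C0_in_def eventually_at_filter intro!: always_eventually nspace_diff[OF E]\<close>)
  then show "((\<lambda>r. nrm F (W (u r) - W (u s))) \<longlongrightarrow> 0) (at s within {0..t})" by (simp add: diff)
qed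

lemma deriv_in_map:
  assumes E: "normed_nspace E" and F: "normed_nspace F" and W: "op_bound E F W K"
    and diff: "\<And>x y. W (x - y) = W x - W y" and scale: "\<And>c x. W (c *\<^sub>R x) = c *\<^sub>R W x"
    and u: "\<And>r. r \<in> {0..t} \<Longrightarrow> u r \<in> car E" and s: "s \<in> {0..t}" and d: "deriv_in E t u s d"
  shows "deriv_in F t (\<lambda>s. W (u s)) s (W d)"
  unfolding deriv_in_def
proof
  have car: "d \<in> car E" using d by (simp add: deriv_in_def)
  show "W d \<in> car F" using car W by (simp add: op_bound_def)
  have "((\<lambda>r. nrm F (W ((1 / (r - s)) *\<^sub>R (u r - u s) - d))) \<longlongrightarrow> 0) (at s within {0..t})"
    by (rule Lim_op_bound[OF E F W])
       (use u s d car in \<open>auto simp: deriv_in_def eventually_at_filter intro!: always_eventually nspace_diff[OF E] nspace_scale[OF E]\<close>)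
  then show "((\<lambda>r. nrm F ((1 / (r - s)) *\<^sub>R (W (u r) - W (u s)) - W d)) \<longlongrightarrow> 0) (at s within {0..t})"
    by (simp add: diff scale)
qed

lemma C1_in_map:
  assumes "normed_subspace E" "normed_subspace F" and t: "0 < t" and W: "op_bound E F W K" and K: "0 \<le> K"
    and diff: "\<And>x y. W (x - y) = W x - W y" and scale: "\<And>c x. W (c *\<^sub>R x) = c *\<^sub>R W x"
    and u: "C1_in E t u"
  shows "C1_in F t (\<lambda>s. W (u s))" "C1_norm F t (\<lambda>s. W (u s)) \<le> K * C1_norm E t u"
proof -
  interpret E: normed_subspace E by fact
  interpret F: normed_subspace F by fact
  obtain u' where u: "C0_in E t u" "C0_in E t u'" "\<And>s. s \<in> {0..t} \<Longrightarrow> deriv_in E t u s (u' s)"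
    by (rule E.C1_inE[OF u]) blast
  have car: "u s \<in> car E" "u' s \<in> car E" if "s \<in> {0..t}" for s using u that by (auto simp: C0_in_def)
  have Wu: "C0_in F t (\<lambda>s. W (u s))" "C0_in F t (\<lambda>s. W (u' s))"
    by (intro C0_in_map[OF E.normed F.normed W diff] u)+
  have dWu: "deriv_in F t (\<lambda>s. W (u s)) s (W (u' s))" if "s \<in> {0..t}" for s
    by (rule deriv_in_map[OF E.normed F.normed W diff scale car(1) that u(3)[OF that]])
  show "C1_in F t (\<lambda>s. W (u s))"
    unfolding C1_in_def using Wu dWu by (intro conjI exI[of _ "\<lambda>s. W (u' s)"] ballI)
  obtain a b where ab: "C1_norm E t u = a + b" "\<forall>s\<in>{0..t}. nrm E (u s) \<le> a" "\<forall>s\<in>{0..t}. nrm E (u' s) \<le> b"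
    using E.C1_norm_bounds(5)[OF t u] by blast
  have "C1_norm F t (\<lambda>s. W (u s)) \<le> K * a + K * b"
  proof (rule F.C1_norm_bounds(3)[OF t Wu dWu])
    fix s assume s: "s \<in> {0..t}"
    have "nrm F (W (u s)) \<le> K * nrm E (u s)" "nrm F (W (u' s)) \<le> K * nrm E (u' s)"
      using W car[OF s] by (auto simp: op_bound_def)
    moreover have "K * nrm E (u s) \<le> K * a" "K * nrm E (u' s) \<le> K * b"
      using ab s K by (auto intro: mult_left_mono)
    ultimately show "nrm F (W (u s)) \<le> K * a" "nrm F (W (u' s)) \<le> K * b" by linarith+
  qed
  then show "C1_norm F t (\<lambda>s. W (u s)) \<le> K * C1_norm E t u" by (simp add: ab(1) algebra_simps)
qed

text \<open>The bound telescopes: C \<kappa>^n is the difference of consecutive terms of the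
  remainder r n = C / (1 - \<kappa>) \<kappa>^n.\<close>

lemma geometric_increments:
  assumes E: "normed_nspace E" and s: "\<And>n. s n \<in> car E" and \<kappa>: "0 \<le> \<kappa>" "\<kappa> < 1" and C: "0 \<le> C"
    and step: "\<And>n. nrm E (s (Suc n) - s n) \<le> C * \<kappa> ^ n" and nm: "n \<le> m"
  shows "nrm E (s m - s n) \<le> C / (1 - \<kappa>) * \<kappa> ^ n"
proof -
  define q where "q = C / (1 - \<kappa>)"
  define r where "r n = q * \<kappa> ^ n" for n
  have r: "C * \<kappa> ^ n = r n - r (Suc n)" for n
  proof -
    have "r n - r (Suc n) = q * (1 - \<kappa>) * \<kappa> ^ n" by (simp add: r_def algebra_simps)
    then show ?thesis using \<kappa> by (simp add: q_def)
  qed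
  have "nrm E (s (n + k) - s n) \<le> r n - r (n + k)" for k
  proof (induction k)
    case 0
    then show ?case by (simp add: nrm_zero[OF E])
  next
    case (Suc k)
    show ?case
      using nrm_triangle_diff[OF E s s s, of "Suc (n + k)" n "n + k"] step[of "n + k"] Suc r[of "n + k"] by simp
  qed
  from this[of "m - n"] have "nrm E (s m - s n) \<le> r n - r m" using nm by simp
  also have "\<dots> \<le> r n" using \<kappa> C by (simp add: r_def q_def)
  finally show ?thesis by (simp add: r_def q_def)
qed

lemma geometric_Cauchy:
  assumes E: "normed_nspace E" and s: "\<And>n. s n \<in> car E" and \<kappa>: "0 \<le> \<kappa>" "\<kappa> < 1" and C: "0 \<le> C"
    and step: "\<And>n. nrm E (s (Suc n) - s n) \<le> C * \<kappa> ^ n" and e: "0 < e"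
  shows "\<exists>N. \<forall>m\<ge>N. \<forall>n\<ge>N. nrm E (s m - s n) < e"
proof -
  have "(\<lambda>n. C / (1 - \<kappa>) * \<kappa> ^ n) \<longlonglongrightarrow> 0"
    using \<kappa> by (intro tendsto_mult_right_zero LIMSEQ_power_zero) auto
  then have "eventually (\<lambda>n. C / (1 - \<kappa>) * \<kappa> ^ n < e / 2) sequentially"
    using e by (intro order_tendstoD) auto
  then obtain N where N: "C / (1 - \<kappa>) * \<kappa> ^ N < e / 2" by (auto simp: eventually_sequentially)
  have close: "nrm E (s m - s N) < e / 2" if "m \<ge> N" for m
    by (rule order_le_less_trans[OF geometric_increments[OF E s \<kappa> C step that] N])
  have "nrm E (s m - s n) < e" if "m \<ge> N" "n \<ge> N" for m n
    using nrm_triangle_diff[OF E s s s, of m n N] close[OF that(1)] close[OF that(2)] nrm_minus_commute[OF E s s, of N n] by simp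
  then show ?thesis by blast
qed

lemma C0_in_whole: "C0_in whole t v \<longleftrightarrow> continuous_on {0..t} v"
  unfolding C0_in_def continuous_on_def
  by (auto simp: whole_def LIM_zero_iff tendsto_norm_zero_iff)

lemma deriv_in_whole: "deriv_in whole t v s d \<longleftrightarrow> (v has_vector_derivative d) (at s within {0..t})"
  by (simp add: deriv_in_def whole_def has_vector_derivative_iff_quotient divide_inverse
      LIM_zero_iff tendsto_norm_zero_iff)

text \<open>Since \<open>op_norm\<close> is an infimum, a strict inequality yields an actual bound
  below c once the set of bounds is known to be nonempty.\<close>

lemma op_norm_less:
  assumes "op_norm E F W < c" "\<exists>K\<ge>0. op_bound E F W K"
  obtains K where "0 \<le> K" "K < c" "op_bound E F W K"
proof -
  have "{K. 0 \<le> K \<and> op_bound E F W K} \<noteq> {}" using assms(2) by blast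
  from cInf_lessD[OF this] assms(1) show ?thesis using that unfolding op_norm_def by blast
qed

section \<open>The critical manifold\<close>

text \<open>\<open>Y\<delta>\<close> stands for the space of order 1 - \<delta>, in which the curves
  inserted into \<open>f\<close> have to be continuous; the space of the same name in
  \<open>fast_slow\<close> is the target of \<open>g\<close>. The slow scale is reduced here to two
  normed subspaces.\<close>

locale critical_manifold = generator_scale sc D A S 0 A sce j Z
  for sc :: "'k::real_normed_field \<Rightarrow> 'z::banach \<Rightarrow> 'z" and D A S and sce :: "'k \<Rightarrow> 'e::banach \<Rightarrow> 'e" and j Z +
  fixes Y1 Y\<delta> :: "'y::banach nspace" and f :: "'z \<Rightarrow> 'y \<Rightarrow> 'z" and \<gamma> \<delta> Lf T :: real
  assumes dense: "closure D = UNIV"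
    and \<gamma>: "0 < \<gamma>" "\<gamma> \<le> 1" and \<delta>: "0 < \<delta>" "\<delta> \<le> 1" and T: "0 < T"
    and Y1: "normed_nspace Y1" and Y1_embeds: "\<exists>K. \<forall>y\<in>car Y1. norm y \<le> K * nrm Y1 y"
    and Y\<delta>: "normed_nspace Y\<delta>" and Y1_Y\<delta>: "embeds Y1 Y\<delta>"
    and f_0: "f 0 0 = 0" and Lf: "0 < Lf"
    and f_range: "x \<in> car (level j Z 1) \<Longrightarrow> y \<in> car Y1 \<Longrightarrow> f x y \<in> car (level j Z \<gamma>)"
    and f_lipschitz: "x1 \<in> car (level j Z 1) \<Longrightarrow> x2 \<in> car (level j Z 1) \<Longrightarrow> y1 \<in> car Y1 \<Longrightarrow> y2 \<in> car Y1 \<Longrightarrow>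
      nrm (level j Z \<gamma>) (f x1 y1 - f x2 y2) \<le> Lf * (nrm (level j Z 1) (x1 - x2) + nrm Y1 (y1 - y2))"
    and f_C1: "C1_in (level j Z \<delta>) T u \<Longrightarrow> C1_in whole T v \<Longrightarrow> C0_in Y\<delta> T v \<Longrightarrow>
      C1_in (Z (\<delta> - 1)) T (\<lambda>s. j (f (u s) (v s)))"
    and f_C1_lipschitz: "C1_in (level j Z \<delta>) T u1 \<Longrightarrow> C1_in (level j Z \<delta>) T u2 \<Longrightarrow>
      C1_in whole T v1 \<Longrightarrow> C0_in Y\<delta> T v1 \<Longrightarrow> C1_in whole T v2 \<Longrightarrow> C0_in Y\<delta> T v2 \<Longrightarrow>
      C1_norm (Z (\<delta> - 1)) T (\<lambda>s. j (f (u1 s) (v1 s)) - j (f (u2 s) (v2 s)))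
        \<le> Lf * (C1_norm (level j Z \<delta>) T (\<lambda>s. u1 s - u2 s) + C1_norm whole T (\<lambda>s. v1 s - v2 s))"
    and small: "Lf * max (op_norm (level j Z \<gamma>) (level j Z 1) R)
      (op_norm (Z (\<delta> - 1)) (level j Z \<delta>) (inv (extended_operator D A j))) < 1"
begin

abbreviation "X1 \<equiv> level j Z 1"
abbreviation "X\<gamma> \<equiv> level j Z \<gamma>"
abbreviation "X\<delta> \<equiv> level j Z \<delta>"
abbreviation "Xm \<equiv> Z (\<delta> - 1)"
abbreviation "W \<equiv> inv (extended_operator D A j)"
abbreviation "h \<equiv> critical_map X1 A f"

lemma X1: "normed_nspace X1" and X\<gamma>: "normed_nspace X\<gamma>" and X\<delta>: "normed_nspace X\<delta>" and Xm: "normed_nspace Xm"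
  using \<gamma> \<delta> by (auto intro!: level_normed Z_normed)

lemma X1_embeds: obtains K where "K > 0" "\<And>x. x \<in> car X1 \<Longrightarrow> norm x \<le> K * nrm X1 x"
proof -
  obtain K where K: "\<And>x. x \<in> car X1 \<Longrightarrow> norm x \<le> K * nrm X1 x" using level_embeds[of 1] by auto
  have "norm x \<le> max K 1 * nrm X1 x" if "x \<in> car X1" for x
    by (rule order_trans[OF K[OF that] mult_right_mono]) (auto intro: nrm_nonneg[OF X1 that])
  then show ?thesis using that[of "max K 1"] by simp
qed

lemma R_op_bound: obtains K where "0 \<le> K" "Lf * K < 1" "op_bound X\<gamma> X1 R K"
proof -
  have "\<exists>K\<ge>0. op_bound X\<gamma> X1 R K"
  proof -
    obtain K1 where K1: "\<And>x. x \<in> car X\<gamma> \<Longrightarrow> norm x \<le> K1 * nrm X\<gamma> x" using level_embeds[of \<gamma>] \<gamma> by auto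
    obtain K2 where K2: "K2 > 0" "\<And>x. x \<in> D \<Longrightarrow> x \<in> car X1 \<and> nrm X1 x \<le> K2 * norm (A x)"
      using level_upper[of 1] by auto
    have "nrm X1 (R x) \<le> max (K2 * K1) 0 * nrm X\<gamma> x" if x: "x \<in> car X\<gamma>" for x
    proof -
      have "nrm X1 (R x) \<le> K2 * norm x" using K2(2)[of "R x"] by simp
      also have "\<dots> \<le> K2 * (K1 * nrm X\<gamma> x)" using K1[OF x] K2(1) by simp
      also have "\<dots> \<le> max (K2 * K1) 0 * nrm X\<gamma> x"
        using mult_right_mono[of "K2 * K1" "max (K2 * K1) 0" "nrm X\<gamma> x"] nrm_nonneg[OF X\<gamma> x] by (simp add: mult.assoc)
      finally show ?thesis .
    qed
    then have "op_bound X\<gamma> X1 R (max (K2 * K1) 0)" by (simp add: op_bound_def car_level_1)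
    then show ?thesis by (intro exI[of _ "max (K2 * K1) 0"]) simp
  qed
  moreover have "op_norm X\<gamma> X1 R < 1 / Lf"
  proof -
    have "max (op_norm X\<gamma> X1 R) (op_norm Xm X\<delta> W) < 1 / Lf" 
      unfolding pos_less_divide_eq[OF Lf] using small by (simp only: mult.commute)
    then show ?thesis by simp
  qed
  ultimately obtain K where "0 \<le> K" "K < 1 / Lf" "op_bound X\<gamma> X1 R K" using op_norm_less by blast
  then show ?thesis using that[of K] Lf by (simp add: field_simps)
qed

lemma W_op_bound: obtains K where "0 \<le> K" "Lf * K < 1" "op_bound Xm X\<delta> W K"
proof -
  have "op_norm Xm X\<delta> W < 1 / Lf"
  proof -
    have "max (op_norm X\<gamma> X1 R) (op_norm Xm X\<delta> W) < 1 / Lf" 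
      unfolding pos_less_divide_eq[OF Lf] using small by (simp only: mult.commute)
    then show ?thesis by simp
  qed
  with inv_ext_op_bound[OF dense \<delta>] obtain K where "0 \<le> K" "K < 1 / Lf" "op_bound Xm X\<delta> W K" using op_norm_less by blast
  then show ?thesis using that[of K] Lf by (simp add: field_simps)
qed

lemma R_diff: "R (x - y) = R x - R y"
  using R_add[of "x - y" y] by simp

lemma R_minus: "R (- x) = - R x"
  using R_scaleR[of "-1" x] by simp

lemma fixed_point_iff: "x \<in> car X1 \<Longrightarrow> A x + f x y = 0 \<longleftrightarrow> x = - R (f x y)"
proof -
  assume x: "x \<in> car X1"
  have "A x + f x y = 0 \<longleftrightarrow> A x = - f x y" by (rule eq_neg_iff_add_eq_0[symmetric])
  also have "\<dots> \<longleftrightarrow> x = R (- f x y)" using x car_level_1 by (metis G_R R_G)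
  finally show ?thesis by (simp add: R_minus)
qed

text \<open>One bound below 1 / \<open>Lf\<close> is fixed, so that the Lipschitz constant of the
  critical map is an explicit term.\<close>

definition contraction :: real where
  "contraction = Lf * (SOME K. 0 \<le> K \<and> Lf * K < 1 \<and> op_bound X\<gamma> X1 R K)"

lemma contraction: "0 \<le> contraction" "contraction < 1"
  "x1 \<in> car X1 \<Longrightarrow> x2 \<in> car X1 \<Longrightarrow> y1 \<in> car Y1 \<Longrightarrow> y2 \<in> car Y1 \<Longrightarrow>
    nrm X1 (- R (f x1 y1) - - R (f x2 y2)) \<le> contraction * (nrm X1 (x1 - x2) + nrm Y1 (y1 - y2))"
proof -
  define K where "K = (SOME K. 0 \<le> K \<and> Lf * K < 1 \<and> op_bound X\<gamma> X1 R K)"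
  have "\<exists>K. 0 \<le> K \<and> Lf * K < 1 \<and> op_bound X\<gamma> X1 R K" using R_op_bound by blast
  from someI_ex[OF this] have K: "0 \<le> K" "Lf * K < 1" "op_bound X\<gamma> X1 R K" by (auto simp: K_def)
  have eq: "contraction = Lf * K" by (simp add: contraction_def K_def)
  show "0 \<le> contraction" "contraction < 1" using K Lf by (auto simp: eq)
  assume xy: "x1 \<in> car X1" "x2 \<in> car X1" "y1 \<in> car Y1" "y2 \<in> car Y1"
  have car: "f x2 y2 - f x1 y1 \<in> car X\<gamma>" by (intro nspace_diff[OF X\<gamma>] f_range xy)
  have "- R (f x1 y1) - - R (f x2 y2) = R (f x2 y2 - f x1 y1)" by (simp add: R_diff)
  also have "nrm X1 \<dots> \<le> K * nrm X\<gamma> (f x2 y2 - f x1 y1)" using K(3) car by (simp add: op_bound_def)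
  also have "nrm X\<gamma> (f x2 y2 - f x1 y1) = nrm X\<gamma> (f x1 y1 - f x2 y2)" by (intro nrm_minus_commute[OF X\<gamma>] f_range xy)
  also have "K * \<dots> \<le> K * (Lf * (nrm X1 (x1 - x2) + nrm Y1 (y1 - y2)))" by (intro mult_left_mono f_lipschitz xy K)
  finally show "nrm X1 (- R (f x1 y1) - - R (f x2 y2)) \<le> contraction * (nrm X1 (x1 - x2) + nrm Y1 (y1 - y2))"
    by (simp add: eq mult_ac)
qed

lemma nrm_X1_definite: "x \<in> car X1 \<Longrightarrow> nrm X1 x \<le> 0 \<Longrightarrow> x = 0"
proof -
  assume x: "x \<in> car X1" "nrm X1 x \<le> 0"
  obtain K where "K > 0" "\<And>x. x \<in> car X1 \<Longrightarrow> norm x \<le> K * nrm X1 x" by (rule X1_embeds) blast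
  then have "norm x \<le> K * nrm X1 x" "K * nrm X1 x \<le> 0" using x by (auto simp: mult_nonneg_nonpos)
  then have "norm x \<le> 0" by (rule order_trans)
  then show "x = 0" by simp
qed

lemma neg_R_car: "- R x \<in> car X1"
  using nspace_scale[OF X1, of "R x" "-1"] by (simp add: car_level_1)

text \<open>The iterates themselves are needed, since their time derivatives along a curve are
  followed later. The start 0 is continuously differentiable in time for trivial reasons.\<close>

primrec picard :: "'y \<Rightarrow> nat \<Rightarrow> 'z" where
  "picard y 0 = 0"
| "picard y (Suc n) = - R (f (picard y n) y)"

lemma picard_car: "picard y n \<in> car X1"
  by (cases n) (auto simp: neg_R_car nspace_zero[OF X1])

lemma fixed_point_unique:
  assumes y: "y \<in> car Y1" and x: "x1 \<in> car X1" "x1 = - R (f x1 y)" "x2 \<in> car X1" "x2 = - R (f x2 y)"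
  shows "x1 = x2"
proof -
  have "nrm X1 (x1 - x2) \<le> contraction * nrm X1 (x1 - x2)"
    using contraction(3)[OF x(1,3) y y] x(2,4) by (simp add: nrm_zero[OF Y1])
  then have "(1 - contraction) * nrm X1 (x1 - x2) \<le> 0" by (simp add: algebra_simps)
  then have "nrm X1 (x1 - x2) \<le> 0" using contraction(2) by (simp add: mult_le_0_iff)
  then show ?thesis using nrm_X1_definite[OF nspace_diff[OF X1 x(1,3)]] by simp
qed

text \<open>The domain norm belongs to a subspace and not to a type, so the contraction argument is
  made by hand: consecutive iterates approach each other geometrically, and level 1 is
  complete.\<close>

lemma fixed_point_exists:
  assumes y: "y \<in> car Y1"
  shows "\<exists>x\<in>car X1. x = - R (f x y)"
proof -
  have step: "nrm X1 (picard y (Suc n) - picard y n) \<le> nrm X1 (picard y 1 - picard y 0) * contraction ^ n" for n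
  proof (induction n)
    case (Suc n)
    have "nrm X1 (picard y (Suc (Suc n)) - picard y (Suc n)) \<le> contraction * nrm X1 (picard y (Suc n) - picard y n)"
      using contraction(3)[OF picard_car picard_car y y, of y "Suc n" y n] by (simp add: nrm_zero[OF Y1])
    also have "\<dots> \<le> contraction * (nrm X1 (picard y 1 - picard y 0) * contraction ^ n)"
      by (intro mult_left_mono Suc contraction)
    finally show ?case by (simp only: power_Suc mult_ac)
  qed simp
  obtain l where l: "l \<in> car X1" "(\<lambda>n. nrm X1 (picard y n - l)) \<longlonglongrightarrow> 0"
    by (rule level_complete[of 1 "picard y"])
       (auto intro: picard_car geometric_Cauchy[OF X1 picard_car contraction(1,2) _ step]
        nrm_nonneg[OF X1 nspace_diff[OF X1 picard_car picard_car]])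
  let ?l' = "- R (f l y)"
  have l': "?l' \<in> car X1" by (rule neg_R_car)
  have "(\<lambda>n. nrm X1 (l - ?l')) \<longlonglongrightarrow> 0"
  proof (rule Lim_null_comparison)
    show "(\<lambda>n. nrm X1 (picard y (Suc n) - l) + contraction * nrm X1 (picard y n - l)) \<longlonglongrightarrow> 0"
      by (intro tendsto_add_zero tendsto_mult_right_zero l LIMSEQ_Suc)
    have "norm (nrm X1 (l - ?l')) \<le> nrm X1 (picard y (Suc n) - l) + contraction * nrm X1 (picard y n - l)" for n
    proof -
      have "nrm X1 (picard y (Suc n) - ?l') \<le> contraction * nrm X1 (picard y n - l)"
        using contraction(3)[OF picard_car l(1) y y, of y n] by (simp add: nrm_zero[OF Y1])
      moreover have "nrm X1 (l - ?l') \<le> nrm X1 (l - picard y (Suc n)) + nrm X1 (picard y (Suc n) - ?l')"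
        by (rule nrm_triangle_diff[OF X1 l(1) picard_car l'])
      ultimately show ?thesis
        using nrm_minus_commute[OF X1 l(1) picard_car, of y "Suc n"] nrm_nonneg[OF X1 nspace_diff[OF X1 l(1) l']] by simp
    qed
    then show "\<forall>\<^sub>F n in sequentially. norm (nrm X1 (l - ?l')) \<le> nrm X1 (picard y (Suc n) - l) + contraction * nrm X1 (picard y n - l)"
      by simp
  qed
  then have le: "nrm X1 (l - ?l') \<le> 0" by (simp only: LIMSEQ_const_iff)
  have "l - ?l' = 0" by (rule nrm_X1_definite[OF nspace_diff[OF X1 l(1) l'] le])
  then have "l = ?l'" by (simp only: right_minus_eq)
  then show ?thesis using l(1) by blast
qed

lemma h_eq:
  assumes y: "y \<in> car Y1" and x: "x \<in> car X1" "A x + f x y = 0"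
  shows "h y = x"
  unfolding critical_map_def
proof (rule the_equality)
  show "x \<in> car X1 \<and> 0 = A x + f x y" using x by simp
  show "x' = x" if "x' \<in> car X1 \<and> 0 = A x' + f x' y" for x'
    using fixed_point_unique[OF y, of x' x] fixed_point_iff that x by auto
qed

lemma h_range: "h y \<in> car X1" and h_equation: "A (h y) + f (h y) y = 0" if y: "y \<in> car Y1"
proof -
  obtain x where x: "x \<in> car X1" "A x + f x y = 0" using fixed_point_exists[OF y] fixed_point_iff by blast
  then show "h y \<in> car X1" "A (h y) + f (h y) y = 0" using h_eq[OF y x] by simp_all
qed

lemma h_fixed: "y \<in> car Y1 \<Longrightarrow> - R (f (h y) y) = h y"
  using fixed_point_iff[OF h_range] h_equation by simp

lemma h_0: "h 0 = 0"
proof (rule h_eq)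
  show "A 0 + f 0 0 = 0" using A_scaleR[of 0 0] nspace_zero[OF X1] f_0 car_level_1 by simp
qed (simp_all add: nspace_zero[OF X1] nspace_zero[OF Y1])

lemma h_lipschitz:
  assumes y: "y1 \<in> car Y1" "y2 \<in> car Y1"
  shows "nrm X1 (h y1 - h y2) \<le> contraction / (1 - contraction) * nrm Y1 (y1 - y2)"
proof -
  have "nrm X1 (h y1 - h y2) \<le> contraction * (nrm X1 (h y1 - h y2) + nrm Y1 (y1 - y2))"
    using contraction(3)[OF h_range[OF y(1)] h_range[OF y(2)] y] by (simp only: h_fixed[OF y(1)] h_fixed[OF y(2)])
  then have "nrm X1 (h y1 - h y2) * (1 - contraction) \<le> contraction * nrm Y1 (y1 - y2)" by (simp add: algebra_simps)
  then show ?thesis using contraction(2) by (simp add: pos_le_divide_eq)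
qed

lemma picard_limit: "nrm X1 (picard y n - h y) \<le> contraction ^ n * nrm X1 (h y)" if y: "y \<in> car Y1"
proof (induction n)
  case 0
  show ?case using nrm_minus_commute[OF X1 nspace_zero[OF X1] h_range[OF y]] by simp
next
  case (Suc n)
  have "nrm X1 (picard y (Suc n) - h y) \<le> contraction * nrm X1 (picard y n - h y)"
    using contraction(3)[OF picard_car h_range[OF y] y y, of y n] h_fixed[OF y] by (simp add: nrm_zero[OF Y1])
  also have "\<dots> \<le> contraction * (contraction ^ n * nrm X1 (h y))" by (intro mult_left_mono Suc contraction)
  finally show ?case by simp
qed

sublocale Xd: normed_subspace X\<delta>
proof
  show "x = 0" if "x \<in> car X\<delta>" "nrm X\<delta> x = 0" for x
    using level_embeds[of \<delta>] \<delta> that by fastforce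
qed (rule X\<delta>)

sublocale Xm: normed_subspace Xm
proof
  have "banach_subspace sce Xm" using \<delta> by (intro Z_banach) auto
  then show "x = 0" if "x \<in> car Xm" "nrm Xm x = 0" for x
    using that unfolding banach_subspace_def by blast
qed (rule Xm)

sublocale Yw: normed_subspace "whole :: 'y nspace"
  by standard (auto simp: whole_def normed_nspace_def norm_triangle_ineq subspace_UNIV)

end

section \<open>Differentiability of the critical map along curves\<close>

context critical_manifold
begin

lemma X\<delta>_embeds: obtains K where "K > 0" "\<And>x. x \<in> car X\<delta> \<Longrightarrow> norm x \<le> K * nrm X\<delta> x"
proof -
  obtain K where K: "\<And>x. x \<in> car X\<delta> \<Longrightarrow> norm x \<le> K * nrm X\<delta> x" using level_embeds[of \<delta>] \<delta> by auto
  have "norm x \<le> max K 1 * nrm X\<delta> x" if "x \<in> car X\<delta>" for x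
    by (rule order_trans[OF K[OF that] mult_right_mono]) (auto intro: nrm_nonneg[OF X\<delta> that])
  then show ?thesis using that[of "max K 1"] by simp
qed

lemma deriv_in_X\<delta>_has_vector_derivative:
  assumes u: "\<And>r. r \<in> {0..t} \<Longrightarrow> u r \<in> car X\<delta>" and s: "s \<in> {0..t}" and d: "deriv_in X\<delta> t u s d"
  shows "(u has_vector_derivative d) (at s within {0..t})"
proof -
  obtain K where K: "K > 0" "\<And>x. x \<in> car X\<delta> \<Longrightarrow> norm x \<le> K * nrm X\<delta> x" by (rule X\<delta>_embeds) blast
  have "op_bound X\<delta> whole (\<lambda>x. x) K" using K by (simp add: op_bound_def whole_def)
  from deriv_in_map[OF X\<delta> _ this _ _ u s d] have "deriv_in whole t u s d"
    by (simp add: whole_def normed_nspace_def norm_triangle_ineq)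
  then show ?thesis by (simp add: deriv_in_whole)
qed

text \<open>
  The Picard iterates converge to \<open>h\<close> in \<open>X1\<close>, while their time derivatives form a Cauchy sequence
  in \<open>X\<delta>\<close> by the second smallness condition.
\<close>

lemma h_C1:
  "\<exists>K. \<forall>v v'. C0_in Y1 T v \<and> continuous_on {0..T} v' \<and>
      (\<forall>s\<in>{0..T}. (v has_vector_derivative v' s) (at s within {0..T})) \<longrightarrow>
      (\<exists>d. C0_in X\<delta> T d \<and> (\<forall>s\<in>{0..T}. ((\<lambda>s. h (v s)) has_vector_derivative d s) (at s within {0..T})) \<and>
        (\<forall>b. (\<forall>s\<in>{0..T}. norm (v s) \<le> b \<and> norm (v' s) \<le> b) \<longrightarrow> (\<forall>s\<in>{0..T}. nrm X\<delta> (d s) \<le> K * b)))"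
proof -
  obtain K where K: "0 \<le> K" "Lf * K < 1" and W: "op_bound Xm X\<delta> W K" by (rule W_op_bound) blast
  define \<kappa> where "\<kappa> = Lf * K"
  have \<kappa>: "0 \<le> \<kappa>" "\<kappa> < 1" using K Lf by (auto simp: \<kappa>_def)
  \<comment> \<open>With the extrapolated inverse, the iteration reads u (n + 1) = \<open>V\<close>
    (j (f (u n) v)); it agrees with the iteration through \<open>R\<close> because the extrapolated
    inverse extends \<open>R\<close>. Only this form acts on time derivatives, which lie in the
    space of order \<delta> - 1.\<close>
  define V where "V x = - W x" for x
  have V_diff: "V (x - y) = V x - V y" and V_scale: "V (c *\<^sub>R x) = c *\<^sub>R V x" for x y c
    by (simp_all add: V_def inv_ext_diff[OF dense] inv_ext_scaleR[OF dense])
  have V: "op_bound Xm X\<delta> V K"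
    unfolding op_bound_def V_def
  proof (intro ballI conjI)
    fix x assume "x \<in> car Xm"
    then have "W x \<in> car X\<delta>" "nrm X\<delta> (W x) \<le> K * nrm Xm x" using W by (auto simp: op_bound_def)
    then show "- W x \<in> car X\<delta>" "nrm X\<delta> (- W x) \<le> K * nrm Xm x"
      using nspace_scale[OF X\<delta>, of "W x" "-1"] nrm_scale[OF X\<delta>, of "W x" "-1"] by auto
  qed
  note V_C1 = C1_in_map[OF Xm.normed_subspace_axioms Xd.normed_subspace_axioms T V K(1) V_diff V_scale]
  show ?thesis
  proof (rule exI[of _ "\<kappa> / (1 - \<kappa>) * 2"], intro allI impI, elim conjE)
    fix v v' assume v: "C0_in Y1 T v" and v': "continuous_on {0..T} v'"
      and dv: "\<forall>s\<in>{0..T}. (v has_vector_derivative v' s) (at s within {0..T})"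
    obtain K1 where K1: "\<And>y. y \<in> car Y1 \<Longrightarrow> norm y \<le> K1 * nrm Y1 y" using Y1_embeds by blast
    have v_cont: "continuous_on {0..T} v" by (rule C0_in_continuous_on[OF K1 Y1 v])
    have v_C1: "C1_in whole T v"
      unfolding C1_in_def C0_in_whole deriv_in_whole using v_cont v' dv by blast
    have v_car: "v s \<in> car Y1" if "s \<in> {0..T}" for s using v that by (auto simp: C0_in_def)
    have v_\<delta>: "C0_in Y\<delta> T v"
    proof -
      obtain K2 where "op_bound Y1 Y\<delta> (\<lambda>x. x) K2" using Y1_Y\<delta> unfolding embeds_def op_bound_def by blast
      from C0_in_map[OF Y1 Y\<delta> this _ v] show ?thesis by simp
    qed
    define u where "u n s = picard (v s) n" for n s
    define G where "G n s = j (f (u n s) (v s))" for n s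
    have u_Suc: "u (Suc n) = (\<lambda>s. V (G n s))" for n
      by (simp add: u_def[abs_def] G_def V_def inv_ext_j[OF dense])
    have u_C1: "C1_in X\<delta> T (u n)" for n
    proof (induction n)
      case 0
      show ?case using Xd.C1_in_0 by (simp add: u_def[abs_def])
    next
      case (Suc n)
      have "C1_in Xm T (G n)" unfolding G_def[abs_def] by (rule f_C1[OF Suc v_C1 v_\<delta>])
      then show ?case unfolding u_Suc by (rule V_C1(1))
    qed
    have G_C1: "C1_in Xm T (G n)" for n unfolding G_def[abs_def] by (rule f_C1[OF u_C1 v_C1 v_\<delta>])
    have "\<forall>n. \<exists>D. C0_in X\<delta> T (u n) \<and> C0_in X\<delta> T D \<and> (\<forall>s\<in>{0..T}. deriv_in X\<delta> T (u n) s (D s))"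
      using u_C1 unfolding C1_in_def by blast
    then obtain D where D: "\<And>n. C0_in X\<delta> T (u n)" "\<And>n. C0_in X\<delta> T (D n)"
      "\<And>n s. s \<in> {0..T} \<Longrightarrow> deriv_in X\<delta> T (u n) s (D n s)" by metis
    have u_car: "u n s \<in> car X\<delta>" and D_car: "D n s \<in> car X\<delta>" if "s \<in> {0..T}" for n s
      using D(1)[of n] D(2)[of n] that by (auto simp: C0_in_def)
    have zero_norm: "C1_norm whole T (\<lambda>s. 0 :: 'y) = 0"
    proof -
      have "C1_norm whole T (\<lambda>s. 0 :: 'y) \<le> 0 + 0"
        by (rule Yw.C1_norm_bounds(3)[OF T Yw.C0_in_0 Yw.C0_in_0 Yw.deriv_in_0]) (simp_all add: whole_def)
      then show ?thesis using Yw.C1_norm_bounds(4)[OF T Yw.C0_in_0 Yw.C0_in_0 Yw.deriv_in_0] by simp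
    qed
    \<comment> \<open>For consecutive iterates the curve \<open>v\<close> is the same, so its term
      in the Lipschitz estimate drops out and N contracts by \<kappa>.\<close>
    define N where "N n = C1_norm X\<delta> T (\<lambda>s. u (Suc n) s - u n s)" for n
    have N_step: "N (Suc n) \<le> \<kappa> * N n" for n
    proof -
      have "N (Suc n) = C1_norm X\<delta> T (\<lambda>s. V (G (Suc n) s - G n s))"
        by (simp add: N_def u_Suc[of "Suc n"] u_Suc[of n] V_diff)
      also have "\<dots> \<le> K * C1_norm Xm T (\<lambda>s. G (Suc n) s - G n s)"
        by (rule V_C1(2)[OF Xm.C1_in_diff[OF G_C1 G_C1]])
      also have "\<dots> \<le> K * (Lf * (N n + C1_norm whole T (\<lambda>s. v s - v s)))"
        unfolding G_def N_def by (intro mult_left_mono f_C1_lipschitz u_C1 v_C1 v_\<delta> K)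
      finally show ?thesis by (simp add: zero_norm \<kappa>_def mult_ac)
    qed
    have N_le: "N n \<le> N 0 * \<kappa> ^ n" for n
    proof (induction n)
      case (Suc n)
      show ?case using order_trans[OF N_step mult_left_mono[OF Suc \<kappa>(1)]] by (simp add: mult_ac)
    qed simp
    define B where "B = C1_norm whole T v"
    have B: "0 \<le> B"
      unfolding B_def by (rule Yw.C1_norm_bounds(4)[OF T, where u' = v']) (use v_cont v' dv in \<open>auto simp: C0_in_whole deriv_in_whole\<close>)
    \<comment> \<open>The bound is the fixed point of m \<mapsto> \<kappa> (m + B); the iteration
      starts below it, at 0.\<close>
    have M_le: "C1_norm X\<delta> T (u n) \<le> \<kappa> / (1 - \<kappa>) * B" for n
    proof (induction n)
      case 0
      have "C1_norm X\<delta> T (\<lambda>s. 0) \<le> 0 + 0"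
        by (rule Xd.C1_norm_bounds(3)[OF T Xd.C0_in_0 Xd.C0_in_0 Xd.deriv_in_0]) (simp_all add: nrm_zero[OF X\<delta>])
      moreover have "0 \<le> \<kappa> / (1 - \<kappa>) * B" using \<kappa> B by simp
      ultimately show ?case by (simp add: u_def[abs_def])
    next
      case (Suc n)
      have "C1_norm X\<delta> T (u (Suc n)) \<le> K * C1_norm Xm T (G n)"
        unfolding u_Suc by (rule V_C1(2)[OF G_C1])
      also have "C1_norm Xm T (G n) \<le> Lf * (C1_norm X\<delta> T (u n) + B)"
      proof -
        have "C0_in Y\<delta> T (\<lambda>s. 0)" using nspace_zero[OF Y\<delta>] nrm_zero[OF Y\<delta>] by (simp add: C0_in_def)
        from f_C1_lipschitz[OF u_C1[of n] Xd.C1_in_0 v_C1 v_\<delta> Yw.C1_in_0 this]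
        show ?thesis by (simp add: f_0 j_0 G_def[abs_def] B_def)
      qed
      also have "K * (Lf * (C1_norm X\<delta> T (u n) + B)) = \<kappa> * (C1_norm X\<delta> T (u n) + B)" by (simp add: \<kappa>_def)
      also have "\<dots> \<le> \<kappa> * (\<kappa> / (1 - \<kappa>) * B + B)" using Suc \<kappa> by (intro mult_left_mono add_right_mono) auto
      also have "\<kappa> / (1 - \<kappa>) * B + B = (\<kappa> / (1 - \<kappa>) + 1) * B" by (simp only: distrib_right mult_1)
      also have "\<kappa> / (1 - \<kappa>) + 1 = 1 / (1 - \<kappa>)" using \<kappa> by (simp add: field_simps)
      finally show ?case using K(1) by (simp add: mult_left_mono)
    qed
    have D_step: "nrm X\<delta> (D (Suc n) s - D n s) \<le> N 0 * \<kappa> ^ n" if s: "s \<in> {0..T}" for n s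
    proof -
      have "nrm X\<delta> (D (Suc n) s - D n s) \<le> N n"
        unfolding N_def
        by (rule Xd.C1_norm_bounds(2)[OF T C0_in_diff[OF X\<delta> D(1) D(1)] C0_in_diff[OF X\<delta> D(2)[of "Suc n"] D(2)[of n]] _ s])
           (intro Xd.deriv_in_diff u_car D(3))
      then show ?thesis using N_le by (rule order_trans)
    qed
    have N0: "0 \<le> N 0"
      unfolding N_def
      by (rule Xd.C1_norm_bounds(4)[OF T C0_in_diff[OF X\<delta> D(1) D(1)] C0_in_diff[OF X\<delta> D(2)[of "Suc 0"] D(2)[of 0]]])
         (intro Xd.deriv_in_diff u_car D(3))
    have "\<forall>s\<in>{0..T}. \<exists>l\<in>car X\<delta>. (\<lambda>n. nrm X\<delta> (D n s - l)) \<longlonglongrightarrow> 0"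
    proof
      fix s assume s: "s \<in> {0..T}"
      show "\<exists>l\<in>car X\<delta>. (\<lambda>n. nrm X\<delta> (D n s - l)) \<longlonglongrightarrow> 0"
      proof (rule level_complete[of \<delta> "\<lambda>n. D n s"])
        show "\<exists>N. \<forall>m\<ge>N. \<forall>n\<ge>N. nrm X\<delta> (D m s - D n s) < e" if "0 < e" for e
          by (rule geometric_Cauchy[where s = "\<lambda>n. D n s", OF X\<delta> D_car[OF s] \<kappa> N0 D_step[OF s] that])
      qed (use \<delta> D_car[OF s] in auto)
    qed
    then obtain d where d: "\<And>s. s \<in> {0..T} \<Longrightarrow> d s \<in> car X\<delta>"
      "\<And>s. s \<in> {0..T} \<Longrightarrow> (\<lambda>n. nrm X\<delta> (D n s - d s)) \<longlonglongrightarrow> 0" by metis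
    define r where "r n = N 0 / (1 - \<kappa>) * \<kappa> ^ n" for n
    have r: "r \<longlonglongrightarrow> 0"
      unfolding r_def using \<kappa> by (intro tendsto_mult_right_zero LIMSEQ_power_zero) auto
    \<comment> \<open>The rate \<open>r n\<close> does not depend on \<open>s\<close>. This
      uniformity gives both the continuity of the limit \<open>d\<close> and the differentiation of
      the limit of the iterates.\<close>
    have D_d: "nrm X\<delta> (D n s - d s) \<le> r n" if s: "s \<in> {0..T}" for n s
    proof -
      have "(\<lambda>m. r n + nrm X\<delta> (D m s - d s)) \<longlonglongrightarrow> r n + 0" by (intro tendsto_add tendsto_const d(2) s)
      moreover have "nrm X\<delta> (D n s - d s) \<le> r n + nrm X\<delta> (D m s - d s)" if "n \<le> m" for m
      proof -
        have "nrm X\<delta> (D m s - D n s) \<le> r n"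
          unfolding r_def by (rule geometric_increments[where s = "\<lambda>n. D n s", OF X\<delta> D_car[OF s] \<kappa> N0 D_step[OF s] that])
        then show ?thesis
          using nrm_triangle_diff[OF X\<delta> D_car[OF s] D_car[OF s] d(1)[OF s], of n m]
            nrm_minus_commute[OF X\<delta> D_car[OF s] D_car[OF s], of n m] by simp
      qed
      ultimately have "nrm X\<delta> (D n s - d s) \<le> r n + 0" by (intro LIMSEQ_le_const) auto
      then show ?thesis by simp
    qed
    have d_C0: "C0_in X\<delta> T d"
      unfolding C0_in_def
    proof (intro ballI conjI d(1))
      fix s assume s: "s \<in> {0..T}"
      show "((\<lambda>q. nrm X\<delta> (d q - d s)) \<longlongrightarrow> 0) (at s within {0..T})"
      proof (rule tendstoI)
        fix e :: real assume e: "0 < e"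
        have "eventually (\<lambda>n. r n < e / 3) sequentially" using r e by (intro order_tendstoD) auto
        then obtain n where n: "r n < e / 3" by (auto simp: eventually_sequentially)
        have "((\<lambda>q. nrm X\<delta> (D n q - D n s)) \<longlongrightarrow> 0) (at s within {0..T})" using D(2)[of n] s by (auto simp: C0_in_def)
        then have "eventually (\<lambda>q. nrm X\<delta> (D n q - D n s) < e / 3) (at s within {0..T})" using e by (intro order_tendstoD) auto
        moreover have "eventually (\<lambda>q. q \<in> {0..T}) (at s within {0..T})"
          unfolding eventually_at_filter by (auto intro!: always_eventually)
        ultimately show "eventually (\<lambda>q. dist (nrm X\<delta> (d q - d s)) 0 < e) (at s within {0..T})"
        proof eventually_elim
          case (elim q)
          have "nrm X\<delta> (d q - d s) \<le> nrm X\<delta> (d q - D n q) + (nrm X\<delta> (D n q - D n s) + nrm X\<delta> (D n s - d s))"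
            using nrm_triangle_diff[OF X\<delta> d(1)[OF elim(2)] D_car[OF elim(2)] d(1)[OF s], of n]
              nrm_triangle_diff[OF X\<delta> D_car[OF elim(2)] D_car[OF s] d(1)[OF s], of n n] by simp
          also have "\<dots> < e"
            using D_d[OF elim(2), of n] D_d[OF s, of n] n elim(1) nrm_minus_commute[OF X\<delta> d(1)[OF elim(2)] D_car[OF elim(2)], of n] by simp
          finally show ?case using nrm_nonneg[OF X\<delta> nspace_diff[OF X\<delta> d(1)[OF elim(2)] d(1)[OF s]]] by simp
        qed
      qed
    qed
    have d_le: "nrm X\<delta> (d s) \<le> \<kappa> / (1 - \<kappa>) * B" if s: "s \<in> {0..T}" for s
    proof -
      have "nrm X\<delta> (d s) \<le> \<kappa> / (1 - \<kappa>) * B + nrm X\<delta> (D n s - d s)" for n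
        using nrm_triangle_sub[OF X\<delta> d(1)[OF s] D_car[OF s], of n] nrm_minus_commute[OF X\<delta> d(1)[OF s] D_car[OF s], of n]
          Xd.C1_norm_bounds(2)[OF T D(1) D(2) D(3) s, of n] M_le[of n] by simp
      moreover have "(\<lambda>n. \<kappa> / (1 - \<kappa>) * B + nrm X\<delta> (D n s - d s)) \<longlonglongrightarrow> \<kappa> / (1 - \<kappa>) * B + 0"
        by (intro tendsto_add tendsto_const d(2) s)
      ultimately have "nrm X\<delta> (d s) \<le> \<kappa> / (1 - \<kappa>) * B + 0" by (intro LIMSEQ_le_const) auto
      then show ?thesis by simp
    qed
    obtain KX where KX: "KX > 0" "\<And>x. x \<in> car X\<delta> \<Longrightarrow> norm x \<le> KX * nrm X\<delta> x" by (rule X\<delta>_embeds) blast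
    obtain K1 where K1: "K1 > 0" "\<And>x. x \<in> car X1 \<Longrightarrow> norm x \<le> K1 * nrm X1 x" by (rule X1_embeds) blast
    have u_lim: "(\<lambda>n. u n s) \<longlonglongrightarrow> h (v s)" if s: "s \<in> {0..T}" for s
    proof -
      have "(\<lambda>n. u n s - h (v s)) \<longlonglongrightarrow> 0"
      proof (rule Lim_null_comparison)
        show "(\<lambda>n. K1 * (contraction ^ n * nrm X1 (h (v s)))) \<longlonglongrightarrow> 0"
          using contraction by (intro tendsto_mult_right_zero tendsto_mult_left_zero LIMSEQ_power_zero) auto
        have "norm (u n s - h (v s)) \<le> K1 * (contraction ^ n * nrm X1 (h (v s)))" for n
          unfolding u_def
          by (rule order_trans[OF K1(2)[OF nspace_diff[OF X1 picard_car h_range[OF v_car[OF s]]]]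
                mult_left_mono[OF picard_limit[OF v_car[OF s]] less_imp_le[OF K1(1)]]])
        then show "\<forall>\<^sub>F n in sequentially. norm (u n s - h (v s)) \<le> K1 * (contraction ^ n * nrm X1 (h (v s)))" by simp
      qed
      then show ?thesis by (simp add: LIM_zero_iff)
    qed
    \<comment> \<open>The derivatives converge uniformly in the ambient norm, and convergence of the
      iterates at time 0 suffices to start the theorem; its limit function is then identified with
      the critical map along \<open>v\<close>.\<close>
    have "\<exists>g. \<forall>s\<in>{0..T}. (\<lambda>n. u n s) \<longlonglongrightarrow> g s \<and> (g has_derivative (\<lambda>q. q *\<^sub>R d s)) (at s within {0..T})"
    proof (rule has_derivative_sequence[where f' = "\<lambda>n s q. q *\<^sub>R D n s"])
      show "convex {0..T}" by simp
      show "(u n has_derivative (\<lambda>q. q *\<^sub>R D n s)) (at s within {0..T})" if "s \<in> {0..T}" for n s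
        using deriv_in_X\<delta>_has_vector_derivative[OF u_car that D(3)[OF that]] by (simp add: has_vector_derivative_def)
      show "\<forall>\<^sub>F n in sequentially. \<forall>s\<in>{0..T}. \<forall>q. norm (q *\<^sub>R D n s - q *\<^sub>R d s) \<le> e * norm q" if e: "0 < e" for e
      proof -
        have "eventually (\<lambda>n. KX * r n < e) sequentially"
          using tendsto_mult_right_zero[OF r, of KX] e by (intro order_tendstoD) auto
        then show ?thesis
        proof eventually_elim
          case (elim n)
          show ?case
          proof (intro ballI allI)
            fix s q assume s: "s \<in> {0..T}"
            have "norm (D n s - d s) \<le> KX * nrm X\<delta> (D n s - d s)" by (intro KX nspace_diff[OF X\<delta>] D_car d s)
            also have "\<dots> \<le> KX * r n" using D_d[OF s] KX by (intro mult_left_mono) auto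
            finally have "norm (D n s - d s) \<le> e" using elim by simp
            then show "norm (q *\<^sub>R D n s - q *\<^sub>R d s) \<le> e * norm q"
              using mult_left_mono[of "norm (D n s - d s)" e "norm q"]
              by (simp add: mult.commute flip: scaleR_diff_right)
          qed
        qed
      qed
      show "0 \<in> {0..T}" using T by simp
      show "(\<lambda>n. u n 0) \<longlonglongrightarrow> h (v 0)" by (rule u_lim) (use T in simp)
    qed
    then obtain g where g: "\<And>s. s \<in> {0..T} \<Longrightarrow> (\<lambda>n. u n s) \<longlonglongrightarrow> g s"
      "\<And>s. s \<in> {0..T} \<Longrightarrow> (g has_vector_derivative d s) (at s within {0..T})"
      unfolding has_vector_derivative_def by blast
    have hv: "((\<lambda>s. h (v s)) has_vector_derivative d s) (at s within {0..T})" if s: "s \<in> {0..T}" for s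
      by (rule has_vector_derivative_transform[OF s _ g(2)[OF s]]) (rule LIMSEQ_unique[OF u_lim g(1)])
    have nrm_whole: "nrm whole y = norm y" for y :: 'y by (simp add: whole_def)
    have "nrm X\<delta> (d s) \<le> \<kappa> / (1 - \<kappa>) * 2 * b" if b: "\<forall>s\<in>{0..T}. norm (v s) \<le> b \<and> norm (v' s) \<le> b" and s: "s \<in> {0..T}" for b s
    proof -
      \<comment> \<open>The two summands are the suprema of \<open>v\<close> and of
        \<open>v'\<close>, whence the factor 2 in the constant.\<close>
      have "B \<le> b + b"
        unfolding B_def by (rule Yw.C1_norm_bounds(3)[OF T, where u' = v'])
          (use v_cont v' dv b in \<open>auto simp: C0_in_whole deriv_in_whole nrm_whole\<close>)
      then have "\<kappa> / (1 - \<kappa>) * B \<le> \<kappa> / (1 - \<kappa>) * (b + b)" using \<kappa> by (intro mult_left_mono) auto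
      then show ?thesis using d_le[OF s] by simp
    qed
    then show "\<exists>d. C0_in X\<delta> T d \<and> (\<forall>s\<in>{0..T}. ((\<lambda>s. h (v s)) has_vector_derivative d s) (at s within {0..T})) \<and>
        (\<forall>b. (\<forall>s\<in>{0..T}. norm (v s) \<le> b \<and> norm (v' s) \<le> b) \<longrightarrow> (\<forall>s\<in>{0..T}. nrm X\<delta> (d s) \<le> \<kappa> / (1 - \<kappa>) * 2 * b))"
      using d_C0 hv by (intro exI[of _ d] conjI ballI allI impI) auto
  qed
qed

end

text \<open>For \<gamma> < 1 the formula for \<omega>f amounts to (\<omega>f - \<omega>A) powr
  \<gamma> = 2 C L \<gamma> powr (\<gamma> - 1). The factors before (2 - \<gamma>) then multiply to
  1/2, and the rate is 1 - \<gamma>/2. For \<gamma> = 1 it is C L / (\<omega>f - \<omega>A).\<close>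

lemma contraction_rate_less:
  fixes \<gamma> C L \<omega>A \<omega>f :: real
  assumes \<gamma>: "0 < \<gamma>" "\<gamma> \<le> 1" and C: "0 < C" and L: "0 < L"
    and lt1: "\<gamma> < 1 \<Longrightarrow> \<omega>f = \<omega>A + (2 * C * L) powr (1 / \<gamma>) * (1 / \<gamma>) powr ((1 - \<gamma>) / \<gamma>)"
    and eq1: "\<gamma> = 1 \<Longrightarrow> \<omega>f > \<omega>A + C * L"
  shows "\<omega>A < \<omega>f" "C * L * (\<omega>f - \<omega>A) powr - \<gamma> * \<gamma> powr (\<gamma> - 1) * (2 - \<gamma>) < 1"
proof -
  have CL: "0 < C * L" using C L by simp
  have "\<omega>A < \<omega>f \<and> C * L * (\<omega>f - \<omega>A) powr - \<gamma> * \<gamma> powr (\<gamma> - 1) * (2 - \<gamma>) < 1"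
  proof (cases "\<gamma> = 1")
    case True
    then have "C * L < \<omega>f - \<omega>A" using eq1 by simp
    then show ?thesis using True CL by (simp add: powr_minus_divide)
  next
    case False
    then have \<gamma>1: "\<gamma> < 1" using \<gamma> by simp
    define \<eta> where "\<eta> = \<omega>f - \<omega>A"
    have \<eta>: "\<eta> = (2 * C * L) powr (1 / \<gamma>) * (1 / \<gamma>) powr ((1 - \<gamma>) / \<gamma>)" using lt1[OF \<gamma>1] by (simp add: \<eta>_def)
    have \<eta>0: "0 < \<eta>" unfolding \<eta> using C L \<gamma> by simp
    have "\<eta> powr \<gamma> = (2 * C * L) * (1 / \<gamma>) powr (1 - \<gamma>)"
      unfolding \<eta> using C L \<gamma> by (simp add: powr_mult powr_powr)
    also have "(1 / \<gamma>) powr (1 - \<gamma>) = \<gamma> powr (\<gamma> - 1)"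
      using \<gamma> powr_minus_divide[of \<gamma> "1 - \<gamma>"] by (simp add: powr_divide)
    finally have "\<eta> powr \<gamma> = 2 * (C * L * \<gamma> powr (\<gamma> - 1))" by simp
    moreover have "C * L * \<gamma> powr (\<gamma> - 1) > 0" using CL \<gamma> by simp
    ultimately have "C * L * \<eta> powr - \<gamma> * \<gamma> powr (\<gamma> - 1) = 1 / 2"
      using C L \<gamma> by (simp add: powr_minus_divide)
    then have eq: "C * L * \<eta> powr - \<gamma> * \<gamma> powr (\<gamma> - 1) * (2 - \<gamma>) = (2 - \<gamma>) / 2" by simp
    show ?thesis
    proof
      show "\<omega>A < \<omega>f" using \<eta>0 by (simp add: \<eta>_def)
      show "C * L * (\<omega>f - \<omega>A) powr - \<gamma> * \<gamma> powr (\<gamma> - 1) * (2 - \<gamma>) < 1"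
        unfolding \<eta>_def[symmetric] eq using \<gamma> by simp
    qed
  qed
  then show "\<omega>A < \<omega>f" "C * L * (\<omega>f - \<omega>A) powr - \<gamma> * \<gamma> powr (\<gamma> - 1) * (2 - \<gamma>) < 1" by auto
qed

section \<open>The abstract hypotheses for the given operators and scales\<close>

theorem corollary4p15:
  fixes scX :: "'k::real_normed_field \<Rightarrow> 'x::banach \<Rightarrow> 'x"
    and scY :: "'k \<Rightarrow> 'y::banach \<Rightarrow> 'y"
    and scXe :: "'k \<Rightarrow> 'xe::banach \<Rightarrow> 'xe"
    and scYe :: "'k \<Rightarrow> 'ye::banach \<Rightarrow> 'ye"
    and DA :: "'x set" and A :: "'x \<Rightarrow> 'x" and SA :: "real \<Rightarrow> 'x \<Rightarrow>\<^sub>L 'x"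
    and DB :: "'y set" and B :: "'y \<Rightarrow> 'y" and SB :: "real \<Rightarrow> 'y \<Rightarrow>\<^sub>L 'y"
    and \<mu> :: 'k
    and jX :: "'x \<Rightarrow> 'xe" and Xs :: "real \<Rightarrow> 'xe nspace"
    and jY :: "'y \<Rightarrow> 'ye" and Ys :: "real \<Rightarrow> 'ye nspace"
    and f :: "'x \<Rightarrow> 'y \<Rightarrow> 'x" and g :: "'x \<Rightarrow> 'y \<Rightarrow> 'y"
    and T \<gamma>X \<delta>X \<delta>Y Lf Lg MA MB CA CB \<omega>A \<omega>B \<omega>f :: real
  assumes T: "0 < T"
    \<comment> \<open>operators and semigroups\<close>
    and X: "banach_over scX" and Y: "banach_over scY"
    and A: "closed_linear_operator scX DA A" "C0_semigroup scX SA" "generates DA A SA"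
      "exponentially_stable SA"
    and B: "closed_linear_operator scY DB B" "C0_semigroup scY SB" "generates DB B SB"
    \<comment> \<open>scales\<close>
    and Xs: "interpolation_extrapolation_scale scX scXe DA A jX Xs"
    and \<mu>: "\<mu> \<in> resolvent_set scY DB B" "0 \<in> resolvent_set scY DB B \<Longrightarrow> \<mu> = 0"
    and Ys: "interpolation_extrapolation_scale scY scYe DB (\<lambda>y. B y - scY \<mu> y) jY Ys"
    \<comment> \<open>exponents\<close>
    and exponents: "admissible_exponents (holomorphic_semigroup scX SA) (holomorphic_semigroup scY SB)
      \<gamma>X \<delta>X \<delta>Y"
    \<comment> \<open>nonlinearities\<close>
    and f_cont: "continuous_map2 (level jX Xs \<delta>X) (level jY Ys (1 - \<delta>X)) whole f"
    and g_cont: "continuous_map2 (level jX Xs 1) (level jY Ys 1) (level jY Ys \<delta>Y) g"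
    and f0: "f 0 0 = 0" and g0: "g 0 0 = 0"
    and f_range: "\<And>x y. x \<in> car (level jX Xs 1) \<Longrightarrow> y \<in> car (level jY Ys 1) \<Longrightarrow>
      f x y \<in> car (level jX Xs \<gamma>X)"
    and g_range: "\<And>x y. x \<in> car (level jX Xs 1) \<Longrightarrow> y \<in> car (level jY Ys 1) \<Longrightarrow>
      g x y \<in> car (level jY Ys \<delta>Y)"
    and f_C1: "\<And>t u v. 0 < t \<Longrightarrow> t \<le> T \<Longrightarrow> C1_in (level jX Xs \<delta>X) t u \<Longrightarrow>
      C1_in whole t v \<Longrightarrow> C0_in (level jY Ys (1 - \<delta>X)) t v \<Longrightarrow>
      C1_in (Xs (\<delta>X - 1)) t (\<lambda>s. jX (f (u s) (v s)))"
    and Lf: "0 < Lf" and Lg: "0 < Lg"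
    and f_Lip: "\<And>x1 x2 y1 y2.
      x1 \<in> car (level jX Xs 1) \<Longrightarrow> x2 \<in> car (level jX Xs 1) \<Longrightarrow>
      y1 \<in> car (level jY Ys 1) \<Longrightarrow> y2 \<in> car (level jY Ys 1) \<Longrightarrow>
      nrm (level jX Xs \<gamma>X) (f x1 y1 - f x2 y2)
        \<le> Lf * (nrm (level jX Xs 1) (x1 - x2) + nrm (level jY Ys 1) (y1 - y2))"
    and f_C1_Lip: "\<And>t u1 u2 v1 v2. 0 < t \<Longrightarrow> t \<le> T \<Longrightarrow>
      C1_in (level jX Xs \<delta>X) t u1 \<Longrightarrow> C1_in (level jX Xs \<delta>X) t u2 \<Longrightarrow>
      C1_in whole t v1 \<Longrightarrow> C0_in (level jY Ys (1 - \<delta>X)) t v1 \<Longrightarrow>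
      C1_in whole t v2 \<Longrightarrow> C0_in (level jY Ys (1 - \<delta>X)) t v2 \<Longrightarrow>
      C1_norm (Xs (\<delta>X - 1)) t (\<lambda>s. jX (f (u1 s) (v1 s)) - jX (f (u2 s) (v2 s)))
        \<le> Lf * (C1_norm (level jX Xs \<delta>X) t (\<lambda>s. u1 s - u2 s) + C1_norm whole t (\<lambda>s. v1 s - v2 s))"
    and g_Lip: "\<And>x1 x2 y1 y2.
      x1 \<in> car (level jX Xs 1) \<Longrightarrow> x2 \<in> car (level jX Xs 1) \<Longrightarrow>
      y1 \<in> car (level jY Ys 1) \<Longrightarrow> y2 \<in> car (level jY Ys 1) \<Longrightarrow>
      nrm (level jY Ys \<delta>Y) (g x1 y1 - g x2 y2)
        \<le> Lg * (nrm (level jX Xs 1) (x1 - x2) + nrm (level jY Ys 1) (y1 - y2))"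
    \<comment> \<open>semigroup bounds\<close>
    and constants: "0 < MA" "0 < MB" "0 < CA" "0 < CB" "\<omega>A < 0"
    and SA_1: "\<And>t. 0 < t \<Longrightarrow> op_bound (level jX Xs 1) (level jX Xs 1) (SA t) (MA * exp (\<omega>A * t))"
    and SA_\<gamma>: "\<And>t. 0 < t \<Longrightarrow>
      op_bound (level jX Xs \<gamma>X) (level jX Xs 1) (SA t) (CA * t powr (\<gamma>X - 1) * exp (\<omega>A * t))"
    and SA_\<delta>: "\<And>t. 0 < t \<Longrightarrow>
      op_bound (level jX Xs \<delta>X) (level jX Xs 1) (SA t) (CA * t powr (\<delta>X - 1) * exp (\<omega>A * t))"
    and SB_1: "\<And>t. 0 < t \<Longrightarrow> op_bound (level jY Ys 1) (level jY Ys 1) (SB t) (MB * exp (\<omega>B * t))"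
    and SB_\<delta>: "\<And>t. 0 < t \<Longrightarrow>
      op_bound (level jY Ys \<delta>Y) (level jY Ys 1) (SB t) (CB * t powr (\<delta>Y - 1) * exp (\<omega>B * t))"
    \<comment> \<open>smallness of the Lipschitz constant\<close>
    and \<omega>f_lt1: "\<gamma>X < 1 \<Longrightarrow>
      \<omega>f = \<omega>A + (2 * CA * Lf) powr (1 / \<gamma>X) * (1 / \<gamma>X) powr ((1 - \<gamma>X) / \<gamma>X)"
    and \<omega>f_1: "\<gamma>X = 1 \<Longrightarrow> \<omega>f > \<omega>A + CA * Lf"
    and \<omega>f_neg: "\<omega>f < 0"
    and small: "Lf * max (op_norm (level jX Xs \<gamma>X) (level jX Xs 1) (inv_into DA A))
        (op_norm (Xs (\<delta>X - 1)) (level jX Xs \<delta>X) (inv (extended_operator DA A jX))) < 1"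
  shows "\<exists>C>0. \<exists>c>0. \<forall>u0\<in>car (level jX Xs 1). \<forall>v0\<in>car (level jY Ys 1). \<forall>t\<in>{0..T}. \<forall>\<epsilon>\<in>{0<..1}.
    (let X1 = level jX Xs 1; Y1 = level jY Ys 1; h0 = critical_map X1 A f;
         Tf = flow X1 A f Y1 B g T
     in prod_norm X1 Y1 (Tf \<epsilon> t (u0, v0) - Tf 0 t (h0 v0, v0))
        \<le> C * (\<epsilon> * exp ((\<omega>B + c) * t) * nrm Y1 v0
             + (\<epsilon> powr \<delta>Y * exp ((\<omega>B + c) * t) + exp (\<omega>f * t / \<epsilon>)) * nrm X1 (u0 - h0 v0)))"
proof -
  have \<gamma>: "0 < \<gamma>X" "\<gamma>X \<le> 1" and \<delta>: "0 < \<delta>X" "\<delta>X \<le> 1" and \<delta>Y: "0 < \<delta>Y" "\<delta>Y \<le> 1"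
    using exponents by (auto simp: admissible_exponents_def)
  interpret XG: banach_generator scX DA A SA
    by standard (fact X A)+
  interpret YG: banach_generator scY DB B SB
    by standard (fact Y B)+
  note stable = XG.stable_bijective[OF A(4)]
  interpret xs: generator_scale scX DA A SA 0 A scXe jX Xs
    by standard (use stable(2,3) Xs in auto)
  define G where "G = (\<lambda>y. B y - scY \<mu> y)"
  have resolvent: "bij_betw (\<lambda>y. scY \<mu> y - B y) DB UNIV" "\<exists>C. \<forall>y\<in>DB. norm y \<le> C * norm (scY \<mu> y - B y)"
    using \<mu>(1) by (auto simp: resolvent_set_def)
  interpret ys: generator_scale scY DB B SB \<mu> G scYe jY Ys
  proof
    \<comment> \<open>The resolvent set is expressed by \<mu> - B, the scale by B - \<mu>.\<close>
    have "bij_betw (uminus \<circ> (\<lambda>y. scY \<mu> y - B y)) DB UNIV"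
      by (rule bij_betw_trans[OF resolvent(1)]) (rule bij_uminus)
    then show "bij_betw G DB UNIV" by (simp add: G_def o_def)
    show "\<exists>C. \<forall>y\<in>DB. norm y \<le> C * norm (G y)" using resolvent(2) by (simp add: G_def norm_minus_commute)
    show "interpolation_extrapolation_scale scY scYe DB G jY Ys" using Ys by (simp add: G_def)
  qed (simp add: G_def)
  let ?X1 = "level jX Xs 1" and ?Y1 = "level jY Ys 1"
  have SB_strong: "strong_semigroup (\<lambda>t. blinfun_apply (SB t))"
    by (rule ys.strong_semigroup_of_level_bound[OF SB_1]) (use constants in auto)
  have fast_smoothing: "smoothing_semigroup (\<lambda>t. blinfun_apply (SA t)) A xs.R (\<lambda>x. x) ?X1 (level jX Xs \<theta>) \<theta> CA \<omega>A"
    if "0 < \<theta>" "\<theta> \<le> 1" "\<And>t. 0 < t \<Longrightarrow> op_bound (level jX Xs \<theta>) ?X1 (SA t) (CA * t powr (\<theta> - 1) * exp (\<omega>A * t))" for \<theta>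
    using xs.smoothing_semigroupI[OF stable(1) that(1,2) _ that(3)] constants by simp
  interpret cm: critical_manifold scX DA A SA scXe jX Xs ?Y1 "level jY Ys (1 - \<delta>X)" f \<gamma>X \<delta>X Lf T
  proof
    show "closure DA = UNIV" by (rule xs.D_dense[OF stable(1)])
    show "normed_nspace ?Y1" by (rule ys.level_normed) simp
    show "\<exists>K. \<forall>y\<in>car ?Y1. norm y \<le> K * nrm ?Y1 y" by (rule ys.level_embeds) simp_all
    show "normed_nspace (level jY Ys (1 - \<delta>X))" by (rule ys.level_normed) (use \<delta> in simp)
    show "embeds ?Y1 (level jY Ys (1 - \<delta>X))" by (rule ys.level_1_embeds_level) (use \<delta> in simp_all)
    show "Lf * max (op_norm (level jX Xs \<gamma>X) ?X1 xs.R)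
      (op_norm (Xs (\<delta>X - 1)) (level jX Xs \<delta>X) (inv (extended_operator DA A jX))) < 1"
      using small unfolding xs.R_def .
    show "C1_in (Xs (\<delta>X - 1)) T (\<lambda>s. jX (f (u s) (v s)))"
      if "C1_in (level jX Xs \<delta>X) T u" "C1_in whole T v" "C0_in (level jY Ys (1 - \<delta>X)) T v" for u v
      by (rule f_C1[OF T order_refl that])
    show "C1_norm (Xs (\<delta>X - 1)) T (\<lambda>s. jX (f (u1 s) (v1 s)) - jX (f (u2 s) (v2 s)))
        \<le> Lf * (C1_norm (level jX Xs \<delta>X) T (\<lambda>s. u1 s - u2 s) + C1_norm whole T (\<lambda>s. v1 s - v2 s))"
      if "C1_in (level jX Xs \<delta>X) T u1" "C1_in (level jX Xs \<delta>X) T u2" "C1_in whole T v1"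
        "C0_in (level jY Ys (1 - \<delta>X)) T v1" "C1_in whole T v2" "C0_in (level jY Ys (1 - \<delta>X)) T v2" for u1 u2 v1 v2
      by (rule f_C1_Lip[OF T order_refl that])
  qed (fact \<gamma> \<delta> T f0 Lf f_range f_Lip)+
  let ?h = "critical_map ?X1 A f"
  interpret fs: fast_slow "\<lambda>t. blinfun_apply (SA t)" A xs.R ?X1 "level jX Xs \<gamma>X" \<gamma>X CA \<omega>A "level jX Xs \<delta>X" \<delta>X
    "\<lambda>t. blinfun_apply (SB t)" B ys.R "\<lambda>y. y + scY \<mu> (ys.R y)" ?Y1 "level jY Ys \<delta>Y" \<delta>Y CB \<omega>B
    f g ?h Lf Lg "cm.contraction / (1 - cm.contraction)" MA \<omega>f T
  proof (intro fast_slow.intro fast_slow_axioms.intro fast_smoothing \<gamma> \<delta> SA_\<gamma> SA_\<delta>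
      ys.smoothing_semigroupI SB_strong \<delta>Y SB_\<delta> f_range g_range Lf Lg f_Lip g_Lip g0 SA_1
      cm.h_range cm.h_equation cm.h_0 cm.h_lipschitz T cm.h_C1 \<omega>f_neg)
    show "0 \<le> CB" using constants by simp
    show "0 \<le> cm.contraction / (1 - cm.contraction)" using cm.contraction(1,2) by simp
    show "x = ?h y" if "y \<in> car ?Y1" "x \<in> car ?X1" "A x + f x y = 0" for x y
      using cm.h_eq[OF that] by simp
    show "\<omega>A < \<omega>f" by (rule contraction_rate_less(1)[OF \<gamma> constants(3) Lf \<omega>f_lt1 \<omega>f_1])
    show "CA * Lf * (\<omega>f - \<omega>A) powr - \<gamma>X * \<gamma>X powr (\<gamma>X - 1) * (2 - \<gamma>X) < 1"
      by (rule contraction_rate_less(2)[OF \<gamma> constants(3) Lf \<omega>f_lt1 \<omega>f_1])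
  qed
  obtain K where K: "K > 0" "\<And>\<epsilon> u v w x0 y0 t. 0 < \<epsilon> \<Longrightarrow> x0 \<in> car ?X1 \<Longrightarrow> y0 \<in> car ?Y1 \<Longrightarrow>
      strict_solution ?X1 A f ?Y1 B g T \<epsilon> (x0, y0) u v \<Longrightarrow> fs.slow.solves T y0 w \<Longrightarrow> t \<in> {0..T} \<Longrightarrow>
      nrm ?X1 (u t - ?h (w t)) + nrm ?Y1 (v t - w t) \<le>
        K * (\<epsilon> * nrm ?Y1 y0 + (\<epsilon> powr \<delta>Y + exp (\<omega>f * t / \<epsilon>)) * nrm ?X1 (x0 - ?h y0))"
    by (rule fs.error_bound) blast
  \<comment> \<open>The factor \<open>M\<close> undoes the smallest possible value of exp
    ((\<omega>B + 1) t) on [0, T]; here c = 1 is an arbitrary positive choice.\<close>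
  define M where "M = exp (\<bar>\<omega>B + 1\<bar> * T)"
  have M: "1 \<le> M" using T by (simp add: M_def)
  have KM: "0 < K * M" using K(1) M by simp
  show ?thesis
  proof (rule exI[of _ "K * M"], rule conjI, rule KM, rule exI[of _ 1], rule conjI, rule zero_less_one, intro ballI)
    fix u0 v0 t \<epsilon> assume u0: "u0 \<in> car ?X1" and v0: "v0 \<in> car ?Y1" and t: "t \<in> {0..T}" and \<epsilon>: "\<epsilon> \<in> {0<..1::real}"
    have \<epsilon>0: "0 < \<epsilon>" using \<epsilon> by simp
    have p: "(u0, v0) \<in> car (prod_nspace ?X1 ?Y1)" using u0 v0 by (simp add: car_prod_nspace)
    obtain u v where uv: "strict_solution ?X1 A f ?Y1 B g T \<epsilon> (u0, v0) u v"
      "\<And>t. t \<in> {0..T} \<Longrightarrow> flow ?X1 A f ?Y1 B g T \<epsilon> t (u0, v0) = (u t, v t)"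
      by (rule fs.flow_positive[OF \<epsilon>0 p]) blast
    obtain w where w: "fs.slow.solves T v0 w"
      "\<And>t. t \<in> {0..T} \<Longrightarrow> flow ?X1 A f ?Y1 B g T 0 t (?h v0, v0) = (?h (w t), w t)"
      by (rule fs.flow_zero[OF v0]) blast
    let ?e = "exp ((\<omega>B + 1) * t)" and ?V = "nrm ?Y1 v0" and ?D = "nrm ?X1 (u0 - ?h v0)"
    have V: "0 \<le> ?V" by (rule nrm_nonneg[OF cm.Y1 v0])
    have D: "0 \<le> ?D" by (rule nrm_nonneg[OF cm.X1 nspace_diff[OF cm.X1 u0 cm.h_range[OF v0]]])
    have Me: "1 \<le> M * ?e"
    proof -
      have "- (\<omega>B + 1) * t \<le> \<bar>\<omega>B + 1\<bar> * T" using t by (intro mult_mono) auto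
      then show ?thesis unfolding M_def mult_exp_exp by (simp add: algebra_simps)
    qed
    have "prod_norm ?X1 ?Y1 (flow ?X1 A f ?Y1 B g T \<epsilon> t (u0, v0) - flow ?X1 A f ?Y1 B g T 0 t (?h v0, v0))
        \<le> K * (\<epsilon> * ?V + (\<epsilon> powr \<delta>Y + exp (\<omega>f * t / \<epsilon>)) * ?D)"
      using K(2)[OF \<epsilon>0 u0 v0 uv(1) w(1) t] by (simp add: uv(2)[OF t] w(2)[OF t] prod_norm_def)
    also have "\<dots> \<le> K * ((M * ?e) * (\<epsilon> * ?V) + ((M * ?e) * \<epsilon> powr \<delta>Y + M * exp (\<omega>f * t / \<epsilon>)) * ?D)"
    proof (intro mult_left_mono add_mono mult_right_mono D)
      show "\<epsilon> * ?V \<le> (M * ?e) * (\<epsilon> * ?V)" using mult_right_mono[OF Me, of "\<epsilon> * ?V"] \<epsilon>0 V by simp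
      show "\<epsilon> powr \<delta>Y \<le> (M * ?e) * \<epsilon> powr \<delta>Y" using mult_right_mono[OF Me, of "\<epsilon> powr \<delta>Y"] by simp
      show "exp (\<omega>f * t / \<epsilon>) \<le> M * exp (\<omega>f * t / \<epsilon>)" using mult_right_mono[OF M, of "exp (\<omega>f * t / \<epsilon>)"] by simp
    qed (use K(1) in simp)
    also have "\<dots> = K * M * (\<epsilon> * ?e * ?V + (\<epsilon> powr \<delta>Y * ?e + exp (\<omega>f * t / \<epsilon>)) * ?D)"
      by (simp add: algebra_simps)
    finally show "let X1 = ?X1; Y1 = ?Y1; h0 = critical_map X1 A f; Tf = flow X1 A f Y1 B g T
        in prod_norm X1 Y1 (Tf \<epsilon> t (u0, v0) - Tf 0 t (h0 v0, v0))
          \<le> K * M * (\<epsilon> * exp ((\<omega>B + 1) * t) * nrm Y1 v0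
             + (\<epsilon> powr \<delta>Y * exp ((\<omega>B + 1) * t) + exp (\<omega>f * t / \<epsilon>)) * nrm X1 (u0 - h0 v0))"
      by (simp only: Let_def)
  qed
qed

end
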